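(* Let $k$ be a field and let $R$ and $S$ be (commutative noetherian) local supplemented $k$-algebras, i.e. local $k$-algebras with residue field $k$ for which the surjections $R\to k$ and $S\to k$ are $k$-linear. If $\operatorname{Ext}_R(k,R)$ is finitely generated as a graded right module over $\operatorname{Ext}_R(k,k)$ and $\operatorname{Ext}_S(k,S)$ is finitely generated as a graded right module over $\operatorname{Ext}_S(k,k)$, then $\operatorname{Ext}_{R\otimes_kS}(k,R\otimes_kS)$ is finitely generated as a graded right module over $\operatorname{Ext}_{R\otimes_kS}(k,k)$.
   Context: For an augmented ring $A\to k$, $\operatorname{Ext}_A(k,k)$ is a graded $k$-algebra under composition (Yoneda) products, and $\operatorname{Ext}_A(k,A)$ is a graded right module over it by composition. The ring $R\otimes_kS$ is augmented to $k$ via the tensor product of the augmentations of $R$ and $S$. *)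

theory Defs
  imports "HOL-Algebra.Algebra" "HOL-Algebra.Free_Abelian_Groups"
begin

section \<open>Local supplemented algebras\<close>

definition local_ring :: "('a, 'x) ring_scheme \<Rightarrow> bool"
  where "local_ring A \<longleftrightarrow> cring A \<and> (\<exists>!I. maximalideal I A)"

text \<open>The augmentation is surjective because it is \<open>K\<close>-linear. If \<open>K\<close> is a field, then its kernel is a
  maximal ideal; for a local algebra it is therefore the residue map.\<close>

locale supplemented_algebra = algebra K A
  for K :: "('k, 'x) ring_scheme" and A :: "('k, 'a, 'y) module_scheme" +
  fixes \<epsilon> :: "'a \<Rightarrow> 'k"
  assumes augmentation_ring_hom: "\<epsilon> \<in> ring_hom A K"
    and augmentation_linear:
      "\<lbrakk>c \<in> carrier K; a \<in> carrier A\<rbrakk> \<Longrightarrow> \<epsilon> (c \<odot>\<^bsub>A\<^esub> a) = c \<otimes>\<^bsub>K\<^esub> \<epsilon> a"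

definition local_supplemented_algebra ::
    "('k, 'x) ring_scheme \<Rightarrow> ('k, 'a, 'y) module_scheme \<Rightarrow> ('a \<Rightarrow> 'k) \<Rightarrow> bool"
  where "local_supplemented_algebra K A \<epsilon> \<longleftrightarrow>
    supplemented_algebra K A \<epsilon> \<and> noetherian_ring A \<and> local_ring A"


section \<open>The ring \<open>R \<otimes>\<^sub>K S\<close> and its augmentation\<close>

text \<open>The ring structure on the free abelian group on \<open>R \<times> S\<close> that extends the componentwise
  product of pairs biadditively.\<close>

definition pair_ring ::
    "('r, 'x) ring_scheme \<Rightarrow> ('s, 'y) ring_scheme \<Rightarrow> ('r \<times> 's \<Rightarrow>\<^sub>0 int) ring"
  where "pair_ring R S =
    \<lparr>carrier = carrier (free_Abelian_group (carrier R \<times> carrier S)),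
     monoid.mult = (\<lambda>x y. frag_extend (\<lambda>(r, s). frag_extend (\<lambda>(r', s').
        frag_of (r \<otimes>\<^bsub>R\<^esub> r', s \<otimes>\<^bsub>S\<^esub> s')) y) x),
     one = frag_of (\<one>\<^bsub>R\<^esub>, \<one>\<^bsub>S\<^esub>),
     ring.zero = 0,
     ring.add = (+)\<rparr>"

definition tensor_relations ::
    "('k, 'x) ring_scheme \<Rightarrow> ('k, 'r, 'y) module_scheme \<Rightarrow> ('k, 's, 'z) module_scheme
      \<Rightarrow> ('r \<times> 's \<Rightarrow>\<^sub>0 int) set"
  where "tensor_relations K R S =
    {frag_of (r \<oplus>\<^bsub>R\<^esub> r', s) - frag_of (r, s) - frag_of (r', s) | r r' s.
       r \<in> carrier R \<and> r' \<in> carrier R \<and> s \<in> carrier S}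
  \<union> {frag_of (r, s \<oplus>\<^bsub>S\<^esub> s') - frag_of (r, s) - frag_of (r, s') | r s s'.
       r \<in> carrier R \<and> s \<in> carrier S \<and> s' \<in> carrier S}
  \<union> {frag_of (c \<odot>\<^bsub>R\<^esub> r, s) - frag_of (r, c \<odot>\<^bsub>S\<^esub> s) | c r s.
       c \<in> carrier K \<and> r \<in> carrier R \<and> s \<in> carrier S}"

text \<open>A relation times a pair is again a relation, so the ideal generated by the relations is
  just the subgroup they generate: the additive group below is the usual tensor product.\<close>

definition tensor_ring ::
    "('k, 'x) ring_scheme \<Rightarrow> ('k, 'r, 'y) module_scheme \<Rightarrow> ('k, 's, 'z) module_scheme
      \<Rightarrow> ('r \<times> 's \<Rightarrow>\<^sub>0 int) set ring"
  where "tensor_ring K R S =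
    pair_ring R S Quot (Idl\<^bsub>pair_ring R S\<^esub> (tensor_relations K R S))"

text \<open>The map \<open>r \<otimes> s \<mapsto> \<epsilon> r \<cdot> \<delta> s\<close>, evaluated on representatives.\<close>

definition tensor_augmentation ::
    "('k, 'x) ring_scheme \<Rightarrow> ('r \<Rightarrow> 'k) \<Rightarrow> ('s \<Rightarrow> 'k) \<Rightarrow> ('r \<times> 's \<Rightarrow>\<^sub>0 int) set \<Rightarrow> 'k"
  where "tensor_augmentation K \<epsilon> \<delta> U = the_elem ((\<lambda>x.
    \<Oplus>\<^bsub>K\<^esub>p\<in>Poly_Mapping.keys x.
      add_pow K (Poly_Mapping.lookup x p) (\<epsilon> (fst p) \<otimes>\<^bsub>K\<^esub> \<delta> (snd p))) ` U)"


section \<open>Modules and free resolutions\<close>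

text \<open>The fields \<^const>\<open>monoid.mult\<close> and \<^const>\<open>one\<close> of a module record play no role.\<close>

definition augmentation_module ::
    "('k, 'x) ring_scheme \<Rightarrow> ('a \<Rightarrow> 'k) \<Rightarrow> ('a, 'k) module"
  where "augmentation_module K \<epsilon> =
    \<lparr>carrier = carrier K, monoid.mult = monoid.mult K, one = one K, ring.zero = ring.zero K, ring.add = ring.add K,
     smult = (\<lambda>a x. \<epsilon> a \<otimes>\<^bsub>K\<^esub> x)\<rparr>"

definition regular_module :: "('a, 'x) ring_scheme \<Rightarrow> ('a, 'a) module"
  where "regular_module A =
    \<lparr>carrier = carrier A, monoid.mult = monoid.mult A, one = one A, ring.zero = ring.zero A, ring.add = ring.add A,
     smult = monoid.mult A\<rparr>"

text \<open>Homomorphisms are extensional, so that equality of maps is equality on the carrier.\<close>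

definition mod_hom ::
    "('a, 'x) ring_scheme \<Rightarrow> ('a, 'm, 'y) module_scheme \<Rightarrow> ('a, 'n, 'z) module_scheme
      \<Rightarrow> ('m \<Rightarrow> 'n) set"
  where "mod_hom A M N = {f \<in> carrier M \<rightarrow>\<^sub>E carrier N.
    (\<forall>x\<in>carrier M. \<forall>y\<in>carrier M. f (x \<oplus>\<^bsub>M\<^esub> y) = f x \<oplus>\<^bsub>N\<^esub> f y) \<and>
    (\<forall>a\<in>carrier A. \<forall>x\<in>carrier M. f (a \<odot>\<^bsub>M\<^esub> x) = a \<odot>\<^bsub>N\<^esub> f x)}"

definition free_module :: "('a, 'x) ring_scheme \<Rightarrow> ('a, 'm, 'y) module_scheme \<Rightarrow> bool"
  where "free_module A M \<longleftrightarrow> module A M \<and>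
    (\<exists>B\<subseteq>carrier M. \<forall>x\<in>carrier M. \<exists>!c. c \<in> B \<rightarrow>\<^sub>E carrier A \<and>
       finite {b\<in>B. c b \<noteq> \<zero>\<^bsub>A\<^esub>} \<and>
       x = (\<Oplus>\<^bsub>M\<^esub>b\<in>{b\<in>B. c b \<noteq> \<zero>\<^bsub>A\<^esub>}. c b \<odot>\<^bsub>M\<^esub> b))"

text \<open>Complexes are graded homologically by the integers; \<open>bdry C i\<close> is the map
  \<open>obj C i \<rightarrow> obj C (i - 1)\<close>.\<close>

record ('a, 'm) module_complex =
  obj :: "int \<Rightarrow> ('a, 'm) module"
  bdry :: "int \<Rightarrow> 'm \<Rightarrow> 'm"

definition free_resolution ::
    "('a, 'x) ring_scheme \<Rightarrow> ('a, 'n, 'y) module_scheme \<Rightarrow> ('a, 'm) module_complex \<Rightarrow> bool"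
  where "free_resolution A N P \<longleftrightarrow>
    (\<forall>i. free_module A (obj P i)) \<and>
    (\<forall>i<0. carrier (obj P i) = {\<zero>\<^bsub>obj P i\<^esub>}) \<and>
    (\<forall>i. bdry P i \<in> mod_hom A (obj P i) (obj P (i - 1))) \<and>
    (\<forall>i>0. {x \<in> carrier (obj P i). bdry P i x = \<zero>\<^bsub>obj P (i - 1)\<^esub>}
      = bdry P (i + 1) ` carrier (obj P (i + 1))) \<and>
    (\<exists>\<pi>\<in>mod_hom A (obj P 0) N. \<pi> ` carrier (obj P 0) = carrier N \<and>
      {x \<in> carrier (obj P 0). \<pi> x = \<zero>\<^bsub>N\<^esub>} = bdry P 1 ` carrier (obj P 1))"

text \<open>The ring \<open>A\<close> as a complex concentrated in degree \<open>0\<close>, which is a free resolution of the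
  module \<open>A\<close>.\<close>

definition ring_complex :: "('a, 'x) ring_scheme \<Rightarrow> ('a, 'a) module_complex"
  where "ring_complex A =
    \<lparr>obj = (\<lambda>i. if i = 0 then regular_module A
                  else (regular_module A)\<lparr>carrier := {\<zero>\<^bsub>A\<^esub>}\<rparr>),
     bdry = (\<lambda>i. \<lambda>x\<in>(if i = 0 then carrier A else {\<zero>\<^bsub>A\<^esub>}). \<zero>\<^bsub>A\<^esub>)\<rparr>"


section \<open>Ext and composition products\<close>

text \<open>\<open>Ext\<^sub>A(M, N)\<close> is the cohomology of \<open>Hom\<^sub>A(C, D)\<close>, where \<open>C\<close> and \<open>D\<close> are free resolutions of
  \<open>M\<close> and \<open>N\<close>. A cochain of cohomological degree \<open>n\<close> is a family of \<open>A\<close>-linear maps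
  \<open>C i \<rightarrow> D (i - n)\<close>. The resolutions are parameters: up to canonical isomorphism compatible with
  composition, nothing depends on their choice. As for the homology groups of HOL-Homology, the abelian groups
  of cochains and of cohomology classes are \<^typ>\<open>'a monoid\<close> records: their addition is
  the record's \<open>\<otimes>\<close>, their zero is \<open>\<one>\<close>.\<close>

definition hom_group ::
    "('a, 'x) ring_scheme \<Rightarrow> ('a, 'm) module_complex \<Rightarrow> ('a, 'n) module_complex \<Rightarrow> int
      \<Rightarrow> (int \<Rightarrow> 'm \<Rightarrow> 'n) monoid"
  where "hom_group A C D n =
    \<lparr>carrier = {f. \<forall>i. f i \<in> mod_hom A (obj C i) (obj D (i - n))},
     monoid.mult = (\<lambda>f g i. \<lambda>x\<in>carrier (obj C i). f i x \<oplus>\<^bsub>obj D (i - n)\<^esub> g i x),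
     one = (\<lambda>i. \<lambda>x\<in>carrier (obj C i). \<zero>\<^bsub>obj D (i - n)\<^esub>)\<rparr>"

text \<open>The differential \<open>f \<mapsto> \<partial> \<circ> f - (-1)\<^sup>n f \<circ> \<partial>\<close>.\<close>

definition hom_differential ::
    "('a, 'm) module_complex \<Rightarrow> ('a, 'n) module_complex \<Rightarrow> int
      \<Rightarrow> (int \<Rightarrow> 'm \<Rightarrow> 'n) \<Rightarrow> (int \<Rightarrow> 'm \<Rightarrow> 'n)"
  where "hom_differential C D n f = (\<lambda>i. \<lambda>x\<in>carrier (obj C i).
    if even n then bdry D (i - n) (f i x) \<ominus>\<^bsub>obj D (i - n - 1)\<^esub> f (i - 1) (bdry C i x)
    else bdry D (i - n) (f i x) \<oplus>\<^bsub>obj D (i - n - 1)\<^esub> f (i - 1) (bdry C i x))"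

definition hom_cocycles ::
    "('a, 'x) ring_scheme \<Rightarrow> ('a, 'm) module_complex \<Rightarrow> ('a, 'n) module_complex \<Rightarrow> int
      \<Rightarrow> (int \<Rightarrow> 'm \<Rightarrow> 'n) set"
  where "hom_cocycles A C D n = {f \<in> carrier (hom_group A C D n).
    hom_differential C D n f = \<one>\<^bsub>hom_group A C D (n + 1)\<^esub>}"

definition hom_coboundaries ::
    "('a, 'x) ring_scheme \<Rightarrow> ('a, 'm) module_complex \<Rightarrow> ('a, 'n) module_complex \<Rightarrow> int
      \<Rightarrow> (int \<Rightarrow> 'm \<Rightarrow> 'n) set"
  where "hom_coboundaries A C D n =
    hom_differential C D (n - 1) ` carrier (hom_group A C D (n - 1))"

definition Ext_group ::
    "('a, 'x) ring_scheme \<Rightarrow> ('a, 'm) module_complex \<Rightarrow> ('a, 'n) module_complex \<Rightarrow> int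
      \<Rightarrow> (int \<Rightarrow> 'm \<Rightarrow> 'n) set monoid"
  where "Ext_group A C D n =
    (hom_group A C D n)\<lparr>carrier := hom_cocycles A C D n\<rparr> Mod hom_coboundaries A C D n"

text \<open>Composition of a cochain \<open>g\<close> of \<open>Hom\<^sub>A(D, E)\<close> with a cochain \<open>f\<close> of degree \<open>n\<close> of
  \<open>Hom\<^sub>A(C, D)\<close>.\<close>

definition hom_compose ::
    "('a, 'm) module_complex \<Rightarrow> int \<Rightarrow> (int \<Rightarrow> 'n \<Rightarrow> 'p) \<Rightarrow> (int \<Rightarrow> 'm \<Rightarrow> 'n)
      \<Rightarrow> (int \<Rightarrow> 'm \<Rightarrow> 'p)"
  where "hom_compose C n g f = (\<lambda>i. compose (carrier (obj C i)) (g (i - n)) (f i))"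

text \<open>The induced product of a class \<open>U\<close> of degree \<open>m\<close> and a class \<open>V\<close> of degree \<open>n\<close>; the union
  is over the representatives and all its members are the same coset.\<close>

definition Ext_compose ::
    "('a, 'x) ring_scheme \<Rightarrow> ('a, 'm) module_complex \<Rightarrow> ('a, 'p) module_complex \<Rightarrow> int \<Rightarrow> int
      \<Rightarrow> (int \<Rightarrow> 'n \<Rightarrow> 'p) set \<Rightarrow> (int \<Rightarrow> 'm \<Rightarrow> 'n) set \<Rightarrow> (int \<Rightarrow> 'm \<Rightarrow> 'p) set"
  where "Ext_compose A C E m n U V = (\<Union>g\<in>U. \<Union>f\<in>V.
    hom_coboundaries A C E (m + n) #>\<^bsub>hom_group A C E (m + n)\<^esub> hom_compose C n g f)"

text \<open>A graded right module with homogeneous components \<open>M n\<close> (in multiplicative notation) over a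
  graded ring with homogeneous components \<open>E n\<close>, where \<open>act d e\<close> is the action
  \<open>M d \<times> E e \<rightarrow> M (d + e)\<close>, is finitely generated: there are finitely many homogeneous
  elements \<open>g\<close> of degrees \<open>d\<close> such that every homogeneous element is a sum of \<open>g \<cdot> c\<close>'s.\<close>

definition fin_gen_graded_right_module ::
    "(int \<Rightarrow> ('u, 'x) monoid_scheme) \<Rightarrow> (int \<Rightarrow> ('v, 'y) monoid_scheme)
      \<Rightarrow> (int \<Rightarrow> int \<Rightarrow> 'u \<Rightarrow> 'v \<Rightarrow> 'u) \<Rightarrow> bool"
  where "fin_gen_graded_right_module M E act \<longleftrightarrow>
    (\<exists>G. finite G \<and> (\<forall>(d, g)\<in>G. g \<in> carrier (M d)) \<and>
      (\<forall>n. \<forall>x\<in>carrier (M n). \<exists>c. (\<forall>p\<in>G. c p \<in> carrier (E (n - fst p))) \<and>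
        x = (\<Otimes>\<^bsub>M n\<^esub>p\<in>G. act (fst p) (n - fst p) (snd p) (c p))))"

text \<open>For a free resolution \<open>P\<close> of the residue field \<open>k\<close> of \<open>A\<close>: the right module \<open>Ext\<^sub>A(k, A)\<close> over
  \<open>Ext\<^sub>A(k, k)\<close> is finitely generated.\<close>

definition Ext_ring_fin_gen :: "('a, 'x) ring_scheme \<Rightarrow> ('a, 'm) module_complex \<Rightarrow> bool"
  where "Ext_ring_fin_gen A P \<longleftrightarrow>
    fin_gen_graded_right_module
      (Ext_group A P (ring_complex A)) (Ext_group A P P) (Ext_compose A P (ring_complex A))"

end

theory Submission imports Defs begin

text \<open>A class in \<open>Ext\<^sub>A(k, A)\<close> is represented by a functional on a free resolution of \<open>k\<close>, and finite generation does
  not depend on the resolution. Take resolutions \<open>P\<close> and \<open>Q\<close> of \<open>k\<close> by finitely generated free modules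
  over \<open>R\<close> and \<open>S\<close>, and \<open>P \<otimes>\<^sub>k Q\<close> over \<open>A = R \<otimes>\<^sub>k S\<close>. Because \<open>k\<close> is a field,
  a \<open>k\<close>-linear homotopy on each factor yields one on the tensor product. Applied to \<open>P\<close> and \<open>Q\<close> it shows
  that \<open>P \<otimes>\<^sub>k Q\<close> is a resolution of \<open>k\<close>. Applied to the dual complexes, where the finite ranks give
  \<open>Hom\<^sub>A(P \<otimes>\<^sub>k Q, A) = Hom\<^sub>R(P, R) \<otimes>\<^sub>k Hom\<^sub>S(Q, S)\<close>, it shows that every class over \<open>A\<close> is a sum of
  external products \<open>g \<times> h\<close>. As \<open>(g c) \<times> (h e) = \<plusminus> (g \<times> h) (c \<times> e)\<close>, the products of generators over \<open>R\<close>
  with generators over \<open>S\<close> generate.\<close>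

text \<open>The resolutions in the theorem may have infinite rank, where the dual of a tensor
  product is in general not the tensor product of the duals; the noetherian hypotheses provide
  resolutions of finite rank to replace them. The dual complexes are not contractible, since the
  cohomology sought is exactly what survives. What a field always provides is a K-linear
  \<open>h\<close> with \<open>d h d = d\<close>. The defect \<open>e = 1 - d h - h d\<close> then
  kills boundaries and has values in cycles, and the identity of the tensor product is homotopic to
  \<open>e \<otimes> e'\<close>. On the resolutions \<open>e\<close> lives in degree 0 and factors
  through the augmentation, which gives exactness; on the duals its values are cocycles, which gives
  the external products. One lemma with an odd shift \<open>q\<close> serves both. As
  \<open>h\<close> is only K-linear, the homotopies are built from K-balanced families; the
  differential and the products are A-linear.\<close>

lemma module_imp_abelian_group: "module A M \<Longrightarrow> abelian_group M"
  by (simp add: module_def)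

lemma module_imp_cring: "module A M \<Longrightarrow> cring A"
  by (simp add: module_def)

lemma abelian_group_uminus_zero:
  assumes "abelian_group M"
  shows "\<ominus>\<^bsub>M\<^esub> \<zero>\<^bsub>M\<^esub> = \<zero>\<^bsub>M\<^esub>"
proof -
  interpret M: abelian_group M by fact
  show ?thesis by (rule M.minus_equality) simp_all
qed

lemma abelian_group_minus_eq_zero_iff:
  assumes "abelian_group M" "x \<in> carrier M" "y \<in> carrier M"
  shows "x \<ominus>\<^bsub>M\<^esub> y = \<zero>\<^bsub>M\<^esub> \<longleftrightarrow> x = y"
proof -
  interpret M: abelian_group M by fact
  show ?thesis
    using M.minus_equality[of x "\<ominus>\<^bsub>M\<^esub> y"] assms(2,3) by (auto simp: M.minus_eq M.r_neg)
qed

section \<open>Regular modules and powers of modules\<close>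

lemma regular_module_simps [simp]:
  "carrier (regular_module A) = carrier A"
  "\<zero>\<^bsub>regular_module A\<^esub> = \<zero>\<^bsub>A\<^esub>"
  "x \<oplus>\<^bsub>regular_module A\<^esub> y = x \<oplus>\<^bsub>A\<^esub> y"
  "a \<odot>\<^bsub>regular_module A\<^esub> y = a \<otimes>\<^bsub>A\<^esub> y"
  "\<ominus>\<^bsub>regular_module A\<^esub> y = \<ominus>\<^bsub>A\<^esub> y"
  "x \<ominus>\<^bsub>regular_module A\<^esub> y = x \<ominus>\<^bsub>A\<^esub> y"
  "finsum (regular_module A) f T = finsum A f T"
  by (simp_all add: regular_module_def a_inv_def m_inv_def a_minus_def finsum_def finprod_def)

lemma module_regular_module: "cring A \<Longrightarrow> module A (regular_module A)"
proof -
  assume A: "cring A"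
  interpret A: cring A by fact
  show ?thesis
    by (rule moduleI[OF A], rule abelian_groupI)
      (auto simp: A.a_ac A.m_assoc A.l_distr A.r_distr intro: A.l_neg)
qed

text \<open>The index set is arbitrary: \<open>{..<n}\<close> gives the finite free modules, and a
  finite set of triples gives the terms of the tensor complex.\<close>

definition pow_module :: "('a, 'm, 'z) module_scheme \<Rightarrow> 'x set \<Rightarrow> ('a, 'x \<Rightarrow> 'm) module"
  where "pow_module M J =
    \<lparr>carrier = J \<rightarrow>\<^sub>E carrier M, monoid.mult = (\<lambda>v w. \<lambda>x\<in>J. monoid.mult M (v x) (w x)), one = (\<lambda>x\<in>J. one M),
     ring.zero = (\<lambda>x\<in>J. \<zero>\<^bsub>M\<^esub>), ring.add = (\<lambda>v w. \<lambda>x\<in>J. v x \<oplus>\<^bsub>M\<^esub> w x),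
     smult = (\<lambda>a v. \<lambda>x\<in>J. a \<odot>\<^bsub>M\<^esub> v x)\<rparr>"

lemma pow_module_simps:
  "carrier (pow_module M J) = J \<rightarrow>\<^sub>E carrier M"
  "\<zero>\<^bsub>pow_module M J\<^esub> = (\<lambda>x\<in>J. \<zero>\<^bsub>M\<^esub>)"
  "v \<oplus>\<^bsub>pow_module M J\<^esub> w = (\<lambda>x\<in>J. v x \<oplus>\<^bsub>M\<^esub> w x)"
  "a \<odot>\<^bsub>pow_module M J\<^esub> w = (\<lambda>x\<in>J. a \<odot>\<^bsub>M\<^esub> w x)"
  by (simp_all add: pow_module_def)

lemma PiE_const_mem: "v \<in> J \<rightarrow>\<^sub>E B \<Longrightarrow> x \<in> J \<Longrightarrow> v x \<in> B"
  by auto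

lemma abelian_group_pow_module:
  assumes "abelian_group M"
  shows "abelian_group (pow_module M J)"
proof -
  interpret M: abelian_group M by fact
  show ?thesis
  proof (rule abelian_groupI)
    fix v assume v: "v \<in> carrier (pow_module M J)"
    show "\<exists>w\<in>carrier (pow_module M J). w \<oplus>\<^bsub>pow_module M J\<^esub> v = \<zero>\<^bsub>pow_module M J\<^esub>"
      using v by (intro bexI[of _ "\<lambda>x\<in>J. \<ominus>\<^bsub>M\<^esub> v x"])
        (auto simp: pow_module_simps PiE_const_mem M.l_neg intro!: restrict_ext)
  qed (auto simp: pow_module_simps PiE_const_mem M.a_ac PiE_arb[of _ J "\<lambda>_. carrier M"]
    intro!: ext)
qed

lemma module_pow_module:
  assumes "module A M"
  shows "module A (pow_module M J)"
proof -
  interpret M: module A M by fact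
  show ?thesis
    by (rule moduleI)
      (auto simp: M.R.is_cring abelian_group_pow_module[OF M.abelian_group_axioms]
        pow_module_simps PiE_const_mem M.smult_l_distr M.smult_r_distr M.smult_assoc1 PiE_arb[of _ J "\<lambda>_. carrier M"]
        intro!: ext)
qed

lemma pow_module_mem: "v \<in> carrier (pow_module M J) \<Longrightarrow> x \<in> J \<Longrightarrow> v x \<in> carrier M"
  by (auto simp: pow_module_simps)

lemma pow_module_eqI:
  assumes "v \<in> carrier (pow_module M J)" "w \<in> carrier (pow_module M J)"
    "\<And>x. x \<in> J \<Longrightarrow> v x = w x"
  shows "v = w"
  using assms by (auto simp: pow_module_simps intro: PiE_ext)

lemma pow_module_a_inv:
  assumes "abelian_group M" "v \<in> carrier (pow_module M J)"
  shows "\<ominus>\<^bsub>pow_module M J\<^esub> v = (\<lambda>x\<in>J. \<ominus>\<^bsub>M\<^esub> v x)"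
proof -
  interpret M: abelian_group M by fact
  interpret P: abelian_group "pow_module M J" by (rule abelian_group_pow_module[OF assms(1)])
  show ?thesis
    using assms(2)
    by (intro P.minus_equality) (auto simp: pow_module_simps PiE_const_mem M.l_neg intro!: restrict_ext)
qed

lemma finsum_pow_module:
  assumes M: "abelian_group M" and f: "f \<in> T \<rightarrow> carrier (pow_module M J)" and x: "x \<in> J"
  shows "finsum (pow_module M J) f T x = (\<Oplus>\<^bsub>M\<^esub>t\<in>T. f t x)"
proof -
  interpret M: abelian_group M by fact
  interpret P: abelian_group "pow_module M J" by (rule abelian_group_pow_module[OF M])
  show ?thesis
  proof (cases "finite T")
    case True
    then show ?thesis using f
    proof (induction T)
      case empty
      then show ?case using x by (simp add: pow_module_simps)
    next
      case (insert t T)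
      then have "f t \<in> carrier (pow_module M J)" "f \<in> T \<rightarrow> carrier (pow_module M J)"
        by auto
      then show ?case using insert x
        by (subst P.finsum_insert, simp_all)
          (subst M.finsum_insert, auto simp: pow_module_simps(3) Pi_iff intro!: pow_module_mem[of _ M J])
    qed
  next
    case False
    then show ?thesis using x by (simp add: pow_module_simps)
  qed
qed

definition single :: "('m, 'z) ring_scheme \<Rightarrow> 'x set \<Rightarrow> 'x \<Rightarrow> 'm \<Rightarrow> 'x \<Rightarrow> 'm"
  where "single M J x r = (\<lambda>y\<in>J. if y = x then r else \<zero>\<^bsub>M\<^esub>)"

lemma single_closed [simp]:
  "abelian_group M \<Longrightarrow> r \<in> carrier M \<Longrightarrow> single M J x r \<in> carrier (pow_module M J)"
  by (auto simp: single_def pow_module_simps abelian_group_def abelian_monoid.zero_closed)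

lemma single_apply: "y \<in> J \<Longrightarrow> single M J x r y = (if y = x then r else \<zero>\<^bsub>M\<^esub>)"
  by (simp add: single_def)

lemma single_add:
  assumes "abelian_group M" "r \<in> carrier M" "s \<in> carrier M"
  shows "single M J x (r \<oplus>\<^bsub>M\<^esub> s) = single M J x r \<oplus>\<^bsub>pow_module M J\<^esub> single M J x s"
proof -
  interpret M: abelian_group M by fact
  show ?thesis using assms by (auto simp: single_def pow_module_simps intro!: restrict_ext)
qed

lemma single_smult:
  assumes "module A M" "a \<in> carrier A" "r \<in> carrier M"
  shows "single M J x (a \<odot>\<^bsub>M\<^esub> r) = a \<odot>\<^bsub>pow_module M J\<^esub> single M J x r"
proof -
  interpret M: module A M by fact
  show ?thesis using assms by (auto simp: single_def pow_module_simps intro!: restrict_ext)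
qed

lemma finsum_delta:
  assumes "abelian_group M" "finite T" "x \<in> T" "r \<in> carrier M"
  shows "(\<Oplus>\<^bsub>M\<^esub>t\<in>T. if x = t then r else \<zero>\<^bsub>M\<^esub>) = r"
proof -
  interpret M: abelian_group M by fact
  show ?thesis using M.finsum_singleton[OF assms(3,2), of "\<lambda>_. r"] assms by simp
qed

lemma pow_module_expand:
  assumes M: "abelian_group M" and J: "finite J" and v: "v \<in> carrier (pow_module M J)"
  shows "v = (\<Oplus>\<^bsub>pow_module M J\<^esub>x\<in>J. single M J x (v x))"
proof (rule pow_module_eqI[OF v])
  interpret M: abelian_group M by fact
  interpret P: abelian_group "pow_module M J" by (rule abelian_group_pow_module[OF M])
  have c: "(\<lambda>x. single M J x (v x)) \<in> J \<rightarrow> carrier (pow_module M J)"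
    using v M by (auto simp: pow_module_mem)
  show "(\<Oplus>\<^bsub>pow_module M J\<^esub>x\<in>J. single M J x (v x)) \<in> carrier (pow_module M J)"
    using c by (rule P.finsum_closed)
  fix x assume x: "x \<in> J"
  have "(\<Oplus>\<^bsub>M\<^esub>t\<in>J. single M J t (v t) x) = (\<Oplus>\<^bsub>M\<^esub>t\<in>J. if x = t then v x else \<zero>\<^bsub>M\<^esub>)"
    using x v by (intro M.finsum_cong') (auto simp: single_apply pow_module_mem)
  also have "\<dots> = v x"
    using x J v M by (simp add: finsum_delta pow_module_mem)
  finally show "v x = finsum (pow_module M J) (\<lambda>x. single M J x (v x)) J x"
    using finsum_pow_module[OF M c x] by simp
qed

section \<open>Homomorphisms\<close>

lemma mod_homI:
  assumes "\<And>x. x \<in> carrier M \<Longrightarrow> f x \<in> carrier N" "f \<in> extensional (carrier M)"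
    "\<And>x y. \<lbrakk>x \<in> carrier M; y \<in> carrier M\<rbrakk> \<Longrightarrow> f (x \<oplus>\<^bsub>M\<^esub> y) = f x \<oplus>\<^bsub>N\<^esub> f y"
    "\<And>a x. \<lbrakk>a \<in> carrier A; x \<in> carrier M\<rbrakk> \<Longrightarrow> f (a \<odot>\<^bsub>M\<^esub> x) = a \<odot>\<^bsub>N\<^esub> f x"
  shows "f \<in> mod_hom A M N"
  using assms by (auto simp: mod_hom_def PiE_def)

lemma mod_hom_restrictI:
  assumes "module A M" "\<And>x. x \<in> carrier M \<Longrightarrow> f x \<in> carrier N"
    "\<And>x y. \<lbrakk>x \<in> carrier M; y \<in> carrier M\<rbrakk> \<Longrightarrow> f (x \<oplus>\<^bsub>M\<^esub> y) = f x \<oplus>\<^bsub>N\<^esub> f y"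
    "\<And>a x. \<lbrakk>a \<in> carrier A; x \<in> carrier M\<rbrakk> \<Longrightarrow> f (a \<odot>\<^bsub>M\<^esub> x) = a \<odot>\<^bsub>N\<^esub> f x"
  shows "restrict f (carrier M) \<in> mod_hom A M N"
proof -
  interpret M: module A M by fact
  show ?thesis by (rule mod_homI) (use assms in auto)
qed

lemma mod_hom_closed: "f \<in> mod_hom A M N \<Longrightarrow> x \<in> carrier M \<Longrightarrow> f x \<in> carrier N"
  by (auto simp: mod_hom_def)

lemma mod_hom_add:
  "\<lbrakk>f \<in> mod_hom A M N; x \<in> carrier M; y \<in> carrier M\<rbrakk> \<Longrightarrow> f (x \<oplus>\<^bsub>M\<^esub> y) = f x \<oplus>\<^bsub>N\<^esub> f y"
  by (auto simp: mod_hom_def)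

lemma mod_hom_smult:
  "\<lbrakk>f \<in> mod_hom A M N; a \<in> carrier A; x \<in> carrier M\<rbrakk> \<Longrightarrow> f (a \<odot>\<^bsub>M\<^esub> x) = a \<odot>\<^bsub>N\<^esub> f x"
  by (auto simp: mod_hom_def)

lemma mod_hom_extensional: "f \<in> mod_hom A M N \<Longrightarrow> f \<in> extensional (carrier M)"
  by (auto simp: mod_hom_def PiE_def)

lemma mod_hom_eqI:
  assumes "f \<in> mod_hom A M N" "g \<in> mod_hom B M N'" "\<And>x. x \<in> carrier M \<Longrightarrow> f x = g x"
  shows "f = g"
  using assms by (meson extensionalityI mod_hom_extensional)

text \<open>Stated for bare additive functions: the homotopies on tensor products, and pairings
  viewed in their first argument, are additive but are not given as members of a
  \<open>mod_hom\<close>.\<close>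

lemma additive_zero:
  assumes "abelian_group M" "abelian_group N"
    "\<And>x. x \<in> carrier M \<Longrightarrow> f x \<in> carrier N"
    "\<And>x y. \<lbrakk>x \<in> carrier M; y \<in> carrier M\<rbrakk> \<Longrightarrow> f (x \<oplus>\<^bsub>M\<^esub> y) = f x \<oplus>\<^bsub>N\<^esub> f y"
  shows "f \<zero>\<^bsub>M\<^esub> = \<zero>\<^bsub>N\<^esub>"
proof -
  interpret M: abelian_group M by fact
  interpret N: abelian_group N by fact
  show ?thesis
    using assms(3)[of "\<zero>\<^bsub>M\<^esub>"] assms(4)[of "\<zero>\<^bsub>M\<^esub>" "\<zero>\<^bsub>M\<^esub>"] by (simp add: N.add.r_cancel_one')
qed

lemma additive_a_inv:
  assumes "abelian_group M" "abelian_group N"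
    "\<And>x. x \<in> carrier M \<Longrightarrow> f x \<in> carrier N"
    "\<And>x y. \<lbrakk>x \<in> carrier M; y \<in> carrier M\<rbrakk> \<Longrightarrow> f (x \<oplus>\<^bsub>M\<^esub> y) = f x \<oplus>\<^bsub>N\<^esub> f y"
    "x \<in> carrier M"
  shows "f (\<ominus>\<^bsub>M\<^esub> x) = \<ominus>\<^bsub>N\<^esub> f x"
proof -
  interpret M: abelian_group M by fact
  interpret N: abelian_group N by fact
  have "f (\<ominus>\<^bsub>M\<^esub> x) \<oplus>\<^bsub>N\<^esub> f x = \<zero>\<^bsub>N\<^esub>"
    using assms(4)[of "\<ominus>\<^bsub>M\<^esub> x" x] assms(5) additive_zero[of M N f] assms(1-4) by (simp add: M.l_neg)
  then show ?thesis using N.minus_equality assms(3,5) by (metis M.a_inv_closed)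
qed

lemma additive_finsum:
  assumes "abelian_group M" "abelian_group N"
    "\<And>x. x \<in> carrier M \<Longrightarrow> f x \<in> carrier N"
    "\<And>x y. \<lbrakk>x \<in> carrier M; y \<in> carrier M\<rbrakk> \<Longrightarrow> f (x \<oplus>\<^bsub>M\<^esub> y) = f x \<oplus>\<^bsub>N\<^esub> f y"
    "g \<in> T \<rightarrow> carrier M"
  shows "f (finsum M g T) = (\<Oplus>\<^bsub>N\<^esub>t\<in>T. f (g t))"
proof -
  interpret M: abelian_group M by fact
  interpret N: abelian_group N by fact
  have z: "f \<zero>\<^bsub>M\<^esub> = \<zero>\<^bsub>N\<^esub>" using assms additive_zero by blast
  show ?thesis
  proof (cases "finite T")
    case True
    then show ?thesis using assms(5)
    proof (induction T)
      case (insert t T)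
      then show ?case using assms(3,4) by (subst M.finsum_insert, auto, subst N.finsum_insert) auto
    qed (simp add: z)
  qed (simp add: z)
qed

lemma
  assumes "f \<in> mod_hom A M N" "abelian_group M" "abelian_group N"
  shows mod_hom_zero: "f \<zero>\<^bsub>M\<^esub> = \<zero>\<^bsub>N\<^esub>"
    and mod_hom_a_inv: "x \<in> carrier M \<Longrightarrow> f (\<ominus>\<^bsub>M\<^esub> x) = \<ominus>\<^bsub>N\<^esub> f x"
    and mod_hom_finsum: "g \<in> T \<rightarrow> carrier M \<Longrightarrow> f (finsum M g T) = (\<Oplus>\<^bsub>N\<^esub>t\<in>T. f (g t))"
  using additive_zero[of M N f] additive_a_inv[of M N f x] additive_finsum[of M N f g T] assms
  by (auto simp: mod_hom_def)

lemma mod_hom_minus: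
  assumes "f \<in> mod_hom A M N" "abelian_group M" "abelian_group N" "x \<in> carrier M" "y \<in> carrier M"
  shows "f (x \<ominus>\<^bsub>M\<^esub> y) = f x \<ominus>\<^bsub>N\<^esub> f y"
proof -
  interpret M: abelian_group M by fact
  show ?thesis using assms by (simp add: a_minus_def mod_hom_add mod_hom_a_inv)
qed

lemma mod_hom_compose:
  assumes "module A M" "f \<in> mod_hom A M N" "g \<in> mod_hom A N L"
  shows "compose (carrier M) g f \<in> mod_hom A M L"
  unfolding compose_def using assms
  by (intro mod_hom_restrictI) (auto simp: mod_hom_closed mod_hom_add mod_hom_smult)

lemma mod_hom_plus:
  assumes "module A M" "module A N" "f \<in> mod_hom A M N" "g \<in> mod_hom A M N"
  shows "(\<lambda>x\<in>carrier M. f x \<oplus>\<^bsub>N\<^esub> g x) \<in> mod_hom A M N"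
proof -
  interpret N: module A N by fact
  show ?thesis using assms
    by (intro mod_hom_restrictI) (auto simp: mod_hom_closed mod_hom_add mod_hom_smult N.M.a_ac N.smult_r_distr)
qed

lemma mod_hom_uminus:
  assumes "module A M" "module A N" "f \<in> mod_hom A M N"
  shows "(\<lambda>x\<in>carrier M. \<ominus>\<^bsub>N\<^esub> f x) \<in> mod_hom A M N"
proof -
  interpret N: module A N by fact
  show ?thesis using assms
    by (intro mod_hom_restrictI) (auto simp: mod_hom_closed mod_hom_add mod_hom_smult N.M.minus_add N.smult_r_minus)
qed

lemma mod_hom_diff:
  assumes "module A M" "module A N" "f \<in> mod_hom A M N" "g \<in> mod_hom A M N"
  shows "(\<lambda>x\<in>carrier M. f x \<ominus>\<^bsub>N\<^esub> g x) \<in> mod_hom A M N"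
proof -
  have "(\<lambda>x\<in>carrier M. f x \<ominus>\<^bsub>N\<^esub> g x) = (\<lambda>x\<in>carrier M. f x \<oplus>\<^bsub>N\<^esub> (\<lambda>x\<in>carrier M. \<ominus>\<^bsub>N\<^esub> g x) x)"
    by (auto simp: a_minus_def)
  then show ?thesis using mod_hom_plus[OF assms(1-3) mod_hom_uminus[OF assms(1,2,4)]] by simp
qed

lemma mod_hom_null:
  assumes "module A M" "module A N"
  shows "(\<lambda>x\<in>carrier M. \<zero>\<^bsub>N\<^esub>) \<in> mod_hom A M N"
proof -
  interpret N: module A N by fact
  show ?thesis using assms by (intro mod_hom_restrictI) auto
qed

lemma mod_hom_id:
  assumes "module A M"
  shows "(\<lambda>x\<in>carrier M. x) \<in> mod_hom A M M"
  using assms by (intro mod_hom_restrictI) auto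

section \<open>Free modules\<close>

lemma free_module_imp_module: "free_module A F \<Longrightarrow> module A F"
  by (simp add: free_module_def)

lemma finsum_smult_support:
  assumes "module A M" "finite T" "T \<subseteq> B" "c \<in> B \<rightarrow> carrier A" "{b \<in> B. c b \<noteq> \<zero>\<^bsub>A\<^esub>} \<subseteq> T" "m \<in> B \<rightarrow> carrier M"
  shows "(\<Oplus>\<^bsub>M\<^esub>b\<in>{b \<in> B. c b \<noteq> \<zero>\<^bsub>A\<^esub>}. c b \<odot>\<^bsub>M\<^esub> m b) = (\<Oplus>\<^bsub>M\<^esub>b\<in>T. c b \<odot>\<^bsub>M\<^esub> m b)"
proof -
  interpret M: module A M by fact
  show ?thesis
    by (rule M.M.add.finprod_mono_neutral_cong_left) (use assms in \<open>auto simp: Pi_iff subset_iff\<close>)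
qed

text \<open>Projectivity in the form that the recursions on resolutions use: \<open>f\<close> has to
  take its values in the image of \<open>g\<close>. A lift is chosen on the basis and extended
  through the coordinates; linearity of the extension comes from the uniqueness of
  coordinates.\<close>

lemma free_module_lift:
  assumes F: "free_module A F" and M: "module A M" and N: "abelian_group N"
    and f: "f \<in> mod_hom A F N" and g: "g \<in> mod_hom A M N"
    and im: "\<And>x. x \<in> carrier F \<Longrightarrow> f x \<in> g ` carrier M"
  obtains l where "l \<in> mod_hom A F M" "\<And>x. x \<in> carrier F \<Longrightarrow> g (l x) = f x"
proof -
  interpret F: module A F using F by (rule free_module_imp_module)
  interpret M: module A M by fact
  interpret N: abelian_group N by fact
  obtain B where B: "B \<subseteq> carrier F" and ex: "\<And>x. x \<in> carrier F \<Longrightarrow> \<exists>!c. c \<in> B \<rightarrow>\<^sub>E carrier A \<and>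
       finite {b\<in>B. c b \<noteq> \<zero>\<^bsub>A\<^esub>} \<and> x = (\<Oplus>\<^bsub>F\<^esub>b\<in>{b\<in>B. c b \<noteq> \<zero>\<^bsub>A\<^esub>}. c b \<odot>\<^bsub>F\<^esub> b)"
    using F unfolding free_module_def by (elim conjE exE) (rule that, assumption, erule (1) bspec)
  define P where "P x c \<longleftrightarrow> c \<in> B \<rightarrow>\<^sub>E carrier A \<and>
       finite {b\<in>B. c b \<noteq> \<zero>\<^bsub>A\<^esub>} \<and> x = (\<Oplus>\<^bsub>F\<^esub>b\<in>{b\<in>B. c b \<noteq> \<zero>\<^bsub>A\<^esub>}. c b \<odot>\<^bsub>F\<^esub> b)" for x c
  define C where "C = (\<lambda>x. THE c. P x c)"
  have PC: "P x (C x)" if "x \<in> carrier F" for x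
    unfolding C_def using ex[OF that] unfolding P_def by (rule theI')
  have CP: "C x = c" if "P x c" "x \<in> carrier F" for x c
    using ex[OF that(2)] PC[OF that(2)] that(1) unfolding P_def[symmetric] by (elim ex1E) metis
  have CB: "b \<in> B \<Longrightarrow> C x b \<in> carrier A" if "x \<in> carrier F" for x b
    using PC[OF that] unfolding P_def by blast
  have Cfin: "finite {b\<in>B. C x b \<noteq> \<zero>\<^bsub>A\<^esub>}" if "x \<in> carrier F" for x
    using PC[OF that] unfolding P_def by (elim conjE)
  have "\<exists>m. \<forall>b\<in>B. m b \<in> carrier M \<and> g (m b) = f b"
    using im B by (intro bchoice) (force simp: subset_iff)
  then obtain m where m: "\<And>b. b \<in> B \<Longrightarrow> m b \<in> carrier M" "\<And>b. b \<in> B \<Longrightarrow> g (m b) = f b" by blast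
  define l where "l = (\<lambda>x\<in>carrier F. \<Oplus>\<^bsub>M\<^esub>b\<in>{b\<in>B. C x b \<noteq> \<zero>\<^bsub>A\<^esub>}. C x b \<odot>\<^bsub>M\<^esub> m b)"
  \<comment> \<open>The support of the coordinates varies with \<open>x\<close>. Passing to any
    finite \<open>T\<close> that contains it puts several elements over a common index set.\<close>
  have CT: "x = (\<Oplus>\<^bsub>F\<^esub>b\<in>T. C x b \<odot>\<^bsub>F\<^esub> b)"
    if "finite T" "T \<subseteq> B" "{b\<in>B. C x b \<noteq> \<zero>\<^bsub>A\<^esub>} \<subseteq> T" "x \<in> carrier F" for x T
  proof -
    have "(\<Oplus>\<^bsub>F\<^esub>b\<in>{b\<in>B. C x b \<noteq> \<zero>\<^bsub>A\<^esub>}. C x b \<odot>\<^bsub>F\<^esub> b) = (\<Oplus>\<^bsub>F\<^esub>b\<in>T. C x b \<odot>\<^bsub>F\<^esub> b)"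
      by (rule finsum_smult_support[OF F.module_axioms that(1,2) _ that(3)]) (use CB that(4) B in auto)
    then show ?thesis using PC[OF that(4)] unfolding P_def by (metis (no_types, lifting))
  qed
  have lT: "l x = (\<Oplus>\<^bsub>M\<^esub>b\<in>T. C x b \<odot>\<^bsub>M\<^esub> m b)"
    if "finite T" "T \<subseteq> B" "{b\<in>B. C x b \<noteq> \<zero>\<^bsub>A\<^esub>} \<subseteq> T" "x \<in> carrier F" for x T
  proof -
    have "(\<Oplus>\<^bsub>M\<^esub>b\<in>{b\<in>B. C x b \<noteq> \<zero>\<^bsub>A\<^esub>}. C x b \<odot>\<^bsub>M\<^esub> m b) = (\<Oplus>\<^bsub>M\<^esub>b\<in>T. C x b \<odot>\<^bsub>M\<^esub> m b)"
      by (rule finsum_smult_support[OF M.module_axioms that(1,2) _ that(3)]) (use CB that(4) m in auto)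
    then show ?thesis using that(4) by (simp add: l_def)
  qed
  have PIc: "P x c" if "c \<in> B \<rightarrow>\<^sub>E carrier A" "finite T" "T \<subseteq> B" "{b\<in>B. c b \<noteq> \<zero>\<^bsub>A\<^esub>} \<subseteq> T"
      "x = (\<Oplus>\<^bsub>F\<^esub>b\<in>T. c b \<odot>\<^bsub>F\<^esub> b)" for x c T
  proof -
    have "(\<Oplus>\<^bsub>F\<^esub>b\<in>{b\<in>B. c b \<noteq> \<zero>\<^bsub>A\<^esub>}. c b \<odot>\<^bsub>F\<^esub> b) = (\<Oplus>\<^bsub>F\<^esub>b\<in>T. c b \<odot>\<^bsub>F\<^esub> b)"
      by (rule finsum_smult_support[OF F.module_axioms that(2,3) _ that(4)]) (use that(1) B in auto)
    then show ?thesis using that finite_subset[OF that(4,2)] unfolding P_def by simp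
  qed
  \<comment> \<open>Coordinates are unique, so it is enough that the pointwise sum represents the
    sum of \<open>x\<close> and \<open>y\<close>.\<close>
  have Cadd: "C (x \<oplus>\<^bsub>F\<^esub> y) = (\<lambda>b\<in>B. C x b \<oplus>\<^bsub>A\<^esub> C y b)" if xy: "x \<in> carrier F" "y \<in> carrier F" for x y
  proof (rule CP)
    let ?T = "{b\<in>B. C x b \<noteq> \<zero>\<^bsub>A\<^esub>} \<union> {b\<in>B. C y b \<noteq> \<zero>\<^bsub>A\<^esub>}"
    show "P (x \<oplus>\<^bsub>F\<^esub> y) (\<lambda>b\<in>B. C x b \<oplus>\<^bsub>A\<^esub> C y b)"
    proof (rule PIc[of _ ?T])
      have "x \<oplus>\<^bsub>F\<^esub> y = (\<Oplus>\<^bsub>F\<^esub>b\<in>?T. C x b \<odot>\<^bsub>F\<^esub> b) \<oplus>\<^bsub>F\<^esub> (\<Oplus>\<^bsub>F\<^esub>b\<in>?T. C y b \<odot>\<^bsub>F\<^esub> b)"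
        using CT[of ?T x] CT[of ?T y] Cfin xy by auto
      also have "\<dots> = (\<Oplus>\<^bsub>F\<^esub>b\<in>?T. C x b \<odot>\<^bsub>F\<^esub> b \<oplus>\<^bsub>F\<^esub> C y b \<odot>\<^bsub>F\<^esub> b)"
        using xy CB B by (intro F.finsum_addf[symmetric]) auto
      also have "\<dots> = (\<Oplus>\<^bsub>F\<^esub>b\<in>?T. (\<lambda>b\<in>B. C x b \<oplus>\<^bsub>A\<^esub> C y b) b \<odot>\<^bsub>F\<^esub> b)"
        using xy CB B by (intro F.finsum_cong') (auto simp: F.smult_l_distr subset_iff)
      finally show "x \<oplus>\<^bsub>F\<^esub> y = (\<Oplus>\<^bsub>F\<^esub>b\<in>?T. (\<lambda>b\<in>B. C x b \<oplus>\<^bsub>A\<^esub> C y b) b \<odot>\<^bsub>F\<^esub> b)" .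
    qed (use xy CB Cfin in auto)
  qed (use xy in auto)
  have Csmult: "C (a \<odot>\<^bsub>F\<^esub> x) = (\<lambda>b\<in>B. a \<otimes>\<^bsub>A\<^esub> C x b)" if xy: "a \<in> carrier A" "x \<in> carrier F" for a x
  proof (rule CP)
    let ?T = "{b\<in>B. C x b \<noteq> \<zero>\<^bsub>A\<^esub>}"
    show "P (a \<odot>\<^bsub>F\<^esub> x) (\<lambda>b\<in>B. a \<otimes>\<^bsub>A\<^esub> C x b)"
    proof (rule PIc[of _ ?T])
      have "a \<odot>\<^bsub>F\<^esub> x = a \<odot>\<^bsub>F\<^esub> (\<Oplus>\<^bsub>F\<^esub>b\<in>?T. C x b \<odot>\<^bsub>F\<^esub> b)"
        using CT[of ?T x] Cfin xy by auto
      also have "\<dots> = (\<Oplus>\<^bsub>F\<^esub>b\<in>?T. a \<odot>\<^bsub>F\<^esub> (C x b \<odot>\<^bsub>F\<^esub> b))"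
        using xy CB B Cfin by (intro F.finsum_smult_ldistr) auto
      also have "\<dots> = (\<Oplus>\<^bsub>F\<^esub>b\<in>?T. (\<lambda>b\<in>B. a \<otimes>\<^bsub>A\<^esub> C x b) b \<odot>\<^bsub>F\<^esub> b)"
        using xy CB B by (intro F.finsum_cong') (auto simp: F.smult_assoc1 subset_iff)
      finally show "a \<odot>\<^bsub>F\<^esub> x = (\<Oplus>\<^bsub>F\<^esub>b\<in>?T. (\<lambda>b\<in>B. a \<otimes>\<^bsub>A\<^esub> C x b) b \<odot>\<^bsub>F\<^esub> b)" .
    qed (use xy CB Cfin in auto)
  qed (use xy in auto)
  show thesis
  proof (rule that)
    show "l \<in> mod_hom A F M"
    proof (rule mod_homI)
      fix x assume x: "x \<in> carrier F"
      show "l x \<in> carrier M"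
        unfolding l_def using x m CB by (auto intro!: M.finsum_closed)
    next
      fix x y assume xy: "x \<in> carrier F" "y \<in> carrier F"
      let ?T = "{b\<in>B. C x b \<noteq> \<zero>\<^bsub>A\<^esub>} \<union> {b\<in>B. C y b \<noteq> \<zero>\<^bsub>A\<^esub>}"
      have "l (x \<oplus>\<^bsub>F\<^esub> y) = (\<Oplus>\<^bsub>M\<^esub>b\<in>?T. C (x \<oplus>\<^bsub>F\<^esub> y) b \<odot>\<^bsub>M\<^esub> m b)"
        using xy CB Cfin by (intro lT) (auto simp: Cadd)
      also have "\<dots> = (\<Oplus>\<^bsub>M\<^esub>b\<in>?T. C x b \<odot>\<^bsub>M\<^esub> m b \<oplus>\<^bsub>M\<^esub> C y b \<odot>\<^bsub>M\<^esub> m b)"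
        using xy CB m by (intro M.finsum_cong') (auto simp: Cadd M.smult_l_distr)
      also have "\<dots> = (\<Oplus>\<^bsub>M\<^esub>b\<in>?T. C x b \<odot>\<^bsub>M\<^esub> m b) \<oplus>\<^bsub>M\<^esub> (\<Oplus>\<^bsub>M\<^esub>b\<in>?T. C y b \<odot>\<^bsub>M\<^esub> m b)"
        using xy CB m by (intro M.finsum_addf) auto
      also have "\<dots> = l x \<oplus>\<^bsub>M\<^esub> l y"
        using lT[of ?T x] lT[of ?T y] Cfin xy by auto
      finally show "l (x \<oplus>\<^bsub>F\<^esub> y) = l x \<oplus>\<^bsub>M\<^esub> l y" .
    next
      fix a x assume xy: "a \<in> carrier A" "x \<in> carrier F"
      let ?T = "{b\<in>B. C x b \<noteq> \<zero>\<^bsub>A\<^esub>}"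
      have "l (a \<odot>\<^bsub>F\<^esub> x) = (\<Oplus>\<^bsub>M\<^esub>b\<in>?T. C (a \<odot>\<^bsub>F\<^esub> x) b \<odot>\<^bsub>M\<^esub> m b)"
        using xy CB Cfin by (intro lT) (auto simp: Csmult)
      also have "\<dots> = (\<Oplus>\<^bsub>M\<^esub>b\<in>?T. a \<odot>\<^bsub>M\<^esub> (C x b \<odot>\<^bsub>M\<^esub> m b))"
        using xy CB m by (intro M.finsum_cong') (auto simp: Csmult M.smult_assoc1)
      also have "\<dots> = a \<odot>\<^bsub>M\<^esub> (\<Oplus>\<^bsub>M\<^esub>b\<in>?T. C x b \<odot>\<^bsub>M\<^esub> m b)"
        using xy CB m Cfin by (intro M.finsum_smult_ldistr[symmetric]) auto
      also have "\<dots> = a \<odot>\<^bsub>M\<^esub> l x"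
        using lT[of ?T x] Cfin xy by auto
      finally show "l (a \<odot>\<^bsub>F\<^esub> x) = a \<odot>\<^bsub>M\<^esub> l x" .
    qed (simp add: l_def)
  next
    fix x assume x: "x \<in> carrier F"
    let ?T = "{b\<in>B. C x b \<noteq> \<zero>\<^bsub>A\<^esub>}"
    have "g (l x) = g (\<Oplus>\<^bsub>M\<^esub>b\<in>?T. C x b \<odot>\<^bsub>M\<^esub> m b)"
      using lT[of ?T x] Cfin x by auto
    also have "\<dots> = (\<Oplus>\<^bsub>N\<^esub>b\<in>?T. g (C x b \<odot>\<^bsub>M\<^esub> m b))"
      using x CB m by (intro mod_hom_finsum[OF g]) (auto intro: N M.abelian_group_axioms)
    also have "\<dots> = (\<Oplus>\<^bsub>N\<^esub>b\<in>?T. f (C x b \<odot>\<^bsub>F\<^esub> b))"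
      using x CB m B by (intro N.finsum_cong')
        (auto simp: mod_hom_smult[OF g] mod_hom_smult[OF f] subset_iff intro!: mod_hom_closed[OF f]
          simp flip: mod_hom_smult[OF f])
    also have "\<dots> = f (\<Oplus>\<^bsub>F\<^esub>b\<in>?T. C x b \<odot>\<^bsub>F\<^esub> b)"
      using x CB B by (intro mod_hom_finsum[OF f, symmetric]) (auto intro: N F.abelian_group_axioms)
    also have "\<dots> = f x"
      using CT[of ?T x] Cfin x by auto
    finally show "g (l x) = f x" .
  qed
qed

text \<open>Freeness indexes coordinates by a set of basis elements, not by a family. Since
  \<open>\<one> \<noteq> \<zero>\<close>, distinct indices have distinct unit vectors, and the two
  ways of indexing agree.\<close>

lemma free_module_pow_module:
  assumes A: "cring A" and ne: "\<one>\<^bsub>A\<^esub> \<noteq> \<zero>\<^bsub>A\<^esub>" and J: "finite J"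
  shows "free_module A (pow_module (regular_module A) J)"
proof -
  interpret A: cring A by fact
  let ?M = "regular_module A"
  let ?P = "pow_module ?M J"
  let ?d = "\<lambda>x. single ?M J x \<one>\<^bsub>A\<^esub>"
  note M = module_regular_module[OF A]
  note G = module_imp_abelian_group[OF M]
  interpret P: module A ?P by (rule module_pow_module[OF M])
  have inj: "inj_on ?d J"
    using ne by (auto simp: inj_on_def single_def fun_eq_iff restrict_def split: if_splits)
  have d: "?d x \<in> carrier ?P" for x using G by simp
  have sumB: "(\<Oplus>\<^bsub>?P\<^esub>b\<in>{b \<in> ?d ` J. c b \<noteq> \<zero>\<^bsub>A\<^esub>}. c b \<odot>\<^bsub>?P\<^esub> b) = (\<lambda>x\<in>J. c (?d x))"
    if c: "c \<in> ?d ` J \<rightarrow> carrier A" for c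
  proof (rule pow_module_eqI[where M = ?M and J = J])
    show "(\<Oplus>\<^bsub>?P\<^esub>b\<in>{b \<in> ?d ` J. c b \<noteq> \<zero>\<^bsub>A\<^esub>}. c b \<odot>\<^bsub>?P\<^esub> b) \<in> carrier ?P"
      using c d by (intro P.finsum_closed) auto
    show r: "(\<lambda>x\<in>J. c (?d x)) \<in> carrier ?P"
      using c by (auto simp: pow_module_simps)
    fix x assume x: "x \<in> J"
    have "(\<Oplus>\<^bsub>?P\<^esub>b\<in>{b \<in> ?d ` J. c b \<noteq> \<zero>\<^bsub>A\<^esub>}. c b \<odot>\<^bsub>?P\<^esub> b) = (\<Oplus>\<^bsub>?P\<^esub>b\<in>?d ` J. c b \<odot>\<^bsub>?P\<^esub> b)"
      using c d J by (intro finsum_smult_support[OF P.module_axioms]) auto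
    also have "\<dots> = (\<Oplus>\<^bsub>?P\<^esub>x\<in>J. c (?d x) \<odot>\<^bsub>?P\<^esub> ?d x)"
      using c d by (intro P.finsum_reindex inj) auto
    also have "\<dots> = (\<Oplus>\<^bsub>?P\<^esub>x\<in>J. single ?M J x ((\<lambda>x\<in>J. c (?d x)) x))"
    proof (intro P.finsum_cong')
      fix y assume y: "y \<in> J"
      then have cy: "c (?d y) \<in> carrier A" using c by auto
      from single_smult[OF M cy, of "\<one>\<^bsub>A\<^esub>" J y] y cy
      show "c (?d y) \<odot>\<^bsub>?P\<^esub> ?d y = single ?M J y ((\<lambda>x\<in>J. c (?d x)) y)" by simp
    qed (use c G in \<open>auto intro!: single_closed simp: Pi_iff\<close>)
    also have "\<dots> = (\<lambda>x\<in>J. c (?d x))"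
      by (rule pow_module_expand[OF G J r, symmetric])
    finally show "(\<Oplus>\<^bsub>?P\<^esub>b\<in>{b \<in> ?d ` J. c b \<noteq> \<zero>\<^bsub>A\<^esub>}. c b \<odot>\<^bsub>?P\<^esub> b) x = (\<lambda>x\<in>J. c (?d x)) x" by simp
  qed
  show ?thesis unfolding free_module_def
  proof (intro conjI exI[of _ "?d ` J"] ballI)
    fix v assume v: "v \<in> carrier ?P"
    let ?c = "\<lambda>b\<in>?d ` J. v (the_inv_into J ?d b)"
    have cd: "?c (?d x) = v x" if "x \<in> J" for x
      using that by (simp add: the_inv_into_f_f[OF inj])
    show "\<exists>!c. c \<in> ?d ` J \<rightarrow>\<^sub>E carrier A \<and> finite {b \<in> ?d ` J. c b \<noteq> \<zero>\<^bsub>A\<^esub>} \<and>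
       v = (\<Oplus>\<^bsub>?P\<^esub>b\<in>{b \<in> ?d ` J. c b \<noteq> \<zero>\<^bsub>A\<^esub>}. c b \<odot>\<^bsub>?P\<^esub> b)"
    proof (rule ex1I[of _ ?c], intro conjI)
      show c: "?c \<in> ?d ` J \<rightarrow>\<^sub>E carrier A"
        using v by (auto simp: the_inv_into_f_f[OF inj] pow_module_mem[OF v, simplified])
      show "finite {b \<in> ?d ` J. ?c b \<noteq> \<zero>\<^bsub>A\<^esub>}" using J by simp
      show "v = (\<Oplus>\<^bsub>?P\<^esub>b\<in>{b \<in> ?d ` J. ?c b \<noteq> \<zero>\<^bsub>A\<^esub>}. ?c b \<odot>\<^bsub>?P\<^esub> b)"
      proof (subst sumB)
        show "v = (\<lambda>x\<in>J. ?c (?d x))"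
          using v cd by (intro extensionalityI[of _ J]) (auto simp: pow_module_simps PiE_iff cd)
      qed (use c in auto)
    next
      fix c assume c: "c \<in> ?d ` J \<rightarrow>\<^sub>E carrier A \<and> finite {b \<in> ?d ` J. c b \<noteq> \<zero>\<^bsub>A\<^esub>} \<and>
       v = (\<Oplus>\<^bsub>?P\<^esub>b\<in>{b \<in> ?d ` J. c b \<noteq> \<zero>\<^bsub>A\<^esub>}. c b \<odot>\<^bsub>?P\<^esub> b)"
      have "c \<in> ?d ` J \<rightarrow> carrier A" using c by blast
      from sumB[OF this] c have vc: "v = (\<lambda>x\<in>J. c (?d x))" by simp
      have "c b = ?c b" if "b \<in> ?d ` J" for b
        using that by (auto simp: vc the_inv_into_f_f[OF inj])
      then show "c = ?c"
        using c by (intro extensionalityI[of _ "?d ` J"]) (auto simp: PiE_def)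
    qed
  qed (use P.module_axioms d in auto)
qed

section \<open>Cochain complexes of homomorphisms and their cohomology\<close>

definition chain_complex :: "('a, 'x) ring_scheme \<Rightarrow> ('a, 'm) module_complex \<Rightarrow> bool"
  where "chain_complex A C \<longleftrightarrow>
    (\<forall>i. module A (obj C i)) \<and>
    (\<forall>i. bdry C i \<in> mod_hom A (obj C i) (obj C (i - 1))) \<and>
    (\<forall>i. \<forall>x\<in>carrier (obj C i). bdry C (i - 1) (bdry C i x) = \<zero>\<^bsub>obj C (i - 1 - 1)\<^esub>)"

locale hom_complex =
  fixes A :: "('a, 'x) ring_scheme" and P :: "('a, 'm) module_complex" and D :: "('a, 'n) module_complex"
  assumes P: "chain_complex A P" and D: "chain_complex A D"
begin

sublocale P: module A "obj P i" for i
  using P by (simp add: chain_complex_def)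

sublocale D: module A "obj D i" for i
  using D by (simp add: chain_complex_def)

lemma bdry_P [simp]: "bdry P i \<in> mod_hom A (obj P i) (obj P (i - 1))"
  using P by (simp add: chain_complex_def)

lemma bdry_D [simp]: "bdry D i \<in> mod_hom A (obj D i) (obj D (i - 1))"
  using D by (simp add: chain_complex_def)

lemma bdry_bdry_P [simp]: "x \<in> carrier (obj P i) \<Longrightarrow> bdry P (i - 1) (bdry P i x) = \<zero>\<^bsub>obj P (i - 1 - 1)\<^esub>"
  using P by (simp add: chain_complex_def)

lemma bdry_bdry_D [simp]: "x \<in> carrier (obj D i) \<Longrightarrow> bdry D (i - 1) (bdry D i x) = \<zero>\<^bsub>obj D (i - 1 - 1)\<^esub>"
  using D by (simp add: chain_complex_def)

lemma bdry_P_closed [simp]: "x \<in> carrier (obj P i) \<Longrightarrow> bdry P i x \<in> carrier (obj P (i - 1))"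
  by (rule mod_hom_closed[OF bdry_P])

lemma bdry_D_closed [simp]: "x \<in> carrier (obj D i) \<Longrightarrow> bdry D i x \<in> carrier (obj D (i - 1))"
  by (rule mod_hom_closed[OF bdry_D])

abbreviation "cochains \<equiv> hom_group A P D"
abbreviation "\<Delta> \<equiv> hom_differential P D"

lemma cochainD: "f \<in> carrier (cochains n) \<Longrightarrow> f i \<in> mod_hom A (obj P i) (obj D (i - n))"
  by (simp add: hom_group_def)

lemma cochain_closed [simp]:
  "f \<in> carrier (cochains n) \<Longrightarrow> x \<in> carrier (obj P i) \<Longrightarrow> f i x \<in> carrier (obj D (i - n))"
  by (rule mod_hom_closed[OF cochainD])

lemma cochain_eqI:
  assumes "f \<in> carrier (cochains n)" "g \<in> carrier (cochains n)"
    "\<And>i x. x \<in> carrier (obj P i) \<Longrightarrow> f i x = g i x"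
  shows "f = g"
  by (intro ext[where 'a = int] mod_hom_eqI[OF cochainD[OF assms(1)] cochainD[OF assms(2)]] assms(3))

lemma cochain_simps:
  "x \<in> carrier (obj P i) \<Longrightarrow> (f \<otimes>\<^bsub>cochains n\<^esub> g) i x = f i x \<oplus>\<^bsub>obj D (i - n)\<^esub> g i x"
  "x \<in> carrier (obj P i) \<Longrightarrow> \<one>\<^bsub>cochains n\<^esub> i x = \<zero>\<^bsub>obj D (i - n)\<^esub>"
  by (simp_all add: hom_group_def)

lemma cochain_mult_closed [simp]:
  "f \<in> carrier (cochains n) \<Longrightarrow> g \<in> carrier (cochains n) \<Longrightarrow> f \<otimes>\<^bsub>cochains n\<^esub> g \<in> carrier (cochains n)"
  by (simp add: hom_group_def mod_hom_plus P.module_axioms D.module_axioms)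

lemma cochain_one_closed [simp]: "\<one>\<^bsub>cochains n\<^esub> \<in> carrier (cochains n)"
  by (simp add: hom_group_def mod_hom_null P.module_axioms D.module_axioms)

lemma comm_group_cochains: "comm_group (cochains n)"
proof (rule comm_groupI)
  fix f assume f: "f \<in> carrier (cochains n)"
  show "\<exists>g\<in>carrier (cochains n). g \<otimes>\<^bsub>cochains n\<^esub> f = \<one>\<^bsub>cochains n\<^esub>"
  proof
    show g: "(\<lambda>i. \<lambda>x\<in>carrier (obj P i). \<ominus>\<^bsub>obj D (i - n)\<^esub> f i x) \<in> carrier (cochains n)"
      using f by (simp add: hom_group_def mod_hom_uminus P.module_axioms D.module_axioms)
    then show "(\<lambda>i. \<lambda>x\<in>carrier (obj P i). \<ominus>\<^bsub>obj D (i - n)\<^esub> f i x) \<otimes>\<^bsub>cochains n\<^esub> f = \<one>\<^bsub>cochains n\<^esub>"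
      using f by (intro cochain_eqI[of _ n]) (auto simp: cochain_simps D.l_neg)
  qed
qed (auto intro!: cochain_eqI[of _ n] simp: cochain_simps D.a_ac)

sublocale C: comm_group "cochains n" for n
  by (rule comm_group_cochains)

lemma differential_apply:
  "x \<in> carrier (obj P i) \<Longrightarrow> \<Delta> n f i x =
    (if even n then bdry D (i - n) (f i x) \<ominus>\<^bsub>obj D (i - n - 1)\<^esub> f (i - 1) (bdry P i x)
     else bdry D (i - n) (f i x) \<oplus>\<^bsub>obj D (i - n - 1)\<^esub> f (i - 1) (bdry P i x))"
  by (simp add: hom_differential_def)

lemma differential_closed:
  assumes f: "f \<in> carrier (cochains n)"
  shows "\<Delta> n f \<in> carrier (cochains (n + 1))"
proof -
  have 1: "compose (carrier (obj P i)) (bdry D (i - n)) (f i) \<in> mod_hom A (obj P i) (obj D (i - n - 1))" for i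
    by (rule mod_hom_compose[OF P.module_axioms cochainD[OF f] bdry_D])
  have "compose (carrier (obj P i)) (f (i - 1)) (bdry P i) \<in> mod_hom A (obj P i) (obj D (i - 1 - n))" for i
    by (rule mod_hom_compose[OF P.module_axioms bdry_P cochainD[OF f]])
  then have 2: "compose (carrier (obj P i)) (f (i - 1)) (bdry P i) \<in> mod_hom A (obj P i) (obj D (i - n - 1))" for i
    by (simp add: algebra_simps)
  have "\<Delta> n f i \<in> mod_hom A (obj P i) (obj D (i - n - 1))" for i
    using mod_hom_diff[OF P.module_axioms D.module_axioms 1 2] mod_hom_plus[OF P.module_axioms D.module_axioms 1 2]
    by (cases "even n") (simp_all add: hom_differential_def compose_def cong: restrict_cong)
  then show ?thesis by (simp add: hom_group_def algebra_simps)
qed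

lemma f_bdry_closed:
  assumes "f \<in> carrier (cochains n)" "x \<in> carrier (obj P i)"
  shows "f (i - 1) (bdry P i x) \<in> carrier (obj D (i - n - 1))"
  using cochain_closed[OF assms(1) bdry_P_closed[OF assms(2)]] by (simp add: algebra_simps)

lemma differential_mult:
  assumes f: "f \<in> carrier (cochains n)" and g: "g \<in> carrier (cochains n)"
  shows "\<Delta> n (f \<otimes>\<^bsub>cochains n\<^esub> g) = \<Delta> n f \<otimes>\<^bsub>cochains (n + 1)\<^esub> \<Delta> n g"
proof (rule cochain_eqI[of _ "n + 1"])
  fix i x assume x: "x \<in> carrier (obj P i)"
  note c = x f_bdry_closed[OF f x] f_bdry_closed[OF g x] cochain_closed[OF f x] cochain_closed[OF g x]
  have e: "i - 1 - n = i - n - 1" "i - (n + 1) = i - n - 1" by simp_all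
  show "\<Delta> n (f \<otimes>\<^bsub>cochains n\<^esub> g) i x = (\<Delta> n f \<otimes>\<^bsub>cochains (n + 1)\<^esub> \<Delta> n g) i x"
    using c unfolding cochain_simps(1)[OF x] differential_apply[OF x] cochain_simps(1)[OF bdry_P_closed[OF x]] e
    by (simp add: mod_hom_add[OF bdry_D] D.minus_eq D.minus_add D.a_ac)
qed (use f g in \<open>auto intro!: differential_closed\<close>)

text \<open>The two mixed terms \<open>\<partial> f \<partial>\<close> cancel because the sign in
  the differential changes with the parity of the degree; the outer terms vanish by
  \<open>\<partial> \<partial> = 0\<close>.\<close>

lemma differential_differential:
  assumes f: "f \<in> carrier (cochains n)"
  shows "\<Delta> (n + 1) (\<Delta> n f) = \<one>\<^bsub>cochains (n + 1 + 1)\<^esub>"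
proof (rule cochain_eqI[of _ "n + 1 + 1"])
  fix i x assume x: "x \<in> carrier (obj P i)"
  have e: "i - 1 - n = i - n - 1" "i - (n + 1) = i - n - 1" "i - (n + 1 + 1) = i - n - 1 - 1"
    "i - 1 - n - 1 = i - n - 1 - 1" by simp_all
  note c = x f_bdry_closed[OF f x] cochain_closed[OF f x] bdry_P_closed[OF x]
  have z: "f (i - 1 - 1) \<zero>\<^bsub>obj P (i - 1 - 1)\<^esub> = \<zero>\<^bsub>obj D (i - n - 1 - 1)\<^esub>"
    using mod_hom_zero[OF cochainD[OF f, of "i - 1 - 1"] P.abelian_group_axioms D.abelian_group_axioms]
    by (simp add: algebra_simps)
  have w: "bdry D (i - n - 1) (f (i - 1) (bdry P i x)) \<in> carrier (obj D (i - n - 2))"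
    using bdry_D_closed[OF f_bdry_closed[OF f x]] by simp
  show "\<Delta> (n + 1) (\<Delta> n f) i x = \<one>\<^bsub>cochains (n + 1 + 1)\<^esub> i x"
    using c z w unfolding cochain_simps(2)[OF x] differential_apply[OF x] differential_apply[OF bdry_P_closed[OF x]] e
      bdry_bdry_P[OF x]
    by (simp add: mod_hom_add[OF bdry_D] mod_hom_minus[OF bdry_D] D.abelian_group_axioms D.minus_eq D.minus_add
        D.a_ac D.r_neg D.l_neg abelian_group_uminus_zero[OF D.abelian_group_axioms] mod_hom_a_inv[OF bdry_D] bdry_D_closed[where i = "i - n - 1"])
qed (rule differential_closed[OF differential_closed[OF f]], simp)

lemma group_hom_differential: "group_hom (cochains n) (cochains (n + 1)) (\<Delta> n)"
  by (unfold_locales) (auto simp: hom_def differential_closed differential_mult)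

abbreviation "cocycles \<equiv> hom_cocycles A P D"
abbreviation "coboundaries \<equiv> hom_coboundaries A P D"

lemma subgroup_cocycles: "subgroup (cocycles n) (cochains n)"
  using group_hom.subgroup_kernel[OF group_hom_differential[of n]]
  by (simp add: kernel_def hom_cocycles_def)

lemma subgroup_coboundaries: "subgroup (coboundaries n) (cochains n)"
  using group_hom.img_is_subgroup[OF group_hom_differential[of "n - 1"]]
  by (simp add: hom_coboundaries_def)

lemma coboundaries_subset: "coboundaries n \<subseteq> cocycles n"
proof
  fix f assume "f \<in> coboundaries n"
  then obtain u where u: "u \<in> carrier (cochains (n - 1))" "f = \<Delta> (n - 1) u"
    by (auto simp: hom_coboundaries_def)
  show "f \<in> cocycles n"
    using differential_closed[OF u(1)] differential_differential[OF u(1)] u(2)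
    by (simp add: hom_cocycles_def)
qed

lemma cocycles_imp_cochain [simp]: "f \<in> cocycles n \<Longrightarrow> f \<in> carrier (cochains n)"
  by (simp add: hom_cocycles_def)

lemma cocycles_mult [simp]:
  "f \<in> cocycles n \<Longrightarrow> g \<in> cocycles n \<Longrightarrow> f \<otimes>\<^bsub>cochains n\<^esub> g \<in> cocycles n"
  using subgroup_cocycles by (rule subgroup.m_closed)

lemma cocycles_iff:
  "f \<in> cocycles n \<longleftrightarrow> f \<in> carrier (cochains n) \<and>
    (\<forall>i. \<forall>x\<in>carrier (obj P i). bdry D (i - n) (f i x) =
      (if even n then f (i - 1) (bdry P i x) else \<ominus>\<^bsub>obj D (i - n - 1)\<^esub> f (i - 1) (bdry P i x)))"
proof (cases "f \<in> carrier (cochains n)")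
  case f: True
  have "\<Delta> n f = \<one>\<^bsub>cochains (n + 1)\<^esub> \<longleftrightarrow> (\<forall>i. \<forall>x\<in>carrier (obj P i). \<Delta> n f i x = \<one>\<^bsub>cochains (n + 1)\<^esub> i x)"
    using cochain_eqI[OF differential_closed[OF f] cochain_one_closed] by auto
  also have "\<dots> \<longleftrightarrow> (\<forall>i. \<forall>x\<in>carrier (obj P i). bdry D (i - n) (f i x) =
      (if even n then f (i - 1) (bdry P i x) else \<ominus>\<^bsub>obj D (i - n - 1)\<^esub> f (i - 1) (bdry P i x)))"
  proof (intro iff_allI ball_cong refl)
    fix i x assume x: "x \<in> carrier (obj P i)"
    have e: "i - (n + 1) = i - n - 1" by simp
    note c = f_bdry_closed[OF f x] bdry_D_closed[OF cochain_closed[OF f x]]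
    have iff: "bdry D (i - n) (f i x) \<oplus>\<^bsub>obj D (i - n - 1)\<^esub> f (i - 1) (bdry P i x) = \<zero>\<^bsub>obj D (i - n - 1)\<^esub> \<longleftrightarrow>
        bdry D (i - n) (f i x) = \<ominus>\<^bsub>obj D (i - n - 1)\<^esub> f (i - 1) (bdry P i x)"
      using D.minus_equality[OF _ c] D.l_neg[OF c(1)] by metis
    note iff' = abelian_group_minus_eq_zero_iff[OF D.abelian_group_axioms c(2,1)]
    show "(\<Delta> n f i x = \<one>\<^bsub>cochains (n + 1)\<^esub> i x) \<longleftrightarrow> (bdry D (i - n) (f i x) =
      (if even n then f (i - 1) (bdry P i x) else \<ominus>\<^bsub>obj D (i - n - 1)\<^esub> f (i - 1) (bdry P i x)))"
      using iff iff' unfolding differential_apply[OF x] cochain_simps(2)[OF x] e by (cases "even n") simp_all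
  qed
  finally show ?thesis using f by (simp only: hom_cocycles_def mem_Collect_eq simp_thms)
qed (simp only: hom_cocycles_def mem_Collect_eq simp_thms)

abbreviation "cls n f \<equiv> coboundaries n #>\<^bsub>cochains n\<^esub> f"
abbreviation "Z n \<equiv> (cochains n)\<lparr>carrier := cocycles n\<rparr>"

lemma comm_group_Z: "comm_group (Z n)"
  by (rule group.group_comm_groupI[OF subgroup.subgroup_is_group[OF subgroup_cocycles]])
    (auto simp: C.group_axioms C.m_comm)

lemma normal_coboundaries: "coboundaries n \<lhd> Z n"
  using comm_group.normal_iff_subgroup[OF comm_group_Z] C.subgroup_incl[OF subgroup_coboundaries subgroup_cocycles]
    coboundaries_subset by simp

lemma comm_group_Ext: "comm_group (Ext_group A P D n)"
  unfolding Ext_group_def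
  using comm_group.abelian_FactGroup[OF comm_group_Z] C.subgroup_incl[OF subgroup_coboundaries subgroup_cocycles]
    coboundaries_subset by simp

lemma carrier_Ext: "carrier (Ext_group A P D n) = cls n ` cocycles n"
  by (auto simp: Ext_group_def FactGroup_def RCOSETS_def r_coset_def)

lemma cls_closed [simp]: "f \<in> cocycles n \<Longrightarrow> cls n f \<in> carrier (Ext_group A P D n)"
  by (simp add: carrier_Ext)

lemma cls_mult:
  assumes "f \<in> cocycles n" "g \<in> cocycles n"
  shows "cls n f \<otimes>\<^bsub>Ext_group A P D n\<^esub> cls n g = cls n (f \<otimes>\<^bsub>cochains n\<^esub> g)"
  using normal.rcos_sum[OF normal_coboundaries, of f n g] assms
  by (simp add: Ext_group_def FactGroup_def r_coset_def set_mult_def)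

lemma one_Ext: "\<one>\<^bsub>Ext_group A P D n\<^esub> = cls n \<one>\<^bsub>cochains n\<^esub>"
proof -
  have "cls n \<one>\<^bsub>cochains n\<^esub> = coboundaries n"
    using subgroup.subset[OF subgroup_coboundaries] by (rule C.coset_mult_one)
  then show ?thesis by (simp add: Ext_group_def FactGroup_def)
qed

lemma cls_eq_iff:
  assumes "f \<in> carrier (cochains n)" "g \<in> carrier (cochains n)"
  shows "cls n f = cls n g \<longleftrightarrow> (\<exists>u\<in>carrier (cochains (n - 1)). f = \<Delta> (n - 1) u \<otimes>\<^bsub>cochains n\<^esub> g)"
proof
  assume "cls n f = cls n g"
  then have "f \<in> cls n g" using C.rcos_self[OF assms(1) subgroup_coboundaries] by simp
  then show "\<exists>u\<in>carrier (cochains (n - 1)). f = \<Delta> (n - 1) u \<otimes>\<^bsub>cochains n\<^esub> g"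
    by (auto simp: r_coset_def hom_coboundaries_def)
next
  assume "\<exists>u\<in>carrier (cochains (n - 1)). f = \<Delta> (n - 1) u \<otimes>\<^bsub>cochains n\<^esub> g"
  then have "f \<in> cls n g" by (auto simp: r_coset_def hom_coboundaries_def)
  then show "cls n f = cls n g" using C.repr_independence[OF _ assms(2) subgroup_coboundaries] by blast
qed

lemma mem_cls_iff:
  "f \<in> cls n g \<longleftrightarrow> (\<exists>u\<in>carrier (cochains (n - 1)). f = \<Delta> (n - 1) u \<otimes>\<^bsub>cochains n\<^esub> g)"
  by (auto simp: r_coset_def hom_coboundaries_def)

end

section \<open>Composition products and functionals\<close>

lemma ring_complex_simps:
  "carrier (obj (ring_complex A) i) = (if i = 0 then carrier A else {\<zero>\<^bsub>A\<^esub>})"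
  "\<zero>\<^bsub>obj (ring_complex A) i\<^esub> = \<zero>\<^bsub>A\<^esub>"
  "x \<oplus>\<^bsub>obj (ring_complex A) i\<^esub> y = x \<oplus>\<^bsub>A\<^esub> y"
  "a \<odot>\<^bsub>obj (ring_complex A) i\<^esub> x = a \<otimes>\<^bsub>A\<^esub> x"
  "bdry (ring_complex A) i = (\<lambda>x\<in>carrier (obj (ring_complex A) i). \<zero>\<^bsub>A\<^esub>)"
  by (auto simp: ring_complex_def regular_module_def)

lemma obj_ring_complex_0: "obj (ring_complex A) 0 = regular_module A"
  by (simp add: ring_complex_def)

lemma chain_complex_ring_complex:
  assumes "cring A"
  shows "chain_complex A (ring_complex A)"
proof -
  interpret A: cring A by fact
  have m: "module A (obj (ring_complex A) i)" for i
  proof (cases "i = 0")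
    case True
    then show ?thesis using assms by (simp add: obj_ring_complex_0 module_regular_module)
  next
    case False
    show ?thesis
      by (rule moduleI[OF assms], rule abelian_groupI) (use False in \<open>auto simp: ring_complex_simps\<close>)
  qed
  have "bdry (ring_complex A) i \<in> mod_hom A (obj (ring_complex A) i) (obj (ring_complex A) (i - 1))" for i
    using mod_hom_null[OF m[of i] m[of "i - 1"]] by (simp add: ring_complex_simps)
  then show ?thesis using m by (auto simp: chain_complex_def ring_complex_simps)
qed

text \<open>As \<open>ring_complex A\<close> lives in degree 0, a cochain of degree \<open>n\<close>
  into it has its only nonzero component at index \<open>n\<close>. These are the cocycles of degree
  \<open>n\<close> stripped of the zero components.\<close>

definition cocycle_functionals :: "('a, 'x) ring_scheme \<Rightarrow> ('a, 'm) module_complex \<Rightarrow> int \<Rightarrow> ('m \<Rightarrow> 'a) set"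
  where "cocycle_functionals A P n = {\<phi> \<in> mod_hom A (obj P n) (regular_module A).
    \<forall>y\<in>carrier (obj P (n + 1)). \<phi> (bdry P (n + 1) y) = \<zero>\<^bsub>A\<^esub>}"

text \<open>Replaces the finite sum in \<open>fin_gen_graded_right_module\<close>: closure under
  three rules is easier to carry along homotopies and products than a family of coefficients.
  Admitting all boundaries makes it a predicate on cocycles instead of classes; zero arises as the
  boundary of the zero functional.\<close>

inductive generated_functional ::
    "('a, 'x) ring_scheme \<Rightarrow> ('a, 'm) module_complex \<Rightarrow> (int \<times> ('m \<Rightarrow> 'a)) set \<Rightarrow> int \<Rightarrow> ('m \<Rightarrow> 'a) \<Rightarrow> bool"
  for A P G where
    act: "\<lbrakk>(d, g) \<in> G; c \<in> hom_cocycles A P P (n - d)\<rbrakk> \<Longrightarrow>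
      generated_functional A P G n (\<lambda>x\<in>carrier (obj P n). g (c n x))"
  | add: "\<lbrakk>generated_functional A P G n \<phi>; generated_functional A P G n \<psi>\<rbrakk> \<Longrightarrow>
      generated_functional A P G n (\<lambda>x\<in>carrier (obj P n). \<phi> x \<oplus>\<^bsub>A\<^esub> \<psi> x)"
  | bdry: "u \<in> mod_hom A (obj P (n - 1)) (regular_module A) \<Longrightarrow>
      generated_functional A P G n (\<lambda>x\<in>carrier (obj P n). u (bdry P n x))"

definition functionals_fin_gen :: "('a, 'x) ring_scheme \<Rightarrow> ('a, 'm) module_complex \<Rightarrow> bool"
  where "functionals_fin_gen A P \<longleftrightarrow> (\<exists>G. finite G \<and> (\<forall>(d, g)\<in>G. g \<in> cocycle_functionals A P d) \<and>
    (\<forall>n. \<forall>\<phi>\<in>cocycle_functionals A P n. generated_functional A P G n \<phi>))"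

locale ring_hom_complex =
  fixes A :: "('a, 'x) ring_scheme" and P :: "('a, 'm) module_complex"
  assumes P: "chain_complex A P"
begin

lemma cring_A: "cring A"
  using P module_imp_cring by (auto simp: chain_complex_def)

sublocale A: cring A by (rule cring_A)

sublocale E: hom_complex A P P
  by unfold_locales (rule P)+

sublocale F: hom_complex A P "ring_complex A"
  by unfold_locales (rule P chain_complex_ring_complex[OF cring_A])+

lemma ring_cochain_zero:
  assumes "f \<in> carrier (F.cochains n)" "i \<noteq> n"
  shows "f i = (\<lambda>x\<in>carrier (obj P i). \<zero>\<^bsub>A\<^esub>)"
  using F.cochainD[OF assms(1), of i] assms(2)
  by (intro extensionalityI[of _ "carrier (obj P i)"])
    (auto dest: mod_hom_extensional mod_hom_closed simp: ring_complex_simps)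

lemma ring_cochain_at:
  assumes "f \<in> carrier (F.cochains n)"
  shows "f n \<in> mod_hom A (obj P n) (regular_module A)"
  using F.cochainD[OF assms(1), of n] by (simp add: obj_ring_complex_0)

definition emb :: "int \<Rightarrow> ('m \<Rightarrow> 'a) \<Rightarrow> int \<Rightarrow> 'm \<Rightarrow> 'a"
  where "emb n \<phi> = (\<lambda>i. if i = n then \<phi> else (\<lambda>x\<in>carrier (obj P i). \<zero>\<^bsub>A\<^esub>))"

lemma emb_at [simp]: "emb n \<phi> n = \<phi>"
  by (simp add: emb_def)

lemma emb_cochain:
  assumes "\<phi> \<in> mod_hom A (obj P n) (regular_module A)"
  shows "emb n \<phi> \<in> carrier (F.cochains n)"
  using assms mod_hom_null[OF E.P.module_axioms F.D.module_axioms]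
  by (auto simp: hom_group_def emb_def obj_ring_complex_0 ring_complex_simps)

lemma cochain_eq_emb: "f \<in> carrier (F.cochains n) \<Longrightarrow> f = emb n (f n)"
  by (rule F.cochain_eqI[OF _ emb_cochain[OF ring_cochain_at]]) (auto simp: emb_def ring_cochain_zero)

text \<open>The target has zero boundary, so of the cocycle condition only
  \<open>f \<circ> \<partial> = 0\<close> remains, and its sign is immaterial. All components but
  the one at index \<open>n\<close> satisfy it trivially.\<close>

lemma ring_cocycle_iff:
  "f \<in> F.cocycles n \<longleftrightarrow> f \<in> carrier (F.cochains n) \<and> f n \<in> cocycle_functionals A P n"
proof (cases "f \<in> carrier (F.cochains n)")
  case f: True
  have "(\<forall>i. \<forall>x\<in>carrier (obj P i). bdry (ring_complex A) (i - n) (f i x) =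
      (if even n then f (i - 1) (bdry P i x) else \<ominus>\<^bsub>obj (ring_complex A) (i - n - 1)\<^esub> f (i - 1) (bdry P i x))) \<longleftrightarrow>
     (\<forall>i. \<forall>x\<in>carrier (obj P i). f (i - 1) (bdry P i x) = \<zero>\<^bsub>A\<^esub>)"
  proof (intro iff_allI ball_cong refl)
    fix i x assume x: "x \<in> carrier (obj P i)"
    have z: "\<ominus>\<^bsub>obj (ring_complex A) (i - n - 1)\<^esub> a = \<zero>\<^bsub>obj (ring_complex A) (i - n - 1)\<^esub> \<longleftrightarrow>
        a = \<zero>\<^bsub>obj (ring_complex A) (i - n - 1)\<^esub>" if "a \<in> carrier (obj (ring_complex A) (i - n - 1))" for a
      using F.D.add.inv_eq_1_iff[OF that] .
    show "(bdry (ring_complex A) (i - n) (f i x) =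
      (if even n then f (i - 1) (bdry P i x) else \<ominus>\<^bsub>obj (ring_complex A) (i - n - 1)\<^esub> f (i - 1) (bdry P i x))) \<longleftrightarrow>
      (f (i - 1) (bdry P i x) = \<zero>\<^bsub>A\<^esub>)"
      using F.cochain_closed[OF f x] z[OF F.f_bdry_closed[OF f x]] unfolding ring_complex_simps(2,5)
      by (cases "even n") (simp, metis, simp, metis)
  qed
  also have "\<dots> \<longleftrightarrow> (\<forall>x\<in>carrier (obj P (n + 1)). f n (bdry P (n + 1) x) = \<zero>\<^bsub>A\<^esub>)"
  proof (intro iffI allI ballI)
    fix i x assume h: "\<forall>x\<in>carrier (obj P (n + 1)). f n (bdry P (n + 1) x) = \<zero>\<^bsub>A\<^esub>" and x: "x \<in> carrier (obj P i)"
    show "f (i - 1) (bdry P i x) = \<zero>\<^bsub>A\<^esub>"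
    proof (cases "i = n + 1")
      case False
      then show ?thesis using ring_cochain_zero[OF f, of "i - 1"] F.bdry_P_closed[OF x] by simp
    qed (use h x in simp)
  next
    fix x assume "\<forall>i. \<forall>x\<in>carrier (obj P i). f (i - 1) (bdry P i x) = \<zero>\<^bsub>A\<^esub>" "x \<in> carrier (obj P (n + 1))"
    from this(1)[rule_format, OF this(2)] show "f n (bdry P (n + 1) x) = \<zero>\<^bsub>A\<^esub>" by simp
  qed
  finally show ?thesis using f ring_cochain_at[OF f] by (simp add: F.cocycles_iff cocycle_functionals_def)
next
  case False
  then show ?thesis unfolding hom_cocycles_def by blast
qed

lemma emb_cocycle: "\<phi> \<in> cocycle_functionals A P n \<Longrightarrow> emb n \<phi> \<in> F.cocycles n"
  by (simp add: ring_cocycle_iff emb_cochain cocycle_functionals_def)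

text \<open>The term through the target vanishes because \<open>u n = 0\<close>; the other one
  carries the sign \<open>-(-1)^(n-1) = (-1)^n\<close>.\<close>

lemma ring_differential_at:
  assumes u: "u \<in> carrier (F.cochains (n - 1))" and x: "x \<in> carrier (obj P n)"
  shows "F.\<Delta> (n - 1) u n x = (if even n then u (n - 1) (bdry P n x) else \<ominus>\<^bsub>A\<^esub> u (n - 1) (bdry P n x))"
proof -
  have [simp]: "u n x = \<zero>\<^bsub>A\<^esub>" using ring_cochain_zero[OF u, of n] x by simp
  have c: "u (n - 1) (bdry P n x) \<in> carrier A"
    using mod_hom_closed[OF ring_cochain_at[OF u] F.bdry_P_closed[OF x]] by simp
  show ?thesis
    using x c by (simp add: F.differential_apply obj_ring_complex_0 ring_complex_simps A.minus_eq)
qed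

lemma compose_cochain:
  assumes g: "g \<in> carrier (F.cochains m)" and f: "f \<in> carrier (E.cochains n)"
  shows "hom_compose P n g f \<in> carrier (F.cochains (m + n))"
  using mod_hom_compose[OF E.P.module_axioms E.cochainD[OF f] F.cochainD[OF g]]
  by (simp add: hom_group_def hom_compose_def algebra_simps)

lemma compose_apply: "x \<in> carrier (obj P i) \<Longrightarrow> hom_compose P n g f i x = g (i - n) (f i x)"
  by (simp add: hom_compose_def compose_def)

text \<open>\<open>f\<close> commutes with the boundaries up to a sign and \<open>g\<close> kills
  boundaries, so \<open>g \<circ> f\<close> kills boundaries.\<close>

lemma compose_cocycle:
  assumes g: "g \<in> F.cocycles m" and f: "f \<in> E.cocycles n"
  shows "hom_compose P n g f \<in> F.cocycles (m + n)"
proof -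
  have g': "g \<in> carrier (F.cochains m)" and f': "f \<in> carrier (E.cochains n)" using assms by auto
  note c = compose_cochain[OF g' f']
  have "hom_compose P n g f (m + n) (bdry P (m + n + 1) y) = \<zero>\<^bsub>A\<^esub>" if y: "y \<in> carrier (obj P (m + n + 1))" for y
  proof -
    let ?z = "f (m + n + 1) y"
    have z: "?z \<in> carrier (obj P (m + 1))"
      using E.cochain_closed[OF f' y] by (simp add: algebra_simps)
    have b: "f (m + n) (bdry P (m + n + 1) y) \<in> carrier (obj P m)"
      using E.f_bdry_closed[OF f' y] by (simp add: algebra_simps)
    have by': "bdry P (m + n + 1) y \<in> carrier (obj P (m + n))"
      using E.bdry_P_closed[OF y] by simp
    have gb: "g m (bdry P (m + 1) ?z) = \<zero>\<^bsub>A\<^esub>"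
      using g z by (simp add: ring_cocycle_iff cocycle_functionals_def)
    have fb: "bdry P (m + 1) ?z = (if even n then f (m + n) (bdry P (m + n + 1) y)
        else \<ominus>\<^bsub>obj P m\<^esub> f (m + n) (bdry P (m + n + 1) y))"
      using f y unfolding E.cocycles_iff by (force simp: algebra_simps dest: spec[of _ "m + n + 1"])
    have "g m (\<ominus>\<^bsub>obj P m\<^esub> w) = \<ominus>\<^bsub>A\<^esub> g m w" if "w \<in> carrier (obj P m)" for w
      using mod_hom_a_inv[OF ring_cochain_at[OF g'] E.P.abelian_group_axioms
        module_imp_abelian_group[OF module_regular_module[OF cring_A]] that] by simp
    moreover have "g m w \<in> carrier A" if "w \<in> carrier (obj P m)" for w
      using mod_hom_closed[OF ring_cochain_at[OF g'] that] by simp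
    ultimately have "g m (f (m + n) (bdry P (m + n + 1) y)) = \<zero>\<^bsub>A\<^esub>"
      using gb fb b A.add.inv_eq_1_iff by (auto split: if_splits)
    then show ?thesis using by' by (simp add: compose_apply)
  qed
  then show ?thesis using c ring_cochain_at[OF c] by (simp add: ring_cocycle_iff cocycle_functionals_def)
qed

text \<open>The Leibniz rule for a cocycle \<open>f\<close>: the degrees of the two differentials
  differ by \<open>n\<close>, and \<open>f\<close> commutes with the boundaries up to exactly
  \<open>(-1)^n\<close>.\<close>

lemma compose_differential_left:
  assumes u: "u \<in> carrier (F.cochains (m - 1))" and f: "f \<in> E.cocycles n"
  shows "hom_compose P n (F.\<Delta> (m - 1) u) f = F.\<Delta> (m + n - 1) (hom_compose P n u f)"
proof -
  have f': "f \<in> carrier (E.cochains n)" using f by auto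
  have du: "F.\<Delta> (m - 1) u \<in> carrier (F.cochains m)" using F.differential_closed[OF u] by simp
  have uf: "hom_compose P n u f \<in> carrier (F.cochains (m + n - 1))"
    using compose_cochain[OF u f'] by (simp add: algebra_simps)
  have duf: "F.\<Delta> (m + n - 1) (hom_compose P n u f) \<in> carrier (F.cochains (m + n))"
    using F.differential_closed[OF uf] by simp
  have "hom_compose P n (F.\<Delta> (m - 1) u) f (m + n) x = F.\<Delta> (m + n - 1) (hom_compose P n u f) (m + n) x"
    if x: "x \<in> carrier (obj P (m + n))" for x
  proof -
    have fx: "f (m + n) x \<in> carrier (obj P m)"
      using E.cochain_closed[OF f' x] by simp
    have fb: "bdry P m (f (m + n) x) = (if even n then f (m + n - 1) (bdry P (m + n) x)
        else \<ominus>\<^bsub>obj P (m - 1)\<^esub> f (m + n - 1) (bdry P (m + n) x))"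
      using f x unfolding E.cocycles_iff by (force simp: algebra_simps dest: spec[of _ "m + n"])
    have b: "f (m + n - 1) (bdry P (m + n) x) \<in> carrier (obj P (m - 1))"
      using E.f_bdry_closed[OF f' x] by (simp add: algebra_simps)
    have um: "u (m - 1) (\<ominus>\<^bsub>obj P (m - 1)\<^esub> w) = \<ominus>\<^bsub>A\<^esub> u (m - 1) w" if "w \<in> carrier (obj P (m - 1))" for w
      using mod_hom_a_inv[OF ring_cochain_at[OF u] E.P.abelian_group_axioms
        module_imp_abelian_group[OF module_regular_module[OF cring_A]] that] by simp
    have uc: "u (m - 1) w \<in> carrier A" if "w \<in> carrier (obj P (m - 1))" for w
      using mod_hom_closed[OF ring_cochain_at[OF u] that] by simp
    have e: "m + n - 1 - n = m - 1" by simp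
    show ?thesis
      unfolding compose_apply[OF x] ring_differential_at[OF uf x] compose_apply[OF F.bdry_P_closed[OF x]] e
      using ring_differential_at[OF u fx] fb um[OF b] uc[OF b] by auto
  qed
  then have "hom_compose P n (F.\<Delta> (m - 1) u) f (m + n) = F.\<Delta> (m + n - 1) (hom_compose P n u f) (m + n)"
    by (intro mod_hom_eqI[OF ring_cochain_at[OF compose_cochain[OF du f']] ring_cochain_at[OF duf]])
  then show ?thesis
    using cochain_eq_emb[OF compose_cochain[OF du f']] cochain_eq_emb[OF duf] by simp
qed

text \<open>The Leibniz rule on the other side gives \<open>(-1)^m\<close> times the differential of
  \<open>g \<circ> v\<close>; the sign is absorbed into the witness.\<close>

lemma compose_differential_right:
  assumes g: "g \<in> F.cocycles m" and v: "v \<in> carrier (E.cochains (n - 1))"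
  shows "\<exists>w\<in>carrier (F.cochains (m + n - 1)). hom_compose P n g (E.\<Delta> (n - 1) v) = F.\<Delta> (m + n - 1) w"
proof -
  have g': "g \<in> carrier (F.cochains m)" using g by auto
  have dv: "E.\<Delta> (n - 1) v \<in> carrier (E.cochains n)" using E.differential_closed[OF v] by simp
  let ?w = "hom_compose P (n - 1) g v"
  have w: "?w \<in> carrier (F.cochains (m + n - 1))"
    using compose_cochain[OF g' v] by (simp add: algebra_simps)
  have dw: "F.\<Delta> (m + n - 1) ?w \<in> carrier (F.cochains (m + n))"
    using F.differential_closed[OF w] by simp
  define w' where "w' = (if even m then ?w else inv\<^bsub>F.cochains (m + n - 1)\<^esub> ?w)"
  have w': "w' \<in> carrier (F.cochains (m + n - 1))" using w by (simp add: w'_def)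
  have dw': "F.\<Delta> (m + n - 1) w' \<in> carrier (F.cochains (m + n))"
    using F.differential_closed[OF w'] by simp
  have inv_at: "(inv\<^bsub>F.cochains (m + n - 1)\<^esub> ?w) (m + n - 1) y = \<ominus>\<^bsub>A\<^esub> ?w (m + n - 1) y"
    if y: "y \<in> carrier (obj P (m + n - 1))" for y
  proof -
    have "((inv\<^bsub>F.cochains (m + n - 1)\<^esub> ?w) \<otimes>\<^bsub>F.cochains (m + n - 1)\<^esub> ?w) (m + n - 1) y = \<zero>\<^bsub>A\<^esub>"
      using w y by (simp add: F.cochain_simps(2)[OF y] ring_complex_simps)
    then show ?thesis
      using mod_hom_closed[OF ring_cochain_at[OF w] y] mod_hom_closed[OF ring_cochain_at[OF F.C.inv_closed[OF w]] y]
      by (simp add: F.cochain_simps(1)[OF y] ring_complex_simps A.minus_equality)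
  qed
  have "hom_compose P n g (E.\<Delta> (n - 1) v) (m + n) x = F.\<Delta> (m + n - 1) w' (m + n) x"
    if x: "x \<in> carrier (obj P (m + n))" for x
  proof -
    let ?b = "bdry P (m + n) x"
    note b = F.bdry_P_closed[OF x]
    have vx: "v (m + n) x \<in> carrier (obj P (m + 1))"
      using E.cochain_closed[OF v x] by (simp add: algebra_simps)
    have vb: "v (m + n - 1) ?b \<in> carrier (obj P m)"
      using E.cochain_closed[OF v b] by simp
    have gb: "g m (bdry P (m + 1) (v (m + n) x)) = \<zero>\<^bsub>A\<^esub>"
      using g vx by (simp add: ring_cocycle_iff cocycle_functionals_def)
    have bv: "bdry P (m + 1) (v (m + n) x) \<in> carrier (obj P m)"
      using F.bdry_P_closed[OF vx] by simp
    have e: "m + n - (n - 1) = m + 1" "m + n - n = m" "m + 1 - 1 = m" "m + n - 1 - (n - 1) = m" by simp_all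
    have dvx: "E.\<Delta> (n - 1) v (m + n) x = (if even n then bdry P (m + 1) (v (m + n) x) \<oplus>\<^bsub>obj P m\<^esub> v (m + n - 1) ?b
        else bdry P (m + 1) (v (m + n) x) \<ominus>\<^bsub>obj P m\<^esub> v (m + n - 1) ?b)"
      using E.differential_apply[OF x, of "n - 1" v] unfolding e by simp
    note gm = ring_cochain_at[OF g'] and G = E.P.abelian_group_axioms
      module_imp_abelian_group[OF module_regular_module[OF cring_A]]
    have gv: "g m (v (m + n - 1) ?b) \<in> carrier A" using mod_hom_closed[OF gm vb] by simp
    have "g m (E.\<Delta> (n - 1) v (m + n) x) =
        (if even n then g m (v (m + n - 1) ?b) else \<ominus>\<^bsub>A\<^esub> g m (v (m + n - 1) ?b))"
      using mod_hom_add[OF gm bv vb] mod_hom_minus[OF gm G bv vb] gv unfolding dvx by (simp add: gb A.minus_eq)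
    moreover have "?w (m + n - 1) ?b = g m (v (m + n - 1) ?b)"
      unfolding compose_apply[OF b] e ..
    moreover have "w' (m + n - 1) ?b = (if even m then ?w (m + n - 1) ?b else \<ominus>\<^bsub>A\<^esub> ?w (m + n - 1) ?b)"
      using inv_at[OF b] by (simp add: w'_def)
    ultimately show ?thesis
      using gv unfolding compose_apply[OF x] ring_differential_at[OF w' x] e by simp
  qed
  then have "hom_compose P n g (E.\<Delta> (n - 1) v) (m + n) = F.\<Delta> (m + n - 1) w' (m + n)"
    by (intro mod_hom_eqI[OF ring_cochain_at[OF compose_cochain[OF g' dv]] ring_cochain_at[OF dw']])
  then show ?thesis
    using cochain_eq_emb[OF compose_cochain[OF g' dv]] cochain_eq_emb[OF dw'] w' by metis
qed

lemma compose_mult_left: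
  assumes "g \<in> carrier (F.cochains m)" "h \<in> carrier (F.cochains m)" "f \<in> carrier (E.cochains n)"
  shows "hom_compose P n (g \<otimes>\<^bsub>F.cochains m\<^esub> h) f
    = hom_compose P n g f \<otimes>\<^bsub>F.cochains (m + n)\<^esub> hom_compose P n h f"
  using assms
  by (intro F.cochain_eqI[of _ "m + n"])
    (auto intro!: compose_cochain simp: F.cochain_simps compose_apply ring_complex_simps)

lemma compose_mult_right:
  assumes g: "g \<in> carrier (F.cochains m)" and f: "f \<in> carrier (E.cochains n)" "f' \<in> carrier (E.cochains n)"
  shows "hom_compose P n g (f \<otimes>\<^bsub>E.cochains n\<^esub> f')
    = hom_compose P n g f \<otimes>\<^bsub>F.cochains (m + n)\<^esub> hom_compose P n g f'"
proof (rule F.cochain_eqI[of _ "m + n"])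
  fix i x assume x: "x \<in> carrier (obj P i)"
  show "hom_compose P n g (f \<otimes>\<^bsub>E.cochains n\<^esub> f') i x
    = (hom_compose P n g f \<otimes>\<^bsub>F.cochains (m + n)\<^esub> hom_compose P n g f') i x"
    using mod_hom_add[OF F.cochainD[OF g] E.cochain_closed[OF f(1) x] E.cochain_closed[OF f(2) x]] x
    by (simp add: E.cochain_simps F.cochain_simps compose_apply ring_complex_simps)
qed (use assms in \<open>auto intro!: compose_cochain\<close>)

text \<open>By the two Leibniz rules, changing either representative by a coboundary changes the
  composite by a coboundary. So the union that defines the product is a union of copies of one
  coset.\<close>

lemma Ext_compose_cls:
  assumes g: "g \<in> F.cocycles m" and f: "f \<in> E.cocycles n"
  shows "Ext_compose A P (ring_complex A) m n (F.cls m g) (E.cls n f) = F.cls (m + n) (hom_compose P n g f)"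
proof -
  have g': "g \<in> carrier (F.cochains m)" and f': "f \<in> carrier (E.cochains n)" using assms by auto
  note gf = compose_cochain[OF g' f']
  have "F.cls (m + n) (hom_compose P n g1 f1) = F.cls (m + n) (hom_compose P n g f)"
    if g1: "g1 \<in> F.cls m g" and f1: "f1 \<in> E.cls n f" for g1 f1
  proof -
    obtain u where u: "u \<in> carrier (F.cochains (m - 1))" "g1 = F.\<Delta> (m - 1) u \<otimes>\<^bsub>F.cochains m\<^esub> g"
      using g1 by (auto simp: F.mem_cls_iff)
    obtain v where v: "v \<in> carrier (E.cochains (n - 1))" "f1 = E.\<Delta> (n - 1) v \<otimes>\<^bsub>E.cochains n\<^esub> f"
      using f1 by (auto simp: E.mem_cls_iff)
    have du: "F.\<Delta> (m - 1) u \<in> carrier (F.cochains m)" and dv: "E.\<Delta> (n - 1) v \<in> carrier (E.cochains n)"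
      using F.differential_closed[OF u(1)] E.differential_closed[OF v(1)] by simp_all
    have dvz: "E.\<Delta> (n - 1) v \<in> E.cocycles n"
      using E.coboundaries_subset v(1) by (auto simp: hom_coboundaries_def)
    then have f1z: "f1 \<in> E.cocycles n" unfolding v(2) using f by (rule E.cocycles_mult)
    have f1c: "f1 \<in> carrier (E.cochains n)" using f1z by simp
    obtain w where w: "w \<in> carrier (F.cochains (m + n - 1))"
        "hom_compose P n g (E.\<Delta> (n - 1) v) = F.\<Delta> (m + n - 1) w"
      using compose_differential_right[OF g v(1)] by blast
    have uf: "hom_compose P n u f1 \<in> carrier (F.cochains (m + n - 1))"
      using compose_cochain[OF u(1) f1c] by (simp add: algebra_simps)
    have duf: "F.\<Delta> (m + n - 1) (hom_compose P n u f1) \<in> carrier (F.cochains (m + n))"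
      and dw: "F.\<Delta> (m + n - 1) w \<in> carrier (F.cochains (m + n))"
      using F.differential_closed[OF uf] F.differential_closed[OF w(1)] by simp_all
    \<comment> \<open>The change of \<open>g\<close> is composed with the new representative
      \<open>f1\<close>, which is again a cocycle: \<open>g1 f1 = d(u f1) + g f1\<close>, and
      \<open>g f1 = d w + g f\<close>.\<close>
    let ?t = "hom_compose P n u f1 \<otimes>\<^bsub>F.cochains (m + n - 1)\<^esub> w"
    have "hom_compose P n g1 f1 = hom_compose P n (F.\<Delta> (m - 1) u) f1 \<otimes>\<^bsub>F.cochains (m + n)\<^esub> hom_compose P n g f1"
      unfolding u(2) by (rule compose_mult_left[OF du g' f1c])
    also have "hom_compose P n g f1 = F.\<Delta> (m + n - 1) w \<otimes>\<^bsub>F.cochains (m + n)\<^esub> hom_compose P n g f"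
      unfolding v(2) compose_mult_right[OF g' dv f'] w(2) ..
    also have "hom_compose P n (F.\<Delta> (m - 1) u) f1 = F.\<Delta> (m + n - 1) (hom_compose P n u f1)"
      by (rule compose_differential_left[OF u(1) f1z])
    finally have "hom_compose P n g1 f1 = F.\<Delta> (m + n - 1) ?t \<otimes>\<^bsub>F.cochains (m + n)\<^esub> hom_compose P n g f"
      using F.differential_mult[OF uf w(1)] F.C.m_assoc[OF duf dw gf] by simp
    moreover from this have "hom_compose P n g1 f1 \<in> carrier (F.cochains (m + n))"
      using compose_cochain[OF _ f1c, of g1 m] du g' by (simp add: u(2))
    ultimately show ?thesis
      using F.cls_eq_iff[OF _ gf] F.C.m_closed[OF uf w(1)] by blast
  qed
  moreover have "F.cls m g \<noteq> {}" "E.cls n f \<noteq> {}"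
    using F.C.rcos_self[OF g' F.subgroup_coboundaries] E.C.rcos_self[OF f' E.subgroup_coboundaries] by blast+
  ultimately show ?thesis unfolding Ext_compose_def by simp
qed

end

section \<open>Finite generation of Ext in terms of functionals\<close>

lemma image_choice:
  assumes "\<And>p. p \<in> G \<Longrightarrow> f p \<in> h p ` B p"
  shows "\<exists>k. \<forall>p\<in>G. k p \<in> B p \<and> f p = h p (k p)"
  using assms by (intro bchoice) auto

context ring_hom_complex
begin

lemma compose_emb_at:
  "hom_compose P (n - d) (emb d g) c n = (\<lambda>x\<in>carrier (obj P n). g (c n x))"
  by (simp add: hom_compose_def compose_def)

lemma mult_at:
  "(f \<otimes>\<^bsub>F.cochains n\<^esub> g) n = (\<lambda>x\<in>carrier (obj P n). f n x \<oplus>\<^bsub>A\<^esub> g n x)"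
  by (simp add: hom_group_def ring_complex_simps)

lemma emb_mult:
  assumes "\<phi> \<in> mod_hom A (obj P n) (regular_module A)" "\<psi> \<in> mod_hom A (obj P n) (regular_module A)"
  shows "emb n (\<lambda>x\<in>carrier (obj P n). \<phi> x \<oplus>\<^bsub>A\<^esub> \<psi> x) = emb n \<phi> \<otimes>\<^bsub>F.cochains n\<^esub> emb n \<psi>"
  using cochain_eq_emb[OF F.cochain_mult_closed[OF emb_cochain[OF assms(1)] emb_cochain[OF assms(2)]]]
  by (simp add: mult_at)

lemma bdry_functional:
  assumes u: "u \<in> mod_hom A (obj P (n - 1)) (regular_module A)"
  shows "(\<lambda>x\<in>carrier (obj P n). u (bdry P n x)) \<in> cocycle_functionals A P n"
proof -
  have "u (bdry P n (bdry P (n + 1) y)) = \<zero>\<^bsub>A\<^esub>" if y: "y \<in> carrier (obj P (n + 1))" for y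
    using E.bdry_bdry_P[OF y] mod_hom_zero[OF u E.P.abelian_group_axioms
        module_imp_abelian_group[OF module_regular_module[OF cring_A]]] by simp
  moreover have "bdry P (n + 1) y \<in> carrier (obj P n)" if "y \<in> carrier (obj P (n + 1))" for y
    using E.bdry_P_closed[OF that] by simp
  ultimately show ?thesis
    using mod_hom_compose[OF E.P.module_axioms E.bdry_P u]
    by (simp add: cocycle_functionals_def compose_def)
qed

lemma add_functional:
  assumes "\<phi> \<in> cocycle_functionals A P n" "\<psi> \<in> cocycle_functionals A P n"
  shows "(\<lambda>x\<in>carrier (obj P n). \<phi> x \<oplus>\<^bsub>A\<^esub> \<psi> x) \<in> cocycle_functionals A P n"
proof -
  have "bdry P (n + 1) y \<in> carrier (obj P n)" if "y \<in> carrier (obj P (n + 1))" for y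
    using E.bdry_P_closed[OF that] by simp
  then show ?thesis
    using assms mod_hom_plus[OF E.P.module_axioms module_regular_module[OF cring_A], of \<phi> n \<psi>]
    by (auto simp: cocycle_functionals_def)
qed

lemma act_functional:
  assumes "g \<in> cocycle_functionals A P d" "c \<in> E.cocycles (n - d)"
  shows "(\<lambda>x\<in>carrier (obj P n). g (c n x)) \<in> cocycle_functionals A P n"
  using compose_cocycle[OF emb_cocycle[OF assms(1)] assms(2)] compose_emb_at[of n d g c]
  by (simp add: ring_cocycle_iff)

lemma generated_imp_cocycle:
  assumes "\<And>d g. (d, g) \<in> G \<Longrightarrow> g \<in> cocycle_functionals A P d"
  shows "generated_functional A P G n \<phi> \<Longrightarrow> \<phi> \<in> cocycle_functionals A P n"
  by (induction rule: generated_functional.induct)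
    (blast intro: act_functional add_functional bdry_functional assms)+

text \<open>Cocycles are chosen to represent the generators and the coefficients. An equality of
  classes then becomes an equality of functionals up to a boundary, which the rule
  \<open>bdry\<close> absorbs.\<close>

lemma Ext_ring_fin_gen_imp:
  assumes "Ext_ring_fin_gen A P"
  shows "functionals_fin_gen A P"
proof -
  obtain G where G: "finite G" "\<And>p. p \<in> G \<Longrightarrow> snd p \<in> carrier (Ext_group A P (ring_complex A) (fst p))"
    and gen: "\<And>n x. x \<in> carrier (Ext_group A P (ring_complex A) n) \<Longrightarrow>
      \<exists>c. (\<forall>p\<in>G. c p \<in> carrier (Ext_group A P P (n - fst p))) \<and>
        x = (\<Otimes>\<^bsub>Ext_group A P (ring_complex A) n\<^esub>p\<in>G.
              Ext_compose A P (ring_complex A) (fst p) (n - fst p) (snd p) (c p))"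
    using assms unfolding Ext_ring_fin_gen_def fin_gen_graded_right_module_def by (auto simp: case_prod_beta)
  have "\<exists>\<gamma>. \<forall>p\<in>G. \<gamma> p \<in> F.cocycles (fst p) \<and> snd p = F.cls (fst p) (\<gamma> p)"
    by (rule image_choice) (use G(2) in \<open>simp only: F.carrier_Ext\<close>)
  then obtain \<gamma> where \<gamma>: "\<And>p. p \<in> G \<Longrightarrow> \<gamma> p \<in> F.cocycles (fst p)" "\<And>p. p \<in> G \<Longrightarrow> snd p = F.cls (fst p) (\<gamma> p)"
    by metis
  define G0 where "G0 = (\<lambda>p. (fst p, \<gamma> p (fst p))) ` G"
  have G0: "g \<in> cocycle_functionals A P d" if "(d, g) \<in> G0" for d g
    using that \<gamma>(1) by (auto simp: G0_def ring_cocycle_iff)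
  have "generated_functional A P G0 n \<phi>" if \<phi>: "\<phi> \<in> cocycle_functionals A P n" for n \<phi>
  proof -
    let ?X = "Ext_group A P (ring_complex A) n"
    interpret X: comm_group ?X by (rule F.comm_group_Ext)
    obtain c where c: "\<And>p. p \<in> G \<Longrightarrow> c p \<in> carrier (Ext_group A P P (n - fst p))"
      "F.cls n (emb n \<phi>) = (\<Otimes>\<^bsub>?X\<^esub>p\<in>G.
              Ext_compose A P (ring_complex A) (fst p) (n - fst p) (snd p) (c p))"
      using gen[OF F.cls_closed[OF emb_cocycle[OF \<phi>]]] by auto
    have "\<exists>\<chi>. \<forall>p\<in>G. \<chi> p \<in> E.cocycles (n - fst p) \<and> c p = E.cls (n - fst p) (\<chi> p)"
      by (rule image_choice) (use c(1) in \<open>simp only: E.carrier_Ext\<close>)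
    then obtain \<chi> where \<chi>: "\<And>p. p \<in> G \<Longrightarrow> \<chi> p \<in> E.cocycles (n - fst p)"
        "\<And>p. p \<in> G \<Longrightarrow> c p = E.cls (n - fst p) (\<chi> p)"
      by metis
    define t where "t p = hom_compose P (n - fst p) (\<gamma> p) (\<chi> p)" for p
    have t: "t p \<in> F.cocycles n" if "p \<in> G" for p
      using compose_cocycle[OF \<gamma>(1)[OF that] \<chi>(1)[OF that]] by (simp add: t_def)
    have t_gen: "generated_functional A P G0 n (t p n)" if "p \<in> G" for p
    proof -
      have "(fst p, \<gamma> p (fst p)) \<in> G0" using that by (auto simp: G0_def)
      from generated_functional.act[OF this \<chi>(1)[OF that]]
      show ?thesis by (simp add: t_def hom_compose_def compose_def)
    qed
    have act: "Ext_compose A P (ring_complex A) (fst p) (n - fst p) (snd p) (c p) = F.cls n (t p)" if "p \<in> G" for p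
      using Ext_compose_cls[OF \<gamma>(1)[OF that] \<chi>(1)[OF that]] by (simp add: t_def \<gamma>(2)[OF that] \<chi>(2)[OF that])
    have cx: "F.cls n (emb n \<phi>) = (\<Otimes>\<^bsub>?X\<^esub>p\<in>G. F.cls n (t p))"
      unfolding c(2) using t by (intro X.finprod_cong') (auto simp: act)
    \<comment> \<open>The product of classes is turned into the class of a single generated cocycle,
      adding one generator at a time.\<close>
    have "H \<subseteq> G \<Longrightarrow> \<exists>\<xi>\<in>F.cocycles n. (\<Otimes>\<^bsub>?X\<^esub>p\<in>H. F.cls n (t p)) = F.cls n \<xi> \<and> generated_functional A P G0 n (\<xi> n)"
      if "finite H" for H
      using that
    proof (induction H)
      case empty
      have "generated_functional A P G0 n (\<lambda>x\<in>carrier (obj P n). (\<lambda>x\<in>carrier (obj P (n - 1)). \<zero>\<^bsub>A\<^esub>) (bdry P n x))"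
        using mod_hom_null[OF E.P.module_axioms module_regular_module[OF cring_A]]
        by (intro generated_functional.bdry) (simp only: regular_module_simps)
      then have "generated_functional A P G0 n (\<one>\<^bsub>F.cochains n\<^esub> n)"
        by (simp add: hom_group_def ring_complex_simps cong: restrict_cong)
      then show ?case
        using subgroup.one_closed[OF F.subgroup_cocycles] by (auto simp: F.one_Ext)
    next
      case (insert p H)
      then obtain \<xi> where \<xi>: "\<xi> \<in> F.cocycles n" "(\<Otimes>\<^bsub>?X\<^esub>p\<in>H. F.cls n (t p)) = F.cls n \<xi>"
          "generated_functional A P G0 n (\<xi> n)"
        by auto
      have p: "p \<in> G" using insert by auto
      have "(\<Otimes>\<^bsub>?X\<^esub>p\<in>insert p H. F.cls n (t p)) = F.cls n (t p) \<otimes>\<^bsub>?X\<^esub> F.cls n \<xi>"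
        using insert t by (subst X.finprod_insert) (auto simp: \<xi>(2))
      also have "\<dots> = F.cls n (t p \<otimes>\<^bsub>F.cochains n\<^esub> \<xi>)"
        by (rule F.cls_mult[OF t[OF p] \<xi>(1)])
      finally show ?case
        using F.cocycles_mult[OF t[OF p] \<xi>(1)] generated_functional.add[OF t_gen[OF p] \<xi>(3)]
        by (intro bexI[of _ "t p \<otimes>\<^bsub>F.cochains n\<^esub> \<xi>"]) (simp_all only: mult_at simp_thms)
    qed
    from this[OF G(1) order.refl] obtain \<xi> where \<xi>: "\<xi> \<in> F.cocycles n" "F.cls n (emb n \<phi>) = F.cls n \<xi>"
        "generated_functional A P G0 n (\<xi> n)"
      using cx by auto
    have "emb n \<phi> \<in> carrier (F.cochains n)" "\<xi> \<in> carrier (F.cochains n)"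
      using emb_cocycle[OF \<phi>] \<xi>(1) by auto
    from F.cls_eq_iff[OF this] \<xi>(2) obtain u where u: "u \<in> carrier (F.cochains (n - 1))"
        "emb n \<phi> = F.\<Delta> (n - 1) u \<otimes>\<^bsub>F.cochains n\<^esub> \<xi>"
      by auto
    \<comment> \<open>The differential contributes the sign \<open>(-1)^n\<close>, which is moved
      into the functional.\<close>
    define w where "w = (if even n then u (n - 1) else (\<lambda>x\<in>carrier (obj P (n - 1)). \<ominus>\<^bsub>A\<^esub> u (n - 1) x))"
    have w: "w \<in> mod_hom A (obj P (n - 1)) (regular_module A)"
      using ring_cochain_at[OF u(1)] mod_hom_uminus[OF E.P.module_axioms module_regular_module[OF cring_A] ring_cochain_at[OF u(1)]]
      by (simp add: w_def)
    have "\<phi> = (F.\<Delta> (n - 1) u \<otimes>\<^bsub>F.cochains n\<^esub> \<xi>) n" using u(2) by (metis emb_at)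
    also have "\<dots> = (\<lambda>x\<in>carrier (obj P n). (\<lambda>x\<in>carrier (obj P n). w (bdry P n x)) x \<oplus>\<^bsub>A\<^esub> \<xi> n x)"
      unfolding mult_at using u(1) by (intro restrict_ext) (simp add: ring_differential_at w_def)
    finally show ?thesis
      using generated_functional.add[OF generated_functional.bdry[OF w] \<xi>(3)] by simp
  qed
  then show ?thesis unfolding functionals_fin_gen_def
    using G0 G(1) by (intro exI[of _ G0]) (auto simp: G0_def)
qed

text \<open>The classes that are sums of generators times coefficients are shown to be closed under
  the three rules of \<open>generated_functional\<close>.\<close>

lemma Ext_ring_fin_gen_if:
  assumes "functionals_fin_gen A P"
  shows "Ext_ring_fin_gen A P"
proof -
  obtain G where G: "finite G" "\<And>d g. (d, g) \<in> G \<Longrightarrow> g \<in> cocycle_functionals A P d"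
    and gen: "\<And>n \<phi>. \<phi> \<in> cocycle_functionals A P n \<Longrightarrow> generated_functional A P G n \<phi>"
    using assms unfolding functionals_fin_gen_def by blast
  \<comment> \<open>Several functionals of \<open>G\<close> may have the same class, so
    \<open>H\<close> is an image set, and a functional is chosen again for each of its
    members.\<close>
  define H where "H = (\<lambda>(d, g). (d, F.cls d (emb d g))) ` G"
  have finH: "finite H" using G(1) by (simp add: H_def)
  have H: "\<exists>g. (fst p, g) \<in> G \<and> snd p = F.cls (fst p) (emb (fst p) g)" if "p \<in> H" for p
    using that by (auto simp: H_def)
  define ac where "ac n p c = Ext_compose A P (ring_complex A) (fst p) (n - fst p) (snd p) c"
    for n c and p :: "int \<times> (int \<Rightarrow> 'm \<Rightarrow> 'a) set"
  have ac: "\<exists>g. g \<in> F.cocycles (fst p) \<and> (\<forall>\<chi>\<in>E.cocycles (n - fst p).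
      hom_compose P (n - fst p) g \<chi> \<in> F.cocycles n \<and>
      ac n p (E.cls (n - fst p) \<chi>) = F.cls n (hom_compose P (n - fst p) g \<chi>))" if p: "p \<in> H" for p n
  proof -
    obtain g where g: "(fst p, g) \<in> G" "snd p = F.cls (fst p) (emb (fst p) g)" using H[OF p] by auto
    note g' = emb_cocycle[OF G(2)[OF g(1)]]
    show ?thesis
      using g' compose_cocycle[OF g', of _ "n - fst p"] Ext_compose_cls[OF g', of _ "n - fst p"] g(2)
      by (intro exI[of _ "emb (fst p) g"]) (auto simp: ac_def)
  qed
  \<comment> \<open>The sums of generators times coefficients, one coefficient for each member of
    \<open>H\<close>.\<close>
  define S where "S n x \<longleftrightarrow> (\<exists>c. (\<forall>p\<in>H. c p \<in> carrier (Ext_group A P P (n - fst p))) \<and>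
        x = (\<Otimes>\<^bsub>Ext_group A P (ring_complex A) n\<^esub>p\<in>H. ac n p (c p)))" for n x
  have ac_closed: "ac n p c \<in> carrier (Ext_group A P (ring_complex A) n)"
    if "p \<in> H" "c \<in> carrier (Ext_group A P P (n - fst p))" for n p c
    using ac[OF that(1), of n] that(2) by (auto simp: E.carrier_Ext)
  have ac_mult: "ac n p (c \<otimes>\<^bsub>Ext_group A P P (n - fst p)\<^esub> c') = ac n p c \<otimes>\<^bsub>Ext_group A P (ring_complex A) n\<^esub> ac n p c'"
    if p: "p \<in> H" and c: "c \<in> carrier (Ext_group A P P (n - fst p))" "c' \<in> carrier (Ext_group A P P (n - fst p))" for n p c c'
  proof -
    obtain g where g: "g \<in> F.cocycles (fst p)" "\<And>\<chi>. \<chi>\<in>E.cocycles (n - fst p) \<Longrightarrow>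
      hom_compose P (n - fst p) g \<chi> \<in> F.cocycles n \<and>
      ac n p (E.cls (n - fst p) \<chi>) = F.cls n (hom_compose P (n - fst p) g \<chi>)"
      using ac[OF p, of n] by auto
    obtain \<chi> \<chi>' where \<chi>: "\<chi> \<in> E.cocycles (n - fst p)" "c = E.cls (n - fst p) \<chi>"
        "\<chi>' \<in> E.cocycles (n - fst p)" "c' = E.cls (n - fst p) \<chi>'"
      using c by (auto simp: E.carrier_Ext)
    have "hom_compose P (n - fst p) g (\<chi> \<otimes>\<^bsub>E.cochains (n - fst p)\<^esub> \<chi>')
        = hom_compose P (n - fst p) g \<chi> \<otimes>\<^bsub>F.cochains n\<^esub> hom_compose P (n - fst p) g \<chi>'"
      using compose_mult_right[of g "fst p" \<chi> "n - fst p" \<chi>'] g(1) \<chi>(1,3) by simp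
    then show ?thesis
      using g(2)[OF \<chi>(1)] g(2)[OF \<chi>(3)] g(2)[OF E.cocycles_mult[OF \<chi>(1,3)]]
      by (simp add: \<chi>(2,4) E.cls_mult[OF \<chi>(1,3)] F.cls_mult)
  qed
  \<comment> \<open>The action is additive in the coefficient, so it sends the unit to an idempotent
    of a group.\<close>
  have ac_one: "ac n p \<one>\<^bsub>Ext_group A P P (n - fst p)\<^esub> = \<one>\<^bsub>Ext_group A P (ring_complex A) n\<^esub>"
    if p: "p \<in> H" for n p
  proof -
    interpret X: comm_group "Ext_group A P (ring_complex A) n" by (rule F.comm_group_Ext)
    interpret Y: comm_group "Ext_group A P P (n - fst p)" by (rule E.comm_group_Ext)
    show ?thesis
      using ac_mult[OF p Y.one_closed Y.one_closed] ac_closed[OF p Y.one_closed]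
      by (metis Y.l_one Y.one_closed X.r_cancel_one')
  qed
  have S_mult: "S n (x \<otimes>\<^bsub>Ext_group A P (ring_complex A) n\<^esub> y)" if xy: "S n x" "S n y" for n x y
  proof -
    interpret X: comm_group "Ext_group A P (ring_complex A) n" by (rule F.comm_group_Ext)
    obtain c where c: "\<And>p. p \<in> H \<Longrightarrow> c p \<in> carrier (Ext_group A P P (n - fst p))"
      "x = (\<Otimes>\<^bsub>Ext_group A P (ring_complex A) n\<^esub>p\<in>H. ac n p (c p))" using xy(1) by (auto simp: S_def)
    obtain c' where c': "\<And>p. p \<in> H \<Longrightarrow> c' p \<in> carrier (Ext_group A P P (n - fst p))"
      "y = (\<Otimes>\<^bsub>Ext_group A P (ring_complex A) n\<^esub>p\<in>H. ac n p (c' p))" using xy(2) by (auto simp: S_def)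
    have "x \<otimes>\<^bsub>Ext_group A P (ring_complex A) n\<^esub> y =
       (\<Otimes>\<^bsub>Ext_group A P (ring_complex A) n\<^esub>p\<in>H. ac n p (c p) \<otimes>\<^bsub>Ext_group A P (ring_complex A) n\<^esub> ac n p (c' p))"
      unfolding c(2) c'(2) using ac_closed c(1) c'(1) by (intro X.finprod_multf[symmetric]) auto
    also have "\<dots> = (\<Otimes>\<^bsub>Ext_group A P (ring_complex A) n\<^esub>p\<in>H. ac n p (c p \<otimes>\<^bsub>Ext_group A P P (n - fst p)\<^esub> c' p))"
      using ac_closed c(1) c'(1) by (intro X.finprod_cong') (auto simp: ac_mult)
    finally show ?thesis
      unfolding S_def using c(1) c'(1) comm_groupE(1)[OF E.comm_group_Ext]
      by (intro exI[of _ "\<lambda>p. c p \<otimes>\<^bsub>Ext_group A P P (n - fst p)\<^esub> c' p"]) simp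
  qed
  have S_one: "S n \<one>\<^bsub>Ext_group A P (ring_complex A) n\<^esub>" for n
  proof -
    interpret X: comm_group "Ext_group A P (ring_complex A) n" by (rule F.comm_group_Ext)
    have "(\<Otimes>\<^bsub>Ext_group A P (ring_complex A) n\<^esub>p\<in>H. ac n p \<one>\<^bsub>Ext_group A P P (n - fst p)\<^esub>)
        = \<one>\<^bsub>Ext_group A P (ring_complex A) n\<^esub>"
      by (rule X.finprod_one_eqI) (rule ac_one)
    then show ?thesis
      unfolding S_def using comm_groupE(2)[OF E.comm_group_Ext]
      by (intro exI[of _ "\<lambda>p. \<one>\<^bsub>Ext_group A P P (n - fst p)\<^esub>"]) simp
  qed
  have S: "generated_functional A P G n \<phi> \<Longrightarrow> S n (F.cls n (emb n \<phi>))" for n \<phi>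
  proof (induction rule: generated_functional.induct)
    case (act d g c n)
    interpret X: comm_group "Ext_group A P (ring_complex A) n" by (rule F.comm_group_Ext)
    let ?p = "(d, F.cls d (emb d g))"
    have p: "?p \<in> H" using act by (force simp: H_def)
    have g: "emb d g \<in> F.cocycles d" using emb_cocycle[OF G(2)] act by blast
    \<comment> \<open>The coefficient family that is \<open>c\<close> at the given generator and
      zero elsewhere.\<close>
    define k where "k p = (if p = ?p then E.cls (n - d) c else \<one>\<^bsub>Ext_group A P P (n - fst p)\<^esub>)" for p
    have k: "k p \<in> carrier (Ext_group A P P (n - fst p))" if "p \<in> H" for p
      using comm_groupE(2)[OF E.comm_group_Ext] E.cls_closed[OF act(2)] by (simp add: k_def)
    let ?t = "hom_compose P (n - d) (emb d g) c"
    have t: "?t \<in> F.cocycles n" using compose_cocycle[OF g act(2)] by simp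
    have et: "emb n (\<lambda>x\<in>carrier (obj P n). g (c n x)) = ?t"
      using cochain_eq_emb[OF F.cocycles_imp_cochain[OF t]] compose_emb_at[of n d g c] by simp
    have ac_k: "ac n ?p (E.cls (n - d) c) = F.cls n ?t"
      using Ext_compose_cls[OF g act(2)] by (simp add: ac_def)
    have "(\<Otimes>\<^bsub>Ext_group A P (ring_complex A) n\<^esub>p\<in>H. ac n p (k p)) = F.cls n ?t"
    proof -
      have "(\<Otimes>\<^bsub>Ext_group A P (ring_complex A) n\<^esub>p\<in>H. ac n p (k p)) =
        (\<Otimes>\<^bsub>Ext_group A P (ring_complex A) n\<^esub>p\<in>H. if ?p = p then F.cls n ?t else \<one>\<^bsub>Ext_group A P (ring_complex A) n\<^esub>)"
        using F.cls_closed[OF t] ac_one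
        by (intro X.finprod_cong') (auto simp: k_def ac_k)
      also have "\<dots> = F.cls n ?t"
        using X.finprod_singleton[OF p finH, of "\<lambda>_. F.cls n ?t"] F.cls_closed[OF t] by simp
      finally show ?thesis .
    qed
    then show ?case unfolding S_def et using k by (intro exI[of _ k]) simp
  next
    case (add n \<phi> \<psi>)
    have c: "\<phi> \<in> cocycle_functionals A P n" "\<psi> \<in> cocycle_functionals A P n"
      using add generated_imp_cocycle G(2) by blast+
    then have m: "\<phi> \<in> mod_hom A (obj P n) (regular_module A)" "\<psi> \<in> mod_hom A (obj P n) (regular_module A)"
      by (simp_all add: cocycle_functionals_def)
    show ?case
      using S_mult[OF add.IH] unfolding F.cls_mult[OF emb_cocycle[OF c(1)] emb_cocycle[OF c(2)]] emb_mult[OF m] .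
  next
    case (bdry u n)
    \<comment> \<open>With this sign the differential of \<open>emb (n - 1) w\<close> is
      \<open>u \<circ> \<partial>\<close> itself, so the class is zero and zero coefficients
      represent it.\<close>
    define w where "w = (if even n then u else (\<lambda>x\<in>carrier (obj P (n - 1)). \<ominus>\<^bsub>A\<^esub> u x))"
    have w: "w \<in> mod_hom A (obj P (n - 1)) (regular_module A)"
      using bdry mod_hom_uminus[OF E.P.module_axioms module_regular_module[OF cring_A] bdry]
      by (simp add: w_def)
    note ew = emb_cochain[OF w]
    let ?f = "\<lambda>x\<in>carrier (obj P n). u (bdry P n x)"
    have f: "emb n ?f \<in> carrier (F.cochains n)"
      using emb_cocycle[OF bdry_functional[OF bdry]] by simp
    have "F.\<Delta> (n - 1) (emb (n - 1) w) n x = ?f x" if x: "x \<in> carrier (obj P n)" for x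
      using ring_differential_at[OF ew x] mod_hom_closed[OF bdry E.bdry_P_closed[OF x]] E.bdry_P_closed[OF x] x
      by (simp add: w_def)
    moreover have d: "F.\<Delta> (n - 1) (emb (n - 1) w) \<in> carrier (F.cochains n)"
      using F.differential_closed[OF ew] by simp
    ultimately have "F.\<Delta> (n - 1) (emb (n - 1) w) n = ?f"
      using mod_hom_extensional[OF ring_cochain_at[OF d]] by (intro extensionalityI[of _ "carrier (obj P n)"]) auto
    then have "emb n ?f = F.\<Delta> (n - 1) (emb (n - 1) w) \<otimes>\<^bsub>F.cochains n\<^esub> \<one>\<^bsub>F.cochains n\<^esub>"
      using cochain_eq_emb[OF d] d by simp
    then have "F.cls n (emb n ?f) = \<one>\<^bsub>Ext_group A P (ring_complex A) n\<^esub>"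
      using F.cls_eq_iff[OF f F.cochain_one_closed] ew F.one_Ext by blast
    then show ?case using S_one[of n] by (simp only:)
  qed
  have "S n x" if x: "x \<in> carrier (Ext_group A P (ring_complex A) n)" for n x
  proof -
    obtain \<xi> where \<xi>: "\<xi> \<in> F.cocycles n" "x = F.cls n \<xi>" using x by (auto simp: F.carrier_Ext)
    have "\<xi> = emb n (\<xi> n)" "\<xi> n \<in> cocycle_functionals A P n"
      using \<xi>(1) cochain_eq_emb[OF F.cocycles_imp_cochain[OF \<xi>(1)]] by (simp_all add: ring_cocycle_iff)
    then show ?thesis using S[OF gen] \<xi>(2) by metis
  qed
  moreover have "\<forall>(d, g)\<in>H. g \<in> carrier (Ext_group A P (ring_complex A) d)"
    using emb_cocycle[OF G(2)] by (auto simp: H_def)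
  ultimately show ?thesis
    unfolding Ext_ring_fin_gen_def fin_gen_graded_right_module_def S_def ac_def using finH
    by (intro exI[of _ H]) simp
qed

end

lemma Ext_ring_fin_gen_iff:
  "chain_complex A P \<Longrightarrow> Ext_ring_fin_gen A P \<longleftrightarrow> functionals_fin_gen A P"
  using ring_hom_complex.Ext_ring_fin_gen_imp ring_hom_complex.Ext_ring_fin_gen_if ring_hom_complex.intro by blast

section \<open>Comparison of free resolutions\<close>

definition augments :: "('a, 'x) ring_scheme \<Rightarrow> ('a, 'n, 'y) module_scheme \<Rightarrow> ('a, 'm) module_complex \<Rightarrow> ('m \<Rightarrow> 'n) \<Rightarrow> bool"
  where "augments A N P \<pi> \<longleftrightarrow> \<pi> \<in> mod_hom A (obj P 0) N \<and> \<pi> ` carrier (obj P 0) = carrier N \<and>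
      {x \<in> carrier (obj P 0). \<pi> x = \<zero>\<^bsub>N\<^esub>} = bdry P 1 ` carrier (obj P 1)"

lemma free_resolution_augments:
  assumes "free_resolution A N P"
  obtains \<pi> where "augments A N P \<pi>"
  using assms unfolding free_resolution_def
  by (elim conjE bexE) (rule that, unfold augments_def, intro conjI)

lemma free_resolution_free: "free_resolution A N P \<Longrightarrow> free_module A (obj P i)"
  by (simp add: free_resolution_def)

lemma free_resolution_neg: "free_resolution A N P \<Longrightarrow> i < 0 \<Longrightarrow> carrier (obj P i) = {\<zero>\<^bsub>obj P i\<^esub>}"
  by (simp add: free_resolution_def)

lemma free_resolution_exact:
  assumes "free_resolution A N P" "0 < i" "x \<in> carrier (obj P i)" "bdry P i x = \<zero>\<^bsub>obj P (i - 1)\<^esub>"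
  shows "x \<in> bdry P (i + 1) ` carrier (obj P (i + 1))"
proof -
  have "\<forall>i>0. {x \<in> carrier (obj P i). bdry P i x = \<zero>\<^bsub>obj P (i - 1)\<^esub>} = bdry P (i + 1) ` carrier (obj P (i + 1))"
    using assms(1) unfolding free_resolution_def by (elim conjE)
  then show ?thesis using assms(2-4) by auto
qed

text \<open>A free resolution is given by exactness alone. Above degree 1 this contains
  \<open>\<partial> \<partial> = 0\<close>; from degree 1 downwards the target of
  \<open>\<partial> \<partial>\<close> is a zero module.\<close>

lemma free_resolution_chain_complex:
  assumes P: "free_resolution A N P"
  shows "chain_complex A P"
proof -
  have m: "module A (obj P i)" for i
    using free_resolution_free[OF P] by (rule free_module_imp_module)
  have b: "bdry P i \<in> mod_hom A (obj P i) (obj P (i - 1))" for i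
    using P by (simp add: free_resolution_def)
  have "bdry P (i - 1) (bdry P i x) = \<zero>\<^bsub>obj P (i - 1 - 1)\<^esub>" if x: "x \<in> carrier (obj P i)" for i x
  proof (cases "i - 1 > 0")
    case True
    then have "{y \<in> carrier (obj P (i - 1)). bdry P (i - 1) y = \<zero>\<^bsub>obj P (i - 1 - 1)\<^esub>}
      = bdry P (i - 1 + 1) ` carrier (obj P (i - 1 + 1))"
      using P unfolding free_resolution_def by (elim conjE) (erule allE, erule (1) mp)
    moreover have "bdry P i x \<in> bdry P (i - 1 + 1) ` carrier (obj P (i - 1 + 1))" using x by simp
    ultimately show ?thesis by auto
  next
    case False
    then have "carrier (obj P (i - 1 - 1)) = {\<zero>\<^bsub>obj P (i - 1 - 1)\<^esub>}"
      by (intro free_resolution_neg[OF P]) simp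
    then show ?thesis using mod_hom_closed[OF b mod_hom_closed[OF b x]] by simp
  qed
  then show ?thesis using m b by (simp add: chain_complex_def)
qed

definition chain_map :: "('a, 'x) ring_scheme \<Rightarrow> ('a, 'm) module_complex \<Rightarrow> ('a, 'n) module_complex \<Rightarrow> (int \<Rightarrow> 'm \<Rightarrow> 'n) \<Rightarrow> bool"
  where "chain_map A P D u \<longleftrightarrow> (\<forall>i. u i \<in> mod_hom A (obj P i) (obj D i)) \<and>
    (\<forall>i. \<forall>x\<in>carrier (obj P i). bdry D i (u i x) = u (i - 1) (bdry P i x))"

text \<open>Degreewise lifting along free modules. Naming the augmentations by
  \<open>augments\<close> makes it possible to require that the chain map lifts the identity of
  \<open>N\<close>.\<close>

lemma chain_map_exists:
  assumes P: "free_resolution A N P" and D: "free_resolution A N D" and N: "abelian_group N"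
    and \<pi>: "augments A N P \<pi>" and \<rho>: "augments A N D \<rho>"
  obtains u where "chain_map A P D u" "\<And>x. x \<in> carrier (obj P 0) \<Longrightarrow> \<rho> (u 0 x) = \<pi> x"
proof -
  interpret H: hom_complex A P D
    by unfold_locales (rule free_resolution_chain_complex[OF P] free_resolution_chain_complex[OF D])+
  \<comment> \<open>Besides linearity the invariant records that boundaries go to boundaries, the
    condition under which the next lift exists, and in degree 0 the compatibility with the
    augmentations.\<close>
  let ?ok = "\<lambda>n \<phi>. \<phi> \<in> mod_hom A (obj P (int n)) (obj D (int n)) \<and>
      (\<forall>x\<in>carrier (obj P (int n + 1)). \<phi> (bdry P (int n + 1) x) \<in> bdry D (int n + 1) ` carrier (obj D (int n + 1))) \<and>
      (n = 0 \<longrightarrow> (\<forall>x\<in>carrier (obj P 0). \<rho> (\<phi> x) = \<pi> x))"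
  have "\<exists>\<phi>. \<forall>n. ?ok n (\<phi> n) \<and> (\<forall>x\<in>carrier (obj P (int n + 1)). bdry D (int n + 1) (\<phi> (Suc n) x) = \<phi> n (bdry P (int n + 1) x))"
  proof (rule dependent_nat_choice)
    obtain \<phi> where \<phi>: "\<phi> \<in> mod_hom A (obj P 0) (obj D 0)" "\<And>x. x \<in> carrier (obj P 0) \<Longrightarrow> \<rho> (\<phi> x) = \<pi> x"
    proof (rule free_module_lift[OF free_resolution_free[OF P, of 0] H.D.module_axioms[of 0] N])
      show "\<pi> \<in> mod_hom A (obj P 0) N" "\<rho> \<in> mod_hom A (obj D 0) N"
        using \<pi> \<rho> by (simp_all add: augments_def)
      show "\<pi> x \<in> \<rho> ` carrier (obj D 0)" if "x \<in> carrier (obj P 0)" for x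
        using \<pi> \<rho> that by (auto simp: augments_def)
    qed (rule that)
    have "\<phi> (bdry P 1 x) \<in> bdry D 1 ` carrier (obj D 1)" if x: "x \<in> carrier (obj P 1)" for x
    proof -
      have b: "bdry P 1 x \<in> carrier (obj P 0)" using H.bdry_P_closed[OF x] by simp
      then have "\<rho> (\<phi> (bdry P 1 x)) = \<zero>\<^bsub>N\<^esub>" using \<phi>(2)[OF b] \<pi> x by (auto simp: augments_def)
      then have "\<phi> (bdry P 1 x) \<in> {y \<in> carrier (obj D 0). \<rho> y = \<zero>\<^bsub>N\<^esub>}"
        using mod_hom_closed[OF \<phi>(1) b] by simp
      then show ?thesis using \<rho> unfolding augments_def by (elim conjE) (simp only:)
    qed
    then have "?ok 0 \<phi>" using \<phi> by simp
    then show "\<exists>\<phi>. ?ok 0 \<phi>" by (intro exI[of _ \<phi>])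
  next
    fix \<phi> n assume ok: "?ok n \<phi>"
    let ?i = "int n + 1"
    have f: "compose (carrier (obj P ?i)) \<phi> (bdry P ?i) \<in> mod_hom A (obj P ?i) (obj D (int n))"
      using mod_hom_compose[OF H.P.module_axioms[of ?i] H.bdry_P[of ?i], of \<phi> "obj D (int n)"] ok by simp
    obtain \<psi> where \<psi>: "\<psi> \<in> mod_hom A (obj P ?i) (obj D ?i)"
        "\<And>x. x \<in> carrier (obj P ?i) \<Longrightarrow> bdry D ?i (\<psi> x) = compose (carrier (obj P ?i)) \<phi> (bdry P ?i) x"
    proof (rule free_module_lift[OF free_resolution_free[OF P, of ?i] H.D.module_axioms[of ?i] H.D.abelian_group_axioms f])
      show "bdry D ?i \<in> mod_hom A (obj D ?i) (obj D (int n))" using H.bdry_D[of ?i] by simp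
      show "compose (carrier (obj P ?i)) \<phi> (bdry P ?i) x \<in> bdry D ?i ` carrier (obj D ?i)" if "x \<in> carrier (obj P ?i)" for x
        using ok that by (simp add: compose_def)
    qed (rule that)
    have "\<psi> (bdry P (?i + 1) x) \<in> bdry D (?i + 1) ` carrier (obj D (?i + 1))" if x: "x \<in> carrier (obj P (?i + 1))" for x
    proof (rule free_resolution_exact[OF D])
      have b: "bdry P (?i + 1) x \<in> carrier (obj P ?i)" using H.bdry_P_closed[OF x] by (simp add: algebra_simps)
      show "\<psi> (bdry P (?i + 1) x) \<in> carrier (obj D ?i)" by (rule mod_hom_closed[OF \<psi>(1) b])
      have "bdry D ?i (\<psi> (bdry P (?i + 1) x)) = \<phi> (bdry P ?i (bdry P (?i + 1) x))"
        using \<psi>(2)[OF b] b by (simp add: compose_def)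
      also have "\<dots> = \<phi> \<zero>\<^bsub>obj P (int n)\<^esub>" using H.bdry_bdry_P[OF x] by (simp add: algebra_simps)
      also have "\<dots> = \<zero>\<^bsub>obj D (int n)\<^esub>"
        by (rule mod_hom_zero[OF conjunct1[OF ok] H.P.abelian_group_axioms H.D.abelian_group_axioms])
      finally show "bdry D ?i (\<psi> (bdry P (?i + 1) x)) = \<zero>\<^bsub>obj D (?i - 1)\<^esub>" by simp
    qed simp
    then have "?ok (Suc n) \<psi> \<and> (\<forall>x\<in>carrier (obj P ?i). bdry D ?i (\<psi> x) = \<phi> (bdry P ?i x))"
      using \<psi> by (simp add: compose_def algebra_simps)
    then show "\<exists>\<psi>. ?ok (Suc n) \<psi> \<and> (\<forall>x\<in>carrier (obj P ?i). bdry D ?i (\<psi> x) = \<phi> (bdry P ?i x))"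
      by (intro exI[of _ \<psi>])
  qed
  then obtain \<phi> where \<phi>0: "\<forall>n. ?ok n (\<phi> n) \<and> (\<forall>x\<in>carrier (obj P (int n + 1)).
      bdry D (int n + 1) (\<phi> (Suc n) x) = \<phi> n (bdry P (int n + 1) x))"
    by (rule exE)
  note \<phi> = spec[OF \<phi>0, THEN conjunct1] spec[OF \<phi>0, THEN conjunct2, THEN bspec]
  define u where "u i = (if i \<ge> 0 then \<phi> (nat i) else (\<lambda>x\<in>carrier (obj P i). \<zero>\<^bsub>obj D i\<^esub>))" for i
  have u: "u i \<in> mod_hom A (obj P i) (obj D i)" for i
    using \<phi>(1)[of "nat i"] mod_hom_null[OF H.P.module_axioms[of i] H.D.module_axioms[of i]] by (auto simp: u_def)
  have "bdry D i (u i x) = u (i - 1) (bdry P i x)" if x: "x \<in> carrier (obj P i)" for i x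
  proof (cases "i > 0")
    case True
    then obtain n where n: "i = int n + 1" by (metis zless_iff_Suc_zadd add.left_neutral of_nat_Suc add.commute)
    then have "nat i = Suc n" "nat (i - 1) = n" by auto
    then show ?thesis using \<phi>(2)[of x n] x n by (simp add: u_def)
  next
    case False
    then have "carrier (obj D (i - 1)) = {\<zero>\<^bsub>obj D (i - 1)\<^esub>}" by (intro free_resolution_neg[OF D]) simp
    then show ?thesis using mod_hom_closed[OF H.bdry_D mod_hom_closed[OF u x]]
        mod_hom_closed[OF u H.bdry_P_closed[OF x]] by simp
  qed
  then have "chain_map A P D u" using u by (simp add: chain_map_def)
  moreover have "\<rho> (u 0 x) = \<pi> x" if "x \<in> carrier (obj P 0)" for x
    using \<phi>(1)[of 0] that by (simp add: u_def)
  ultimately show thesis by (rule that)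
qed

text \<open>A chain endomorphism that the augmentation kills is null homotopic: in degree 0 its
  values are boundaries, and each further step corrects \<open>f\<close> by the part of the homotopy
  already found.\<close>

lemma null_homotopy_exists:
  assumes P: "free_resolution A N P" and \<pi>: "augments A N P \<pi>"
    and f: "chain_map A P P f" "\<And>x. x \<in> carrier (obj P 0) \<Longrightarrow> \<pi> (f 0 x) = \<zero>\<^bsub>N\<^esub>"
  obtains s where "\<And>i. s i \<in> mod_hom A (obj P i) (obj P (i + 1))"
    "\<And>i x. x \<in> carrier (obj P i) \<Longrightarrow> f i x = bdry P (i + 1) (s i x) \<oplus>\<^bsub>obj P i\<^esub> s (i - 1) (bdry P i x)"
proof -
  interpret H: hom_complex A P P
    by unfold_locales (rule free_resolution_chain_complex[OF P])+
  have fm: "f i \<in> mod_hom A (obj P i) (obj P i)" for i using f(1) by (simp add: chain_map_def)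
  have fb: "bdry P i (f i x) = f (i - 1) (bdry P i x)" if "x \<in> carrier (obj P i)" for i x
    using f(1) that by (simp add: chain_map_def)
  \<comment> \<open>The invariant says that \<open>f - s \<partial>\<close> has values in the cycles
    one degree up, hence in the boundaries, so that the next \<open>s\<close> can be lifted.\<close>
  let ?ok = "\<lambda>n s. s \<in> mod_hom A (obj P (int n)) (obj P (int n + 1)) \<and>
      (\<forall>x\<in>carrier (obj P (int n + 1)). bdry P (int n + 1) (f (int n + 1) x \<ominus>\<^bsub>obj P (int n + 1)\<^esub> s (bdry P (int n + 1) x)) = \<zero>\<^bsub>obj P (int n)\<^esub>) \<and>
      (n = 0 \<longrightarrow> (\<forall>x\<in>carrier (obj P 0). f 0 x = bdry P 1 (s x)))"
  have "\<exists>s. \<forall>n. ?ok n (s n) \<and> (\<forall>x\<in>carrier (obj P (int n + 1)). bdry P (int n + 2) (s (Suc n) x)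
      = f (int n + 1) x \<ominus>\<^bsub>obj P (int n + 1)\<^esub> s n (bdry P (int n + 1) x))"
  proof (rule dependent_nat_choice)
    have b1: "bdry P 1 \<in> mod_hom A (obj P 1) (obj P 0)" using H.bdry_P[of 1] by simp
    obtain s where s: "s \<in> mod_hom A (obj P 0) (obj P 1)" "\<And>x. x \<in> carrier (obj P 0) \<Longrightarrow> bdry P 1 (s x) = f 0 x"
    proof (rule free_module_lift[OF free_resolution_free[OF P, of 0] H.P.module_axioms[of 1] H.P.abelian_group_axioms fm b1])
      show "f 0 x \<in> bdry P 1 ` carrier (obj P 1)" if x: "x \<in> carrier (obj P 0)" for x
      proof -
        have "f 0 x \<in> {y \<in> carrier (obj P 0). \<pi> y = \<zero>\<^bsub>N\<^esub>}"
          using f(2)[OF x] mod_hom_closed[OF fm x] by simp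
        then show ?thesis using \<pi> unfolding augments_def by (elim conjE) (simp only:)
      qed
    qed (rule that)
    have "bdry P 1 (f 1 x \<ominus>\<^bsub>obj P 1\<^esub> s (bdry P 1 x)) = \<zero>\<^bsub>obj P 0\<^esub>" if x: "x \<in> carrier (obj P 1)" for x
    proof -
      have b: "bdry P 1 x \<in> carrier (obj P 0)" by (rule mod_hom_closed[OF b1 x])
      note c = mod_hom_closed[OF fm x] mod_hom_closed[OF s(1) b]
      have "bdry P 1 (f 1 x \<ominus>\<^bsub>obj P 1\<^esub> s (bdry P 1 x)) = f 0 (bdry P 1 x) \<ominus>\<^bsub>obj P 0\<^esub> f 0 (bdry P 1 x)"
        using mod_hom_minus[OF b1 H.P.abelian_group_axioms H.P.abelian_group_axioms c] fb[OF x] s(2)[OF b] by simp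
      then show ?thesis
        using abelian_group_minus_eq_zero_iff[OF H.P.abelian_group_axioms mod_hom_closed[OF fm b] mod_hom_closed[OF fm b]]
        by simp
    qed
    then have "?ok 0 s" using s by simp
    then show "\<exists>s. ?ok 0 s" by (intro exI[of _ s])
  next
    fix s n assume ok: "?ok n s"
    let ?i = "int n + 1"
    have sm: "s \<in> mod_hom A (obj P (int n)) (obj P ?i)" using ok by blast
    have b0: "bdry P ?i \<in> mod_hom A (obj P ?i) (obj P (int n))" using H.bdry_P[of ?i] by simp
    have b1: "bdry P (int n + 2) \<in> mod_hom A (obj P (int n + 2)) (obj P ?i)" using H.bdry_P[of "int n + 2"] by (simp add: algebra_simps)
    let ?g = "\<lambda>x\<in>carrier (obj P ?i). f ?i x \<ominus>\<^bsub>obj P ?i\<^esub> compose (carrier (obj P ?i)) s (bdry P ?i) x"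
    have g: "?g \<in> mod_hom A (obj P ?i) (obj P ?i)"
      by (rule mod_hom_diff[OF H.P.module_axioms H.P.module_axioms fm mod_hom_compose[OF H.P.module_axioms b0 sm]])
    have gx: "?g x = f ?i x \<ominus>\<^bsub>obj P ?i\<^esub> s (bdry P ?i x)" if "x \<in> carrier (obj P ?i)" for x
      using that by (simp add: compose_def)
    obtain t where t: "t \<in> mod_hom A (obj P ?i) (obj P (int n + 2))"
        "\<And>x. x \<in> carrier (obj P ?i) \<Longrightarrow> bdry P (int n + 2) (t x) = ?g x"
    proof (rule free_module_lift[OF free_resolution_free[OF P, of ?i] H.P.module_axioms H.P.abelian_group_axioms g b1])
      show "?g x \<in> bdry P (int n + 2) ` carrier (obj P (int n + 2))" if x: "x \<in> carrier (obj P ?i)" for x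
      proof -
        have "bdry P ?i (?g x) = \<zero>\<^bsub>obj P (?i - 1)\<^esub>" using ok x by (simp only: gx[OF x]) simp
        from free_resolution_exact[OF P _ mod_hom_closed[OF g x] this] show ?thesis by (simp add: algebra_simps)
      qed
    qed (rule that)
    have "bdry P (int n + 2) (f (int n + 2) x \<ominus>\<^bsub>obj P (int n + 2)\<^esub> t (bdry P (int n + 2) x)) = \<zero>\<^bsub>obj P ?i\<^esub>"
      if x: "x \<in> carrier (obj P (int n + 2))" for x
    proof -
      have b: "bdry P (int n + 2) x \<in> carrier (obj P ?i)" by (rule mod_hom_closed[OF b1 x])
      have bb: "bdry P ?i (bdry P (int n + 2) x) = \<zero>\<^bsub>obj P (int n)\<^esub>" using H.bdry_bdry_P[OF x] by (simp add: algebra_simps)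
      note c = mod_hom_closed[OF fm x] mod_hom_closed[OF t(1) b]
      have fx: "bdry P (int n + 2) (f (int n + 2) x) = f ?i (bdry P (int n + 2) x)" using fb[OF x] by (simp add: algebra_simps)
      have tx: "bdry P (int n + 2) (t (bdry P (int n + 2) x)) = f ?i (bdry P (int n + 2) x) \<ominus>\<^bsub>obj P ?i\<^esub> \<zero>\<^bsub>obj P ?i\<^esub>"
        unfolding t(2)[OF b] gx[OF b] bb mod_hom_zero[OF sm H.P.abelian_group_axioms H.P.abelian_group_axioms] ..
      note w = mod_hom_closed[OF fm b]
      have "f ?i (bdry P (int n + 2) x) \<ominus>\<^bsub>obj P ?i\<^esub> \<zero>\<^bsub>obj P ?i\<^esub> = f ?i (bdry P (int n + 2) x)"
        using w by (simp add: a_minus_def abelian_group_uminus_zero[OF H.P.abelian_group_axioms])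
      then show ?thesis
        unfolding mod_hom_minus[OF b1 H.P.abelian_group_axioms H.P.abelian_group_axioms c] fx tx
        using abelian_group_minus_eq_zero_iff[OF H.P.abelian_group_axioms w w] by simp
    qed
    then have "?ok (Suc n) t \<and> (\<forall>x\<in>carrier (obj P ?i). bdry P (int n + 2) (t x)
      = f ?i x \<ominus>\<^bsub>obj P ?i\<^esub> s (bdry P ?i x))"
      using t gx by (simp add: algebra_simps)
    then show "\<exists>t. ?ok (Suc n) t \<and> (\<forall>x\<in>carrier (obj P ?i). bdry P (int n + 2) (t x)
      = f ?i x \<ominus>\<^bsub>obj P ?i\<^esub> s (bdry P ?i x))"
      by (intro exI[of _ t])
  qed
  then obtain s where s0: "\<forall>n. ?ok n (s n) \<and> (\<forall>x\<in>carrier (obj P (int n + 1)). bdry P (int n + 2) (s (Suc n) x)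
      = f (int n + 1) x \<ominus>\<^bsub>obj P (int n + 1)\<^esub> s n (bdry P (int n + 1) x))"
    by (rule exE)
  note s = spec[OF s0, THEN conjunct1] spec[OF s0, THEN conjunct2, THEN bspec]
  define t where "t i = (if i \<ge> 0 then s (nat i) else (\<lambda>x\<in>carrier (obj P i). \<zero>\<^bsub>obj P (i + 1)\<^esub>))" for i
  have t: "t i \<in> mod_hom A (obj P i) (obj P (i + 1))" for i
    using s(1)[of "nat i"] mod_hom_null[OF H.P.module_axioms[of i] H.P.module_axioms[of "i + 1"]] by (auto simp: t_def)
  have "f i x = bdry P (i + 1) (t i x) \<oplus>\<^bsub>obj P i\<^esub> t (i - 1) (bdry P i x)" if x: "x \<in> carrier (obj P i)" for i x
  proof -
    consider "i < 0" | "i = 0" | n where "i = int n + 1"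
      by (metis zless_iff_Suc_zadd add.left_neutral of_nat_Suc add.commute linorder_neqE)
    then show ?thesis
    proof cases
      case 1
      then have z: "carrier (obj P i) = {\<zero>\<^bsub>obj P i\<^esub>}" by (rule free_resolution_neg[OF P])
      have "bdry P (i + 1) (t i x) \<in> carrier (obj P i)" using H.bdry_P_closed[OF mod_hom_closed[OF t x]] by simp
      moreover have "t (i - 1) (bdry P i x) \<in> carrier (obj P i)" using mod_hom_closed[OF t H.bdry_P_closed[OF x]] by simp
      ultimately show ?thesis using mod_hom_closed[OF fm x] z H.P.add.l_one by simp
    next
      case 2
      have "t (i - 1) (bdry P i x) = \<zero>\<^bsub>obj P 0\<^esub>"
        using 2 H.bdry_P_closed[OF x] by (simp add: t_def)
      moreover have "f 0 x = bdry P 1 (t 0 x)" using s(1)[of 0] 2 x by (simp add: t_def)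
      moreover have "bdry P 1 (t 0 x) \<in> carrier (obj P 0)"
        using H.bdry_P_closed[OF mod_hom_closed[OF t[of 0]]] 2 x by force
      ultimately show ?thesis using 2 by simp
    next
      case 3
      then have n: "nat i = Suc n" "nat (i - 1) = n" by auto
      have tx: "t (i - 1) (bdry P i x) \<in> carrier (obj P i)" using mod_hom_closed[OF t H.bdry_P_closed[OF x]] by simp
      have "bdry P (i + 1) (t i x) = f i x \<ominus>\<^bsub>obj P i\<^esub> t (i - 1) (bdry P i x)"
        using s(2)[of x n] x 3 n by (simp add: t_def add.commute)
      then show ?thesis using tx mod_hom_closed[OF fm x] by (simp add: H.P.minus_eq H.P.a_assoc H.P.l_neg)
    qed
  qed
  then show thesis using t that by blast
qed

lemma cocycle_endo_iff:
  assumes "chain_complex A P"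
  shows "c \<in> hom_cocycles A P P e \<longleftrightarrow> (\<forall>i. c i \<in> mod_hom A (obj P i) (obj P (i - e))) \<and>
    (\<forall>i. \<forall>x\<in>carrier (obj P i). bdry P (i - e) (c i x) =
      (if even e then c (i - 1) (bdry P i x) else \<ominus>\<^bsub>obj P (i - e - 1)\<^esub> c (i - 1) (bdry P i x)))"
proof -
  interpret H: hom_complex A P P by unfold_locales (rule assms)+
  show ?thesis unfolding H.cocycles_iff by (simp add: hom_group_def)
qed

text \<open>With \<open>u : P \<rightarrow> P'\<close> and \<open>v : P' \<rightarrow> P\<close> lifting the identity of \<open>N\<close>, a generator \<open>g \<circ> c\<close> pulls back to
  \<open>g \<circ> c \<circ> v\<close>, which is homotopic to \<open>(g \<circ> v) \<circ> (u \<circ> c \<circ> v)\<close>.\<close>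

lemma functionals_fin_gen_transfer:
  assumes P: "free_resolution A N P" and D: "free_resolution A N D" and N: "abelian_group N"
    and fg: "functionals_fin_gen A P"
  shows "functionals_fin_gen A D"
proof -
  note cP = free_resolution_chain_complex[OF P] and cD = free_resolution_chain_complex[OF D]
  interpret RP: ring_hom_complex A P by unfold_locales (rule cP)
  interpret RD: ring_hom_complex A D by unfold_locales (rule cD)
  note PM = RP.E.P.module_axioms and DM = RD.E.P.module_axioms
  note PG = RP.E.P.abelian_group_axioms and DG = RD.E.P.abelian_group_axioms
  note AM = module_regular_module[OF RP.cring_A]
  note AG = module_imp_abelian_group[OF AM]
  obtain \<pi> where \<pi>: "augments A N P \<pi>" by (rule free_resolution_augments[OF P])
  obtain \<rho> where \<rho>: "augments A N D \<rho>" by (rule free_resolution_augments[OF D])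
  obtain u where u: "chain_map A P D u" "\<And>x. x \<in> carrier (obj P 0) \<Longrightarrow> \<rho> (u 0 x) = \<pi> x"
    by (rule chain_map_exists[OF P D N \<pi> \<rho>]) (rule that)
  obtain v where v: "chain_map A D P v" "\<And>x. x \<in> carrier (obj D 0) \<Longrightarrow> \<pi> (v 0 x) = \<rho> x"
    by (rule chain_map_exists[OF D P N \<rho> \<pi>]) (rule that)
  have um: "u i \<in> mod_hom A (obj P i) (obj D i)" and vm: "v i \<in> mod_hom A (obj D i) (obj P i)" for i
    using u(1) v(1) by (simp_all add: chain_map_def)
  have ub: "x \<in> carrier (obj P i) \<Longrightarrow> bdry D i (u i x) = u (i - 1) (bdry P i x)" for i x
    using u(1) by (simp add: chain_map_def)
  have vb: "x \<in> carrier (obj D i) \<Longrightarrow> bdry P i (v i x) = v (i - 1) (bdry D i x)" for i x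
    using v(1) by (simp add: chain_map_def)
  \<comment> \<open>Stated for two arbitrary complexes over possibly different types, because it is
    applied to \<open>v \<circ> u\<close> on \<open>P\<close> and to \<open>u \<circ> v\<close> on
    \<open>D\<close>. The null homotopic map is \<open>1 - b' a\<close>.\<close>
  have homotopy: "\<exists>s. (\<forall>i. s i \<in> mod_hom A (obj C i) (obj C (i + 1))) \<and> (\<forall>i. \<forall>x\<in>carrier (obj C i).
      x = b' i (a i x) \<oplus>\<^bsub>obj C i\<^esub> (bdry C (i + 1) (s i x) \<oplus>\<^bsub>obj C i\<^esub> s (i - 1) (bdry C i x)))"
    if C: "free_resolution A N C" "augments A N C \<tau>"
      and am: "\<And>i. a i \<in> mod_hom A (obj C i) (obj E i)" and bm: "\<And>i. b' i \<in> mod_hom A (obj E i) (obj C i)"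
      and ab: "\<And>i x. x \<in> carrier (obj C i) \<Longrightarrow> bdry E i (a i x) = a (i - 1) (bdry C i x)"
      and bb: "\<And>i x. x \<in> carrier (obj E i) \<Longrightarrow> bdry C i (b' i x) = b' (i - 1) (bdry E i x)"
      and t: "\<And>x. x \<in> carrier (obj C 0) \<Longrightarrow> \<tau> (b' 0 (a 0 x)) = \<tau> x"
    for C :: "('a, 'g) module_complex" and E :: "('a, 'h) module_complex" and \<tau> a b'
  proof -
    interpret RC: ring_hom_complex A C by unfold_locales (rule free_resolution_chain_complex[OF C(1)])
    note CM = RC.E.P.module_axioms and CG = RC.E.P.abelian_group_axioms
    define f where "f i = (\<lambda>x\<in>carrier (obj C i). x \<ominus>\<^bsub>obj C i\<^esub> b' i (a i x))" for i
    have bac: "b' i (a i x) \<in> carrier (obj C i)" if "x \<in> carrier (obj C i)" for i x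
      using mod_hom_closed[OF bm mod_hom_closed[OF am that]] .
    have fm: "f i \<in> mod_hom A (obj C i) (obj C i)" for i
      using mod_hom_diff[OF CM CM mod_hom_id[OF CM] mod_hom_compose[OF CM am bm], of i]
      by (simp add: f_def compose_def cong: restrict_cong)
    have "bdry C i (f i x) = f (i - 1) (bdry C i x)" if x: "x \<in> carrier (obj C i)" for i x
      using mod_hom_minus[OF RC.E.bdry_P CG CG x bac[OF x]] x RC.E.bdry_P_closed[OF x]
      by (simp add: f_def ab[OF x] bb[OF mod_hom_closed[OF am x]])
    then have cf: "chain_map A C C f" using fm by (simp add: chain_map_def)
    have tf: "\<tau> (f 0 x) = \<zero>\<^bsub>N\<^esub>" if x: "x \<in> carrier (obj C 0)" for x
    proof -
      have \<tau>: "\<tau> \<in> mod_hom A (obj C 0) N" using C(2) by (simp add: augments_def)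
      show ?thesis
        using mod_hom_minus[OF \<tau> CG N x bac[OF x]] x t[OF x] mod_hom_closed[OF \<tau> x]
          abelian_group_minus_eq_zero_iff[OF N]
        by (simp add: f_def)
    qed
    obtain s where s: "\<And>i. s i \<in> mod_hom A (obj C i) (obj C (i + 1))"
      "\<And>i x. x \<in> carrier (obj C i) \<Longrightarrow> f i x = bdry C (i + 1) (s i x) \<oplus>\<^bsub>obj C i\<^esub> s (i - 1) (bdry C i x)"
      by (rule null_homotopy_exists[OF C cf tf], assumption, rule that)
    have "x = b' i (a i x) \<oplus>\<^bsub>obj C i\<^esub> (bdry C (i + 1) (s i x) \<oplus>\<^bsub>obj C i\<^esub> s (i - 1) (bdry C i x))"
      if x: "x \<in> carrier (obj C i)" for i x
      unfolding s(2)[OF x, symmetric] using x bac[OF x]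
      by (simp add: f_def RC.E.P.minus_eq RC.E.P.a_lcomm RC.E.P.r_neg)
    then show ?thesis using s(1) by blast
  qed
  have \<pi>t: "\<pi> (v 0 (u 0 x)) = \<pi> x" if "x \<in> carrier (obj P 0)" for x
    using v(2)[OF mod_hom_closed[OF um that]] u(2)[OF that] by simp
  have \<rho>t: "\<rho> (u 0 (v 0 x)) = \<rho> x" if "x \<in> carrier (obj D 0)" for x
    using u(2)[OF mod_hom_closed[OF vm that]] v(2)[OF that] by simp
  obtain s where s: "\<And>i. s i \<in> mod_hom A (obj P i) (obj P (i + 1))"
      "\<And>i x. x \<in> carrier (obj P i) \<Longrightarrow> x = v i (u i x) \<oplus>\<^bsub>obj P i\<^esub> (bdry P (i + 1) (s i x) \<oplus>\<^bsub>obj P i\<^esub> s (i - 1) (bdry P i x))"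
    using homotopy[OF P \<pi> um vm ub vb \<pi>t] by blast
  obtain r where r: "\<And>i. r i \<in> mod_hom A (obj D i) (obj D (i + 1))"
      "\<And>i x. x \<in> carrier (obj D i) \<Longrightarrow> x = u i (v i x) \<oplus>\<^bsub>obj D i\<^esub> (bdry D (i + 1) (r i x) \<oplus>\<^bsub>obj D i\<^esub> r (i - 1) (bdry D i x))"
    using homotopy[OF D \<rho> vm um vb ub \<rho>t] by blast
  obtain G where G: "finite G" "\<And>d g. (d, g) \<in> G \<Longrightarrow> g \<in> cocycle_functionals A P d"
    and gen: "\<And>n \<phi>. \<phi> \<in> cocycle_functionals A P n \<Longrightarrow> generated_functional A P G n \<phi>"
    using fg unfolding functionals_fin_gen_def by blast
  define G' where "G' = (\<lambda>(d, g). (d, \<lambda>x\<in>carrier (obj D d). g (v d x))) ` G"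
  \<comment> \<open>A cocycle functional does not see boundaries, so the middle term of the homotopy
    formula drops out.\<close>
  have split: "\<phi> (x \<oplus>\<^bsub>obj C n\<^esub> (bdry C (n + 1) y \<oplus>\<^bsub>obj C n\<^esub> z)) = \<phi> x \<oplus>\<^bsub>A\<^esub> \<phi> z"
    if \<phi>: "\<phi> \<in> cocycle_functionals A C n" and C: "chain_complex A C"
      and "x \<in> carrier (obj C n)" "z \<in> carrier (obj C n)" "y \<in> carrier (obj C (n + 1))"
    for C :: "('a, 'g) module_complex" and \<phi> n x y z
  proof -
    interpret RC: ring_hom_complex A C by unfold_locales (rule C)
    have \<phi>m: "\<phi> \<in> mod_hom A (obj C n) (regular_module A)" and \<phi>b: "\<phi> (bdry C (n + 1) y) = \<zero>\<^bsub>A\<^esub>"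
      using \<phi> that(5) by (auto simp: cocycle_functionals_def)
    have b: "bdry C (n + 1) y \<in> carrier (obj C n)" using RC.E.bdry_P_closed[OF that(5)] by simp
    show ?thesis
      using that(3,4) b mod_hom_closed[OF \<phi>m] by (simp add: mod_hom_add[OF \<phi>m] \<phi>b)
  qed
  \<comment> \<open>Pullback along \<open>v\<close> carries generated functionals to functionals
    generated by the pullbacks of the generators.\<close>
  have pull: "generated_functional A P G n \<phi> \<Longrightarrow> generated_functional A D G' n (\<lambda>x\<in>carrier (obj D n). \<phi> (v n x))" for n \<phi>
  proof (induction rule: generated_functional.induct)
    case (act d g c n)
    let ?e = "n - d"
    have cm: "c i \<in> mod_hom A (obj P i) (obj P (i - ?e))" for i
      using act(2) by (simp add: cocycle_endo_iff[OF cP])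
    have cb: "bdry P (i - ?e) (c i x) =
      (if even ?e then c (i - 1) (bdry P i x) else \<ominus>\<^bsub>obj P (i - ?e - 1)\<^esub> c (i - 1) (bdry P i x))"
      if "x \<in> carrier (obj P i)" for i x
      using act(2) that unfolding cocycle_endo_iff[OF cP] by (elim conjE) (erule allE, erule (1) bspec)
    note g = G(2)[OF act(1)]
    then have gm: "g \<in> mod_hom A (obj P d) (regular_module A)" by (simp add: cocycle_functionals_def)
    \<comment> \<open>The coefficient transported to \<open>D\<close> as
      \<open>u \<circ> c \<circ> v\<close>; it is a cocycle of the same degree because
      \<open>u\<close> and \<open>v\<close> are chain maps.\<close>
    define c' where "c' i = compose (carrier (obj D i)) (u (i - ?e)) (compose (carrier (obj D i)) (c i) (v i))" for i
    have c'x: "c' i x = u (i - ?e) (c i (v i x))" if "x \<in> carrier (obj D i)" for i x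
      using that by (simp add: c'_def compose_def)
    have c'm: "c' i \<in> mod_hom A (obj D i) (obj D (i - ?e))" for i
      unfolding c'_def by (rule mod_hom_compose[OF DM mod_hom_compose[OF DM vm cm] um])
    have "bdry D (i - ?e) (c' i x) =
      (if even ?e then c' (i - 1) (bdry D i x) else \<ominus>\<^bsub>obj D (i - ?e - 1)\<^esub> c' (i - 1) (bdry D i x))"
      if x: "x \<in> carrier (obj D i)" for i x
    proof -
      note vx = mod_hom_closed[OF vm x] and bx = RD.E.bdry_P_closed[OF x]
      have w: "c (i - 1) (v (i - 1) (bdry D i x)) \<in> carrier (obj P (i - ?e - 1))"
        using mod_hom_closed[OF cm mod_hom_closed[OF vm bx]] by (simp add: algebra_simps)
      have "bdry D (i - ?e) (c' i x) = u (i - ?e - 1) (bdry P (i - ?e) (c i (v i x)))"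
        unfolding c'x[OF x] by (rule ub[OF mod_hom_closed[OF cm vx]])
      also have "\<dots> = (if even ?e then u (i - ?e - 1) (c (i - 1) (v (i - 1) (bdry D i x)))
          else \<ominus>\<^bsub>obj D (i - ?e - 1)\<^esub> u (i - ?e - 1) (c (i - 1) (v (i - 1) (bdry D i x))))"
        unfolding cb[OF vx] vb[OF x] using mod_hom_a_inv[OF um PG DG w] by simp
      also have "u (i - ?e - 1) (c (i - 1) (v (i - 1) (bdry D i x))) = c' (i - 1) (bdry D i x)"
        unfolding c'x[OF bx] by (simp add: algebra_simps)
      finally show ?thesis .
    qed
    then have c': "c' \<in> hom_cocycles A D D ?e"
      using c'm unfolding cocycle_endo_iff[OF cD] by blast
    have mem: "(d, \<lambda>x\<in>carrier (obj D d). g (v d x)) \<in> G'" using act(1) by (force simp: G'_def)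
    have vn1: "v (n - 1) \<in> mod_hom A (obj D (n - 1)) (obj P (n - 1))" by (rule vm)
    have cn1: "c (n - 1) \<in> mod_hom A (obj P (n - 1)) (obj P (d - 1))" using cm[of "n - 1"] by simp
    have sd: "s (d - 1) \<in> mod_hom A (obj P (d - 1)) (obj P d)" using s(1)[of "d - 1"] by simp
    \<comment> \<open>The homotopy term is \<open>g s \<partial> c v\<close>. Moving
      \<open>\<partial>\<close> to the right through \<open>c\<close> and \<open>v\<close> makes it
      \<open>(-1)^e (g s c v) \<partial>\<close> with \<open>e = n - d\<close>, a boundary; the sign
      goes into \<open>w\<close>.\<close>
    define w0 where "w0 = compose (carrier (obj D (n - 1))) g (compose (carrier (obj D (n - 1))) (s (d - 1))
        (compose (carrier (obj D (n - 1))) (c (n - 1)) (v (n - 1))))"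
    have w0: "w0 \<in> mod_hom A (obj D (n - 1)) (regular_module A)"
      unfolding w0_def
      by (rule mod_hom_compose[OF DM mod_hom_compose[OF DM mod_hom_compose[OF DM vn1 cn1] sd] gm])
    define w where "w = (if even ?e then w0 else (\<lambda>x\<in>carrier (obj D (n - 1)). \<ominus>\<^bsub>A\<^esub> w0 x))"
    have w: "w \<in> mod_hom A (obj D (n - 1)) (regular_module A)"
      using w0 mod_hom_uminus[OF DM AM w0] by (simp add: w_def)
    have "g (c n (v n x)) = g (v d (c' n x)) \<oplus>\<^bsub>A\<^esub> w (bdry D n x)" if x: "x \<in> carrier (obj D n)" for x
    proof -
      note vx = mod_hom_closed[OF vm x] and bx = RD.E.bdry_P_closed[OF x]
      have y: "c n (v n x) \<in> carrier (obj P d)" using mod_hom_closed[OF cm vx] by simp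
      have cw: "c (n - 1) (v (n - 1) (bdry D n x)) \<in> carrier (obj P (d - 1))"
        using mod_hom_closed[OF cn1 mod_hom_closed[OF vm bx]] .
      have "bdry P d (c n (v n x)) = (if even ?e then c (n - 1) (v (n - 1) (bdry D n x))
          else \<ominus>\<^bsub>obj P (d - 1)\<^esub> c (n - 1) (v (n - 1) (bdry D n x)))"
        using cb[OF vx] vb[OF x] by simp
      then have sb: "g (s (d - 1) (bdry P d (c n (v n x)))) = w (bdry D n x)"
        using bx mod_hom_a_inv[OF sd PG PG cw] mod_hom_a_inv[OF gm PG AG mod_hom_closed[OF sd cw]]
        by (simp add: w_def w0_def compose_def)
      have "g (c n (v n x)) = g (v d (u d (c n (v n x))) \<oplus>\<^bsub>obj P d\<^esub>
          (bdry P (d + 1) (s d (c n (v n x))) \<oplus>\<^bsub>obj P d\<^esub> s (d - 1) (bdry P d (c n (v n x)))))"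
        by (rule arg_cong[OF s(2)[OF y]])
      also have "\<dots> = g (v d (u d (c n (v n x)))) \<oplus>\<^bsub>A\<^esub> g (s (d - 1) (bdry P d (c n (v n x))))"
        by (rule split[OF g cP mod_hom_closed[OF vm mod_hom_closed[OF um y]]
            mod_hom_closed[OF sd RP.E.bdry_P_closed[OF y]] mod_hom_closed[OF s(1) y]])
      finally show ?thesis unfolding sb using c'x[OF x] by simp
    qed
    moreover have "c' n x \<in> carrier (obj D d)" if "x \<in> carrier (obj D n)" for x
      using mod_hom_closed[OF c'm that] by simp
    moreover have "c n (v n x) = c n (v n x)" and "v n x \<in> carrier (obj P n)" if "x \<in> carrier (obj D n)" for x
      using mod_hom_closed[OF vm that] by simp_all
    ultimately have "(\<lambda>x\<in>carrier (obj D n). (\<lambda>x\<in>carrier (obj P n). g (c n x)) (v n x)) =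
      (\<lambda>x\<in>carrier (obj D n). (\<lambda>x\<in>carrier (obj D n). (\<lambda>x\<in>carrier (obj D d). g (v d x)) (c' n x)) x
          \<oplus>\<^bsub>A\<^esub> (\<lambda>x\<in>carrier (obj D n). w (bdry D n x)) x)"
      by (intro restrict_ext) simp
    then show ?case
      using generated_functional.add[OF generated_functional.act[OF mem c'] generated_functional.bdry[OF w]]
      by (simp only:)
  next
    case (add n \<phi> \<psi>)
    have "(\<lambda>x\<in>carrier (obj D n). (\<lambda>x\<in>carrier (obj P n). \<phi> x \<oplus>\<^bsub>A\<^esub> \<psi> x) (v n x)) =
      (\<lambda>x\<in>carrier (obj D n). (\<lambda>x\<in>carrier (obj D n). \<phi> (v n x)) x \<oplus>\<^bsub>A\<^esub> (\<lambda>x\<in>carrier (obj D n). \<psi> (v n x)) x)"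
      using mod_hom_closed[OF vm] by (intro restrict_ext) simp
    then show ?case using generated_functional.add[OF add.IH] by (simp only:)
  next
    case (bdry w n)
    have "(\<lambda>x\<in>carrier (obj D n). (\<lambda>x\<in>carrier (obj P n). w (bdry P n x)) (v n x)) =
      (\<lambda>x\<in>carrier (obj D n). compose (carrier (obj D (n - 1))) w (v (n - 1)) (bdry D n x))"
      using mod_hom_closed[OF vm] RD.E.bdry_P_closed by (intro restrict_ext) (simp add: vb compose_def)
    then show ?case
      using generated_functional.bdry[OF mod_hom_compose[OF DM vm bdry], of G'] by (simp only:)
  qed
  have "generated_functional A D G' n \<phi>" if \<phi>: "\<phi> \<in> cocycle_functionals A D n" for n \<phi>
  proof -
    have \<phi>m: "\<phi> \<in> mod_hom A (obj D n) (regular_module A)"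
      and \<phi>b: "\<And>y. y \<in> carrier (obj D (n + 1)) \<Longrightarrow> \<phi> (bdry D (n + 1) y) = \<zero>\<^bsub>A\<^esub>"
      using \<phi> by (auto simp: cocycle_functionals_def)
    have \<phi>u: "compose (carrier (obj P n)) \<phi> (u n) \<in> cocycle_functionals A P n"
    proof -
      have "\<phi> (u n (bdry P (n + 1) y)) = \<zero>\<^bsub>A\<^esub>" if y: "y \<in> carrier (obj P (n + 1))" for y
        using ub[OF y] \<phi>b[OF mod_hom_closed[OF um y]] by simp
      moreover have "bdry P (n + 1) y \<in> carrier (obj P n)" if y: "y \<in> carrier (obj P (n + 1))" for y
        using RP.E.bdry_P_closed[OF y] by simp
      ultimately show ?thesis
        using mod_hom_compose[OF PM um \<phi>m] by (simp add: cocycle_functionals_def compose_def)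
    qed
    have rn: "r (n - 1) \<in> mod_hom A (obj D (n - 1)) (obj D n)" using r(1)[of "n - 1"] by simp
    define w where "w = compose (carrier (obj D (n - 1))) \<phi> (r (n - 1))"
    have w: "w \<in> mod_hom A (obj D (n - 1)) (regular_module A)"
      unfolding w_def by (rule mod_hom_compose[OF DM rn \<phi>m])
    \<comment> \<open>The homotopy \<open>1 = u v + \<partial> r + r \<partial>\<close> on
      \<open>D\<close> under the cocycle \<open>\<phi>\<close>: up to the boundary
      \<open>(\<phi> r) \<partial>\<close>, \<open>\<phi>\<close> is the pullback along
      \<open>v\<close> of \<open>\<phi> \<circ> u\<close>, which is generated over
      \<open>P\<close>.\<close>
    have "\<phi> x = \<phi> (u n (v n x)) \<oplus>\<^bsub>A\<^esub> w (bdry D n x)" if x: "x \<in> carrier (obj D n)" for x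
    proof -
      note bx = RD.E.bdry_P_closed[OF x]
      have "\<phi> x = \<phi> (u n (v n x) \<oplus>\<^bsub>obj D n\<^esub> (bdry D (n + 1) (r n x) \<oplus>\<^bsub>obj D n\<^esub> r (n - 1) (bdry D n x)))"
        by (rule arg_cong[OF r(2)[OF x]])
      also have "\<dots> = \<phi> (u n (v n x)) \<oplus>\<^bsub>A\<^esub> \<phi> (r (n - 1) (bdry D n x))"
        by (rule split[OF \<phi> cD mod_hom_closed[OF um mod_hom_closed[OF vm x]] mod_hom_closed[OF rn bx]
            mod_hom_closed[OF r(1) x]])
      finally show ?thesis using bx by (simp add: w_def compose_def)
    qed
    then have "\<phi> = (\<lambda>x\<in>carrier (obj D n). (\<lambda>x\<in>carrier (obj D n). compose (carrier (obj P n)) \<phi> (u n) (v n x)) x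
        \<oplus>\<^bsub>A\<^esub> (\<lambda>x\<in>carrier (obj D n). w (bdry D n x)) x)"
      using mod_hom_extensional[OF \<phi>m] mod_hom_closed[OF vm]
      by (intro extensionalityI[of _ "carrier (obj D n)"]) (auto simp: compose_def)
    then show ?thesis
      using generated_functional.add[OF pull[OF gen[OF \<phi>u]] generated_functional.bdry[OF w, of G']] by (simp only:)
  qed
  moreover have "g' \<in> cocycle_functionals A D d" if dg: "(d, g') \<in> G'" for d g'
  proof -
    obtain p where p: "p \<in> G" "(d, g') = (case p of (d, g) \<Rightarrow> (d, \<lambda>x\<in>carrier (obj D d). g (v d x)))"
      using dg unfolding G'_def by (rule imageE)
    obtain d0 g where p': "p = (d0, g)" by (cases p)
    have g: "(d, g) \<in> G" "g' = compose (carrier (obj D d)) g (v d)"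
      using p unfolding p' by (simp_all add: compose_def)
    have gm: "g \<in> mod_hom A (obj P d) (regular_module A)"
      and gb: "\<And>y. y \<in> carrier (obj P (d + 1)) \<Longrightarrow> g (bdry P (d + 1) y) = \<zero>\<^bsub>A\<^esub>"
      using G(2)[OF g(1)] by (auto simp: cocycle_functionals_def)
    have "g (v d (bdry D (d + 1) y)) = \<zero>\<^bsub>A\<^esub>" if y: "y \<in> carrier (obj D (d + 1))" for y
      using vb[OF y] gb[OF mod_hom_closed[OF vm y]] by simp
    moreover have "bdry D (d + 1) y \<in> carrier (obj D d)" if y: "y \<in> carrier (obj D (d + 1))" for y
      using RD.E.bdry_P_closed[OF y] by simp
    ultimately show ?thesis
      using mod_hom_compose[OF DM vm gm] by (simp add: cocycle_functionals_def compose_def g(2))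
  qed
  moreover have "finite G'" using G(1) by (simp add: G'_def)
  ultimately show ?thesis unfolding functionals_fin_gen_def by blast
qed

section \<open>The tensor product of two algebras\<close>

lemma frag_extend_add_fun:
  "frag_extend (\<lambda>i. f i + g i) x = frag_extend f x + frag_extend g x"
  by (simp add: frag_extend_def frag_cmul_distrib2 sum.distrib)

lemma frag_extend_diff_fun:
  "frag_extend (\<lambda>i. f i - g i) x = frag_extend f x - frag_extend g x"
  using frag_extend_add_fun[of "\<lambda>i. f i - g i" g x] by simp

locale tensor_algebras =
  fixes K :: "('k, 'x) ring_scheme" and R :: "('k, 'r, 'y) module_scheme" and S :: "('k, 's, 'z) module_scheme"
  assumes field_K: "field K" and algebra_R: "algebra K R" and algebra_S: "algebra K S"
begin

sublocale K: field K by (rule field_K)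
sublocale R: algebra K R by (rule algebra_R)
sublocale S: algebra K S by (rule algebra_S)

abbreviation "F \<equiv> pair_ring R S"

lemma pair_ring_simps:
  "x \<in> carrier F \<longleftrightarrow> Poly_Mapping.keys x \<subseteq> carrier R \<times> carrier S"
  "x \<oplus>\<^bsub>F\<^esub> y = x + y" "\<zero>\<^bsub>F\<^esub> = 0" "\<one>\<^bsub>F\<^esub> = frag_of (\<one>\<^bsub>R\<^esub>, \<one>\<^bsub>S\<^esub>)"
  by (simp_all add: pair_ring_def)

lemma pair_ring_mult:
  "(x + x') \<otimes>\<^bsub>F\<^esub> y = x \<otimes>\<^bsub>F\<^esub> y + x' \<otimes>\<^bsub>F\<^esub> y"
  "x \<otimes>\<^bsub>F\<^esub> (y + y') = x \<otimes>\<^bsub>F\<^esub> y + x \<otimes>\<^bsub>F\<^esub> y'"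
  "(x - x') \<otimes>\<^bsub>F\<^esub> y = x \<otimes>\<^bsub>F\<^esub> y - x' \<otimes>\<^bsub>F\<^esub> y"
  "x \<otimes>\<^bsub>F\<^esub> (y - y') = x \<otimes>\<^bsub>F\<^esub> y - x \<otimes>\<^bsub>F\<^esub> y'"
  "0 \<otimes>\<^bsub>F\<^esub> y = 0" "x \<otimes>\<^bsub>F\<^esub> 0 = 0"
  "frag_of (r, s) \<otimes>\<^bsub>F\<^esub> frag_of (r', s') = frag_of (r \<otimes>\<^bsub>R\<^esub> r', s \<otimes>\<^bsub>S\<^esub> s')"
  by (simp_all add: pair_ring_def frag_extend_add frag_extend_diff frag_extend_add_fun frag_extend_diff_fun case_prod_unfold
      frag_extend_eq_0)

lemma pair_ring_induct [consumes 1, case_names zero frag diff]: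
  assumes "x \<in> carrier F" "P 0" "\<And>r s. \<lbrakk>r \<in> carrier R; s \<in> carrier S\<rbrakk> \<Longrightarrow> P (frag_of (r, s))"
    "\<And>x y. \<lbrakk>x \<in> carrier F; y \<in> carrier F; P x; P y\<rbrakk> \<Longrightarrow> P (x - y)"
  shows "P x"
  using assms(1) unfolding pair_ring_simps(1)
  by (rule free_Abelian_group_induct) (use assms(2-) in \<open>auto simp: pair_ring_simps(1)\<close>)

lemma pair_ring_diff_closed: "x \<in> carrier F \<Longrightarrow> y \<in> carrier F \<Longrightarrow> x - y \<in> carrier F"
  unfolding pair_ring_simps(1) using keys_diff[of x y] by blast

lemma pair_ring_mult_closed:
  assumes "x \<in> carrier F" "y \<in> carrier F"
  shows "x \<otimes>\<^bsub>F\<^esub> y \<in> carrier F"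
  using assms(1)
proof (induction x rule: pair_ring_induct)
  case (frag r s)
  from assms(2) show ?case
  proof (induction y rule: pair_ring_induct)
    case (frag r' s')
    then show ?case using \<open>r \<in> carrier R\<close> \<open>s \<in> carrier S\<close> by (simp add: pair_ring_mult pair_ring_simps(1))
  next
    case (diff x y)
    then show ?case using pair_ring_diff_closed by (simp add: pair_ring_mult)
  qed (simp add: pair_ring_mult pair_ring_simps(1))
next
  case (diff x y)
  then show ?case using pair_ring_diff_closed by (simp add: pair_ring_mult)
qed (simp add: pair_ring_mult pair_ring_simps(1))

lemma pair_ring_assoc:
  assumes "x \<in> carrier F" "y \<in> carrier F" "z \<in> carrier F"
  shows "(x \<otimes>\<^bsub>F\<^esub> y) \<otimes>\<^bsub>F\<^esub> z = x \<otimes>\<^bsub>F\<^esub> (y \<otimes>\<^bsub>F\<^esub> z)"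
  using assms(1)
proof (induction x rule: pair_ring_induct)
  case (frag r s)
  note r = this
  from assms(2) show ?case
  proof (induction y rule: pair_ring_induct)
    case (frag r' s')
    note r' = this
    from assms(3) show ?case
    proof (induction z rule: pair_ring_induct)
      case (frag r'' s'')
      then show ?case using r r' by (simp add: pair_ring_mult R.m_assoc S.m_assoc)
    qed (simp_all add: pair_ring_mult)
  qed (simp_all add: pair_ring_mult)
qed (simp_all add: pair_ring_mult)

lemma pair_ring_comm:
  assumes "x \<in> carrier F" "y \<in> carrier F"
  shows "x \<otimes>\<^bsub>F\<^esub> y = y \<otimes>\<^bsub>F\<^esub> x"
  using assms(1)
proof (induction x rule: pair_ring_induct)
  case (frag r s)
  note r = this
  from assms(2) show ?case
  proof (induction y rule: pair_ring_induct)
    case (frag r' s')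
    then show ?case using r by (simp add: pair_ring_mult R.m_comm S.m_comm)
  qed (simp_all add: pair_ring_mult)
qed (simp_all add: pair_ring_mult)

lemma pair_ring_l_one:
  assumes "x \<in> carrier F"
  shows "\<one>\<^bsub>F\<^esub> \<otimes>\<^bsub>F\<^esub> x = x"
  using assms by (induction x rule: pair_ring_induct) (simp_all add: pair_ring_mult pair_ring_simps(4))

lemma cring_pair_ring: "cring F"
proof (rule cringI)
  show "abelian_group F"
  proof (rule abelian_groupI)
    fix x assume "x \<in> carrier F"
    then show "\<exists>y\<in>carrier F. y \<oplus>\<^bsub>F\<^esub> x = \<zero>\<^bsub>F\<^esub>"
      by (intro bexI[of _ "- x"]) (simp_all add: pair_ring_simps)
  qed (auto simp: pair_ring_simps dest: subsetD[OF keys_add])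
  show "comm_monoid F"
    by (rule comm_monoidI)
      ((rule pair_ring_mult_closed pair_ring_assoc pair_ring_l_one pair_ring_comm, assumption+)
        | simp add: pair_ring_simps(1,4))+
qed (simp add: pair_ring_mult pair_ring_simps)

sublocale F: cring F by (rule cring_pair_ring)

lemma pair_ring_minus:
  assumes "x \<in> carrier F" "y \<in> carrier F"
  shows "x \<ominus>\<^bsub>F\<^esub> y = x - y"
proof -
  have "\<ominus>\<^bsub>F\<^esub> y = - y"
    by (rule F.minus_equality) (use assms in \<open>simp_all add: pair_ring_simps\<close>)
  then show ?thesis by (simp add: a_minus_def pair_ring_simps)
qed

abbreviation "relations \<equiv> tensor_relations K R S"
abbreviation "I \<equiv> Idl\<^bsub>F\<^esub> relations"

lemma tensor_relations_subset: "relations \<subseteq> carrier F"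
proof -
  have f: "frag_of (r, s) \<in> carrier F" if "r \<in> carrier R" "s \<in> carrier S" for r s
    using that by (simp add: pair_ring_simps)
  show ?thesis
    unfolding tensor_relations_def by (auto intro!: pair_ring_diff_closed f)
qed

lemma tensor_relationsI:
  "\<lbrakk>r \<in> carrier R; r' \<in> carrier R; s \<in> carrier S\<rbrakk> \<Longrightarrow>
    frag_of (r \<oplus>\<^bsub>R\<^esub> r', s) - frag_of (r, s) - frag_of (r', s) \<in> relations"
  "\<lbrakk>r \<in> carrier R; s \<in> carrier S; s' \<in> carrier S\<rbrakk> \<Longrightarrow>
    frag_of (r, s \<oplus>\<^bsub>S\<^esub> s') - frag_of (r, s) - frag_of (r, s') \<in> relations"
  "\<lbrakk>c \<in> carrier K; r \<in> carrier R; s \<in> carrier S\<rbrakk> \<Longrightarrow>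
    frag_of (c \<odot>\<^bsub>R\<^esub> r, s) - frag_of (r, c \<odot>\<^bsub>S\<^esub> s) \<in> relations"
  unfolding tensor_relations_def by blast+

sublocale I: ideal I F
  by (rule F.genideal_ideal[OF tensor_relations_subset])

abbreviation "A \<equiv> tensor_ring K R S"

lemma tensor_ring_eq: "A = F Quot I"
  by (simp add: tensor_ring_def)

lemma cring_A: "cring A"
  unfolding tensor_ring_eq by (rule I.quotient_is_cring[OF cring_pair_ring])

sublocale A: cring A by (rule cring_A)

definition q :: "('r \<times> 's \<Rightarrow>\<^sub>0 int) \<Rightarrow> ('r \<times> 's \<Rightarrow>\<^sub>0 int) set"
  where "q x = I +>\<^bsub>F\<^esub> x"

definition tens :: "'r \<Rightarrow> 's \<Rightarrow> ('r \<times> 's \<Rightarrow>\<^sub>0 int) set"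
  where "tens r s = q (frag_of (r, s))"

lemma q_hom: "q \<in> ring_hom F A"
  using I.rcos_ring_hom unfolding tensor_ring_eq q_def[abs_def] by simp

lemma carrier_A: "carrier A = q ` carrier F"
  by (auto simp: tensor_ring_eq FactRing_def A_RCOSETS_def' q_def)

lemma q_eq:
  assumes "x \<in> carrier F" "y \<in> carrier F" "x - y \<in> I"
  shows "q x = q y"
  using F.quotient_eq_iff_same_a_r_cos[OF I.ideal_axioms assms(1,2)] assms(3) pair_ring_minus[OF assms(1,2)]
  by (simp add: q_def)

lemma q_closed [simp]: "x \<in> carrier F \<Longrightarrow> q x \<in> carrier A"
  by (simp add: carrier_A)

lemma frag_closed [simp]: "r \<in> carrier R \<Longrightarrow> s \<in> carrier S \<Longrightarrow> frag_of (r, s) \<in> carrier F"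
  by (simp add: pair_ring_simps)

lemma q_add: "x \<in> carrier F \<Longrightarrow> y \<in> carrier F \<Longrightarrow> q (x + y) = q x \<oplus>\<^bsub>A\<^esub> q y"
  using ring_hom_add[OF q_hom] by (simp add: pair_ring_simps)

lemma q_zero: "q 0 = \<zero>\<^bsub>A\<^esub>"
  using ring_hom_zero[OF q_hom F.ring_axioms A.ring_axioms] by (simp add: pair_ring_simps)

lemma tens_closed [simp]: "r \<in> carrier R \<Longrightarrow> s \<in> carrier S \<Longrightarrow> tens r s \<in> carrier A"
  by (simp add: tens_def)

lemma tens_one: "tens \<one>\<^bsub>R\<^esub> \<one>\<^bsub>S\<^esub> = \<one>\<^bsub>A\<^esub>"
  using ring_hom_one[OF q_hom] by (simp add: tens_def pair_ring_simps)

lemma tens_mult: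
  assumes "r \<in> carrier R" "s \<in> carrier S" "r' \<in> carrier R" "s' \<in> carrier S"
  shows "tens r s \<otimes>\<^bsub>A\<^esub> tens r' s' = tens (r \<otimes>\<^bsub>R\<^esub> r') (s \<otimes>\<^bsub>S\<^esub> s')"
  using ring_hom_mult[OF q_hom, of "frag_of (r, s)" "frag_of (r', s')"] assms
  by (simp add: tens_def pair_ring_mult)

lemma q_relation:
  assumes "a - b - c \<in> relations" "a \<in> carrier F" "b \<in> carrier F" "c \<in> carrier F"
  shows "q a = q b \<oplus>\<^bsub>A\<^esub> q c"
proof -
  have "a - (b + c) \<in> I" using F.genideal_self[OF tensor_relations_subset] assms(1) by (auto simp: diff_diff_eq)
  moreover have bc: "b + c \<in> carrier F" using assms F.a_closed[of b c] by (simp add: pair_ring_simps(2))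
  ultimately have "q a = q (b + c)" using q_eq assms(2) by blast
  then show ?thesis using q_add assms by simp
qed

lemma tens_add_left:
  assumes "r \<in> carrier R" "r' \<in> carrier R" "s \<in> carrier S"
  shows "tens (r \<oplus>\<^bsub>R\<^esub> r') s = tens r s \<oplus>\<^bsub>A\<^esub> tens r' s"
  unfolding tens_def
  by (rule q_relation) (use assms tensor_relationsI in auto)

lemma tens_add_right:
  assumes "r \<in> carrier R" "s \<in> carrier S" "s' \<in> carrier S"
  shows "tens r (s \<oplus>\<^bsub>S\<^esub> s') = tens r s \<oplus>\<^bsub>A\<^esub> tens r s'"
  unfolding tens_def
  by (rule q_relation) (use assms tensor_relationsI in auto)

lemma tens_smult:
  assumes "c \<in> carrier K" "r \<in> carrier R" "s \<in> carrier S"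
  shows "tens (c \<odot>\<^bsub>R\<^esub> r) s = tens r (c \<odot>\<^bsub>S\<^esub> s)"
  unfolding tens_def
proof (rule q_eq)
  show "frag_of (c \<odot>\<^bsub>R\<^esub> r, s) - frag_of (r, c \<odot>\<^bsub>S\<^esub> s) \<in> I"
    using F.genideal_self[OF tensor_relations_subset] tensor_relationsI(3)[OF assms] by (rule subsetD)
qed (use assms in auto)

lemma tens_zero_left: "s \<in> carrier S \<Longrightarrow> tens \<zero>\<^bsub>R\<^esub> s = \<zero>\<^bsub>A\<^esub>"
  by (rule additive_zero[OF R.abelian_group_axioms A.abelian_group_axioms]) (auto simp: tens_add_left)

lemma tens_zero_right: "r \<in> carrier R \<Longrightarrow> tens r \<zero>\<^bsub>S\<^esub> = \<zero>\<^bsub>A\<^esub>"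
  by (rule additive_zero[OF S.abelian_group_axioms A.abelian_group_axioms]) (auto simp: tens_add_right)

lemma tens_minus_left: "r \<in> carrier R \<Longrightarrow> s \<in> carrier S \<Longrightarrow> tens (\<ominus>\<^bsub>R\<^esub> r) s = \<ominus>\<^bsub>A\<^esub> tens r s"
  by (rule additive_a_inv[OF R.abelian_group_axioms A.abelian_group_axioms]) (auto simp: tens_add_left)

text \<open>Negatives need no case of their own because
  \<open>-(r \<otimes> s) = (-r) \<otimes> s\<close>. The free abelian group is generated by
  differences, so the induction is run for an element and its negative together.\<close>

lemma tensor_induct [consumes 1, case_names tens add]:
  assumes a: "a \<in> carrier A" and t: "\<And>r s. \<lbrakk>r \<in> carrier R; s \<in> carrier S\<rbrakk> \<Longrightarrow> P (tens r s)"
    and add: "\<And>a b. \<lbrakk>a \<in> carrier A; b \<in> carrier A; P a; P b\<rbrakk> \<Longrightarrow> P (a \<oplus>\<^bsub>A\<^esub> b)"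
  shows "P a"
proof -
  obtain x where x: "x \<in> carrier F" "a = q x" using a by (auto simp: carrier_A)
  have z: "P \<zero>\<^bsub>A\<^esub>" using t[OF R.zero_closed S.zero_closed] by (simp add: tens_zero_left)
  have "P (q x) \<and> P (\<ominus>\<^bsub>A\<^esub> q x)"
    using x(1)
  proof (induction x rule: pair_ring_induct)
    case zero
    then show ?case using z by (simp add: q_zero)
  next
    case (frag r s)
    then show ?case using t[of r s] t[of "\<ominus>\<^bsub>R\<^esub> r" s] by (simp add: tens_minus_left flip: tens_def)
  next
    case (diff x y)
    have "q x = q (x - y) \<oplus>\<^bsub>A\<^esub> q y"
      using q_add[OF pair_ring_diff_closed[OF diff(1,2)] diff(2)] by simp
    then have e: "q (x - y) = q x \<oplus>\<^bsub>A\<^esub> \<ominus>\<^bsub>A\<^esub> q y"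
      using diff(1,2) pair_ring_diff_closed by (simp add: A.a_assoc A.r_neg)
    then have "\<ominus>\<^bsub>A\<^esub> q (x - y) = q y \<oplus>\<^bsub>A\<^esub> \<ominus>\<^bsub>A\<^esub> q x"
      using diff(1,2) by (simp add: A.minus_add A.a_comm)
    then show ?case using e diff add by simp
  qed
  then show ?thesis using x(2) by simp
qed

text \<open>The tensor ring divides by the ideal that the relations generate, while an additive map
  is only known on the relations. The elements all of whose multiples \<open>h\<close> kills form an
  ideal; it contains the relations because a pair times a relation is a relation.\<close>

lemma relation_kill:
  assumes h: "\<And>x y. \<lbrakk>x \<in> carrier F; y \<in> carrier F\<rbrakk> \<Longrightarrow> h (x + y) = h x \<oplus>\<^bsub>G\<^esub> h y"
    and hc: "\<And>x. x \<in> carrier F \<Longrightarrow> h x \<in> carrier G" and G: "abelian_group G"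
    and k: "\<And>x. x \<in> relations \<Longrightarrow> h x = \<zero>\<^bsub>G\<^esub>" and x: "x \<in> I"
  shows "h x = \<zero>\<^bsub>G\<^esub>"
proof -
  interpret G: abelian_group G by (rule G)
  have h0: "h 0 = \<zero>\<^bsub>G\<^esub>"
    using additive_zero[OF F.abelian_group_axioms G, of h] h hc by (simp add: pair_ring_simps)
  have hd: "h (x - y) = h x \<oplus>\<^bsub>G\<^esub> \<ominus>\<^bsub>G\<^esub> h y" if "x \<in> carrier F" "y \<in> carrier F" for x y
  proof -
    have "h x = h (x - y) \<oplus>\<^bsub>G\<^esub> h y"
      using h[OF pair_ring_diff_closed[OF that] that(2)] by simp
    then show ?thesis using that hc pair_ring_diff_closed by (simp add: G.a_assoc G.r_neg)
  qed
  \<comment> \<open>Multiplication by a pair preserves each of the three kinds of relation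
    separately.\<close>
  have rel: "frag_of (r, s) \<otimes>\<^bsub>F\<^esub> x \<in> relations" if "r \<in> carrier R" "s \<in> carrier S" "x \<in> relations" for r s x
    using that(3)[unfolded tensor_relations_def]
  proof (elim UnE CollectE exE conjE)
    fix r1 r2 s1 assume x: "x = frag_of (r1 \<oplus>\<^bsub>R\<^esub> r2, s1) - frag_of (r1, s1) - frag_of (r2, s1)"
      and c: "r1 \<in> carrier R" "r2 \<in> carrier R" "s1 \<in> carrier S"
    have "frag_of (r, s) \<otimes>\<^bsub>F\<^esub> x \<in> relations"
      unfolding x using that(1,2) c tensor_relationsI(1)[of "r \<otimes>\<^bsub>R\<^esub> r1" "r \<otimes>\<^bsub>R\<^esub> r2" "s \<otimes>\<^bsub>S\<^esub> s1"]
      by (simp add: pair_ring_mult R.r_distr)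
    then show ?thesis .
  next
    fix r1 s1 s2 assume x: "x = frag_of (r1, s1 \<oplus>\<^bsub>S\<^esub> s2) - frag_of (r1, s1) - frag_of (r1, s2)"
      and c: "r1 \<in> carrier R" "s1 \<in> carrier S" "s2 \<in> carrier S"
    have "frag_of (r, s) \<otimes>\<^bsub>F\<^esub> x \<in> relations"
      unfolding x using that(1,2) c tensor_relationsI(2)[of "r \<otimes>\<^bsub>R\<^esub> r1" "s \<otimes>\<^bsub>S\<^esub> s1" "s \<otimes>\<^bsub>S\<^esub> s2"]
      by (simp add: pair_ring_mult S.r_distr)
    then show ?thesis .
  next
    fix c r1 s1 assume x: "x = frag_of (c \<odot>\<^bsub>R\<^esub> r1, s1) - frag_of (r1, c \<odot>\<^bsub>S\<^esub> s1)"
      and c: "c \<in> carrier K" "r1 \<in> carrier R" "s1 \<in> carrier S"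
    have "frag_of (r, s) \<otimes>\<^bsub>F\<^esub> x \<in> relations"
      unfolding x using that(1,2) c tensor_relationsI(3)[of c "r \<otimes>\<^bsub>R\<^esub> r1" "s \<otimes>\<^bsub>S\<^esub> s1"]
        R.smult_assoc2[of c r1 r] S.smult_assoc2[of c s1 s]
      by (simp add: pair_ring_mult R.m_comm S.m_comm)
    then show ?thesis .
  qed
  \<comment> \<open>Demanding that all multiples are killed, not only the element, makes
    \<open>L\<close> closed under multiplication. The element itself is recovered as its multiple by
    1.\<close>
  define L where "L = {x \<in> carrier F. \<forall>y\<in>carrier F. h (y \<otimes>\<^bsub>F\<^esub> x) = \<zero>\<^bsub>G\<^esub>}"
  have "ideal L F"
  proof (rule idealI)
    show "ring F" by (rule F.ring_axioms)
    show "subgroup L (add_monoid F)"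
    proof (rule group.subgroupI[OF F.a_group])
      show "L \<subseteq> carrier (add_monoid F)" by (auto simp: L_def)
      have "\<zero>\<^bsub>F\<^esub> \<in> L" by (simp add: L_def) (simp add: pair_ring_simps h0)
      then show "L \<noteq> {}" by blast
    next
      fix a assume a: "a \<in> L"
      then have ac: "a \<in> carrier F" by (simp add: L_def)
      have "h (y \<otimes>\<^bsub>F\<^esub> (\<ominus>\<^bsub>F\<^esub> a)) = \<zero>\<^bsub>G\<^esub>" if y: "y \<in> carrier F" for y
      proof -
        have "y \<otimes>\<^bsub>F\<^esub> (\<ominus>\<^bsub>F\<^esub> a) = \<ominus>\<^bsub>F\<^esub> (y \<otimes>\<^bsub>F\<^esub> a)" using y ac by (simp add: F.r_minus)
        also have "h \<dots> = \<ominus>\<^bsub>G\<^esub> h (y \<otimes>\<^bsub>F\<^esub> a)"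
          by (rule additive_a_inv[OF F.abelian_group_axioms G])
            (use h hc y ac in \<open>auto simp: pair_ring_simps(2)\<close>)
        finally show ?thesis using a y abelian_group_uminus_zero[OF G] by (simp add: L_def)
      qed
      then have "\<ominus>\<^bsub>F\<^esub> a \<in> L" using ac by (simp add: L_def)
      then show "inv\<^bsub>add_monoid F\<^esub> a \<in> L" by (simp add: a_inv_def)
    next
      fix a b assume ab: "a \<in> L" "b \<in> L"
      have "h (y \<otimes>\<^bsub>F\<^esub> a + y \<otimes>\<^bsub>F\<^esub> b) = \<zero>\<^bsub>G\<^esub>" if y: "y \<in> carrier F" for y
        using h[of "y \<otimes>\<^bsub>F\<^esub> a" "y \<otimes>\<^bsub>F\<^esub> b"] ab y by (simp add: L_def)
      then show "a \<otimes>\<^bsub>add_monoid F\<^esub> b \<in> L"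
        using ab F.a_closed[of a b] by (simp add: L_def pair_ring_simps(2) pair_ring_mult)
    qed
  next
    fix a x assume ax: "a \<in> L" "x \<in> carrier F"
    have "h (y \<otimes>\<^bsub>F\<^esub> (x \<otimes>\<^bsub>F\<^esub> a)) = \<zero>\<^bsub>G\<^esub>" if y: "y \<in> carrier F" for y
      using ax y F.m_assoc[of y x a] by (simp add: L_def flip: F.m_assoc)
    then show xa: "x \<otimes>\<^bsub>F\<^esub> a \<in> L" using ax by (simp add: L_def)
    then show "a \<otimes>\<^bsub>F\<^esub> x \<in> L" using ax by (simp add: L_def F.m_comm)
  qed
  moreover have "relations \<subseteq> L"
  proof
    fix t assume t: "t \<in> relations"
    then have tc: "t \<in> carrier F" using tensor_relations_subset by blast
    have "h (y \<otimes>\<^bsub>F\<^esub> t) = \<zero>\<^bsub>G\<^esub>" if y: "y \<in> carrier F" for y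
      using y
    proof (induction y rule: pair_ring_induct)
      case (frag r s)
      then show ?case using rel[OF frag t] k by blast
    next
      case (diff x y)
      then show ?case using hd[of "x \<otimes>\<^bsub>F\<^esub> t" "y \<otimes>\<^bsub>F\<^esub> t"] tc
        by (simp add: pair_ring_mult abelian_group_uminus_zero[OF G])
    qed (simp add: pair_ring_mult h0)
    then show "t \<in> L" using tc by (simp add: L_def)
  qed
  ultimately have "x \<in> L" using F.genideal_minimal[of L relations] x by blast
  then have xc: "x \<in> carrier F" and "\<forall>y\<in>carrier F. h (y \<otimes>\<^bsub>F\<^esub> x) = \<zero>\<^bsub>G\<^esub>" by (simp_all add: L_def)
  from bspec[OF this(2) F.one_closed] show ?thesis unfolding F.l_one[OF xc] .
qed

text \<open>The last clause evaluates the induced map on any representative of a class by the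
  formula in \<open>tensor_augmentation\<close>; it serves to identify the augmentation.\<close>

lemma tensor_universal:
  assumes G: "abelian_group G"
    and bc: "\<And>r s. \<lbrakk>r \<in> carrier R; s \<in> carrier S\<rbrakk> \<Longrightarrow> b r s \<in> carrier G"
    and bl: "\<And>r r' s. \<lbrakk>r \<in> carrier R; r' \<in> carrier R; s \<in> carrier S\<rbrakk> \<Longrightarrow> b (r \<oplus>\<^bsub>R\<^esub> r') s = b r s \<oplus>\<^bsub>G\<^esub> b r' s"
    and br: "\<And>r s s'. \<lbrakk>r \<in> carrier R; s \<in> carrier S; s' \<in> carrier S\<rbrakk> \<Longrightarrow> b r (s \<oplus>\<^bsub>S\<^esub> s') = b r s \<oplus>\<^bsub>G\<^esub> b r s'"
    and bs: "\<And>c r s. \<lbrakk>c \<in> carrier K; r \<in> carrier R; s \<in> carrier S\<rbrakk> \<Longrightarrow> b (c \<odot>\<^bsub>R\<^esub> r) s = b r (c \<odot>\<^bsub>S\<^esub> s)"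
  obtains h where "\<And>a. a \<in> carrier A \<Longrightarrow> h a \<in> carrier G"
    "\<And>a a'. \<lbrakk>a \<in> carrier A; a' \<in> carrier A\<rbrakk> \<Longrightarrow> h (a \<oplus>\<^bsub>A\<^esub> a') = h a \<oplus>\<^bsub>G\<^esub> h a'"
    "\<And>r s. \<lbrakk>r \<in> carrier R; s \<in> carrier S\<rbrakk> \<Longrightarrow> h (tens r s) = b r s"
    "\<And>x y. x \<in> carrier F \<Longrightarrow> y \<in> q x \<Longrightarrow> (\<Oplus>\<^bsub>G\<^esub>p\<in>Poly_Mapping.keys y.
      add_pow G (Poly_Mapping.lookup y p) (b (fst p) (snd p))) = h (q x)"
proof -
  interpret G: abelian_group G by (rule G)
  define f where "f = (\<lambda>p. b (fst p) (snd p))"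
  interpret M: comm_group "add_monoid G" by (rule G.a_comm_group)
  have f: "f ` (carrier R \<times> carrier S) \<subseteq> carrier (add_monoid G)" using bc by (auto simp: f_def)
  obtain h where h: "h \<in> hom (free_Abelian_group (carrier R \<times> carrier S)) (add_monoid G)"
    "\<And>p. p \<in> carrier R \<times> carrier S \<Longrightarrow> h (frag_of p) = f p"
    by (rule comm_group.free_Abelian_group_universal[OF G.a_comm_group f]) (rule that)
  have hc: "h x \<in> carrier G" if "x \<in> carrier F" for x
    using h(1) that by (auto simp: hom_def pair_ring_simps(1))
  have ha: "h (x + y) = h x \<oplus>\<^bsub>G\<^esub> h y" if "x \<in> carrier F" "y \<in> carrier F" for x y
    using h(1) that by (auto simp: hom_def pair_ring_simps(1))
  have hf: "h (frag_of (r, s)) = b r s" if "r \<in> carrier R" "s \<in> carrier S" for r s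
    using h(2)[of "(r, s)"] that by (simp add: f_def)
  have h0: "h 0 = \<zero>\<^bsub>G\<^esub>"
    using additive_zero[OF F.abelian_group_axioms G, of h] ha hc by (simp add: pair_ring_simps)
  have hd: "h (x - y) = h x \<oplus>\<^bsub>G\<^esub> \<ominus>\<^bsub>G\<^esub> h y" if "x \<in> carrier F" "y \<in> carrier F" for x y
  proof -
    have "h x = h (x - y) \<oplus>\<^bsub>G\<^esub> h y"
      using ha[OF pair_ring_diff_closed[OF that] that(2)] by simp
    then show ?thesis using that hc pair_ring_diff_closed by (simp add: G.a_assoc G.r_neg)
  qed
  have cancel: "u \<oplus>\<^bsub>G\<^esub> v \<oplus>\<^bsub>G\<^esub> \<ominus>\<^bsub>G\<^esub> u \<oplus>\<^bsub>G\<^esub> \<ominus>\<^bsub>G\<^esub> v = \<zero>\<^bsub>G\<^esub>" if "u \<in> carrier G" "v \<in> carrier G" for u v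
    using that G.r_neg[of "u \<oplus>\<^bsub>G\<^esub> v"] by (simp add: G.minus_add G.a_assoc)
  have hT: "h x = \<zero>\<^bsub>G\<^esub>" if "x \<in> relations" for x
    using that bc unfolding tensor_relations_def
    by (auto simp: hd pair_ring_diff_closed hf bl br bs G.r_neg cancel)
  have hI: "h x = \<zero>\<^bsub>G\<^esub>" if "x \<in> I" for x
    using relation_kill[of h G x] ha hc G hT that by blast
  have hq: "h y = h x" if x: "x \<in> carrier F" and y: "y \<in> q x" for x y
  proof -
    obtain i where i: "i \<in> I" "y = i + x" using y by (auto simp: q_def a_r_coset_def' pair_ring_simps(2))
    then show ?thesis using ha[OF I.Icarr[OF i(1)] x] hI[OF i(1)] hc[OF x] by simp
  qed
  have self: "x \<in> q x" if "x \<in> carrier F" for x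
    using I.a_rcos_self[OF that] by (simp add: q_def)
  \<comment> \<open>The choice of a representative is harmless, because \<open>h\<close> vanishes on
    the ideal and is therefore constant on each class.\<close>
  define H where "H a = h (SOME x. x \<in> a)" for a
  have Hq: "H (q x) = h x" if x: "x \<in> carrier F" for x
    unfolding H_def by (rule hq[OF x]) (rule someI[of "\<lambda>y. y \<in> q x", OF self[OF x]])
  show thesis
  proof (rule that)
    show "H a \<in> carrier G" if "a \<in> carrier A" for a
      using that by (auto simp: carrier_A Hq hc)
    show "H (a \<oplus>\<^bsub>A\<^esub> a') = H a \<oplus>\<^bsub>G\<^esub> H a'" if aa: "a \<in> carrier A" "a' \<in> carrier A" for a a'
    proof -
      obtain x y where xy: "x \<in> carrier F" "a = q x" "y \<in> carrier F" "a' = q y"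
        using aa by (auto simp: carrier_A)
      have "x + y \<in> carrier F" using F.a_closed[OF xy(1,3)] by (simp add: pair_ring_simps(2))
      then show ?thesis using xy by (simp add: Hq ha flip: q_add)
    qed
    show "H (tens r s) = b r s" if "r \<in> carrier R" "s \<in> carrier S" for r s
      using that by (simp add: tens_def Hq hf)
    fix x y assume x: "x \<in> carrier F" and y: "y \<in> q x"
    have yc: "y \<in> carrier F"
    proof -
      obtain i where i: "i \<in> I" "y = i + x" using y by (auto simp: q_def a_r_coset_def' pair_ring_simps(2))
      then show ?thesis using F.a_closed[OF I.Icarr[OF i(1)] x] by (simp add: pair_ring_simps(2))
    qed
    have cm: "h (frag_cmul n (frag_of p)) = add_pow G n (f p)" if p: "p \<in> carrier R \<times> carrier S" for n :: int and p
    proof -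
      interpret H: group_hom "free_Abelian_group (carrier R \<times> carrier S)" "add_monoid G" h
        by (simp add: group_hom_def group_hom_axioms_def h(1) G.a_group)
      have "h (frag_of p [^]\<^bsub>free_Abelian_group (carrier R \<times> carrier S)\<^esub> n) = h (frag_of p) [^]\<^bsub>add_monoid G\<^esub> n"
        using p by (intro H.hom_int_pow) simp
      then show ?thesis using p by (simp add: h(2)[OF p] add_pow_def)
    qed
    have "h (\<Sum>p\<in>J. frag_cmul (Poly_Mapping.lookup y p) (frag_of p)) = (\<Oplus>\<^bsub>G\<^esub>p\<in>J. add_pow G (Poly_Mapping.lookup y p) (f p))
        \<and> (\<Sum>p\<in>J. frag_cmul (Poly_Mapping.lookup y p) (frag_of p)) \<in> carrier F"
      if "finite J" "J \<subseteq> carrier R \<times> carrier S" for J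
      using that
    proof (induction J)
      case empty
      then show ?case using h0 F.zero_closed by (simp add: pair_ring_simps(3))
    next
      case (insert p J)
      let ?w = "frag_cmul (Poly_Mapping.lookup y p) (frag_of p)"
      have w: "?w \<in> carrier F" using insert keys_cmul[of "Poly_Mapping.lookup y p" "frag_of p"]
        by (auto simp: pair_ring_simps(1))
      have ap: "add_pow G (Poly_Mapping.lookup y p') (f p') \<in> carrier G" if "p' \<in> insert p J" for p'
        using insert that f group.int_pow_closed[OF G.a_group, of "f p'"] by (auto simp: add_pow_def)
      show ?case
        using insert w ap F.a_closed[OF w] by (simp add: ha cm G.finsum_insert Pi_iff pair_ring_simps(2))
    qed
    from this[of "Poly_Mapping.keys y"] have "h y = (\<Oplus>\<^bsub>G\<^esub>p\<in>Poly_Mapping.keys y. add_pow G (Poly_Mapping.lookup y p) (f p))"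
      using yc frag_expansion[of y] by (simp add: pair_ring_simps(1) frag_extend_def)
    then show "(\<Oplus>\<^bsub>G\<^esub>p\<in>Poly_Mapping.keys y. add_pow G (Poly_Mapping.lookup y p) (b (fst p) (snd p))) = H (q x)"
      using hq[OF x y] Hq[OF x] by (simp add: f_def)
  qed
qed

lemma q_self: "x \<in> carrier F \<Longrightarrow> x \<in> q x"
  using I.a_rcos_self by (simp add: q_def)

end

section \<open>The augmentation of the tensor product\<close>

locale supplemented_tensor = tensor_algebras K R S
  for K :: "('k, 'x) ring_scheme" and R :: "('k, 'r, 'y) module_scheme" and S :: "('k, 's, 'z) module_scheme" +
  fixes \<epsilon> :: "'r \<Rightarrow> 'k" and \<delta> :: "'s \<Rightarrow> 'k"
  assumes supp_R: "supplemented_algebra K R \<epsilon>" and supp_S: "supplemented_algebra K S \<delta>"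
begin

lemma
  shows aug_R_hom: "\<epsilon> \<in> ring_hom R K" and aug_S_hom: "\<delta> \<in> ring_hom S K"
  using supp_R supp_S by (simp_all add: supplemented_algebra.augmentation_ring_hom)

lemmas aug_R = ring_hom_closed[OF aug_R_hom] ring_hom_add[OF aug_R_hom] ring_hom_mult[OF aug_R_hom]
    ring_hom_one[OF aug_R_hom] supplemented_algebra.augmentation_linear[OF supp_R]
lemmas aug_S = ring_hom_closed[OF aug_S_hom] ring_hom_add[OF aug_S_hom] ring_hom_mult[OF aug_S_hom]
    ring_hom_one[OF aug_S_hom] supplemented_algebra.augmentation_linear[OF supp_S]

abbreviation "aug \<equiv> tensor_augmentation K \<epsilon> \<delta>"

text \<open>The universal property applied to the product of the augmentations shows that the
  defining formula takes one value on each class, which justifies \<open>the_elem\<close>.\<close>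

lemma aug_properties:
  "(\<forall>a\<in>carrier A. aug a \<in> carrier K) \<and> (\<forall>a\<in>carrier A. \<forall>b\<in>carrier A. aug (a \<oplus>\<^bsub>A\<^esub> b) = aug a \<oplus>\<^bsub>K\<^esub> aug b) \<and>
    (\<forall>r\<in>carrier R. \<forall>s\<in>carrier S. aug (tens r s) = \<epsilon> r \<otimes>\<^bsub>K\<^esub> \<delta> s)"
proof -
  obtain h where h: "\<And>a. a \<in> carrier A \<Longrightarrow> h a \<in> carrier K"
    "\<And>a a'. \<lbrakk>a \<in> carrier A; a' \<in> carrier A\<rbrakk> \<Longrightarrow> h (a \<oplus>\<^bsub>A\<^esub> a') = h a \<oplus>\<^bsub>K\<^esub> h a'"
    "\<And>r s. \<lbrakk>r \<in> carrier R; s \<in> carrier S\<rbrakk> \<Longrightarrow> h (tens r s) = \<epsilon> r \<otimes>\<^bsub>K\<^esub> \<delta> s"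
    "\<And>x y. x \<in> carrier F \<Longrightarrow> y \<in> q x \<Longrightarrow> (\<Oplus>\<^bsub>K\<^esub>p\<in>Poly_Mapping.keys y.
      add_pow K (Poly_Mapping.lookup y p) (\<epsilon> (fst p) \<otimes>\<^bsub>K\<^esub> \<delta> (snd p))) = h (q x)"
  proof (rule tensor_universal[OF K.abelian_group_axioms, of "\<lambda>r s. \<epsilon> r \<otimes>\<^bsub>K\<^esub> \<delta> s"])
    show "\<epsilon> (c \<odot>\<^bsub>R\<^esub> r) \<otimes>\<^bsub>K\<^esub> \<delta> s = \<epsilon> r \<otimes>\<^bsub>K\<^esub> \<delta> (c \<odot>\<^bsub>S\<^esub> s)"
      if "c \<in> carrier K" "r \<in> carrier R" "s \<in> carrier S" for c r s
      using that by (simp add: aug_R aug_S K.m_assoc K.m_lcomm)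
  qed (auto simp: aug_R aug_S K.l_distr K.r_distr)
  have "aug a = h a" if a: "a \<in> carrier A" for a
  proof -
    obtain x where x: "x \<in> carrier F" "a = q x" using a by (auto simp: carrier_A)
    have "(\<lambda>y. \<Oplus>\<^bsub>K\<^esub>p\<in>Poly_Mapping.keys y. add_pow K (Poly_Mapping.lookup y p) (\<epsilon> (fst p) \<otimes>\<^bsub>K\<^esub> \<delta> (snd p))) ` q x = {h (q x)}"
      using h(4)[OF x(1)] q_self[OF x(1)] by auto
    then show ?thesis by (simp add: tensor_augmentation_def x(2))
  qed
  then show ?thesis using h(1-3) by simp
qed

lemma aug_closed [simp]: "a \<in> carrier A \<Longrightarrow> aug a \<in> carrier K"
  and aug_add: "\<lbrakk>a \<in> carrier A; b \<in> carrier A\<rbrakk> \<Longrightarrow> aug (a \<oplus>\<^bsub>A\<^esub> b) = aug a \<oplus>\<^bsub>K\<^esub> aug b"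
  and aug_tens: "\<lbrakk>r \<in> carrier R; s \<in> carrier S\<rbrakk> \<Longrightarrow> aug (tens r s) = \<epsilon> r \<otimes>\<^bsub>K\<^esub> \<delta> s"
  using aug_properties by blast+

lemma aug_one: "aug \<one>\<^bsub>A\<^esub> = \<one>\<^bsub>K\<^esub>"
  using aug_tens[OF R.one_closed S.one_closed] by (simp add: tens_one aug_R aug_S)

lemma aug_zero: "aug \<zero>\<^bsub>A\<^esub> = \<zero>\<^bsub>K\<^esub>"
  by (rule additive_zero[OF A.abelian_group_axioms K.abelian_group_axioms aug_closed aug_add])

lemma aug_mult:
  assumes "a \<in> carrier A" "b \<in> carrier A"
  shows "aug (a \<otimes>\<^bsub>A\<^esub> b) = aug a \<otimes>\<^bsub>K\<^esub> aug b"
  using assms(1)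
proof (induction a rule: tensor_induct)
  case (tens r s)
  note rs = this
  from assms(2) show ?case
  proof (induction b rule: tensor_induct)
    case (tens r' s')
    have "\<epsilon> r \<in> carrier K" "\<epsilon> r' \<in> carrier K" "\<delta> s \<in> carrier K" "\<delta> s' \<in> carrier K"
      using rs tens aug_R(1) aug_S(1) by auto
    then show ?case using rs tens
      by (simp add: tens_mult aug_tens aug_R aug_S K.m_ac)
  next
    case (add a b)
    then show ?case using rs by (simp add: A.r_distr aug_add K.r_distr)
  qed
next
  case (add a b)
  then show ?case using assms(2) by (simp add: A.l_distr aug_add K.l_distr)
qed

lemma A_nontrivial: "\<one>\<^bsub>A\<^esub> \<noteq> \<zero>\<^bsub>A\<^esub>"
  using aug_one aug_zero K.one_not_zero by metis

end

section \<open>Linear algebra over a field\<close>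

definition submod :: "('a, 'x) ring_scheme \<Rightarrow> ('a, 'm, 'z) module_scheme \<Rightarrow> 'm set \<Rightarrow> bool"
  where "submod A M U \<longleftrightarrow> U \<subseteq> carrier M \<and> \<zero>\<^bsub>M\<^esub> \<in> U \<and> (\<forall>x\<in>U. \<forall>y\<in>U. x \<oplus>\<^bsub>M\<^esub> y \<in> U) \<and>
    (\<forall>a\<in>carrier A. \<forall>x\<in>U. a \<odot>\<^bsub>M\<^esub> x \<in> U)"

lemma submodD:
  assumes "submod A M U"
  shows "x \<in> U \<Longrightarrow> x \<in> carrier M" "\<zero>\<^bsub>M\<^esub> \<in> U" "x \<in> U \<Longrightarrow> y \<in> U \<Longrightarrow> x \<oplus>\<^bsub>M\<^esub> y \<in> U"
    "a \<in> carrier A \<Longrightarrow> x \<in> U \<Longrightarrow> a \<odot>\<^bsub>M\<^esub> x \<in> U"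
  using assms by (auto simp: submod_def)

lemma submod_minus:
  assumes "module A M" "submod A M U" "x \<in> U" "y \<in> U"
  shows "x \<ominus>\<^bsub>M\<^esub> y \<in> U"
proof -
  interpret M: module A M by fact
  have "\<ominus>\<^bsub>M\<^esub> y = (\<ominus>\<^bsub>A\<^esub> \<one>\<^bsub>A\<^esub>) \<odot>\<^bsub>M\<^esub> y"
    using submodD(1)[OF assms(2,4)] by (simp add: M.smult_l_minus)
  then show ?thesis using submodD[OF assms(2)] assms(3,4) by (simp add: M.minus_eq)
qed

lemma submod_kernel:
  assumes "module A M" "module A N" "f \<in> mod_hom A M N"
  shows "submod A M {x \<in> carrier M. f x = \<zero>\<^bsub>N\<^esub>}"
proof -
  interpret M: module A M by fact
  interpret N: module A N by fact
  show ?thesis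
    using mod_hom_zero[OF assms(3) M.abelian_group_axioms N.abelian_group_axioms]
    by (auto simp: submod_def mod_hom_add[OF assms(3)] mod_hom_smult[OF assms(3)])
qed

lemma submod_image:
  assumes "module A M" "module A N" "f \<in> mod_hom A M N"
  shows "submod A N (f ` carrier M)"
proof -
  interpret M: module A M by fact
  interpret N: module A N by fact
  show ?thesis
    unfolding submod_def
  proof (intro conjI ballI)
    show "\<zero>\<^bsub>N\<^esub> \<in> f ` carrier M"
      using mod_hom_zero[OF assms(3) M.abelian_group_axioms N.abelian_group_axioms] by (metis M.zero_closed image_eqI)
  qed (auto simp: mod_hom_closed[OF assms(3)] simp flip: mod_hom_add[OF assms(3)] mod_hom_smult[OF assms(3)])
qed

text \<open>Zorn's lemma gives a maximal subspace that meets \<open>U\<close> only in zero. If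
  \<open>v\<close> were outside the sum with \<open>U\<close>, adjoining the line through
  \<open>v\<close> would enlarge it.\<close>

lemma submod_complement:
  assumes K: "field K" and V: "module K V" and U: "submod K V U"
  obtains W where "submod K V W" "U \<inter> W = {\<zero>\<^bsub>V\<^esub>}"
    "\<And>v. v \<in> carrier V \<Longrightarrow> \<exists>u\<in>U. \<exists>w\<in>W. v = u \<oplus>\<^bsub>V\<^esub> w"
proof -
  interpret K: field K by fact
  interpret V: module K V by fact
  let ?S = "{W. submod K V W \<and> U \<inter> W = {\<zero>\<^bsub>V\<^esub>}}"
  have "{\<zero>\<^bsub>V\<^esub>} \<in> ?S" using submodD(2)[OF U] by (auto simp: submod_def)
  then have ne: "?S \<noteq> {}" by blast
  have chain: "\<Union>C \<in> ?S" if C: "C \<noteq> {}" "subset.chain ?S C" for C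
  proof -
    have CS: "\<And>W. W \<in> C \<Longrightarrow> submod K V W \<and> U \<inter> W = {\<zero>\<^bsub>V\<^esub>}"
      and lin: "\<And>W W'. W \<in> C \<Longrightarrow> W' \<in> C \<Longrightarrow> W \<subseteq> W' \<or> W' \<subseteq> W"
      using C(2) by (auto simp: subset.chain_def)
    have "x \<oplus>\<^bsub>V\<^esub> y \<in> \<Union>C" if xy: "x \<in> \<Union>C" "y \<in> \<Union>C" for x y
    proof -
      obtain W W' where W: "W \<in> C" "x \<in> W" "W' \<in> C" "y \<in> W'" using xy by blast
      have s: "submod K V W" "submod K V W'" using CS W(1,3) by simp_all
      from lin[OF W(1,3)] show ?thesis
      proof
        assume "W \<subseteq> W'"
        then show ?thesis by (intro UnionI[OF W(3)] submodD(3)[OF s(2) _ W(4)] subsetD[OF _ W(2)])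
      next
        assume "W' \<subseteq> W"
        then show ?thesis by (intro UnionI[OF W(1)] submodD(3)[OF s(1) W(2)] subsetD[OF _ W(4)])
      qed
    qed
    moreover have "\<Union>C \<subseteq> carrier V" using CS by (intro Union_least) (auto simp: submod_def)
    moreover have "\<zero>\<^bsub>V\<^esub> \<in> \<Union>C" using C(1) CS submodD(2) by (metis UnionI all_not_in_conv)
    moreover have "\<forall>a\<in>carrier K. \<forall>x\<in>\<Union>C. a \<odot>\<^bsub>V\<^esub> x \<in> \<Union>C"
      using CS submodD(4) by (metis Union_iff)
    ultimately have "submod K V (\<Union>C)" by (simp add: submod_def)
    moreover have "U \<inter> \<Union>C = {\<zero>\<^bsub>V\<^esub>}" using CS C(1) by blast
    ultimately show ?thesis by simp
  qed
  have "\<exists>M\<in>?S. \<forall>W'\<in>?S. M \<subseteq> W' \<longrightarrow> W' = M"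
    by (rule subset_Zorn_nonempty[OF ne chain])
  then obtain W where W0: "W \<in> ?S" "\<forall>W'\<in>?S. W \<subseteq> W' \<longrightarrow> W' = W" by (rule bexE)
  then have W: "submod K V W" "U \<inter> W = {\<zero>\<^bsub>V\<^esub>}" by simp_all
  have max: "W' = W" if "submod K V W'" "U \<inter> W' = {\<zero>\<^bsub>V\<^esub>}" "W \<subseteq> W'" for W'
    using bspec[OF W0(2), of W'] that by simp
  have "\<exists>u\<in>U. \<exists>w\<in>W. v = u \<oplus>\<^bsub>V\<^esub> w" if v: "v \<in> carrier V" for v
  proof (rule ccontr)
    assume no: "\<not> ?thesis"
    \<comment> \<open>The candidate for a larger subspace: \<open>W\<close> plus the line through
      \<open>v\<close>.\<close>
    define W' where "W' = {w \<oplus>\<^bsub>V\<^esub> c \<odot>\<^bsub>V\<^esub> v | w c. w \<in> W \<and> c \<in> carrier K}"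
    note Wc = submodD(1)[OF W(1)] and Uc = submodD(1)[OF U]
    have W'I: "w \<oplus>\<^bsub>V\<^esub> c \<odot>\<^bsub>V\<^esub> v \<in> W'" if "w \<in> W" "c \<in> carrier K" for w c
      using that by (auto simp: W'_def)
    have "submod K V W'" unfolding submod_def
    proof (intro conjI ballI subsetI)
      show "x \<in> carrier V" if "x \<in> W'" for x using that v Wc by (auto simp: W'_def)
      show "\<zero>\<^bsub>V\<^esub> \<in> W'" using W'I[OF submodD(2)[OF W(1)] K.zero_closed] v by simp
      show "x \<oplus>\<^bsub>V\<^esub> y \<in> W'" if xy: "x \<in> W'" "y \<in> W'" for x y
      proof -
        obtain w c w' c' where w: "w \<in> W" "c \<in> carrier K" "w' \<in> W" "c' \<in> carrier K"
          "x = w \<oplus>\<^bsub>V\<^esub> c \<odot>\<^bsub>V\<^esub> v" "y = w' \<oplus>\<^bsub>V\<^esub> c' \<odot>\<^bsub>V\<^esub> v" using xy by (auto simp: W'_def)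
        have "x \<oplus>\<^bsub>V\<^esub> y = (w \<oplus>\<^bsub>V\<^esub> w') \<oplus>\<^bsub>V\<^esub> (c \<oplus>\<^bsub>K\<^esub> c') \<odot>\<^bsub>V\<^esub> v"
          using w v Wc by (simp add: V.smult_l_distr V.a_ac)
        then show ?thesis using W'I[of "w \<oplus>\<^bsub>V\<^esub> w'" "c \<oplus>\<^bsub>K\<^esub> c'"] w submodD(3)[OF W(1)] by simp
      qed
      show "a \<odot>\<^bsub>V\<^esub> x \<in> W'" if ax: "a \<in> carrier K" "x \<in> W'" for a x
      proof -
        obtain w c where w: "w \<in> W" "c \<in> carrier K" "x = w \<oplus>\<^bsub>V\<^esub> c \<odot>\<^bsub>V\<^esub> v" using ax by (auto simp: W'_def)
        have "a \<odot>\<^bsub>V\<^esub> x = a \<odot>\<^bsub>V\<^esub> w \<oplus>\<^bsub>V\<^esub> (a \<otimes>\<^bsub>K\<^esub> c) \<odot>\<^bsub>V\<^esub> v"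
          using w v Wc ax by (simp add: V.smult_r_distr V.smult_assoc1)
        then show ?thesis using W'I[of "a \<odot>\<^bsub>V\<^esub> w" "a \<otimes>\<^bsub>K\<^esub> c"] w ax submodD(4)[OF W(1)] by simp
      qed
    qed
    moreover have "U \<inter> W' = {\<zero>\<^bsub>V\<^esub>}"
    proof -
      have "x = \<zero>\<^bsub>V\<^esub>" if x: "x \<in> U" "x \<in> W'" for x
      proof -
        obtain w c where w: "w \<in> W" "c \<in> carrier K" "x = w \<oplus>\<^bsub>V\<^esub> c \<odot>\<^bsub>V\<^esub> v" using x by (auto simp: W'_def)
        show ?thesis
        proof (cases "c = \<zero>\<^bsub>K\<^esub>")
          case True
          then have "x \<in> W" using w v Wc by simp
          then show ?thesis using W(2) x(1) by blast
        next
          case False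
          then have ci: "c \<in> Units K" using w(2) K.field_Units by blast
          let ?i = "inv\<^bsub>K\<^esub> c"
          have ic: "?i \<in> carrier K" using ci by simp
          \<comment> \<open>Dividing \<open>x = w + c v\<close> by \<open>c\<close> writes
            \<open>v\<close> as a sum from \<open>U\<close> and \<open>W\<close>, against the
            assumption.\<close>
          have "c \<odot>\<^bsub>V\<^esub> v = x \<oplus>\<^bsub>V\<^esub> \<ominus>\<^bsub>V\<^esub> w" using w v Wc by (simp add: V.a_ac V.r_neg1 V.r_neg2)
          then have "?i \<odot>\<^bsub>V\<^esub> (c \<odot>\<^bsub>V\<^esub> v) = ?i \<odot>\<^bsub>V\<^esub> x \<oplus>\<^bsub>V\<^esub> ?i \<odot>\<^bsub>V\<^esub> (\<ominus>\<^bsub>V\<^esub> w)"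
            using ic w(1) Wc Uc x(1) by (simp add: V.smult_r_distr)
          moreover have "?i \<odot>\<^bsub>V\<^esub> (c \<odot>\<^bsub>V\<^esub> v) = v"
            using ic w(2) v ci V.smult_assoc1[of ?i c v] by (simp add: K.Units_l_inv)
          moreover have "?i \<odot>\<^bsub>V\<^esub> x \<in> U" using submodD(4)[OF U ic x(1)] .
          moreover have "?i \<odot>\<^bsub>V\<^esub> (\<ominus>\<^bsub>V\<^esub> w) \<in> W"
            using submodD(4)[OF W(1) ic] submod_minus[OF V W(1) submodD(2)[OF W(1)] w(1)] Wc[OF w(1)]
            by (simp add: V.minus_eq)
          ultimately show ?thesis using no by metis
        qed
      qed
      moreover have "\<zero>\<^bsub>V\<^esub> \<in> W'" using W'I[OF submodD(2)[OF W(1)] K.zero_closed] v by simp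
      ultimately show ?thesis using submodD(2)[OF U] by blast
    qed
    moreover have "W \<subseteq> W'"
    proof
      fix w assume w: "w \<in> W"
      then show "w \<in> W'" using W'I[OF w K.zero_closed] v Wc by simp
    qed
    ultimately have "W' = W" by (rule max)
    then have "v \<in> W" using W'I[OF submodD(2)[OF W(1)] K.one_closed] v by simp
    then show False using no submodD(2)[OF U] v by (metis V.l_zero)
  qed
  then show thesis using that W by blast
qed

text \<open>Choose complements \<open>C\<close> of the kernel and \<open>E\<close> of the image.
  Then \<open>d\<close> maps \<open>C\<close> bijectively onto the image, and \<open>h\<close> is
  the inverse of that bijection, extended by zero on \<open>E\<close>.\<close>

lemma generalized_inverse:
  assumes K: "field K" and V: "module K V" and W: "module K W" and d: "d \<in> mod_hom K V W"
  obtains h where "h \<in> mod_hom K W V" "\<And>v. v \<in> carrier V \<Longrightarrow> d (h (d v)) = d v"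
proof -
  interpret V: module K V by fact
  interpret W: module K W by fact
  note VG = V.abelian_group_axioms and WG = W.abelian_group_axioms
  let ?k = "{x \<in> carrier V. d x = \<zero>\<^bsub>W\<^esub>}" and ?m = "d ` carrier V"
  obtain C where C: "submod K V C" "?k \<inter> C = {\<zero>\<^bsub>V\<^esub>}"
    "\<And>v. v \<in> carrier V \<Longrightarrow> \<exists>u\<in>?k. \<exists>w\<in>C. v = u \<oplus>\<^bsub>V\<^esub> w"
    by (rule submod_complement[OF K V submod_kernel[OF V W d]]) (rule that)
  obtain E where E: "submod K W E" "?m \<inter> E = {\<zero>\<^bsub>W\<^esub>}"
    "\<And>v. v \<in> carrier W \<Longrightarrow> \<exists>u\<in>?m. \<exists>w\<in>E. v = u \<oplus>\<^bsub>W\<^esub> w"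
    by (rule submod_complement[OF K W submod_image[OF V W d]]) (rule that)
  note Cc = submodD(1)[OF C(1)] and Ec = submodD(1)[OF E(1)] and dc = mod_hom_closed[OF d]
  have ex: "\<exists>c\<in>C. y \<ominus>\<^bsub>W\<^esub> d c \<in> E" if y: "y \<in> carrier W" for y
  proof -
    obtain v e where v: "v \<in> carrier V" "e \<in> E" "y = d v \<oplus>\<^bsub>W\<^esub> e" using E(3)[OF y] by blast
    obtain k c where k: "k \<in> ?k" "c \<in> C" "v = k \<oplus>\<^bsub>V\<^esub> c" using C(3)[OF v(1)] by blast
    have "d v = d c" using k Cc dc by (simp add: mod_hom_add[OF d])
    then have "y \<ominus>\<^bsub>W\<^esub> d c = e" using v dc Ec Cc[OF k(2)]
      by (simp add: W.minus_eq W.a_ac W.r_neg1 W.r_neg2 W.r_neg)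
    then show ?thesis using k v by blast
  qed
  have uniq: "c = c'" if c: "c \<in> C" "c' \<in> C" "y \<in> carrier W" "y \<ominus>\<^bsub>W\<^esub> d c \<in> E" "y \<ominus>\<^bsub>W\<^esub> d c' \<in> E" for c c' y
  proof -
    have "(y \<ominus>\<^bsub>W\<^esub> d c') \<ominus>\<^bsub>W\<^esub> (y \<ominus>\<^bsub>W\<^esub> d c) = d (c \<ominus>\<^bsub>V\<^esub> c')"
      using c Cc dc mod_hom_minus[OF d VG WG, of c c']
      by (simp add: W.minus_eq W.minus_add W.a_ac W.r_neg1 W.r_neg2)
    then have "d (c \<ominus>\<^bsub>V\<^esub> c') \<in> ?m \<inter> E"
      using submod_minus[OF W E(1) c(5,4)] Cc c by auto
    then have "c \<ominus>\<^bsub>V\<^esub> c' \<in> ?k \<inter> C" using E(2) submod_minus[OF V C(1) c(1,2)] Cc c by auto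
    then show ?thesis using C(2) abelian_group_minus_eq_zero_iff[OF VG] Cc c by blast
  qed
  \<comment> \<open>\<open>h y\<close> is the only \<open>c\<close> in \<open>C\<close> with
    \<open>y - d c\<close> in \<open>E\<close>; this characterization yields linearity without any
    choice of bases.\<close>
  define h where "h = (\<lambda>y\<in>carrier W. SOME c. c \<in> C \<and> y \<ominus>\<^bsub>W\<^esub> d c \<in> E)"
  have hs: "h y \<in> C" "y \<ominus>\<^bsub>W\<^esub> d (h y) \<in> E" if y: "y \<in> carrier W" for y
    using someI_ex[OF ex[OF y, unfolded Bex_def]] y by (simp_all add: h_def)
  have hu: "h y = c" if "y \<in> carrier W" "c \<in> C" "y \<ominus>\<^bsub>W\<^esub> d c \<in> E" for y c
    using uniq[OF hs(1)[OF that(1)] that(2,1) hs(2)[OF that(1)] that(3)] .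
  show thesis
  proof (rule that)
    show "h \<in> mod_hom K W V"
    proof (rule mod_homI)
      fix x assume "x \<in> carrier W" then show "h x \<in> carrier V" using hs(1) Cc by blast
    next
      fix x y assume xy: "x \<in> carrier W" "y \<in> carrier W"
      note c = hs[OF xy(1)] hs[OF xy(2)]
      show "h (x \<oplus>\<^bsub>W\<^esub> y) = h x \<oplus>\<^bsub>V\<^esub> h y"
      proof (rule hu)
        have "(x \<oplus>\<^bsub>W\<^esub> y) \<ominus>\<^bsub>W\<^esub> d (h x \<oplus>\<^bsub>V\<^esub> h y) = (x \<ominus>\<^bsub>W\<^esub> d (h x)) \<oplus>\<^bsub>W\<^esub> (y \<ominus>\<^bsub>W\<^esub> d (h y))"
          using xy c Cc dc by (simp add: mod_hom_add[OF d] W.minus_eq W.minus_add W.a_ac)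
        then show "(x \<oplus>\<^bsub>W\<^esub> y) \<ominus>\<^bsub>W\<^esub> d (h x \<oplus>\<^bsub>V\<^esub> h y) \<in> E" using submodD(3)[OF E(1)] c by simp
      qed (use xy c submodD(3)[OF C(1)] in auto)
    next
      fix a x assume xy: "a \<in> carrier K" "x \<in> carrier W"
      note c = hs[OF xy(2)]
      show "h (a \<odot>\<^bsub>W\<^esub> x) = a \<odot>\<^bsub>V\<^esub> h x"
      proof (rule hu)
        have "a \<odot>\<^bsub>W\<^esub> x \<ominus>\<^bsub>W\<^esub> d (a \<odot>\<^bsub>V\<^esub> h x) = a \<odot>\<^bsub>W\<^esub> (x \<ominus>\<^bsub>W\<^esub> d (h x))"
          using xy c Cc dc by (simp add: mod_hom_smult[OF d] W.minus_eq W.smult_r_distr W.smult_r_minus)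
        then show "a \<odot>\<^bsub>W\<^esub> x \<ominus>\<^bsub>W\<^esub> d (a \<odot>\<^bsub>V\<^esub> h x) \<in> E" using submodD(4)[OF E(1)] c xy by simp
      qed (use xy c submodD(4)[OF C(1)] in auto)
    qed (simp add: h_def)
    fix v assume v: "v \<in> carrier V"
    note c = hs[OF dc[OF v]]
    have "d v \<ominus>\<^bsub>W\<^esub> d (h (d v)) = d (v \<ominus>\<^bsub>V\<^esub> h (d v))"
      using mod_hom_minus[OF d VG WG v, of "h (d v)"] c Cc by simp
    then have "d v \<ominus>\<^bsub>W\<^esub> d (h (d v)) \<in> ?m \<inter> E" using c(2) v Cc[OF c(1)] by auto
    then show "d (h (d v)) = d v" using E(2) abelian_group_minus_eq_zero_iff[OF WG dc[OF v] dc[OF Cc[OF c(1)]]] by auto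
  qed
qed

text \<open>The shift \<open>q\<close> is \<open>-1\<close> for resolutions and \<open>1\<close> for
  their duals. A generalized inverse \<open>g\<close> of \<open>d\<close> gives
  \<open>d g d = d\<close>; the corrected \<open>h = g (1 - g d)\<close> keeps this property and
  satisfies \<open>d h + h d = 1\<close> wherever the complex is exact.\<close>

lemma contracting_homotopy:
  fixes V :: "int \<Rightarrow> ('k, 'v, 'z) module_scheme" and K :: "('k, 'x) ring_scheme"
  assumes K: "field K" and V: "\<And>i. module K (V i)" and d: "\<And>i. d i \<in> mod_hom K (V i) (V (i + q))"
    and dd: "\<And>i v. v \<in> carrier (V i) \<Longrightarrow> d (i + q) (d i v) = \<zero>\<^bsub>V (i + q + q)\<^esub>"
  obtains h where "\<And>i. h i \<in> mod_hom K (V i) (V (i - q))"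
    "\<And>i v. v \<in> carrier (V i) \<Longrightarrow> d i (h (i + q) (d i v)) = d i v"
    "\<And>i v. \<lbrakk>{w \<in> carrier (V i). d i w = \<zero>\<^bsub>V (i + q)\<^esub>} \<subseteq> d (i - q) ` carrier (V (i - q)); v \<in> carrier (V i)\<rbrakk>
      \<Longrightarrow> v = d (i - q) (h i v) \<oplus>\<^bsub>V i\<^esub> h (i + q) (d i v)"
proof -
  interpret V: module K "V i" for i by (rule V)
  note G = V.abelian_group_axioms
  have "\<exists>g. g \<in> mod_hom K (V i) (V (i - q)) \<and> (\<forall>v\<in>carrier (V (i - q)). d (i - q) (g (d (i - q) v)) = d (i - q) v)" for i
  proof -
    have di: "d (i - q) \<in> mod_hom K (V (i - q)) (V i)" using d[of "i - q"] by simp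
    obtain g where "g \<in> mod_hom K (V i) (V (i - q))" "\<And>v. v \<in> carrier (V (i - q)) \<Longrightarrow> d (i - q) (g (d (i - q) v)) = d (i - q) v"
      by (rule generalized_inverse[OF K V V di]) (rule that)
    then show ?thesis by blast
  qed
  then obtain g where g: "\<And>i. g i \<in> mod_hom K (V i) (V (i - q))"
    and dgd': "\<And>i v. v \<in> carrier (V (i - q)) \<Longrightarrow> d (i - q) (g i (d (i - q) v)) = d (i - q) v" by metis
  have dgd: "d i (g (i + q) (d i v)) = d i v" if "v \<in> carrier (V i)" for i v
    using dgd'[of v "i + q"] that by simp
  have gd: "compose (carrier (V i)) (g (i + q)) (d i) \<in> mod_hom K (V i) (V i)" for i
    using mod_hom_compose[OF V d g[of "i + q"]] by simp
  \<comment> \<open>\<open>k = 1 - g d\<close> has values in the cycles since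
    \<open>d g d = d\<close>. It acts as the identity on boundaries, whence
    \<open>h d = g d\<close>.\<close>
  define k where "k i = (\<lambda>v\<in>carrier (V i). v \<ominus>\<^bsub>V i\<^esub> g (i + q) (d i v))" for i
  have k: "k i \<in> mod_hom K (V i) (V i)" for i
    using mod_hom_diff[OF V V mod_hom_id[OF V] gd, of i] by (simp add: k_def compose_def cong: restrict_cong)
  define h where "h i = compose (carrier (V i)) (g i) (k i)" for i
  have h: "h i \<in> mod_hom K (V i) (V (i - q))" for i
    unfolding h_def by (rule mod_hom_compose[OF V k g])
  have dc: "d i v \<in> carrier (V (i + q))" if "v \<in> carrier (V i)" for i v using mod_hom_closed[OF d that] .
  have gdc: "g (i + q) (d i v) \<in> carrier (V i)" if "v \<in> carrier (V i)" for i v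
    using mod_hom_closed[OF g dc[OF that]] by simp
  have hd: "h (i + q) (d i v) = g (i + q) (d i v)" if v: "v \<in> carrier (V i)" for i v
  proof -
    have "k (i + q) (d i v) = d i v \<ominus>\<^bsub>V (i + q)\<^esub> g (i + q + q) \<zero>\<^bsub>V (i + q + q)\<^esub>"
      using dc[OF v] dd[OF v] by (simp add: k_def)
    also have "g (i + q + q) \<zero>\<^bsub>V (i + q + q)\<^esub> = \<zero>\<^bsub>V (i + q)\<^esub>"
      using mod_hom_zero[OF g[of "i + q + q"] G G] by (simp add: algebra_simps)
    finally show ?thesis using dc[OF v] by (simp add: h_def compose_def a_minus_def abelian_group_uminus_zero[OF G])
  qed
  show thesis
  proof (rule that[of h, OF h])
    show "d i (h (i + q) (d i v)) = d i v" if "v \<in> carrier (V i)" for i v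
      using hd[OF that] dgd[OF that] by simp
    fix i v
    assume ex: "{w \<in> carrier (V i). d i w = \<zero>\<^bsub>V (i + q)\<^esub>} \<subseteq> d (i - q) ` carrier (V (i - q))"
      and v: "v \<in> carrier (V i)"
    have kc: "k i v \<in> carrier (V i)" by (rule mod_hom_closed[OF k v])
    have "d i (k i v) = d i v \<ominus>\<^bsub>V (i + q)\<^esub> d i (g (i + q) (d i v))"
      using mod_hom_minus[OF d G G v gdc[OF v]] v by (simp add: k_def)
    then have "d i (k i v) = \<zero>\<^bsub>V (i + q)\<^esub>"
      using dgd[OF v] abelian_group_minus_eq_zero_iff[OF G dc[OF v] dc[OF v]] by simp
    with ex kc obtain w where w: "w \<in> carrier (V (i - q))" "k i v = d (i - q) w" by blast
    have "d (i - q) (h i v) = k i v"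
      using v w dgd'[OF w(1)] by (simp add: h_def compose_def)
    then show "v = d (i - q) (h i v) \<oplus>\<^bsub>V i\<^esub> h (i + q) (d i v)"
      using v gdc[OF v] by (simp add: hd[OF v] k_def V.minus_eq V.a_assoc V.l_neg)
  qed
qed

section \<open>Finite free resolutions over noetherian rings\<close>

abbreviation fin_free :: "('a, 'x) ring_scheme \<Rightarrow> nat \<Rightarrow> ('a, nat \<Rightarrow> 'a) module"
  where "fin_free A n \<equiv> pow_module (regular_module A) {..<n}"

text \<open>Elements are built one summand at a time, so that inclusions in submodules and images
  under homomorphisms follow by induction without finite sums.\<close>

inductive_set mod_span :: "('a, 'x) ring_scheme \<Rightarrow> ('a, 'm, 'z) module_scheme \<Rightarrow> 'm set \<Rightarrow> 'm set"
  for A M G where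
    zero: "\<zero>\<^bsub>M\<^esub> \<in> mod_span A M G"
  | step: "\<lbrakk>g \<in> G; a \<in> carrier A; x \<in> mod_span A M G\<rbrakk> \<Longrightarrow> a \<odot>\<^bsub>M\<^esub> g \<oplus>\<^bsub>M\<^esub> x \<in> mod_span A M G"

lemma mod_span_least:
  assumes "submod A M U" "G \<subseteq> U"
  shows "mod_span A M G \<subseteq> U"
proof
  fix x assume "x \<in> mod_span A M G"
  then show "x \<in> U" by induction (use assms submodD[OF assms(1)] in auto)
qed

lemma mod_span_mono:
  assumes "G \<subseteq> H"
  shows "mod_span A M G \<subseteq> mod_span A M H"
proof
  fix x assume "x \<in> mod_span A M G"
  then show "x \<in> mod_span A M H" by induction (use assms in \<open>auto intro: mod_span.intros\<close>)
qed

lemma submod_mod_span: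
  assumes M: "module A M" and G: "G \<subseteq> carrier M"
  shows "submod A M (mod_span A M G)"
proof -
  interpret M: module A M by fact
  have c: "x \<in> carrier M" if "x \<in> mod_span A M G" for x
    using that by induction (use G in auto)
  have add: "x \<oplus>\<^bsub>M\<^esub> y \<in> mod_span A M G" if "x \<in> mod_span A M G" "y \<in> mod_span A M G" for x y
    using that(1)
  proof induction
    case (step g a x)
    then have "a \<odot>\<^bsub>M\<^esub> g \<oplus>\<^bsub>M\<^esub> x \<oplus>\<^bsub>M\<^esub> y = a \<odot>\<^bsub>M\<^esub> g \<oplus>\<^bsub>M\<^esub> (x \<oplus>\<^bsub>M\<^esub> y)"
      using G c that(2) by (intro M.a_assoc) auto
    then show ?case using step mod_span.step by metis
  qed (use that c in simp)
  have "b \<odot>\<^bsub>M\<^esub> x \<in> mod_span A M G" if "b \<in> carrier A" "x \<in> mod_span A M G" for b x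
    using that(2)
  proof induction
    case (step g a x)
    then have "b \<odot>\<^bsub>M\<^esub> (a \<odot>\<^bsub>M\<^esub> g \<oplus>\<^bsub>M\<^esub> x) = (b \<otimes>\<^bsub>A\<^esub> a) \<odot>\<^bsub>M\<^esub> g \<oplus>\<^bsub>M\<^esub> b \<odot>\<^bsub>M\<^esub> x"
      using that(1) c[OF step(3)] subsetD[OF G step(1)] by (simp add: M.smult_r_distr M.smult_assoc1)
    then show ?case using step that(1) mod_span.step[of g G "b \<otimes>\<^bsub>A\<^esub> a" A "b \<odot>\<^bsub>M\<^esub> x" M] by simp
  qed (use that in \<open>simp add: mod_span.zero\<close>)
  then show ?thesis using c add mod_span.zero by (simp add: submod_def subset_iff)
qed

lemma mod_span_superset:
  assumes M: "module A M" and G: "G \<subseteq> carrier M"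
  shows "G \<subseteq> mod_span A M G"
proof
  interpret M: module A M by fact
  fix g assume "g \<in> G"
  then show "g \<in> mod_span A M G"
    using mod_span.step[of g G "\<one>\<^bsub>A\<^esub>" A "\<zero>\<^bsub>M\<^esub>" M] mod_span.zero[of M A G] subsetD[OF G] by simp
qed

lemma fin_free_inclusion:
  assumes A: "cring A"
  shows "(\<lambda>u\<in>carrier (fin_free A n). \<lambda>x\<in>{..<Suc n}. if x < n then u x else \<zero>\<^bsub>A\<^esub>)
    \<in> mod_hom A (fin_free A n) (fin_free A (Suc n))"
proof -
  interpret A: cring A by fact
  show ?thesis
  proof (rule mod_hom_restrictI[OF module_pow_module[OF module_regular_module[OF A]]])
    fix u assume u: "u \<in> carrier (fin_free A n)"
    have "u x \<in> carrier A" if "x < n" for x using pow_module_mem[OF u, of x] that by simp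
    then show "(\<lambda>x\<in>{..<Suc n}. if x < n then u x else \<zero>\<^bsub>A\<^esub>) \<in> carrier (fin_free A (Suc n))"
      by (simp add: pow_module_simps(1))
  qed (auto simp: pow_module_simps(3,4) intro!: restrict_ext)
qed

text \<open>Induction on the rank. The last coordinates of \<open>N\<close> form an ideal, finitely
  generated by the noetherian hypothesis; generators of it are lifted to \<open>N\<close>. The
  elements of \<open>N\<close> whose last coordinate is zero form a submodule of a free module of
  smaller rank.\<close>

lemma submodule_finitely_generated:
  fixes A :: "('a, 'x) ring_scheme"
  assumes A: "cring A" and noeth: "noetherian_ring A" and N: "submod A (fin_free A n) N"
  shows "\<exists>G. finite G \<and> G \<subseteq> N \<and> N = mod_span A (fin_free A n) G"
  using N
proof (induction n arbitrary: N)
  interpret A: cring A by fact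
  case 0
  have "N = {\<zero>\<^bsub>fin_free A 0\<^esub>}" using 0 by (auto simp: submod_def pow_module_simps restrict_def)
  moreover have "mod_span A (fin_free A 0) {} = {\<zero>\<^bsub>fin_free A 0\<^esub>}"
    by (auto intro: mod_span.zero elim: mod_span.cases)
  ultimately show ?case by (intro exI[of _ "{}"]) simp
next
  interpret A: cring A by fact
  case (Suc n)
  let ?M = "fin_free A (Suc n)" and ?L = "fin_free A n"
  note AM = module_regular_module[OF A]
  interpret M: module A ?M by (rule module_pow_module[OF AM])
  interpret L: module A ?L by (rule module_pow_module[OF AM])
  note Nc = submodD(1)[OF Suc.prems]
  have vn: "v n \<in> carrier A" if "v \<in> N" for v
    using pow_module_mem[OF Nc[OF that], of n] by simp
  define J where "J = (\<lambda>v. v n) ` N"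
  \<comment> \<open>Stated for every submodule, because it is applied to \<open>N\<close> and to the
    span of the lifted generators.\<close>
  have sub: "ideal ((\<lambda>v. v n) ` U) A" if U: "submod A ?M U" for U
  proof -
    note Uc = submodD(1)[OF U]
    have un: "v n \<in> carrier A" if "v \<in> U" for v using pow_module_mem[OF Uc[OF that], of n] by simp
    show ?thesis
    proof (rule idealI)
    show "ring A" by (rule A.ring_axioms)
    show "subgroup ((\<lambda>v. v n) ` U) (add_monoid A)"
    proof (rule group.subgroupI[OF A.a_group])
      show "(\<lambda>v. v n) ` U \<subseteq> carrier (add_monoid A)" using un by auto
      show "(\<lambda>v. v n) ` U \<noteq> {}" using submodD(2)[OF U] by blast
    next
      fix a assume "a \<in> (\<lambda>v. v n) ` U"
      then obtain v where v: "v \<in> U" "a = v n" by blast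
      have "(\<zero>\<^bsub>?M\<^esub> \<ominus>\<^bsub>?M\<^esub> v) n = \<ominus>\<^bsub>A\<^esub> a"
        using Uc[OF v(1)] un[OF v(1)] v(2) pow_module_a_inv[OF module_imp_abelian_group[OF AM] Uc[OF v(1)]]
        by (simp add: M.minus_eq pow_module_simps)
      then show "inv\<^bsub>add_monoid A\<^esub> a \<in> (\<lambda>v. v n) ` U"
        using submod_minus[OF M.module_axioms U submodD(2)[OF U] v(1)] by (metis a_inv_def image_eqI)
    next
      fix a b assume "a \<in> (\<lambda>v. v n) ` U" "b \<in> (\<lambda>v. v n) ` U"
      then obtain v w where v: "v \<in> U" "a = v n" "w \<in> U" "b = w n" by blast
      have "(v \<oplus>\<^bsub>?M\<^esub> w) n = a \<oplus>\<^bsub>A\<^esub> b" using v by (simp add: pow_module_simps)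
      then show "a \<otimes>\<^bsub>add_monoid A\<^esub> b \<in> (\<lambda>v. v n) ` U"
        using submodD(3)[OF U v(1,3)] by (metis image_eqI monoid.select_convs(1))
    qed
  next
    fix a x assume "a \<in> (\<lambda>v. v n) ` U" and x: "x \<in> carrier A"
    then obtain v where v: "v \<in> U" "a = v n" by blast
    have "(x \<odot>\<^bsub>?M\<^esub> v) n = x \<otimes>\<^bsub>A\<^esub> a" using v by (simp add: pow_module_simps)
    then show xa: "x \<otimes>\<^bsub>A\<^esub> a \<in> (\<lambda>v. v n) ` U" using submodD(4)[OF U x v(1)] by (metis image_eqI)
    then show "a \<otimes>\<^bsub>A\<^esub> x \<in> (\<lambda>v. v n) ` U" using x un[OF v(1)] v(2) by (simp add: A.m_comm)
    qed
  qed
  obtain B where B: "B \<subseteq> carrier A" "finite B" "J = Idl\<^bsub>A\<^esub> B"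
    using noetherian_ring.finetely_gen[OF noeth sub[OF Suc.prems]] unfolding J_def[symmetric] by (elim exE conjE)
  have "B \<subseteq> J" using A.genideal_self[OF B(1)] B(3) by simp
  then obtain G1 where G1: "finite G1" "G1 \<subseteq> N" "B = (\<lambda>v. v n) ` G1"
    using finite_subset_image[OF B(2), of "\<lambda>v. v n" N] unfolding J_def by (elim meta_impE exE conjE)
  have G1M: "G1 \<subseteq> carrier ?M" using G1(2) Nc by blast
  \<comment> \<open>The last coordinates of the span of \<open>G1\<close> form an ideal that
    contains \<open>B\<close>, hence all of \<open>J\<close>.\<close>
  have JG1: "J \<subseteq> (\<lambda>v. v n) ` mod_span A ?M G1"
    unfolding B(3) using mod_span_superset[OF M.module_axioms G1M] G1(3)
    by (intro A.genideal_minimal sub submod_mod_span[OF M.module_axioms G1M]) blast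
  \<comment> \<open>Extension by a zero in the last place identifies the free module of rank
    \<open>n\<close> with the vectors whose last coordinate is zero.\<close>
  define e where "e = (\<lambda>u\<in>carrier ?L. \<lambda>x\<in>{..<Suc n}. if x < n then u x else \<zero>\<^bsub>A\<^esub>)"
  have e: "e \<in> mod_hom A ?L ?M"
    unfolding e_def by (rule fin_free_inclusion[OF A])
  define N' where "N' = {u \<in> carrier ?L. e u \<in> N}"
  have "submod A ?L N'"
    using submodD[OF Suc.prems] mod_hom_zero[OF e L.abelian_group_axioms M.abelian_group_axioms]
    by (auto simp: submod_def N'_def mod_hom_add[OF e] mod_hom_smult[OF e])
  from Suc.IH[OF this] obtain G2 where G2: "finite G2" "G2 \<subseteq> N'" "N' = mod_span A ?L G2" by blast
  have eG2: "e ` G2 \<subseteq> N" using G2(2) by (auto simp: N'_def)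
  have G2L: "G2 \<subseteq> carrier ?L" using G2(2) by (auto simp: N'_def)
  have e_span: "e u \<in> mod_span A ?M (e ` G2)" if "u \<in> mod_span A ?L G2" for u
    using that
  proof induction
    case zero
    then show ?case using mod_hom_zero[OF e L.abelian_group_axioms M.abelian_group_axioms] mod_span.zero by metis
  next
    case (step g a x)
    have "x \<in> carrier ?L" using step(3) submodD(1)[OF submod_mod_span[OF L.module_axioms G2L]] by blast
    then have "e (a \<odot>\<^bsub>?L\<^esub> g \<oplus>\<^bsub>?L\<^esub> x) = a \<odot>\<^bsub>?M\<^esub> e g \<oplus>\<^bsub>?M\<^esub> e x"
      using subsetD[OF G2L step(1)] step(2) by (simp add: mod_hom_add[OF e] mod_hom_smult[OF e])
    then show ?case using mod_span.step[OF imageI[OF step(1)] step(2) step.IH] by simp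
  qed
  let ?G = "G1 \<union> e ` G2"
  have GN: "?G \<subseteq> N" using G1(2) eG2 by blast
  then have GM: "?G \<subseteq> carrier ?M" using Nc by (meson subsetI subsetD)
  have "N \<subseteq> mod_span A ?M ?G"
  proof
    fix v assume v: "v \<in> N"
    then have "v n \<in> J" by (simp add: J_def)
    then obtain w where w: "w \<in> mod_span A ?M G1" "v n = w n" using JG1 by blast
    have wN: "w \<in> N" using w(1) mod_span_least[OF Suc.prems G1(2)] by blast
    \<comment> \<open>\<open>w\<close> lies in the span of \<open>G1\<close> and has the last
      coordinate of \<open>v\<close>, so the difference comes from rank \<open>n\<close>, where
      \<open>G2\<close> generates.\<close>
    let ?y = "v \<ominus>\<^bsub>?M\<^esub> w" and ?u = "\<lambda>x\<in>{..<n}. v x \<oplus>\<^bsub>A\<^esub> \<ominus>\<^bsub>A\<^esub> w x"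
    have yx: "?y x = v x \<oplus>\<^bsub>A\<^esub> \<ominus>\<^bsub>A\<^esub> w x" if "x < Suc n" for x
      using that pow_module_a_inv[OF module_imp_abelian_group[OF AM] Nc[OF wN]]
      by (simp add: M.minus_eq pow_module_simps)
    have y: "?y \<in> N" by (rule submod_minus[OF M.module_axioms Suc.prems v wN])
    have u: "?u \<in> carrier ?L"
      using pow_module_mem[OF Nc[OF v]] pow_module_mem[OF Nc[OF wN]] by (auto simp: pow_module_simps)
    have eu: "e ?u = ?y"
    proof (rule pow_module_eqI[OF mod_hom_closed[OF e u] Nc[OF y]])
      fix x assume x: "x \<in> {..<Suc n}"
      then consider "x < n" | "x = n" by (auto simp: less_Suc_eq)
      then show "e ?u x = ?y x"
      proof cases
        case 1
        then show ?thesis using u yx[of x] by (simp add: e_def)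
      next
        case 2
        then show ?thesis using u yx[of x] vn[OF wN] w(2) by (simp add: e_def A.r_neg)
      qed
    qed
    have "?u \<in> N'" unfolding N'_def mem_Collect_eq eu using u y by (rule conjI)
    then have "?u \<in> mod_span A ?L G2" using G2(3) by (simp only:)
    from e_span[OF this] have "?y \<in> mod_span A ?M (e ` G2)" unfolding eu .
    then have "?y \<in> mod_span A ?M ?G" by (rule subsetD[OF mod_span_mono[OF Un_upper2]])
    moreover have "w \<in> mod_span A ?M ?G" by (rule subsetD[OF mod_span_mono[OF Un_upper1] w(1)])
    ultimately have "?y \<oplus>\<^bsub>?M\<^esub> w \<in> mod_span A ?M ?G" by (rule submodD(3)[OF submod_mod_span[OF M.module_axioms GM]])
    moreover have "?y \<oplus>\<^bsub>?M\<^esub> w = v" using Nc[OF v] Nc[OF wN] by (simp add: M.minus_eq M.a_assoc M.l_neg)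
    ultimately show "v \<in> mod_span A ?M ?G" by simp
  qed
  then show ?case using mod_span_least[OF Suc.prems GN] G1(1) G2(1) GN by (intro exI[of _ ?G]) auto
qed

text \<open>Supplies the next free module of a resolution: a finite generating set, enumerated by
  naturals, becomes a surjection from a finite free module.\<close>

lemma mod_span_image:
  assumes A: "cring A" and M: "module A M" and G: "finite G" "G \<subseteq> carrier M"
  shows "\<exists>b f. f \<in> mod_hom A (fin_free A b) M \<and> f ` carrier (fin_free A b) = mod_span A M G"
proof -
  interpret A: cring A by fact
  interpret M: module A M by fact
  note AM = module_regular_module[OF A]
  let ?b = "card G" and ?F = "fin_free A (card G)"
  interpret F: module A ?F by (rule module_pow_module[OF AM])
  obtain g where g: "bij_betw g {..<?b} G" using ex_bij_betw_nat_finite[OF G(1)] atLeast0LessThan by metis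
  have gG: "g j \<in> G" if "j < ?b" for j using g that by (auto simp: bij_betw_def)
  then have gc: "g j \<in> carrier M" if "j < ?b" for j using that G(2) by blast
  define f where "f = (\<lambda>v\<in>carrier ?F. \<Oplus>\<^bsub>M\<^esub>j\<in>{..<?b}. v j \<odot>\<^bsub>M\<^esub> g j)"
  have vc: "v j \<in> carrier A" if "v \<in> carrier ?F" "j < ?b" for v j
    using pow_module_mem[OF that(1)] that(2) by simp
  have f: "f \<in> mod_hom A ?F M"
    unfolding f_def
  proof (rule mod_hom_restrictI[OF F.module_axioms])
    fix x y assume xy: "x \<in> carrier ?F" "y \<in> carrier ?F"
    have "(\<Oplus>\<^bsub>M\<^esub>j\<in>{..<?b}. (x \<oplus>\<^bsub>?F\<^esub> y) j \<odot>\<^bsub>M\<^esub> g j) = (\<Oplus>\<^bsub>M\<^esub>j\<in>{..<?b}. x j \<odot>\<^bsub>M\<^esub> g j \<oplus>\<^bsub>M\<^esub> y j \<odot>\<^bsub>M\<^esub> g j)"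
      using xy gc vc by (intro M.finsum_cong') (auto simp: pow_module_simps(3) M.smult_l_distr)
    also have "\<dots> = (\<Oplus>\<^bsub>M\<^esub>j\<in>{..<?b}. x j \<odot>\<^bsub>M\<^esub> g j) \<oplus>\<^bsub>M\<^esub> (\<Oplus>\<^bsub>M\<^esub>j\<in>{..<?b}. y j \<odot>\<^bsub>M\<^esub> g j)"
      using xy gc vc by (intro M.finsum_addf) auto
    finally show "(\<Oplus>\<^bsub>M\<^esub>j\<in>{..<?b}. (x \<oplus>\<^bsub>?F\<^esub> y) j \<odot>\<^bsub>M\<^esub> g j) = \<dots>" .
  next
    fix a x assume xy: "a \<in> carrier A" "x \<in> carrier ?F"
    have "(\<Oplus>\<^bsub>M\<^esub>j\<in>{..<?b}. (a \<odot>\<^bsub>?F\<^esub> x) j \<odot>\<^bsub>M\<^esub> g j) = (\<Oplus>\<^bsub>M\<^esub>j\<in>{..<?b}. a \<odot>\<^bsub>M\<^esub> (x j \<odot>\<^bsub>M\<^esub> g j))"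
      using xy gc vc by (intro M.finsum_cong') (auto simp: pow_module_simps(4) M.smult_assoc1)
    also have "\<dots> = a \<odot>\<^bsub>M\<^esub> (\<Oplus>\<^bsub>M\<^esub>j\<in>{..<?b}. x j \<odot>\<^bsub>M\<^esub> g j)"
      using xy gc vc by (intro M.finsum_smult_ldistr[symmetric]) auto
    finally show "(\<Oplus>\<^bsub>M\<^esub>j\<in>{..<?b}. (a \<odot>\<^bsub>?F\<^esub> x) j \<odot>\<^bsub>M\<^esub> g j) = \<dots>" .
  qed (use gc vc in \<open>auto intro!: M.finsum_closed\<close>)
  note sp = submod_mod_span[OF M G(2)]
  have "f v \<in> mod_span A M G" if v: "v \<in> carrier ?F" for v
  proof -
    have "finite J \<Longrightarrow> J \<subseteq> {..<?b} \<Longrightarrow> (\<Oplus>\<^bsub>M\<^esub>j\<in>J. v j \<odot>\<^bsub>M\<^esub> g j) \<in> mod_span A M G" for J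
    proof (induction J rule: finite_induct)
      case (insert j J)
      have "v i \<odot>\<^bsub>M\<^esub> g i \<in> carrier M" if "i \<in> insert j J" for i
        using insert that vc[OF v] gc by (intro M.smult_closed) auto
      then show ?case using insert mod_span.step[OF gG vc[OF v], of j j "\<Oplus>\<^bsub>M\<^esub>j\<in>J. v j \<odot>\<^bsub>M\<^esub> g j"]
        by (simp add: M.finsum_insert Pi_iff)
    qed (simp add: mod_span.zero)
    then show ?thesis using v by (simp add: f_def)
  qed
  moreover have "mod_span A M G \<subseteq> f ` carrier ?F"
  proof (rule mod_span_least[OF submod_image[OF F.module_axioms M f]])
    show "G \<subseteq> f ` carrier ?F"
    proof
      fix x assume "x \<in> G"
      then obtain j where j: "j < ?b" "x = g j" using g by (auto simp: bij_betw_def)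
      let ?v = "single (regular_module A) {..<?b} j \<one>\<^bsub>A\<^esub>"
      have v: "?v \<in> carrier ?F" using module_imp_abelian_group[OF AM] by (intro single_closed) auto
      have "f ?v = (\<Oplus>\<^bsub>M\<^esub>i\<in>{..<?b}. if j = i then g j else \<zero>\<^bsub>M\<^esub>)"
        unfolding f_def using v j gc
        by (simp, intro M.finsum_cong') (auto simp: single_apply)
      also have "\<dots> = x" using finsum_delta[OF M.abelian_group_axioms, of "{..<?b}" j "g j"] j gc by simp
      finally show "x \<in> f ` carrier ?F" using v by blast
    qed
  qed
  ultimately show ?thesis using f by blast
qed

text \<open>A resolution of the residue field by finite free modules, with the ring itself in degree
  0 and augmentation \<open>v \<mapsto> \<epsilon> (v 0)\<close>. Ranks \<open>b\<close> and maps
  \<open>D\<close> are kept as explicit data, since transposes and index sets are formed from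
  them.\<close>

definition finite_resolution ::
    "('a, 'x) ring_scheme \<Rightarrow> ('k, 'z) ring_scheme \<Rightarrow> ('a \<Rightarrow> 'k) \<Rightarrow> (int \<Rightarrow> nat) \<Rightarrow> (int \<Rightarrow> (nat \<Rightarrow> 'a) \<Rightarrow> nat \<Rightarrow> 'a) \<Rightarrow> bool"
  where "finite_resolution A K \<epsilon> b D \<longleftrightarrow>
    b 0 = 1 \<and> (\<forall>i<0. b i = 0) \<and>
    (\<forall>i. D i \<in> mod_hom A (fin_free A (b i)) (fin_free A (b (i - 1)))) \<and>
    (\<forall>i. \<forall>v\<in>carrier (fin_free A (b i)). D (i - 1) (D i v) = \<zero>\<^bsub>fin_free A (b (i - 1 - 1))\<^esub>) \<and>
    (\<forall>i>0. \<forall>v\<in>carrier (fin_free A (b i)). D i v = \<zero>\<^bsub>fin_free A (b (i - 1))\<^esub> \<longrightarrow>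
      v \<in> D (i + 1) ` carrier (fin_free A (b (i + 1)))) \<and>
    (\<forall>v\<in>carrier (fin_free A 1). \<epsilon> (v 0) = \<zero>\<^bsub>K\<^esub> \<longleftrightarrow> v \<in> D 1 ` carrier (fin_free A (b 1)))"

text \<open>Starting from the kernel of the augmentation, each kernel is covered by a finite free
  module; over a noetherian ring the kernel of the covering map is finitely generated again.\<close>

lemma finite_resolution_exists:
  fixes A :: "('a, 'x) ring_scheme"
  assumes A: "cring A" and noeth: "noetherian_ring A" and K: "cring K" and \<epsilon>: "\<epsilon> \<in> ring_hom A K"
  obtains b D where "finite_resolution A K \<epsilon> b D"
proof -
  interpret A: cring A by fact
  interpret K: cring K by fact
  note AM = module_regular_module[OF A]
  have FM: "module A (fin_free A n)" for n by (rule module_pow_module[OF AM])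
  note \<epsilon>s = ring_hom_closed[OF \<epsilon>] ring_hom_add[OF \<epsilon>] ring_hom_mult[OF \<epsilon>] ring_hom_zero[OF \<epsilon> A.ring_axioms K.ring_axioms]
  define N0 where "N0 = {v \<in> carrier (fin_free A 1). \<epsilon> (v 0) = \<zero>\<^bsub>K\<^esub>}"
  have N0: "submod A (fin_free A 1) N0"
  proof -
    have "v 0 \<in> carrier A" if "v \<in> carrier (fin_free A 1)" for v
      using pow_module_mem[OF that, of 0] by simp
    then show ?thesis
      unfolding submod_def N0_def
      using abelian_groupE(1,2)[OF module_imp_abelian_group[OF FM]] module.smult_closed[OF FM]
      by (simp add: subset_iff \<epsilon>s pow_module_simps(2-4))
  qed
  define ker where "ker b b' d = {v \<in> carrier (fin_free A b). d v = \<zero>\<^bsub>fin_free A b'\<^esub>}"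
    for b b' and d :: "(nat \<Rightarrow> 'a) \<Rightarrow> nat \<Rightarrow> 'a"
  \<comment> \<open>A state consists of a rank, the submodule that the next map has to cover, and
    the last map constructed.\<close>
  let ?ok = "\<lambda>(n::nat) (b, N, d). submod A (fin_free A b) N \<and> (n = 0 \<longrightarrow> b = 1 \<and> N = N0)"
  let ?next = "\<lambda>(n::nat) (b, N, d) (b', N', d'). d' \<in> mod_hom A (fin_free A b') (fin_free A b) \<and>
     d' ` carrier (fin_free A b') = N \<and> N' = ker b' b d'"
  have "\<exists>s. \<forall>n. ?ok n (s n) \<and> ?next n (s n) (s (Suc n))"
  proof (rule dependent_nat_choice)
    \<comment> \<open>The submodule to cover first is the augmentation kernel;
      \<open>undefined\<close> stands in for a map out of degree 0, which is set to zero in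
      \<open>D\<close> below.\<close>
    show "\<exists>x. ?ok 0 x" using N0 by (intro exI[of _ "(1, N0, undefined)"]) simp
    fix x :: "nat \<times> (nat \<Rightarrow> 'a) set \<times> ((nat \<Rightarrow> 'a) \<Rightarrow> nat \<Rightarrow> 'a)" and n
    assume x: "?ok n x"
    obtain b N d where bN: "x = (b, N, d)" by (cases x)
    have N: "submod A (fin_free A b) N" using x bN by simp
    obtain G where G: "finite G" "G \<subseteq> N" "N = mod_span A (fin_free A b) G"
      using submodule_finitely_generated[OF A noeth N] by blast
    have "G \<subseteq> carrier (fin_free A b)" using G(2) submodD(1)[OF N] by blast
    from mod_span_image[OF A FM G(1) this] obtain b' d' where
      d': "d' \<in> mod_hom A (fin_free A b') (fin_free A b)" "d' ` carrier (fin_free A b') = N"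
      unfolding G(3)[symmetric] by blast
    have "submod A (fin_free A b') (ker b' b d')"
      unfolding ker_def by (rule submod_kernel[OF FM FM d'(1)])
    then show "\<exists>y. ?ok (Suc n) y \<and> ?next n x y"
      using d' by (intro exI[of _ "(b', ker b' b d', d')"]) (simp add: bN)
  qed
  then obtain s where s0: "\<forall>n. ?ok n (s n) \<and> ?next n (s n) (s (Suc n))" by (rule exE)
  note s = spec[OF s0, THEN conjunct1] spec[OF s0, THEN conjunct2]
  define \<beta> where "\<beta> n = fst (s n)" for n
  define \<nu> where "\<nu> n = fst (snd (s n))" for n
  define \<theta> where "\<theta> n = snd (snd (s n))" for n
  have sn: "s n = (\<beta> n, \<nu> n, \<theta> n)" for n by (simp add: \<beta>_def \<nu>_def \<theta>_def)
  have z: "\<beta> 0 = 1" "\<nu> 0 = N0" using s(1)[of 0] by (simp_all add: sn)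
  have nx: "\<theta> (Suc n) \<in> mod_hom A (fin_free A (\<beta> (Suc n))) (fin_free A (\<beta> n))"
     "\<theta> (Suc n) ` carrier (fin_free A (\<beta> (Suc n))) = \<nu> n" "\<nu> (Suc n) = ker (\<beta> (Suc n)) (\<beta> n) (\<theta> (Suc n))" for n
    using s(2)[of n] by (simp_all add: sn)
  define b where "b i = (if i < 0 then 0 else \<beta> (nat i))" for i :: int
  define D where "D i = (if i > 0 then \<theta> (nat i) else (\<lambda>v\<in>carrier (fin_free A (b i)). \<zero>\<^bsub>fin_free A (b (i - 1))\<^esub>))" for i :: int
  have pos: "\<exists>n. i = int (Suc n)" if "i > 0" for i :: int
    using that by (metis Suc_pred' nat_0_le less_imp_le zero_less_nat_eq)
  have bS: "b (int n) = \<beta> n" and DS: "D (int (Suc n)) = \<theta> (Suc n)" for n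
    by (simp_all add: b_def D_def del: of_nat_Suc)
  have D: "D i \<in> mod_hom A (fin_free A (b i)) (fin_free A (b (i - 1)))" for i
  proof (cases "i > 0")
    case True
    then obtain n where n: "i = int (Suc n)" using pos by blast
    have e: "i - 1 = int n" using n by simp
    show ?thesis using nx(1)[of n] unfolding e unfolding n bS DS .
  next
    case False
    then show ?thesis using mod_hom_null[OF FM FM] by (simp add: D_def)
  qed
  have DD: "D (i - 1) (D i v) = \<zero>\<^bsub>fin_free A (b (i - 1 - 1))\<^esub>" if v: "v \<in> carrier (fin_free A (b i))" for i v
  proof (cases "i - 1 > 0")
    case True
    then obtain n where n: "i - 1 = int (Suc n)" using pos by blast
    then have i: "i = int (Suc (Suc n))" "i - 1 - 1 = int n" by simp_all
    have "\<theta> (Suc (Suc n)) v \<in> ker (\<beta> (Suc n)) (\<beta> n) (\<theta> (Suc n))"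
      using nx(2)[of "Suc n"] nx(3)[of n] v by (auto simp: i bS simp del: of_nat_Suc)
    then show ?thesis unfolding i(2) n unfolding i(1) DS bS by (simp add: ker_def bS)
  next
    case False
    then show ?thesis using mod_hom_closed[OF D v] by (simp add: D_def)
  qed
  have ex: "v \<in> D (i + 1) ` carrier (fin_free A (b (i + 1)))"
    if i: "0 < i" and v: "v \<in> carrier (fin_free A (b i))" "D i v = \<zero>\<^bsub>fin_free A (b (i - 1))\<^esub>" for i v
  proof -
    obtain n where n: "i = int (Suc n)" using pos i by blast
    then have i: "i - 1 = int n" "i + 1 = int (Suc (Suc n))" by simp_all
    have "v \<in> ker (\<beta> (Suc n)) (\<beta> n) (\<theta> (Suc n))"
      using v unfolding i(1) unfolding n DS bS by (simp add: ker_def)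
    then show ?thesis using nx(2)[of "Suc n"] nx(3)[of n] unfolding i(2) DS bS by simp
  qed
  have "\<epsilon> (v 0) = \<zero>\<^bsub>K\<^esub> \<longleftrightarrow> v \<in> D 1 ` carrier (fin_free A (b 1))" if "v \<in> carrier (fin_free A 1)" for v
    using nx(2)[of 0] that by (simp add: z D_def b_def N0_def)
  then have "finite_resolution A K \<epsilon> b D"
    unfolding finite_resolution_def using D DD ex z(1) by (simp add: b_def)
  then show thesis by (rule that)
qed

definition finite_complex :: "('a, 'x) ring_scheme \<Rightarrow> (int \<Rightarrow> nat) \<Rightarrow> (int \<Rightarrow> (nat \<Rightarrow> 'a) \<Rightarrow> nat \<Rightarrow> 'a) \<Rightarrow> ('a, nat \<Rightarrow> 'a) module_complex"
  where "finite_complex A b D = \<lparr>obj = (\<lambda>i. fin_free A (b i)), bdry = D\<rparr>"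

lemma finite_resolution_free_resolution:
  assumes A: "cring A" and ne: "\<one>\<^bsub>A\<^esub> \<noteq> \<zero>\<^bsub>A\<^esub>" and \<epsilon>: "\<epsilon> \<in> ring_hom A K" and onto: "carrier K \<subseteq> \<epsilon> ` carrier A"
    and res: "finite_resolution A K \<epsilon> b D"
  shows "free_resolution A (augmentation_module K \<epsilon>) (finite_complex A b D)"
proof -
  interpret A: cring A by fact
  note AM = module_regular_module[OF A]
  note r = res[unfolded finite_resolution_def]
  let ?\<pi> = "\<lambda>v\<in>carrier (fin_free A 1). \<epsilon> (v 0)"
  have \<pi>: "?\<pi> \<in> mod_hom A (fin_free A 1) (augmentation_module K \<epsilon>)"
    by (rule mod_hom_restrictI[OF module_pow_module[OF AM]])
      (auto simp: augmentation_module_def pow_module_simps PiE_const_mem ring_hom_closed[OF \<epsilon>]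
        ring_hom_add[OF \<epsilon>] ring_hom_mult[OF \<epsilon>])
  have onto': "?\<pi> ` carrier (fin_free A 1) = carrier (augmentation_module K \<epsilon>)"
  proof
    show "?\<pi> ` carrier (fin_free A 1) \<subseteq> carrier (augmentation_module K \<epsilon>)"
      using mod_hom_closed[OF \<pi>] by blast
    show "carrier (augmentation_module K \<epsilon>) \<subseteq> ?\<pi> ` carrier (fin_free A 1)"
    proof
      fix c assume "c \<in> carrier (augmentation_module K \<epsilon>)"
      then obtain a where a: "a \<in> carrier A" "c = \<epsilon> a" using onto by (auto simp: augmentation_module_def)
      then show "c \<in> ?\<pi> ` carrier (fin_free A 1)"
        by (intro image_eqI[of _ _ "\<lambda>x\<in>{..<1}. a"]) (auto simp: pow_module_simps)
    qed
  qed
  have ker: "{v \<in> carrier (fin_free A 1). ?\<pi> v = \<zero>\<^bsub>augmentation_module K \<epsilon>\<^esub>} = D 1 ` carrier (fin_free A (b 1))"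
  proof -
    have "D 1 ` carrier (fin_free A (b 1)) \<subseteq> carrier (fin_free A 1)"
    proof -
      have "D 1 \<in> mod_hom A (fin_free A (b 1)) (fin_free A (b (1 - 1)))" using r by blast
      then show ?thesis using r by (auto dest: mod_hom_closed)
    qed
    moreover have "\<forall>v\<in>carrier (fin_free A 1). \<epsilon> (v 0) = \<zero>\<^bsub>K\<^esub> \<longleftrightarrow> v \<in> D 1 ` carrier (fin_free A (b 1))"
      using r by blast
    ultimately show ?thesis by (auto simp: augmentation_module_def)
  qed
  have exact: "{v \<in> carrier (fin_free A (b i)). D i v = \<zero>\<^bsub>fin_free A (b (i - 1))\<^esub>} = D (i + 1) ` carrier (fin_free A (b (i + 1)))"
    if "0 < i" for i
  proof
    show "{v \<in> carrier (fin_free A (b i)). D i v = \<zero>\<^bsub>fin_free A (b (i - 1))\<^esub>} \<subseteq> D (i + 1) ` carrier (fin_free A (b (i + 1)))"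
      using r that by blast
    have "D (i + 1) \<in> mod_hom A (fin_free A (b (i + 1))) (fin_free A (b (i + 1 - 1)))" using r by blast
    then have "D (i + 1) v \<in> carrier (fin_free A (b i))" if "v \<in> carrier (fin_free A (b (i + 1)))" for v
      using that by (auto dest: mod_hom_closed)
    moreover have "D (i + 1 - 1) (D (i + 1) v) = \<zero>\<^bsub>fin_free A (b (i + 1 - 1 - 1))\<^esub>"
      if "v \<in> carrier (fin_free A (b (i + 1)))" for v using r that by blast
    ultimately show "D (i + 1) ` carrier (fin_free A (b (i + 1))) \<subseteq> {v \<in> carrier (fin_free A (b i)). D i v = \<zero>\<^bsub>fin_free A (b (i - 1))\<^esub>}"
      by auto
  qed
  show ?thesis
    unfolding free_resolution_def
  proof (intro conjI allI impI bexI[of _ ?\<pi>])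
    show "free_module A (obj (finite_complex A b D) i)" for i
      by (simp add: finite_complex_def free_module_pow_module[OF A ne])
    show "carrier (obj (finite_complex A b D) i) = {\<zero>\<^bsub>obj (finite_complex A b D) i\<^esub>}" if "i < 0" for i
      using r that by (simp add: finite_complex_def pow_module_simps restrict_def)
    show "bdry (finite_complex A b D) i \<in> mod_hom A (obj (finite_complex A b D) i) (obj (finite_complex A b D) (i - 1))" for i
      using r by (simp add: finite_complex_def)
  qed (use exact \<pi> onto' ker r in \<open>simp_all add: finite_complex_def\<close>)
qed

section \<open>Tensor products of based modules\<close>

text \<open>The power of the algebra \<open>R\<close> as a module over \<open>K\<close> and the free
  module over \<open>R\<close> differ in the scalar action alone. These rules let one carrier serve
  both structures.\<close>

lemma pow_regular_simps [simp]:
  fixes R :: "('k, 'r, 'y) module_scheme"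
  shows "carrier (pow_module (regular_module R) J) = carrier (pow_module R J)"
    "\<zero>\<^bsub>pow_module (regular_module R) J\<^esub> = \<zero>\<^bsub>pow_module R J\<^esub>"
    "v \<oplus>\<^bsub>pow_module (regular_module R) J\<^esub> w = v \<oplus>\<^bsub>pow_module R J\<^esub> w"
    "\<ominus>\<^bsub>pow_module (regular_module R) J\<^esub> v = \<ominus>\<^bsub>pow_module R J\<^esub> v"
    "v \<ominus>\<^bsub>pow_module (regular_module R) J\<^esub> w = v \<ominus>\<^bsub>pow_module R J\<^esub> w"
    "single (regular_module R) J = single R J"
  by (simp_all add: pow_module_def regular_module_def a_inv_def m_inv_def a_minus_def single_def fun_eq_iff)

lemma pow_regular_smult:
  "a \<odot>\<^bsub>pow_module (regular_module A) J\<^esub> v = (\<lambda>x\<in>J. a \<otimes>\<^bsub>A\<^esub> v x)"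
  by (simp add: pow_module_simps)

lemma pow_module_induct [consumes 3, case_names zero single add]:
  assumes M: "abelian_group M" and J: "finite J" and v: "v \<in> carrier (pow_module M J)"
    and zero: "P \<zero>\<^bsub>pow_module M J\<^esub>"
    and single: "\<And>j r. \<lbrakk>j \<in> J; r \<in> carrier M\<rbrakk> \<Longrightarrow> P (single M J j r)"
    and add: "\<And>v w. \<lbrakk>v \<in> carrier (pow_module M J); w \<in> carrier (pow_module M J); P v; P w\<rbrakk>
      \<Longrightarrow> P (v \<oplus>\<^bsub>pow_module M J\<^esub> w)"
  shows "P v"
proof -
  interpret P: abelian_group "pow_module M J" by (rule abelian_group_pow_module[OF M])
  have "finite I \<Longrightarrow> I \<subseteq> J \<Longrightarrow> P (\<Oplus>\<^bsub>pow_module M J\<^esub>j\<in>I. single M J j (v j)) \<and>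
      (\<Oplus>\<^bsub>pow_module M J\<^esub>j\<in>I. single M J j (v j)) \<in> carrier (pow_module M J)" for I
  proof (induction I rule: finite_induct)
    case (insert i I)
    have c: "single M J j (v j) \<in> carrier (pow_module M J)" if "j \<in> insert i I" for j
      using that insert.prems by (intro single_closed M pow_module_mem[OF v]) auto
    then have f: "(\<lambda>j. single M J j (v j)) \<in> I \<rightarrow> carrier (pow_module M J)" by simp
    have s: "P (single M J i (v i))" using insert.prems by (intro single pow_module_mem[OF v]) auto
    show ?case
      using insert s P.finsum_insert[OF insert(1,2) f c[of i]] add[OF c[of i] P.finsum_closed[OF f]] c[of i]
        P.finsum_closed[OF f] by simp
  qed (simp add: zero)
  from this[OF J order.refl] show ?thesis using pow_module_expand[OF M J v] by simp
qed

text \<open>A scalar of \<open>K\<close> acts through its multiple of the unit of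
  \<open>R\<close>.\<close>

lemma mod_hom_restrict_scalars:
  fixes K :: "('k, 'x) ring_scheme" and R :: "('k, 'r, 'y) module_scheme"
  assumes R: "algebra K R" and f: "f \<in> mod_hom R (pow_module (regular_module R) J) (pow_module (regular_module R) J')"
  shows "f \<in> mod_hom K (pow_module R J) (pow_module R J')"
proof -
  interpret R: algebra K R by fact
  have sm: "c \<odot>\<^bsub>pow_module R I\<^esub> v = (c \<odot>\<^bsub>R\<^esub> \<one>\<^bsub>R\<^esub>) \<odot>\<^bsub>pow_module (regular_module R) I\<^esub> v"
    if "c \<in> carrier K" "v \<in> carrier (pow_module R I)" for c I and v :: "'e \<Rightarrow> 'r"
    unfolding pow_module_simps(4) using that pow_module_mem[OF that(2)]
    by (intro restrict_ext) (simp add: R.smult_assoc2)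
  show ?thesis
  proof (rule mod_homI)
    fix c v assume c: "c \<in> carrier K" "v \<in> carrier (pow_module R J)"
    then have fv: "f v \<in> carrier (pow_module R J')" using mod_hom_closed[OF f] by simp
    have "c \<odot>\<^bsub>R\<^esub> \<one>\<^bsub>R\<^esub> \<in> carrier R" using c by simp
    from mod_hom_smult[OF f this] c(2) show "f (c \<odot>\<^bsub>pow_module R J\<^esub> v) = c \<odot>\<^bsub>pow_module R J'\<^esub> f v"
      by (simp add: sm[OF c] sm[OF c(1) fv])
  qed (use mod_hom_closed[OF f] mod_hom_add[OF f] mod_hom_extensional[OF f] in simp_all)
qed

text \<open>The Koszul sign \<open>(-1)^k\<close>. With integer exponents, signs compose by adding
  exponents (\<open>sg_sg\<close>) and are compared modulo 2 (\<open>sg_cong\<close>).\<close>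

definition sg :: "('m, 'z) ring_scheme \<Rightarrow> int \<Rightarrow> 'm \<Rightarrow> 'm"
  where "sg M k x = (if even k then x else \<ominus>\<^bsub>M\<^esub> x)"

locale tensor_modules = supplemented_tensor K R S \<epsilon> \<delta>
  for K :: "('k, 'x) ring_scheme" and R :: "('k, 'r, 'y) module_scheme" and S :: "('k, 's, 'z) module_scheme"
    and \<epsilon> :: "'r \<Rightarrow> 'k" and \<delta> :: "'s \<Rightarrow> 'k" +
  fixes b c :: "int \<Rightarrow> nat"
  assumes b_neg: "i < 0 \<Longrightarrow> b i = 0" and c_neg: "i < 0 \<Longrightarrow> c i = 0"
begin

abbreviation "V i \<equiv> pow_module R {..<b i}"
abbreviation "W j \<equiv> pow_module S {..<c j}"
abbreviation "VR i \<equiv> pow_module (regular_module R) {..<b i}"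
abbreviation "WS j \<equiv> pow_module (regular_module S) {..<c j}"

text \<open>Indexes the basis of the degree \<open>n\<close> part of a tensor product of complexes:
  a basis vector of degree \<open>i\<close> in the left factor and one of degree
  \<open>n - i\<close> in the right. The bounds on \<open>i\<close> make the set finite and lose
  nothing, as the ranks vanish in negative degrees.\<close>

definition Zs :: "int \<Rightarrow> (int \<times> nat \<times> nat) set"
  where "Zs n = (SIGMA i:{0..n}. {..<b i} \<times> {..<c (n - i)})"

lemma finite_Zs [simp]: "finite (Zs n)"
  by (simp add: Zs_def)

lemma mem_Zs: "(i, x, y) \<in> Zs n \<longleftrightarrow> x < b i \<and> y < c (n - i)"
proof -
  have "0 \<le> i" if "x < b i" using b_neg[of i] that by (cases "0 \<le> i") auto
  moreover have "i \<le> n" if "y < c (n - i)" using c_neg[of "n - i"] that by (cases "i \<le> n") auto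
  ultimately show ?thesis by (auto simp: Zs_def)
qed

text \<open>The direct sum over \<open>i\<close> of \<open>V i \<otimes>\<^sub>K W (n - i)\<close>,
  modelled as the free module over \<open>A\<close> on its basis. Thus only the two algebras are
  tensored as a quotient, never the modules.\<close>

abbreviation "T n \<equiv> pow_module (regular_module A) (Zs n)"

lemma module_T: "module A (T n)"
  by (rule module_pow_module[OF module_regular_module[OF cring_A]])

lemma abelian_T: "abelian_group (T n)"
  by (rule module_imp_abelian_group[OF module_T])

lemma module_V: "module K (V i)" and module_W: "module K (W j)"
  by (rule module_pow_module[OF R.module_axioms] module_pow_module[OF S.module_axioms])+

lemma module_VR: "module R (VR i)" and module_WS: "module S (WS j)"
  by (rule module_pow_module[OF module_regular_module] R.is_cring S.is_cring)+

lemma abelian_V: "abelian_group (V i)" and abelian_W: "abelian_group (W j)"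
  by (rule module_imp_abelian_group module_V module_W)+

lemmas abelian_A = A.abelian_group_axioms

text \<open>The pure tensor \<open>v \<otimes> w\<close> in the summand with left degree
  \<open>i\<close>, written in coordinates.\<close>

definition gen :: "int \<Rightarrow> int \<Rightarrow> (nat \<Rightarrow> 'r) \<Rightarrow> (nat \<Rightarrow> 's) \<Rightarrow> int \<times> nat \<times> nat \<Rightarrow> ('r \<times> 's \<Rightarrow>\<^sub>0 int) set"
  where "gen n i v w = (\<lambda>(i', x, y)\<in>Zs n. if i' = i then tens (v x) (w y) else \<zero>\<^bsub>A\<^esub>)"

lemma gen_apply: "(i', x, y) \<in> Zs n \<Longrightarrow> gen n i v w (i', x, y) = (if i' = i then tens (v x) (w y) else \<zero>\<^bsub>A\<^esub>)"
  by (simp add: gen_def)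

lemma V_mem: "v \<in> carrier (V i) \<Longrightarrow> x < b i \<Longrightarrow> v x \<in> carrier R"
  and W_mem: "w \<in> carrier (W j) \<Longrightarrow> x < c j \<Longrightarrow> w x \<in> carrier S"
  by (erule pow_module_mem, simp)+

lemma V_apply:
  "x < b i \<Longrightarrow> (v \<oplus>\<^bsub>V i\<^esub> v') x = v x \<oplus>\<^bsub>R\<^esub> v' x"
  "x < b i \<Longrightarrow> (k \<odot>\<^bsub>V i\<^esub> v) x = k \<odot>\<^bsub>R\<^esub> v x"
  "x < b i \<Longrightarrow> (r \<odot>\<^bsub>VR i\<^esub> v) x = r \<otimes>\<^bsub>R\<^esub> v x"
  by (simp_all add: pow_module_simps)

lemma W_apply:
  "x < c j \<Longrightarrow> (w \<oplus>\<^bsub>W j\<^esub> w') x = w x \<oplus>\<^bsub>S\<^esub> w' x"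
  "x < c j \<Longrightarrow> (k \<odot>\<^bsub>W j\<^esub> w) x = k \<odot>\<^bsub>S\<^esub> w x"
  "x < c j \<Longrightarrow> (s \<odot>\<^bsub>WS j\<^esub> w) x = s \<otimes>\<^bsub>S\<^esub> w x"
  by (simp_all add: pow_module_simps)

lemma gen_closed [simp]:
  assumes "v \<in> carrier (V i)" "w \<in> carrier (W (n - i))"
  shows "gen n i v w \<in> carrier (T n)"
  using V_mem[OF assms(1)] W_mem[OF assms(2)]
  by (auto simp: pow_module_simps gen_def mem_Zs)

lemma T_eqI:
  assumes "z \<in> carrier (T n)" "z' \<in> carrier (T n)" "\<And>i x y. (i, x, y) \<in> Zs n \<Longrightarrow> z (i, x, y) = z' (i, x, y)"
  shows "z = z'"
  using assms by (intro pow_module_eqI[of z "regular_module A" "Zs n" z']) auto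

lemma T_add: "p \<in> Zs n \<Longrightarrow> (z \<oplus>\<^bsub>T n\<^esub> z') p = z p \<oplus>\<^bsub>A\<^esub> z' p"
  by (simp add: pow_module_simps)

lemma T_smult: "p \<in> Zs n \<Longrightarrow> (a \<odot>\<^bsub>T n\<^esub> z) p = a \<otimes>\<^bsub>A\<^esub> z p"
  by (simp add: pow_module_simps)

lemma V_add_closed [simp]: "v \<in> carrier (V i) \<Longrightarrow> v' \<in> carrier (V i) \<Longrightarrow> v \<oplus>\<^bsub>V i\<^esub> v' \<in> carrier (V i)"
  and W_add_closed [simp]: "w \<in> carrier (W j) \<Longrightarrow> w' \<in> carrier (W j) \<Longrightarrow> w \<oplus>\<^bsub>W j\<^esub> w' \<in> carrier (W j)"
  and T_add_closed [simp]: "z \<in> carrier (T n) \<Longrightarrow> z' \<in> carrier (T n) \<Longrightarrow> z \<oplus>\<^bsub>T n\<^esub> z' \<in> carrier (T n)"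
  and V_zero_closed [simp]: "\<zero>\<^bsub>V i\<^esub> \<in> carrier (V i)"
  and W_zero_closed [simp]: "\<zero>\<^bsub>W j\<^esub> \<in> carrier (W j)"
  and T_zero_closed [simp]: "\<zero>\<^bsub>T n\<^esub> \<in> carrier (T n)"
  by (rule abelian_groupE(1,2)[OF abelian_V] abelian_groupE(1,2)[OF abelian_W] abelian_groupE(1,2)[OF abelian_T]; assumption)+

lemma VR_smult_closed [simp]: "r \<in> carrier R \<Longrightarrow> v \<in> carrier (V i) \<Longrightarrow> r \<odot>\<^bsub>VR i\<^esub> v \<in> carrier (V i)"
  and WS_smult_closed [simp]: "s \<in> carrier S \<Longrightarrow> w \<in> carrier (W j) \<Longrightarrow> s \<odot>\<^bsub>WS j\<^esub> w \<in> carrier (W j)"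
  using module.smult_closed[OF module_VR, of r v i] module.smult_closed[OF module_WS, of s w j] by simp_all

lemma V_smult_closed [simp]: "r \<in> carrier K \<Longrightarrow> v \<in> carrier (V i) \<Longrightarrow> r \<odot>\<^bsub>V i\<^esub> v \<in> carrier (V i)"
  and W_smult_closed [simp]: "r \<in> carrier K \<Longrightarrow> w \<in> carrier (W j) \<Longrightarrow> r \<odot>\<^bsub>W j\<^esub> w \<in> carrier (W j)"
  and T_smult_closed [simp]: "a \<in> carrier A \<Longrightarrow> z \<in> carrier (T n) \<Longrightarrow> a \<odot>\<^bsub>T n\<^esub> z \<in> carrier (T n)"
  by (rule module.smult_closed[OF module_V] module.smult_closed[OF module_W] module.smult_closed[OF module_T]; assumption)+

lemma gen_add_left:
  assumes "v \<in> carrier (V i)" "v' \<in> carrier (V i)" "w \<in> carrier (W (n - i))"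
  shows "gen n i (v \<oplus>\<^bsub>V i\<^esub> v') w = gen n i v w \<oplus>\<^bsub>T n\<^esub> gen n i v' w"
  using assms
  by (intro T_eqI[where n = n]) (auto simp: T_add gen_apply mem_Zs V_apply W_apply V_mem W_mem tens_add_left)

lemma gen_add_right:
  assumes "v \<in> carrier (V i)" "w \<in> carrier (W (n - i))" "w' \<in> carrier (W (n - i))"
  shows "gen n i v (w \<oplus>\<^bsub>W (n - i)\<^esub> w') = gen n i v w \<oplus>\<^bsub>T n\<^esub> gen n i v w'"
  using assms
  by (intro T_eqI[where n = n]) (auto simp: T_add gen_apply mem_Zs V_apply W_apply V_mem W_mem tens_add_right)

lemma gen_smult:
  assumes "r \<in> carrier R" "s \<in> carrier S" "v \<in> carrier (V i)" "w \<in> carrier (W (n - i))"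
  shows "gen n i (r \<odot>\<^bsub>VR i\<^esub> v) (s \<odot>\<^bsub>WS (n - i)\<^esub> w) = tens r s \<odot>\<^bsub>T n\<^esub> gen n i v w"
  using assms
  by (intro T_eqI[where n = n]) (auto simp: T_smult gen_apply mem_Zs V_apply W_apply V_mem W_mem tens_mult)

lemma gen_balanced:
  assumes "k \<in> carrier K" "v \<in> carrier (V i)" "w \<in> carrier (W (n - i))"
  shows "gen n i (k \<odot>\<^bsub>V i\<^esub> v) w = gen n i v (k \<odot>\<^bsub>W (n - i)\<^esub> w)"
  using assms
  by (intro T_eqI[where n = n]) (auto simp: gen_apply mem_Zs V_apply W_apply V_mem W_mem tens_smult)

lemma gen_zero_left [simp]: "w \<in> carrier (W (n - i)) \<Longrightarrow> gen n i \<zero>\<^bsub>V i\<^esub> w = \<zero>\<^bsub>T n\<^esub>"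
  by (rule additive_zero[OF abelian_V abelian_T]) (auto simp: gen_add_left)

lemma gen_zero_right [simp]: "v \<in> carrier (V i) \<Longrightarrow> gen n i v \<zero>\<^bsub>W (n - i)\<^esub> = \<zero>\<^bsub>T n\<^esub>"
  by (rule additive_zero[OF abelian_W abelian_T]) (auto simp: gen_add_right)

lemma gen_minus_left: "v \<in> carrier (V i) \<Longrightarrow> w \<in> carrier (W (n - i)) \<Longrightarrow> gen n i (\<ominus>\<^bsub>V i\<^esub> v) w = \<ominus>\<^bsub>T n\<^esub> gen n i v w"
  by (rule additive_a_inv[OF abelian_V abelian_T]) (auto simp: gen_add_left)

lemma gen_minus_right: "v \<in> carrier (V i) \<Longrightarrow> w \<in> carrier (W (n - i)) \<Longrightarrow> gen n i v (\<ominus>\<^bsub>W (n - i)\<^esub> w) = \<ominus>\<^bsub>T n\<^esub> gen n i v w"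
  by (rule additive_a_inv[OF abelian_W abelian_T]) (auto simp: gen_add_right)

lemma gen_single:
  assumes "(i, x, y) \<in> Zs n" "r \<in> carrier R" "s \<in> carrier S"
  shows "gen n i (single R {..<b i} x r) (single S {..<c (n - i)} y s) = single A (Zs n) (i, x, y) (tens r s)"
proof (rule extensionalityI[of _ "Zs n"])
  fix p assume p: "p \<in> Zs n"
  obtain i' x' y' where p': "p = (i', x', y')" by (cases p)
  have "gen n i (single R {..<b i} x r) (single S {..<c (n - i)} y s) p =
      (if i' = i then tens (if x' = x then r else \<zero>\<^bsub>R\<^esub>) (if y' = y then s else \<zero>\<^bsub>S\<^esub>) else \<zero>\<^bsub>A\<^esub>)"
    using p by (cases "i' = i") (simp_all add: p' gen_apply single_apply mem_Zs)
  then show "gen n i (single R {..<b i} x r) (single S {..<c (n - i)} y s) p = single A (Zs n) (i, x, y) (tens r s) p"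
    using assms(2,3) p by (simp add: p' single_apply tens_zero_left tens_zero_right)
qed (simp_all add: gen_def single_def)

lemma single_T_closed [simp]: "a \<in> carrier A \<Longrightarrow> single A (Zs n) p a \<in> carrier (T n)"
  using abelian_groupE(2)[OF abelian_A] by (auto simp: single_def pow_module_simps)

lemma single_T_add: "a \<in> carrier A \<Longrightarrow> a' \<in> carrier A \<Longrightarrow>
    single A (Zs n) p (a \<oplus>\<^bsub>A\<^esub> a') = single A (Zs n) p a \<oplus>\<^bsub>T n\<^esub> single A (Zs n) p a'"
  by (auto simp: single_def pow_module_simps intro!: restrict_ext)

lemma single_regular: "single (regular_module A) J = single A J"
  by (simp add: single_def fun_eq_iff)

text \<open>Pure tensors generate additively: each element is a sum of coordinate vectors, and the
  entries in \<open>A\<close> are themselves sums of pure tensors.\<close>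

lemma T_induct [consumes 1, case_names gen add]:
  assumes z: "z \<in> carrier (T n)"
    and gen: "\<And>i v w. \<lbrakk>v \<in> carrier (V i); w \<in> carrier (W (n - i))\<rbrakk> \<Longrightarrow> P (gen n i v w)"
    and add: "\<And>z z'. \<lbrakk>z \<in> carrier (T n); z' \<in> carrier (T n); P z; P z'\<rbrakk> \<Longrightarrow> P (z \<oplus>\<^bsub>T n\<^esub> z')"
  shows "P z"
  using module_imp_abelian_group[OF module_regular_module[OF cring_A]] finite_Zs z
proof (induction z rule: pow_module_induct)
  case zero
  have "P (gen n 0 \<zero>\<^bsub>V 0\<^esub> \<zero>\<^bsub>W (n - 0)\<^esub>)" by (rule gen) simp_all
  then show ?case by simp
next
  case (single p a)
  obtain i x y where p: "p = (i, x, y)" by (cases p)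
  from single(2) have a: "a \<in> carrier A" by simp
  have "P (single A (Zs n) p a)"
    using a
  proof (induction a rule: tensor_induct)
    case (tens r s)
    have "P (gen n i (single R {..<b i} x r) (single S {..<c (n - i)} y s))"
      by (rule gen) (use tens R.abelian_group_axioms S.abelian_group_axioms in simp_all)
    then show ?case using gen_single single(1) tens by (simp add: p)
  next
    case (add a a')
    then show ?case using assms(3) by (simp add: single_T_add)
  qed
  then show ?case by (simp add: single_regular)
qed (rule add)

lemma T_ext:
  assumes G: "abelian_group G" and f: "\<And>z. z \<in> carrier (T n) \<Longrightarrow> f z \<in> carrier G"
    "\<And>z z'. \<lbrakk>z \<in> carrier (T n); z' \<in> carrier (T n)\<rbrakk> \<Longrightarrow> f (z \<oplus>\<^bsub>T n\<^esub> z') = f z \<oplus>\<^bsub>G\<^esub> f z'"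
    and g: "\<And>z z'. \<lbrakk>z \<in> carrier (T n); z' \<in> carrier (T n)\<rbrakk> \<Longrightarrow> g (z \<oplus>\<^bsub>T n\<^esub> z') = g z \<oplus>\<^bsub>G\<^esub> g z'"
    and fg: "\<And>i v w. \<lbrakk>v \<in> carrier (V i); w \<in> carrier (W (n - i))\<rbrakk> \<Longrightarrow> f (gen n i v w) = g (gen n i v w)"
    and z: "z \<in> carrier (T n)"
  shows "f z = g z"
  using z by (induction z rule: T_induct) (simp_all add: f(2) g fg)

text \<open>The input for an additive map out of \<open>T n\<close>: one K-balanced biadditive map
  on \<open>V i \<times> W (n - i)\<close> for each \<open>i\<close>.\<close>

definition balanced_family :: "int \<Rightarrow> ('g, 'u) ring_scheme \<Rightarrow> (int \<Rightarrow> (nat \<Rightarrow> 'r) \<Rightarrow> (nat \<Rightarrow> 's) \<Rightarrow> 'g) \<Rightarrow> bool"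
  where "balanced_family n G B \<longleftrightarrow>
    (\<forall>i. \<forall>v\<in>carrier (V i). \<forall>w\<in>carrier (W (n - i)). B i v w \<in> carrier G) \<and>
    (\<forall>i. \<forall>v\<in>carrier (V i). \<forall>v'\<in>carrier (V i). \<forall>w\<in>carrier (W (n - i)). B i (v \<oplus>\<^bsub>V i\<^esub> v') w = B i v w \<oplus>\<^bsub>G\<^esub> B i v' w) \<and>
    (\<forall>i. \<forall>v\<in>carrier (V i). \<forall>w\<in>carrier (W (n - i)). \<forall>w'\<in>carrier (W (n - i)). B i v (w \<oplus>\<^bsub>W (n - i)\<^esub> w') = B i v w \<oplus>\<^bsub>G\<^esub> B i v w') \<and>
    (\<forall>i. \<forall>k\<in>carrier K. \<forall>v\<in>carrier (V i). \<forall>w\<in>carrier (W (n - i)). B i (k \<odot>\<^bsub>V i\<^esub> v) w = B i v (k \<odot>\<^bsub>W (n - i)\<^esub> w))"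

lemma balanced_familyI:
  assumes "\<And>i v w. \<lbrakk>v \<in> carrier (V i); w \<in> carrier (W (n - i))\<rbrakk> \<Longrightarrow> B i v w \<in> carrier G"
    "\<And>i v v' w. \<lbrakk>v \<in> carrier (V i); v' \<in> carrier (V i); w \<in> carrier (W (n - i))\<rbrakk> \<Longrightarrow> B i (v \<oplus>\<^bsub>V i\<^esub> v') w = B i v w \<oplus>\<^bsub>G\<^esub> B i v' w"
    "\<And>i v w w'. \<lbrakk>v \<in> carrier (V i); w \<in> carrier (W (n - i)); w' \<in> carrier (W (n - i))\<rbrakk> \<Longrightarrow> B i v (w \<oplus>\<^bsub>W (n - i)\<^esub> w') = B i v w \<oplus>\<^bsub>G\<^esub> B i v w'"
    "\<And>i k v w. \<lbrakk>k \<in> carrier K; v \<in> carrier (V i); w \<in> carrier (W (n - i))\<rbrakk> \<Longrightarrow> B i (k \<odot>\<^bsub>V i\<^esub> v) w = B i v (k \<odot>\<^bsub>W (n - i)\<^esub> w)"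
  shows "balanced_family n G B"
  using assms by (simp add: balanced_family_def)

lemma balanced_familyD:
  assumes "balanced_family n G B"
  shows "\<lbrakk>v \<in> carrier (V i); w \<in> carrier (W (n - i))\<rbrakk> \<Longrightarrow> B i v w \<in> carrier G"
    "\<lbrakk>v \<in> carrier (V i); v' \<in> carrier (V i); w \<in> carrier (W (n - i))\<rbrakk> \<Longrightarrow> B i (v \<oplus>\<^bsub>V i\<^esub> v') w = B i v w \<oplus>\<^bsub>G\<^esub> B i v' w"
    "\<lbrakk>v \<in> carrier (V i); w \<in> carrier (W (n - i)); w' \<in> carrier (W (n - i))\<rbrakk> \<Longrightarrow> B i v (w \<oplus>\<^bsub>W (n - i)\<^esub> w') = B i v w \<oplus>\<^bsub>G\<^esub> B i v w'"
    "\<lbrakk>k \<in> carrier K; v \<in> carrier (V i); w \<in> carrier (W (n - i))\<rbrakk> \<Longrightarrow> B i (k \<odot>\<^bsub>V i\<^esub> v) w = B i v (k \<odot>\<^bsub>W (n - i)\<^esub> w)"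
  using assms by (simp_all add: balanced_family_def)

text \<open>On the coordinate with index \<open>(i, x, y)\<close> the family restricts to a balanced
  map on \<open>R \<times> S\<close>, which factors through \<open>A\<close>. The map sought is the
  sum of these over the finitely many coordinates.\<close>

lemma T_universal:
  assumes G: "abelian_group G" and B: "balanced_family n G B"
  obtains f where "\<And>z. z \<in> carrier (T n) \<Longrightarrow> f z \<in> carrier G"
    "\<And>z z'. \<lbrakk>z \<in> carrier (T n); z' \<in> carrier (T n)\<rbrakk> \<Longrightarrow> f (z \<oplus>\<^bsub>T n\<^esub> z') = f z \<oplus>\<^bsub>G\<^esub> f z'"
    "\<And>i v w. \<lbrakk>v \<in> carrier (V i); w \<in> carrier (W (n - i))\<rbrakk> \<Longrightarrow> f (gen n i v w) = B i v w"
proof -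
  interpret G: abelian_group G by fact
  note BD = balanced_familyD[OF B]
  let ?s = "\<lambda>i x r. single R {..<b i} x r" and ?t = "\<lambda>i y s. single S {..<c (n - i)} y s"
  have sc: "r \<in> carrier R \<Longrightarrow> ?s i x r \<in> carrier (V i)" and tc: "s \<in> carrier S \<Longrightarrow> ?t i x s \<in> carrier (W (n - i))" for i x r s
    by (simp_all add: R.abelian_group_axioms S.abelian_group_axioms)
  have "\<exists>h. (\<forall>a\<in>carrier A. h a \<in> carrier G) \<and> (\<forall>a\<in>carrier A. \<forall>a'\<in>carrier A. h (a \<oplus>\<^bsub>A\<^esub> a') = h a \<oplus>\<^bsub>G\<^esub> h a') \<and>
     (\<forall>r\<in>carrier R. \<forall>s\<in>carrier S. h (tens r s) = B (fst p) (?s (fst p) (fst (snd p)) r) (?t (fst p) (snd (snd p)) s))" for p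
  proof -
    obtain i x y where p: "p = (i, x, y)" by (cases p)
    obtain h where h: "\<And>a. a \<in> carrier A \<Longrightarrow> h a \<in> carrier G"
      "\<And>a a'. \<lbrakk>a \<in> carrier A; a' \<in> carrier A\<rbrakk> \<Longrightarrow> h (a \<oplus>\<^bsub>A\<^esub> a') = h a \<oplus>\<^bsub>G\<^esub> h a'"
      "\<And>r s. \<lbrakk>r \<in> carrier R; s \<in> carrier S\<rbrakk> \<Longrightarrow> h (tens r s) = B i (?s i x r) (?t i y s)"
    proof (rule tensor_universal[OF G, of "\<lambda>r s. B i (?s i x r) (?t i y s)"])
      show "B i (?s i x (k \<odot>\<^bsub>R\<^esub> r)) (?t i y s) = B i (?s i x r) (?t i y (k \<odot>\<^bsub>S\<^esub> s))"
        if k: "k \<in> carrier K" "r \<in> carrier R" "s \<in> carrier S" for k r s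
        unfolding single_smult[OF R.module_axioms k(1,2)] single_smult[OF S.module_axioms k(1,3)]
        by (rule BD(4)[OF k(1) sc[OF k(2)] tc[OF k(3)]])
    qed (auto simp: BD(1-3) sc tc single_add R.abelian_group_axioms S.abelian_group_axioms)
    then show ?thesis by (intro exI[of _ h]) (simp add: p)
  qed
  then obtain h where h: "\<And>p a. a \<in> carrier A \<Longrightarrow> h p a \<in> carrier G"
     "\<And>p a a'. \<lbrakk>a \<in> carrier A; a' \<in> carrier A\<rbrakk> \<Longrightarrow> h p (a \<oplus>\<^bsub>A\<^esub> a') = h p a \<oplus>\<^bsub>G\<^esub> h p a'"
     "\<And>p r s. \<lbrakk>r \<in> carrier R; s \<in> carrier S\<rbrakk> \<Longrightarrow> h p (tens r s) = B (fst p) (?s (fst p) (fst (snd p)) r) (?t (fst p) (snd (snd p)) s)"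
    by metis
  have h0: "h p \<zero>\<^bsub>A\<^esub> = \<zero>\<^bsub>G\<^esub>" for p
    using additive_zero[OF abelian_A G, of "h p"] h(1,2) by blast
  define f where "f z = (\<Oplus>\<^bsub>G\<^esub>p\<in>Zs n. h p (z p))" for z
  have zc: "z p \<in> carrier A" if "z \<in> carrier (T n)" "p \<in> Zs n" for z p
    using pow_module_mem[OF that] by simp
  have f: "f z \<in> carrier G" if "z \<in> carrier (T n)" for z
    unfolding f_def using h(1) zc[OF that] by (intro G.finsum_closed) auto
  have fa: "f (z \<oplus>\<^bsub>T n\<^esub> z') = f z \<oplus>\<^bsub>G\<^esub> f z'" if "z \<in> carrier (T n)" "z' \<in> carrier (T n)" for z z'
  proof -
    have "f (z \<oplus>\<^bsub>T n\<^esub> z') = (\<Oplus>\<^bsub>G\<^esub>p\<in>Zs n. h p (z p) \<oplus>\<^bsub>G\<^esub> h p (z' p))"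
      unfolding f_def using h(1,2) zc[OF that(1)] zc[OF that(2)] by (intro G.finsum_cong') (auto simp: T_add)
    then show ?thesis unfolding f_def using h(1) zc[OF that(1)] zc[OF that(2)] by (subst (asm) G.finsum_addf) auto
  qed
  have f0: "f \<zero>\<^bsub>T n\<^esub> = \<zero>\<^bsub>G\<^esub>" using additive_zero[OF abelian_T G, of n f] f fa by blast
  have fs: "f (single A (Zs n) p (tens r s)) = B (fst p) (?s (fst p) (fst (snd p)) r) (?t (fst p) (snd (snd p)) s)"
    if p: "p \<in> Zs n" and rs: "r \<in> carrier R" "s \<in> carrier S" for p r s
  proof -
    have "f (single A (Zs n) p (tens r s)) = (\<Oplus>\<^bsub>G\<^esub>p'\<in>Zs n. if p = p' then h p (tens r s) else \<zero>\<^bsub>G\<^esub>)"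
      unfolding f_def using h(1) rs by (intro G.finsum_cong') (auto simp: single_apply h0)
    also have "\<dots> = h p (tens r s)" using rs h(1) by (intro finsum_delta[OF G finite_Zs p]) simp
    finally show ?thesis using h(3) rs by simp
  qed
  \<comment> \<open>By biadditivity the equation is checked on coordinate vectors, first in the left
    argument and then in the right.\<close>
  have fgen: "f (gen n i v w) = B i v w" if v: "v \<in> carrier (V i)" and w: "w \<in> carrier (W (n - i))" for i v w
    using R.abelian_group_axioms finite_lessThan v
  proof (induction v rule: pow_module_induct)
    case zero
    have "B i \<zero>\<^bsub>V i\<^esub> w = \<zero>\<^bsub>G\<^esub>"
      by (rule additive_zero[OF abelian_V G, of i "\<lambda>v. B i v w"]) (auto simp: BD w)
    then show ?case using w f0 by simp
  next
    case (add v v')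
    then show ?case using w by (simp add: gen_add_left fa BD(2))
  next
    case (single x r)
    note x = this
    show ?case
      using S.abelian_group_axioms finite_lessThan w
    proof (induction w rule: pow_module_induct)
      case zero
      have "B i (?s i x r) \<zero>\<^bsub>W (n - i)\<^esub> = \<zero>\<^bsub>G\<^esub>"
        by (rule additive_zero[OF abelian_W G, of "n - i" "\<lambda>w. B i (?s i x r) w"]) (auto simp: BD sc x(2))
      then show ?case using sc[OF x(2)] f0 by simp
    next
      case (single y s)
      have p: "(i, x, y) \<in> Zs n" using x single by (simp add: mem_Zs)
      show ?case using fs[OF p x(2) single(2)] by (simp add: gen_single[OF p x(2) single(2)])
    next
      case (add w w')
      then show ?case using sc[OF x(2)] by (simp add: gen_add_right fa BD(3))
    qed
  qed
  show thesis using f fa fgen by (rule that)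
qed

text \<open>Linearity over \<open>R\<close> and \<open>S\<close> implies balance over
  \<open>K\<close>: a scalar acts through its multiple of 1 in either factor, and both multiples
  give the same tensor by \<open>tens_smult\<close>. Linearity over \<open>A\<close> is then checked
  on pure tensors.\<close>

lemma T_hom:
  assumes M: "module A M" and B: "\<And>i v w. \<lbrakk>v \<in> carrier (V i); w \<in> carrier (W (n - i))\<rbrakk> \<Longrightarrow> B i v w \<in> carrier M"
    "\<And>i v v' w. \<lbrakk>v \<in> carrier (V i); v' \<in> carrier (V i); w \<in> carrier (W (n - i))\<rbrakk> \<Longrightarrow> B i (v \<oplus>\<^bsub>V i\<^esub> v') w = B i v w \<oplus>\<^bsub>M\<^esub> B i v' w"
    "\<And>i v w w'. \<lbrakk>v \<in> carrier (V i); w \<in> carrier (W (n - i)); w' \<in> carrier (W (n - i))\<rbrakk> \<Longrightarrow> B i v (w \<oplus>\<^bsub>W (n - i)\<^esub> w') = B i v w \<oplus>\<^bsub>M\<^esub> B i v w'"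
    and lin: "\<And>i r s v w. \<lbrakk>r \<in> carrier R; s \<in> carrier S; v \<in> carrier (V i); w \<in> carrier (W (n - i))\<rbrakk> \<Longrightarrow>
      B i (r \<odot>\<^bsub>VR i\<^esub> v) (s \<odot>\<^bsub>WS (n - i)\<^esub> w) = tens r s \<odot>\<^bsub>M\<^esub> B i v w"
  obtains f where "f \<in> mod_hom A (T n) M"
    "\<And>i v w. \<lbrakk>v \<in> carrier (V i); w \<in> carrier (W (n - i))\<rbrakk> \<Longrightarrow> f (gen n i v w) = B i v w"
proof -
  note MG = module_imp_abelian_group[OF M]
  have one_smult: "\<one>\<^bsub>R\<^esub> \<odot>\<^bsub>VR i\<^esub> v = v" "\<one>\<^bsub>S\<^esub> \<odot>\<^bsub>WS j\<^esub> w = w" if "v \<in> carrier (V i)" "w \<in> carrier (W j)" for i j v w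
    using module.smult_one[OF module_VR, of v i] module.smult_one[OF module_WS, of w j] that by simp_all
  have k_smult: "k \<odot>\<^bsub>V i\<^esub> v = (k \<odot>\<^bsub>R\<^esub> \<one>\<^bsub>R\<^esub>) \<odot>\<^bsub>VR i\<^esub> v" "k \<odot>\<^bsub>W j\<^esub> w = (k \<odot>\<^bsub>S\<^esub> \<one>\<^bsub>S\<^esub>) \<odot>\<^bsub>WS j\<^esub> w"
    if "k \<in> carrier K" "v \<in> carrier (V i)" "w \<in> carrier (W j)" for k i j v w
    unfolding pow_module_simps(4) using that V_mem[OF that(2)] W_mem[OF that(3)]
    by (auto intro!: restrict_ext simp: R.smult_assoc2 S.smult_assoc2)
  have "balanced_family n M B"
  proof (rule balanced_familyI)
    show "B i (k \<odot>\<^bsub>V i\<^esub> v) w = B i v (k \<odot>\<^bsub>W (n - i)\<^esub> w)"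
      if k: "k \<in> carrier K" and v: "v \<in> carrier (V i)" "w \<in> carrier (W (n - i))" for i k v w
      using lin[of "k \<odot>\<^bsub>R\<^esub> \<one>\<^bsub>R\<^esub>" "\<one>\<^bsub>S\<^esub>" v i w] lin[of "\<one>\<^bsub>R\<^esub>" "k \<odot>\<^bsub>S\<^esub> \<one>\<^bsub>S\<^esub>" v i w] k v
      by (simp add: k_smult[OF k v] one_smult[OF v] tens_smult)
  qed (use B in auto)
  then obtain f where f: "\<And>z. z \<in> carrier (T n) \<Longrightarrow> f z \<in> carrier M"
    "\<And>z z'. \<lbrakk>z \<in> carrier (T n); z' \<in> carrier (T n)\<rbrakk> \<Longrightarrow> f (z \<oplus>\<^bsub>T n\<^esub> z') = f z \<oplus>\<^bsub>M\<^esub> f z'"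
    "\<And>i v w. \<lbrakk>v \<in> carrier (V i); w \<in> carrier (W (n - i))\<rbrakk> \<Longrightarrow> f (gen n i v w) = B i v w"
    by (rule T_universal[OF MG]) (rule that)
  have fl: "f (a \<odot>\<^bsub>T n\<^esub> z) = a \<odot>\<^bsub>M\<^esub> f z" if a: "a \<in> carrier A" and z: "z \<in> carrier (T n)" for a z
    using z
  proof (induction z rule: T_induct)
    case (gen i v w)
    from a show ?case
    proof (induction a rule: tensor_induct)
      case (tens r s)
      then show ?case using gen by (simp add: f(3) lin flip: gen_smult)
    next
      case (add a a')
      then show ?case
        using gen f(1) by (simp add: module.smult_l_distr[OF module_T] module.smult_l_distr[OF M] f(2))
    qed
  next
    case (add z z')
    then show ?case
      using a f(1) by (simp add: module.smult_r_distr[OF module_T] module.smult_r_distr[OF M] f(2))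
  qed
  have "restrict f (carrier (T n)) \<in> mod_hom A (T n) M"
    by (rule mod_hom_restrictI[OF module_T]) (simp_all add: f(1,2) fl)
  then show thesis by (rule that) (simp add: f(3))
qed

end

section \<open>The Kuenneth homotopy\<close>

lemma
  assumes "abelian_group M"
  shows sg_closed: "x \<in> carrier M \<Longrightarrow> sg M k x \<in> carrier M"
    and sg_add: "x \<in> carrier M \<Longrightarrow> y \<in> carrier M \<Longrightarrow> sg M k (x \<oplus>\<^bsub>M\<^esub> y) = sg M k x \<oplus>\<^bsub>M\<^esub> sg M k y"
    and sg_sg: "x \<in> carrier M \<Longrightarrow> sg M k (sg M l x) = sg M (k + l) x"
    and sg_zero: "sg M k \<zero>\<^bsub>M\<^esub> = \<zero>\<^bsub>M\<^esub>"
proof -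
  interpret M: abelian_group M by fact
  show "x \<in> carrier M \<Longrightarrow> sg M k x \<in> carrier M" by (simp add: sg_def)
  show "x \<in> carrier M \<Longrightarrow> y \<in> carrier M \<Longrightarrow> sg M k (x \<oplus>\<^bsub>M\<^esub> y) = sg M k x \<oplus>\<^bsub>M\<^esub> sg M k y"
    by (simp add: sg_def M.minus_add)
  show "x \<in> carrier M \<Longrightarrow> sg M k (sg M l x) = sg M (k + l) x" by (simp add: sg_def)
  show "sg M k \<zero>\<^bsub>M\<^esub> = \<zero>\<^bsub>M\<^esub>" by (simp add: sg_def abelian_group_uminus_zero[OF M.abelian_group_axioms])
qed

lemma sg_even: "even k \<Longrightarrow> sg M k x = x"
  by (simp add: sg_def)

lemma sg_cong: "even (k - l) \<Longrightarrow> sg M k x = sg M l x"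
  by (auto simp: sg_def)

lemma sg_cancel:
  assumes "abelian_group M" "x \<in> carrier M" "odd (k - l)"
  shows "sg M k x \<oplus>\<^bsub>M\<^esub> sg M l x = \<zero>\<^bsub>M\<^esub>"
proof -
  interpret M: abelian_group M by fact
  show ?thesis using assms(2,3) by (auto simp: sg_def M.l_neg M.r_neg)
qed

lemma sg_smult:
  assumes "module A M" "a \<in> carrier A" "x \<in> carrier M"
  shows "sg M k (a \<odot>\<^bsub>M\<^esub> x) = a \<odot>\<^bsub>M\<^esub> sg M k x"
proof -
  interpret M: module A M by fact
  show ?thesis using assms(2,3) by (simp add: sg_def M.smult_r_minus)
qed

lemma additive_sg:
  assumes "abelian_group M" "abelian_group N"
    "\<And>x. x \<in> carrier M \<Longrightarrow> f x \<in> carrier N"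
    "\<And>x y. \<lbrakk>x \<in> carrier M; y \<in> carrier M\<rbrakk> \<Longrightarrow> f (x \<oplus>\<^bsub>M\<^esub> y) = f x \<oplus>\<^bsub>N\<^esub> f y"
    "x \<in> carrier M"
  shows "f (sg M k x) = sg N k (f x)"
  using additive_a_inv[of M N f x] assms by (simp add: sg_def)

lemma mod_hom_sg:
  assumes "f \<in> mod_hom A M N" "abelian_group M" "abelian_group N" "x \<in> carrier M"
  shows "f (sg M k x) = sg N k (f x)"
  using mod_hom_a_inv[OF assms] by (simp add: sg_def)

text \<open>If \<open>d h d = d\<close>, then \<open>e = 1 - d h - h d\<close> vanishes on boundaries and has values in the cycles.\<close>

lemma homotopy_projection:
  fixes V :: "int \<Rightarrow> ('k, 'v, 'z) module_scheme" and K :: "('k, 'x) ring_scheme"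
  assumes V: "\<And>i. module K (V i)" and d: "\<And>i. d i \<in> mod_hom K (V i) (V (i + q))"
    and dd: "\<And>i v. v \<in> carrier (V i) \<Longrightarrow> d (i + q) (d i v) = \<zero>\<^bsub>V (i + q + q)\<^esub>"
    and h: "\<And>i. h i \<in> mod_hom K (V i) (V (i - q))"
    and dhd: "\<And>i v. v \<in> carrier (V i) \<Longrightarrow> d i (h (i + q) (d i v)) = d i v"
    and e_def: "\<And>i. e i = (\<lambda>v\<in>carrier (V i). v \<ominus>\<^bsub>V i\<^esub> (d (i - q) (h i v) \<oplus>\<^bsub>V i\<^esub> h (i + q) (d i v)))"
  shows "e i \<in> mod_hom K (V i) (V i)"
    and "v \<in> carrier (V i) \<Longrightarrow> d i (e i v) = \<zero>\<^bsub>V (i + q)\<^esub>"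
    and "v \<in> carrier (V i) \<Longrightarrow> e (i + q) (d i v) = \<zero>\<^bsub>V (i + q)\<^esub>"
    and "v \<in> carrier (V i) \<Longrightarrow> v = e i v \<oplus>\<^bsub>V i\<^esub> (d (i - q) (h i v) \<oplus>\<^bsub>V i\<^esub> h (i + q) (d i v))"
proof -
  interpret V: module K "V i" for i by (rule V)
  note G = V.abelian_group_axioms
  have di: "d (i - q) \<in> mod_hom K (V (i - q)) (V i)" for i using d[of "i - q"] by simp
  have hi: "h (i + q) \<in> mod_hom K (V (i + q)) (V i)" for i using h[of "i + q"] by simp
  have c: "d (i - q) (h i v) \<in> carrier (V i)" "h (i + q) (d i v) \<in> carrier (V i)" "d i v \<in> carrier (V (i + q))"
    "h i v \<in> carrier (V (i - q))"
    if "v \<in> carrier (V i)" for i v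
    using mod_hom_closed[OF di mod_hom_closed[OF h that]] mod_hom_closed[OF hi mod_hom_closed[OF d that]]
      mod_hom_closed[OF d that] mod_hom_closed[OF h that] by simp_all
  show "e i \<in> mod_hom K (V i) (V i)" for i
    using mod_hom_diff[OF V V mod_hom_id[OF V] mod_hom_plus[OF V V mod_hom_compose[OF V h di] mod_hom_compose[OF V d hi]], of i]
    by (simp add: e_def compose_def cong: restrict_cong)
  show "v = e i v \<oplus>\<^bsub>V i\<^esub> (d (i - q) (h i v) \<oplus>\<^bsub>V i\<^esub> h (i + q) (d i v))" if v: "v \<in> carrier (V i)" for i v
    using v c[OF v] by (simp add: e_def V.minus_eq V.a_assoc V.l_neg)
  show "d i (e i v) = \<zero>\<^bsub>V (i + q)\<^esub>" if v: "v \<in> carrier (V i)" for i v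
  proof -
    have "d i (d (i - q) (h i v)) = \<zero>\<^bsub>V (i + q)\<^esub>" using dd[OF c(4)[OF v]] by simp
    then have "d i (e i v) = d i v \<ominus>\<^bsub>V (i + q)\<^esub> (\<zero>\<^bsub>V (i + q)\<^esub> \<oplus>\<^bsub>V (i + q)\<^esub> d i v)"
      using v c[OF v] mod_hom_minus[OF d G G v V.a_closed[OF c(1,2)[OF v]]]
      by (simp add: e_def mod_hom_add[OF d] dhd)
    then show ?thesis using c(3)[OF v] abelian_group_minus_eq_zero_iff[OF G] by simp
  qed
  show "e (i + q) (d i v) = \<zero>\<^bsub>V (i + q)\<^esub>" if v: "v \<in> carrier (V i)" for i v
  proof -
    have "h (i + q + q) (d (i + q) (d i v)) = \<zero>\<^bsub>V (i + q)\<^esub>"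
      unfolding dd[OF v] using mod_hom_zero[OF hi[of "i + q"] G G] .
    then have "e (i + q) (d i v) = d i v \<ominus>\<^bsub>V (i + q)\<^esub> (d i v \<oplus>\<^bsub>V (i + q)\<^esub> \<zero>\<^bsub>V (i + q)\<^esub>)"
      using c(3)[OF v] dhd[OF v] by (simp add: e_def)
    then show ?thesis using c(3)[OF v] abelian_group_minus_eq_zero_iff[OF G] by simp
  qed
qed

context tensor_modules
begin

lemma T_l_zero [simp]: "z \<in> carrier (T n) \<Longrightarrow> \<zero>\<^bsub>T n\<^esub> \<oplus>\<^bsub>T n\<^esub> z = z"
  and T_r_zero [simp]: "z \<in> carrier (T n) \<Longrightarrow> z \<oplus>\<^bsub>T n\<^esub> \<zero>\<^bsub>T n\<^esub> = z"
  by (rule abelian_monoid.l_zero[OF abelian_group.axioms(1)[OF abelian_T]], assumption)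
    (rule abelian_monoid.r_zero[OF abelian_group.axioms(1)[OF abelian_T]], assumption)

lemma balanced_family_plus:
  assumes G: "abelian_group G" and "balanced_family n G B" "balanced_family n G B'"
  shows "balanced_family n G (\<lambda>i v w. B i v w \<oplus>\<^bsub>G\<^esub> B' i v w)"
proof -
  interpret G: abelian_group G by fact
  note B = balanced_familyD[OF assms(2)] and B' = balanced_familyD[OF assms(3)]
  show ?thesis
    by (rule balanced_familyI) (simp_all add: B(1-3) B'(1-3) B(4) B'(4) G.a_ac)
qed

text \<open>Provides \<open>f \<otimes> g\<close> for K-linear maps of degrees \<open>p\<close> and
  \<open>r\<close>, with a sign exponent that depends on the left degree; Koszul signs are of this
  kind.\<close>

lemma balanced_family_gen:
  assumes f: "\<And>i. f i \<in> mod_hom K (V i) (V (i + p))" and g: "\<And>j. g j \<in> mod_hom K (W j) (W (j + r))"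
    and m: "m = n + p + r"
  shows "balanced_family n (T m) (\<lambda>i v w. sg (T m) (s i) (gen m (i + p) (f i v) (g (n - i) w)))"
proof -
  have fc: "f i v \<in> carrier (V (i + p))" if "v \<in> carrier (V i)" for i v
    by (rule mod_hom_closed[OF f that])
  have gc: "g (n - i) w \<in> carrier (W (m - (i + p)))" if "w \<in> carrier (W (n - i))" for i w
    using mod_hom_closed[OF g that] by (simp add: m algebra_simps)
  have ga: "g (n - i) (w \<oplus>\<^bsub>W (n - i)\<^esub> w') = g (n - i) w \<oplus>\<^bsub>W (m - (i + p))\<^esub> g (n - i) w'"
    if "w \<in> carrier (W (n - i))" "w' \<in> carrier (W (n - i))" for i w w'
    using mod_hom_add[OF g that] by (simp add: m algebra_simps)
  have gs: "g (n - i) (k \<odot>\<^bsub>W (n - i)\<^esub> w) = k \<odot>\<^bsub>W (m - (i + p))\<^esub> g (n - i) w"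
    if "k \<in> carrier K" "w \<in> carrier (W (n - i))" for i k w
    using mod_hom_smult[OF g that] by (simp add: m algebra_simps)
  show ?thesis
    by (rule balanced_familyI)
      (simp_all add: fc gc ga gs mod_hom_add[OF f] mod_hom_smult[OF f] sg_closed[OF abelian_T] sg_add[OF abelian_T]
        gen_add_left gen_add_right gen_balanced)
qed

definition linear_family :: "int \<Rightarrow> (('r \<times> 's \<Rightarrow>\<^sub>0 int) set, 'g, 'u) module_scheme \<Rightarrow> (int \<Rightarrow> (nat \<Rightarrow> 'r) \<Rightarrow> (nat \<Rightarrow> 's) \<Rightarrow> 'g) \<Rightarrow> bool"
  where "linear_family n M B \<longleftrightarrow>
    (\<forall>i. \<forall>v\<in>carrier (V i). \<forall>w\<in>carrier (W (n - i)). B i v w \<in> carrier M) \<and>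
    (\<forall>i. \<forall>v\<in>carrier (V i). \<forall>v'\<in>carrier (V i). \<forall>w\<in>carrier (W (n - i)). B i (v \<oplus>\<^bsub>V i\<^esub> v') w = B i v w \<oplus>\<^bsub>M\<^esub> B i v' w) \<and>
    (\<forall>i. \<forall>v\<in>carrier (V i). \<forall>w\<in>carrier (W (n - i)). \<forall>w'\<in>carrier (W (n - i)). B i v (w \<oplus>\<^bsub>W (n - i)\<^esub> w') = B i v w \<oplus>\<^bsub>M\<^esub> B i v w') \<and>
    (\<forall>i. \<forall>r\<in>carrier R. \<forall>s\<in>carrier S. \<forall>v\<in>carrier (V i). \<forall>w\<in>carrier (W (n - i)).
      B i (r \<odot>\<^bsub>VR i\<^esub> v) (s \<odot>\<^bsub>WS (n - i)\<^esub> w) = tens r s \<odot>\<^bsub>M\<^esub> B i v w)"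

lemma linear_familyI:
  assumes "\<And>i v w. \<lbrakk>v \<in> carrier (V i); w \<in> carrier (W (n - i))\<rbrakk> \<Longrightarrow> B i v w \<in> carrier M"
    "\<And>i v v' w. \<lbrakk>v \<in> carrier (V i); v' \<in> carrier (V i); w \<in> carrier (W (n - i))\<rbrakk> \<Longrightarrow> B i (v \<oplus>\<^bsub>V i\<^esub> v') w = B i v w \<oplus>\<^bsub>M\<^esub> B i v' w"
    "\<And>i v w w'. \<lbrakk>v \<in> carrier (V i); w \<in> carrier (W (n - i)); w' \<in> carrier (W (n - i))\<rbrakk> \<Longrightarrow> B i v (w \<oplus>\<^bsub>W (n - i)\<^esub> w') = B i v w \<oplus>\<^bsub>M\<^esub> B i v w'"
    "\<And>i r s v w. \<lbrakk>r \<in> carrier R; s \<in> carrier S; v \<in> carrier (V i); w \<in> carrier (W (n - i))\<rbrakk> \<Longrightarrow>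
      B i (r \<odot>\<^bsub>VR i\<^esub> v) (s \<odot>\<^bsub>WS (n - i)\<^esub> w) = tens r s \<odot>\<^bsub>M\<^esub> B i v w"
  shows "linear_family n M B"
  using assms by (simp add: linear_family_def)

lemma linear_familyD:
  assumes "linear_family n M B"
  shows "\<lbrakk>v \<in> carrier (V i); w \<in> carrier (W (n - i))\<rbrakk> \<Longrightarrow> B i v w \<in> carrier M"
    "\<lbrakk>v \<in> carrier (V i); v' \<in> carrier (V i); w \<in> carrier (W (n - i))\<rbrakk> \<Longrightarrow> B i (v \<oplus>\<^bsub>V i\<^esub> v') w = B i v w \<oplus>\<^bsub>M\<^esub> B i v' w"
    "\<lbrakk>v \<in> carrier (V i); w \<in> carrier (W (n - i)); w' \<in> carrier (W (n - i))\<rbrakk> \<Longrightarrow> B i v (w \<oplus>\<^bsub>W (n - i)\<^esub> w') = B i v w \<oplus>\<^bsub>M\<^esub> B i v w'"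
    "\<lbrakk>r \<in> carrier R; s \<in> carrier S; v \<in> carrier (V i); w \<in> carrier (W (n - i))\<rbrakk> \<Longrightarrow>
      B i (r \<odot>\<^bsub>VR i\<^esub> v) (s \<odot>\<^bsub>WS (n - i)\<^esub> w) = tens r s \<odot>\<^bsub>M\<^esub> B i v w"
  using assms by (simp_all add: linear_family_def)

lemma linear_family_hom:
  assumes "module A M" and B: "linear_family n M B"
  obtains f where "f \<in> mod_hom A (T n) M"
    "\<And>i v w. \<lbrakk>v \<in> carrier (V i); w \<in> carrier (W (n - i))\<rbrakk> \<Longrightarrow> f (gen n i v w) = B i v w"
  by (rule T_hom[OF assms(1), of n B]) (simp_all add: linear_familyD[OF B] that)

lemma linear_family_plus:
  assumes M: "module A M" and "linear_family n M B" "linear_family n M B'"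
  shows "linear_family n M (\<lambda>i v w. B i v w \<oplus>\<^bsub>M\<^esub> B' i v w)"
proof -
  interpret M: module A M by fact
  note B = linear_familyD[OF assms(2)] and B' = linear_familyD[OF assms(3)]
  show ?thesis
    by (rule linear_familyI) (simp_all add: B B' M.a_ac M.smult_r_distr)
qed

text \<open>The counterpart of \<open>balanced_family_gen\<close> for maps linear over
  \<open>R\<close> and \<open>S\<close>, used for the differential and for products of
  cocycles.\<close>

lemma linear_family_gen:
  assumes f: "\<And>i. f i \<in> mod_hom R (VR i) (VR (i + p))" and g: "\<And>j. g j \<in> mod_hom S (WS j) (WS (j + r))"
    and m: "m = n + p + r"
  shows "linear_family n (T m) (\<lambda>i v w. sg (T m) (s i) (gen m (i + p) (f i v) (g (n - i) w)))"
proof -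
  have fc: "f i v \<in> carrier (V (i + p))" if "v \<in> carrier (V i)" for i v
    using mod_hom_closed[OF f, of v i] that by simp
  have fa: "f i (v \<oplus>\<^bsub>V i\<^esub> v') = f i v \<oplus>\<^bsub>V (i + p)\<^esub> f i v'" if "v \<in> carrier (V i)" "v' \<in> carrier (V i)" for i v v'
    using mod_hom_add[OF f, of v i v'] that by simp
  have fs: "f i (r \<odot>\<^bsub>VR i\<^esub> v) = r \<odot>\<^bsub>VR (i + p)\<^esub> f i v" if "r \<in> carrier R" "v \<in> carrier (V i)" for i r v
    using mod_hom_smult[OF f, of r v i] that by simp
  have gc: "g (n - i) w \<in> carrier (W (m - (i + p)))" if "w \<in> carrier (W (n - i))" for i w
    using mod_hom_closed[OF g, of w "n - i"] that by (simp add: m algebra_simps)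
  have ga: "g (n - i) (w \<oplus>\<^bsub>W (n - i)\<^esub> w') = g (n - i) w \<oplus>\<^bsub>W (m - (i + p))\<^esub> g (n - i) w'"
    if "w \<in> carrier (W (n - i))" "w' \<in> carrier (W (n - i))" for i w w'
    using mod_hom_add[OF g, of w "n - i" w'] that by (simp add: m algebra_simps)
  have gs: "g (n - i) (k \<odot>\<^bsub>WS (n - i)\<^esub> w) = k \<odot>\<^bsub>WS (m - (i + p))\<^esub> g (n - i) w"
    if "k \<in> carrier S" "w \<in> carrier (W (n - i))" for i k w
    using mod_hom_smult[OF g, of k w "n - i"] that by (simp add: m algebra_simps)
  show ?thesis
  proof (rule linear_familyI)
    fix i r s' v w assume h: "r \<in> carrier R" "s' \<in> carrier S" "v \<in> carrier (V i)" "w \<in> carrier (W (n - i))"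
    show "sg (T m) (s i) (gen m (i + p) (f i (r \<odot>\<^bsub>VR i\<^esub> v)) (g (n - i) (s' \<odot>\<^bsub>WS (n - i)\<^esub> w))) =
        tens r s' \<odot>\<^bsub>T m\<^esub> sg (T m) (s i) (gen m (i + p) (f i v) (g (n - i) w))"
      unfolding fs[OF h(1,3)] gs[OF h(2,4)] gen_smult[OF h(1,2) fc[OF h(3)] gc[OF h(4)]]
      by (rule sg_smult[OF module_T]) (use h fc gc in simp_all)
  qed (simp_all add: fc gc ga fa sg_closed[OF abelian_T] sg_add[OF abelian_T] gen_add_left gen_add_right)
qed

lemma mod_hom_V: "f \<in> mod_hom R (VR i) (VR j) \<Longrightarrow> f \<in> mod_hom K (V i) (V j)"
  and mod_hom_W: "g \<in> mod_hom S (WS i) (WS j) \<Longrightarrow> g \<in> mod_hom K (W i) (W j)"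
  by (rule mod_hom_restrict_scalars[OF algebra_R] mod_hom_restrict_scalars[OF algebra_S], assumption)+

abbreviation "idV i \<equiv> \<lambda>v\<in>carrier (V i). v"
abbreviation "idW j \<equiv> \<lambda>w\<in>carrier (W j). w"

lemma idVR: "idV i \<in> mod_hom R (VR i) (VR i)" and idWS: "idW j \<in> mod_hom S (WS j) (WS j)"
  using mod_hom_id[OF module_VR, of i] mod_hom_id[OF module_WS, of j] by simp_all

end

text \<open>One setting for two uses: \<open>q = -1\<close> for the resolutions and
  \<open>q = 1\<close> for their duals. Oddness of \<open>q\<close> is what makes the tensor
  differential square to zero.\<close>

locale tensor_differential = tensor_modules K R S \<epsilon> \<delta> b c
  for K :: "('k, 'x) ring_scheme" and R :: "('k, 'r, 'y) module_scheme" and S :: "('k, 's, 'z) module_scheme"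
    and \<epsilon> :: "'r \<Rightarrow> 'k" and \<delta> :: "'s \<Rightarrow> 'k" and b c :: "int \<Rightarrow> nat" +
  fixes q :: int and d :: "int \<Rightarrow> (nat \<Rightarrow> 'r) \<Rightarrow> nat \<Rightarrow> 'r" and d' :: "int \<Rightarrow> (nat \<Rightarrow> 's) \<Rightarrow> nat \<Rightarrow> 's"
  assumes q: "odd q"
    and d: "d i \<in> mod_hom R (VR i) (VR (i + q))" and d': "d' i \<in> mod_hom S (WS i) (WS (i + q))"
    and dd: "v \<in> carrier (V i) \<Longrightarrow> d (i + q) (d i v) = \<zero>\<^bsub>V (i + q + q)\<^esub>"
    and dd': "w \<in> carrier (W i) \<Longrightarrow> d' (i + q) (d' i w) = \<zero>\<^bsub>W (i + q + q)\<^esub>"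
begin

lemma dV_closed [simp]: "v \<in> carrier (V i) \<Longrightarrow> d i v \<in> carrier (V (i + q))"
  using mod_hom_closed[OF d, of v i] by simp

lemma dW_closed [simp]: "w \<in> carrier (W (n - i)) \<Longrightarrow> d' (n - i) w \<in> carrier (W (n + q - i))"
  using mod_hom_closed[OF d', of w "n - i"] by (simp add: algebra_simps)

text \<open>The usual differential \<open>d v \<otimes> w + (-1)^i v \<otimes> d' w\<close>. It is
  prescribed on pure tensors, so it is selected by \<open>SOME\<close>, and the universal property
  of \<open>T n\<close> provides it.\<close>

definition D :: "int \<Rightarrow> (int \<times> nat \<times> nat \<Rightarrow> ('r \<times> 's \<Rightarrow>\<^sub>0 int) set) \<Rightarrow> int \<times> nat \<times> nat \<Rightarrow> ('r \<times> 's \<Rightarrow>\<^sub>0 int) set"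
  where "D n = (SOME f. f \<in> mod_hom A (T n) (T (n + q)) \<and>
    (\<forall>i. \<forall>v\<in>carrier (V i). \<forall>w\<in>carrier (W (n - i)). f (gen n i v w) =
      gen (n + q) (i + q) (d i v) w \<oplus>\<^bsub>T (n + q)\<^esub> sg (T (n + q)) i (gen (n + q) i v (d' (n - i) w))))"

lemma D_properties:
  "D n \<in> mod_hom A (T n) (T (n + q)) \<and>
    (\<forall>i. \<forall>v\<in>carrier (V i). \<forall>w\<in>carrier (W (n - i)). D n (gen n i v w) =
      gen (n + q) (i + q) (d i v) w \<oplus>\<^bsub>T (n + q)\<^esub> sg (T (n + q)) i (gen (n + q) i v (d' (n - i) w)))"
proof -
  have i: "\<And>i. idV i \<in> mod_hom R (VR i) (VR (i + 0))" "\<And>j. idW j \<in> mod_hom S (WS j) (WS (j + 0))"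
    using idVR idWS by simp_all
  have "linear_family n (T (n + q)) (\<lambda>i v w. sg (T (n + q)) 0 (gen (n + q) (i + q) (d i v) (idW (n - i) w)))"
    by (rule linear_family_gen[OF d i(2), of "n + q" n "\<lambda>_. 0"]) simp
  note B1 = this
  have "linear_family n (T (n + q)) (\<lambda>i v w. sg (T (n + q)) i (gen (n + q) (i + 0) (idV i v) (d' (n - i) w)))"
    by (rule linear_family_gen[OF i(1) d']) simp
  note B2 = this
  obtain f where f: "f \<in> mod_hom A (T n) (T (n + q))"
     "\<And>i v w. \<lbrakk>v \<in> carrier (V i); w \<in> carrier (W (n - i))\<rbrakk> \<Longrightarrow> f (gen n i v w) =
       sg (T (n + q)) 0 (gen (n + q) (i + q) (d i v) (idW (n - i) w)) \<oplus>\<^bsub>T (n + q)\<^esub>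
       sg (T (n + q)) i (gen (n + q) (i + 0) (idV i v) (d' (n - i) w))"
    by (rule linear_family_hom[OF module_T linear_family_plus[OF module_T B1 B2]]) (rule that)
  have "f (gen n i v w) =
      gen (n + q) (i + q) (d i v) w \<oplus>\<^bsub>T (n + q)\<^esub> sg (T (n + q)) i (gen (n + q) i v (d' (n - i) w))"
    if v: "v \<in> carrier (V i)" and w: "w \<in> carrier (W (n - i))" for i v w
    unfolding f(2)[OF v w] restrict_apply'[OF v] restrict_apply'[OF w] sg_even[OF even_zero] add_0_right ..
  note eq = this
  show ?thesis
    unfolding D_def by (rule someI[of _ f], intro conjI allI ballI, rule f(1), rule eq)
qed

lemma D: "D n \<in> mod_hom A (T n) (T (n + q))"
  using D_properties by blast

lemma D_gen: "\<lbrakk>v \<in> carrier (V i); w \<in> carrier (W (n - i))\<rbrakk> \<Longrightarrow> D n (gen n i v w) =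
      gen (n + q) (i + q) (d i v) w \<oplus>\<^bsub>T (n + q)\<^esub> sg (T (n + q)) i (gen (n + q) i v (d' (n - i) w))"
  using D_properties by blast

lemmas D_closed = mod_hom_closed[OF D]
lemmas D_add = mod_hom_add[OF D]
lemmas D_sg = mod_hom_sg[OF D abelian_T abelian_T]

lemma gen_shift_closed [simp]:
  "\<lbrakk>v \<in> carrier (V i); w \<in> carrier (W (n - i))\<rbrakk> \<Longrightarrow> gen (n + q) (i + q) (d i v) w \<in> carrier (T (n + q))"
  "\<lbrakk>v \<in> carrier (V i); w \<in> carrier (W (n - i))\<rbrakk> \<Longrightarrow> gen (n + q) i v (d' (n - i) w) \<in> carrier (T (n + q))"
  by simp_all

text \<open>The two mixed terms both equal \<open>d v \<otimes> d' w\<close> up to sign, with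
  exponents \<open>i + q\<close> and \<open>i\<close>; they cancel as \<open>q\<close> is
  odd.\<close>

lemma D_D:
  assumes "z \<in> carrier (T n)"
  shows "D (n + q) (D n z) = \<zero>\<^bsub>T (n + q + q)\<^esub>"
  using assms
proof (induction z rule: T_induct)
  case (gen i v w)
  interpret T: abelian_group "T (n + q + q)" by (rule abelian_T)
  have w': "w \<in> carrier (W (n + q - (i + q)))" using gen(2) by simp
  have e: "n + q - (i + q) = n - i" by simp
  have dv: "d i v \<in> carrier (V (i + q))" and dw: "d' (n - i) w \<in> carrier (W (n + q - i))"
    using gen by simp_all
  have dw2: "d' (n - i) w \<in> carrier (W (n + q + q - (i + q)))" using dw by (simp add: algebra_simps)
  let ?y = "gen (n + q + q) (i + q) (d i v) (d' (n - i) w)"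
  have y: "?y \<in> carrier (T (n + q + q))" by (rule gen_closed[OF dv dw2])
  have "D (n + q) (gen (n + q) (i + q) (d i v) w) = sg (T (n + q + q)) (i + q) ?y"
    using D_gen[OF dv w'] w' gen sg_closed[OF abelian_T y] unfolding e by (simp add: dd)
  moreover have "D (n + q) (gen (n + q) i v (d' (n - i) w)) = ?y"
  proof -
    have "d' (n + q - i) (d' (n - i) w) = \<zero>\<^bsub>W (n + q + q - i)\<^esub>"
      using dd'[OF gen(2)] by (simp add: algebra_simps)
    then show ?thesis using D_gen[OF gen(1) dw] y gen by (simp add: sg_zero[OF abelian_T])
  qed
  ultimately have "D (n + q) (D n (gen n i v w)) = sg (T (n + q + q)) (i + q) ?y \<oplus>\<^bsub>T (n + q + q)\<^esub> sg (T (n + q + q)) i ?y"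
    using gen by (simp add: D_gen D_add D_sg sg_closed[OF abelian_T])
  also have "\<dots> = \<zero>\<^bsub>T (n + q + q)\<^esub>" by (rule sg_cancel[OF abelian_T y]) (simp add: q)
  finally show ?case .
next
  case (add z z')
  interpret T: abelian_group "T (n + q + q)" by (rule abelian_T)
  show ?case using add by (simp add: D_add D_closed)
qed

text \<open>The homotopy is \<open>H = h \<otimes> 1 + (-1)^i e \<otimes> h'\<close>. With
  \<open>e\<close> instead of the identity in its second term, \<open>D H + H D\<close> is exactly
  \<open>1 - e \<otimes> e'\<close>; this uses \<open>d e = 0\<close> and \<open>e d = 0\<close>. On
  cycles the term \<open>H D\<close> disappears.\<close>

lemma kunneth:
  assumes h: "\<And>i. h i \<in> mod_hom K (V i) (V (i - q))"
    and dhd: "\<And>i v. v \<in> carrier (V i) \<Longrightarrow> d i (h (i + q) (d i v)) = d i v"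
    and h': "\<And>i. h' i \<in> mod_hom K (W i) (W (i - q))"
    and dhd': "\<And>i w. w \<in> carrier (W i) \<Longrightarrow> d' i (h' (i + q) (d' i w)) = d' i w"
  defines "e \<equiv> \<lambda>i. \<lambda>v\<in>carrier (V i). v \<ominus>\<^bsub>V i\<^esub> (d (i - q) (h i v) \<oplus>\<^bsub>V i\<^esub> h (i + q) (d i v))"
  defines "e' \<equiv> \<lambda>i. \<lambda>v\<in>carrier (W i). v \<ominus>\<^bsub>W i\<^esub> (d' (i - q) (h' i v) \<oplus>\<^bsub>W i\<^esub> h' (i + q) (d' i v))"
  obtains E where "\<And>z. z \<in> carrier (T n) \<Longrightarrow> E z \<in> carrier (T n)"
    "\<And>z z'. \<lbrakk>z \<in> carrier (T n); z' \<in> carrier (T n)\<rbrakk> \<Longrightarrow> E (z \<oplus>\<^bsub>T n\<^esub> z') = E z \<oplus>\<^bsub>T n\<^esub> E z'"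
    "\<And>i v w. \<lbrakk>v \<in> carrier (V i); w \<in> carrier (W (n - i))\<rbrakk> \<Longrightarrow> E (gen n i v w) = gen n i (e i v) (e' (n - i) w)"
    "\<And>z. \<lbrakk>z \<in> carrier (T n); D n z = \<zero>\<^bsub>T (n + q)\<^esub>\<rbrakk> \<Longrightarrow> \<exists>y\<in>carrier (T (n - q)). z = E z \<oplus>\<^bsub>T n\<^esub> D (n - q) y"
proof -
  note dK = mod_hom_V[OF d] and dK' = mod_hom_W[OF d']
  have ei: "e i = (\<lambda>v\<in>carrier (V i). v \<ominus>\<^bsub>V i\<^esub> (d (i - q) (h i v) \<oplus>\<^bsub>V i\<^esub> h (i + q) (d i v)))"
    and ei': "e' i = (\<lambda>v\<in>carrier (W i). v \<ominus>\<^bsub>W i\<^esub> (d' (i - q) (h' i v) \<oplus>\<^bsub>W i\<^esub> h' (i + q) (d' i v)))" for i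
    by (simp_all only: e_def e'_def)
  have e: "e i \<in> mod_hom K (V i) (V i)" "v \<in> carrier (V i) \<Longrightarrow> d i (e i v) = \<zero>\<^bsub>V (i + q)\<^esub>"
      "v \<in> carrier (V i) \<Longrightarrow> e (i + q) (d i v) = \<zero>\<^bsub>V (i + q)\<^esub>"
      "v \<in> carrier (V i) \<Longrightarrow> v = e i v \<oplus>\<^bsub>V i\<^esub> (d (i - q) (h i v) \<oplus>\<^bsub>V i\<^esub> h (i + q) (d i v))" for i v
    by (rule homotopy_projection[where V = "\<lambda>i. V i" and K = K and d = d and h = h and q = q and e = e,
      OF module_V dK dd h dhd ei]; assumption)+
  have e': "e' i \<in> mod_hom K (W i) (W i)" "v \<in> carrier (W i) \<Longrightarrow> d' i (e' i v) = \<zero>\<^bsub>W (i + q)\<^esub>"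
      "v \<in> carrier (W i) \<Longrightarrow> e' (i + q) (d' i v) = \<zero>\<^bsub>W (i + q)\<^esub>"
      "v \<in> carrier (W i) \<Longrightarrow> v = e' i v \<oplus>\<^bsub>W i\<^esub> (d' (i - q) (h' i v) \<oplus>\<^bsub>W i\<^esub> h' (i + q) (d' i v))" for i v
    by (rule homotopy_projection[where V = "\<lambda>i. W i" and K = K and d = d' and h = h' and q = q and e = e',
      OF module_W dK' dd' h' dhd' ei']; assumption)+
  have ec: "e i v \<in> carrier (V i)" if "v \<in> carrier (V i)" for i v by (rule mod_hom_closed[OF e(1) that])
  have ec': "e' i v \<in> carrier (W i)" if "v \<in> carrier (W i)" for i v by (rule mod_hom_closed[OF e'(1) that])
  have hc: "h i v \<in> carrier (V (i - q))" if "v \<in> carrier (V i)" for i v by (rule mod_hom_closed[OF h that])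
  have hc': "h' i v \<in> carrier (W (i - q))" if "v \<in> carrier (W i)" for i v by (rule mod_hom_closed[OF h' that])
  have dc': "d' i v \<in> carrier (W (i + q))" if "v \<in> carrier (W i)" for i v by (rule mod_hom_closed[OF dK' that])
  have i0: "\<And>j. idW j \<in> mod_hom K (W j) (W (j + 0))" using mod_hom_id[OF module_W] by simp
  have h1: "\<And>i. h i \<in> mod_hom K (V i) (V (i + - q))" "\<And>i. h' i \<in> mod_hom K (W i) (W (i + - q))"
    using h h' by simp_all
  have e0: "\<And>i. e i \<in> mod_hom K (V i) (V (i + 0))" "\<And>i. e' i \<in> mod_hom K (W i) (W (i + 0))"
    using e(1) e'(1) by simp_all
  obtain E where E: "\<And>z. z \<in> carrier (T n) \<Longrightarrow> E z \<in> carrier (T n)"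
    "\<And>z z'. \<lbrakk>z \<in> carrier (T n); z' \<in> carrier (T n)\<rbrakk> \<Longrightarrow> E (z \<oplus>\<^bsub>T n\<^esub> z') = E z \<oplus>\<^bsub>T n\<^esub> E z'"
    "\<And>i v w. \<lbrakk>v \<in> carrier (V i); w \<in> carrier (W (n - i))\<rbrakk> \<Longrightarrow>
      E (gen n i v w) = sg (T n) 0 (gen n (i + 0) (e i v) (e' (n - i) w))"
    by (rule T_universal[OF abelian_T balanced_family_gen[OF e0, of n n "\<lambda>_. 0"]]) (simp, rule that)
  have "\<exists>H. (\<forall>z\<in>carrier (T m). H z \<in> carrier (T (m - q))) \<and>
    (\<forall>z\<in>carrier (T m). \<forall>z'\<in>carrier (T m). H (z \<oplus>\<^bsub>T m\<^esub> z') = H z \<oplus>\<^bsub>T (m - q)\<^esub> H z') \<and>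
    (\<forall>i. \<forall>v\<in>carrier (V i). \<forall>w\<in>carrier (W (m - i)). H (gen m i v w) =
      gen (m - q) (i - q) (h i v) w \<oplus>\<^bsub>T (m - q)\<^esub> sg (T (m - q)) i (gen (m - q) i (e i v) (h' (m - i) w)))" for m
  proof -
    have B1: "balanced_family m (T (m - q)) (\<lambda>i v w. sg (T (m - q)) 0 (gen (m - q) (i + - q) (h i v) (idW (m - i) w)))"
      by (rule balanced_family_gen[OF h1(1) i0, of "m - q" m "\<lambda>_. 0"]) simp
    have B2: "balanced_family m (T (m - q)) (\<lambda>i v w. sg (T (m - q)) i (gen (m - q) (i + 0) (e i v) (h' (m - i) w)))"
      by (rule balanced_family_gen[OF e0(1) h1(2)]) simp
    obtain H where "\<And>z. z \<in> carrier (T m) \<Longrightarrow> H z \<in> carrier (T (m - q))"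
      "\<And>z z'. \<lbrakk>z \<in> carrier (T m); z' \<in> carrier (T m)\<rbrakk> \<Longrightarrow> H (z \<oplus>\<^bsub>T m\<^esub> z') = H z \<oplus>\<^bsub>T (m - q)\<^esub> H z'"
      "\<And>i v w. \<lbrakk>v \<in> carrier (V i); w \<in> carrier (W (m - i))\<rbrakk> \<Longrightarrow> H (gen m i v w) =
        sg (T (m - q)) 0 (gen (m - q) (i + - q) (h i v) (idW (m - i) w)) \<oplus>\<^bsub>T (m - q)\<^esub>
        sg (T (m - q)) i (gen (m - q) (i + 0) (e i v) (h' (m - i) w))"
      by (rule T_universal[OF abelian_T balanced_family_plus[OF abelian_T B1 B2]]) (rule that)
    then show ?thesis by (intro exI[of _ H]) (simp add: sg_even)
  qed
  then obtain H where H: "\<And>m z. z \<in> carrier (T m) \<Longrightarrow> H m z \<in> carrier (T (m - q))"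
    "\<And>m z z'. \<lbrakk>z \<in> carrier (T m); z' \<in> carrier (T m)\<rbrakk> \<Longrightarrow> H m (z \<oplus>\<^bsub>T m\<^esub> z') = H m z \<oplus>\<^bsub>T (m - q)\<^esub> H m z'"
    "\<And>m i v w. \<lbrakk>v \<in> carrier (V i); w \<in> carrier (W (m - i))\<rbrakk> \<Longrightarrow> H m (gen m i v w) =
      gen (m - q) (i - q) (h i v) w \<oplus>\<^bsub>T (m - q)\<^esub> sg (T (m - q)) i (gen (m - q) i (e i v) (h' (m - i) w))"
    by metis
  have Hsg: "H m (sg (T m) k z) = sg (T (m - q)) k (H m z)" if "z \<in> carrier (T m)" for m k z
    using additive_sg[OF abelian_T abelian_T, of m "H m" "m - q"] H(1,2) that by blast
  have Hz: "H m \<zero>\<^bsub>T m\<^esub> = \<zero>\<^bsub>T (m - q)\<^esub>" for m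
    using additive_zero[OF abelian_T abelian_T, of m "H m" "m - q"] H(1,2) by blast
  have Hn: "H (n + q) z \<in> carrier (T n)" if "z \<in> carrier (T (n + q))" for z using H(1)[OF that] by simp
  have Dn: "D (n - q) z \<in> carrier (T n)" if "z \<in> carrier (T (n - q))" for z using D_closed[OF that] by simp
  interpret T: abelian_group "T n" by (rule abelian_T)
  have homotopy: "z = E z \<oplus>\<^bsub>T n\<^esub> (D (n - q) (H n z) \<oplus>\<^bsub>T n\<^esub> H (n + q) (D n z))" if "z \<in> carrier (T n)" for z
    using that
  proof (induction z rule: T_induct)
    case (gen i v w)
    note v = gen(1) and w = gen(2)
    have w1: "w \<in> carrier (W (n - q - (i - q)))" and w2: "w \<in> carrier (W (n + q - (i + q)))" using w by simp_all
    have h'w: "h' (n - i) w \<in> carrier (W (n - q - i))" using hc'[OF w] by (simp add: algebra_simps)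
    have d'h'w: "d' (n - q - i) (h' (n - i) w) \<in> carrier (W (n - i))"
      using dc'[OF h'w] by (simp add: algebra_simps)
    have dhv: "d (i - q) (h i v) \<in> carrier (V i)" using dV_closed[OF hc[OF v]] by simp
    have hdv: "h (i + q) (d i v) \<in> carrier (V i)" using hc[OF dV_closed[OF v]] by simp
    have h'd'w: "h' (n + q - i) (d' (n - i) w) \<in> carrier (W (n - i))"
      using hc'[OF dW_closed[OF w]] by simp
    have d'w1: "d' (n - i) w \<in> carrier (W (n - (i - q)))" using dc'[OF w] by (simp add: algebra_simps)
    have ix: "n - q + q = n" "i - q + q = i" "n + q - q = n" "i + q - q = i" "n - q - (i - q) = n - i"
      "n + q - (i + q) = n - i" by simp_all
    \<comment> \<open>\<open>D H\<close> yields \<open>x1\<close>, \<open>x2\<close> and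
      \<open>y\<close> with sign exponent \<open>i - q\<close>; \<open>H D\<close> yields
      \<open>x3\<close>, \<open>x4\<close> and \<open>y\<close> with exponent \<open>i\<close>. The
      two copies of \<open>y\<close> cancel, \<open>x1 + x3\<close> is
      \<open>(1 - e) v \<otimes> w\<close>, and \<open>x2 + x4\<close> is
      \<open>e v \<otimes> (1 - e') w\<close>.\<close>
    define x1 where "x1 = gen n i (d (i - q) (h i v)) w"
    define x2 where "x2 = gen n i (e i v) (d' (n - q - i) (h' (n - i) w))"
    define x3 where "x3 = gen n i (h (i + q) (d i v)) w"
    define x4 where "x4 = gen n i (e i v) (h' (n + q - i) (d' (n - i) w))"
    define y where "y = gen n (i - q) (h i v) (d' (n - i) w)"
    have c: "x1 \<in> carrier (T n)" "x2 \<in> carrier (T n)" "x3 \<in> carrier (T n)" "x4 \<in> carrier (T n)" "y \<in> carrier (T n)"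
      unfolding x1_def x2_def x3_def x4_def y_def
      using dhv hdv w d'h'w h'd'w ec[OF v] hc[OF v] d'w1 by simp_all
    note sc = sg_closed[OF abelian_T c(5)]
    have g1: "gen (n - q) (i - q) (h i v) w \<in> carrier (T (n - q))" by (rule gen_closed[OF hc[OF v] w1])
    have g2: "gen (n - q) i (e i v) (h' (n - i) w) \<in> carrier (T (n - q))" by (rule gen_closed[OF ec[OF v] h'w])
    have D1: "D (n - q) (gen (n - q) (i - q) (h i v) w) = x1 \<oplus>\<^bsub>T n\<^esub> sg (T n) (i - q) y"
      using D_gen[OF hc[OF v] w1] unfolding ix x1_def y_def .
    have D2: "D (n - q) (gen (n - q) i (e i v) (h' (n - i) w)) = sg (T n) i x2"
    proof -
      have "gen n (i + q) \<zero>\<^bsub>V (i + q)\<^esub> (h' (n - i) w) = \<zero>\<^bsub>T n\<^esub>"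
        by (rule gen_zero_left) (use h'w in \<open>simp add: algebra_simps\<close>)
      then show ?thesis
        using D_gen[OF ec[OF v] h'w] sg_closed[OF abelian_T c(2)] unfolding ix x2_def e(2)[OF v] by simp
    qed
    have "D (n - q) (H n (gen n i v w)) = x1 \<oplus>\<^bsub>T n\<^esub> sg (T n) (i - q) y \<oplus>\<^bsub>T n\<^esub> sg (T n) i (sg (T n) i x2)"
      unfolding H(3)[OF v w] D_add[OF g1 sg_closed[OF abelian_T g2]] D_sg[OF g2] D1 D2 ix ..
    also have "sg (T n) i (sg (T n) i x2) = x2" using sg_sg[OF abelian_T c(2)] by (simp add: sg_even)
    finally have DH: "D (n - q) (H n (gen n i v w)) = x1 \<oplus>\<^bsub>T n\<^esub> sg (T n) (i - q) y \<oplus>\<^bsub>T n\<^esub> x2" .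
    have g3: "gen (n + q) (i + q) (d i v) w \<in> carrier (T (n + q))" by (rule gen_closed[OF dV_closed[OF v] w2])
    have g4: "gen (n + q) i v (d' (n - i) w) \<in> carrier (T (n + q))" by (rule gen_closed[OF v dW_closed[OF w]])
    have H1: "H (n + q) (gen (n + q) (i + q) (d i v) w) = x3"
    proof -
      have "gen n (i + q) \<zero>\<^bsub>V (i + q)\<^esub> (h' (n - i) w) = \<zero>\<^bsub>T n\<^esub>"
        by (rule gen_zero_left) (use h'w in \<open>simp add: algebra_simps\<close>)
      then show ?thesis
        using H(3)[OF dV_closed[OF v] w2] c(3) unfolding ix x3_def e(3)[OF v] by (simp add: sg_zero[OF abelian_T])
    qed
    have H2: "H (n + q) (gen (n + q) i v (d' (n - i) w)) = y \<oplus>\<^bsub>T n\<^esub> sg (T n) i x4"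
      using H(3)[OF v dW_closed[OF w]] unfolding ix y_def x4_def .
    have "H (n + q) (D n (gen n i v w)) = x3 \<oplus>\<^bsub>T n\<^esub> sg (T n) i (y \<oplus>\<^bsub>T n\<^esub> sg (T n) i x4)"
      unfolding D_gen[OF v w] H(2)[OF g3 sg_closed[OF abelian_T g4]] Hsg[OF g4] H1 H2 ix ..
    also have "sg (T n) i (y \<oplus>\<^bsub>T n\<^esub> sg (T n) i x4) = sg (T n) i y \<oplus>\<^bsub>T n\<^esub> x4"
      using c sg_sg[OF abelian_T c(4)] by (simp add: sg_add[OF abelian_T] sg_closed[OF abelian_T] sg_even)
    finally have HD: "H (n + q) (D n (gen n i v w)) = x3 \<oplus>\<^bsub>T n\<^esub> (sg (T n) i y \<oplus>\<^bsub>T n\<^esub> x4)" .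
    have cancel: "sg (T n) (i - q) y \<oplus>\<^bsub>T n\<^esub> sg (T n) i y = \<zero>\<^bsub>T n\<^esub>"
      by (rule sg_cancel[OF abelian_T c(5)]) (simp add: q)
    have "D (n - q) (H n (gen n i v w)) \<oplus>\<^bsub>T n\<^esub> H (n + q) (D n (gen n i v w)) =
        (sg (T n) (i - q) y \<oplus>\<^bsub>T n\<^esub> sg (T n) i y) \<oplus>\<^bsub>T n\<^esub> ((x1 \<oplus>\<^bsub>T n\<^esub> x3) \<oplus>\<^bsub>T n\<^esub> (x2 \<oplus>\<^bsub>T n\<^esub> x4))"
      unfolding DH HD using c sc by (simp add: T.a_ac)
    also have "\<dots> = (x1 \<oplus>\<^bsub>T n\<^esub> x3) \<oplus>\<^bsub>T n\<^esub> (x2 \<oplus>\<^bsub>T n\<^esub> x4)"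
      unfolding cancel using c by simp
    finally have sum: "D (n - q) (H n (gen n i v w)) \<oplus>\<^bsub>T n\<^esub> H (n + q) (D n (gen n i v w)) =
        (x1 \<oplus>\<^bsub>T n\<^esub> x3) \<oplus>\<^bsub>T n\<^esub> (x2 \<oplus>\<^bsub>T n\<^esub> x4)" .
    \<comment> \<open>The identity is peeled off in two stages: first \<open>1 = e + (1 - e)\<close>
      on the left factor, then \<open>1 = e' + (1 - e')\<close> on the right factor of the
      remainder.\<close>
    have s1: "gen n i v w = gen n i (e i v) w \<oplus>\<^bsub>T n\<^esub> (x1 \<oplus>\<^bsub>T n\<^esub> x3)"
      unfolding x1_def x3_def gen_add_left[OF dhv hdv w, symmetric]
        gen_add_left[OF ec[OF v] V_add_closed[OF dhv hdv] w, symmetric]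
      using e(4)[OF v] by simp
    have dh2: "d' (n - i - q) (h' (n - i) w) = d' (n - q - i) (h' (n - i) w)" "h' (n - i + q) (d' (n - i) w) = h' (n + q - i) (d' (n - i) w)"
      by (simp_all add: algebra_simps)
    have s2: "gen n i (e i v) w = gen n i (e i v) (e' (n - i) w) \<oplus>\<^bsub>T n\<^esub> (x2 \<oplus>\<^bsub>T n\<^esub> x4)"
      unfolding x2_def x4_def gen_add_right[OF ec[OF v] d'h'w h'd'w, symmetric]
        gen_add_right[OF ec[OF v] ec'[OF w] W_add_closed[OF d'h'w h'd'w], symmetric]
      using e'(4)[OF w] unfolding dh2 by simp
    have g5: "gen n i (e i v) (e' (n - i) w) \<in> carrier (T n)" by (rule gen_closed[OF ec[OF v] ec'[OF w]])
    have Eg: "E (gen n i v w) = gen n i (e i v) (e' (n - i) w)" using E(3)[OF v w] by (simp add: sg_even)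
    show ?case
      unfolding sum Eg using s1 s2 c g5 by (simp add: T.a_ac)
  next
    case (add z z')
    have c: "D (n - q) (H n z) \<in> carrier (T n)" "D (n - q) (H n z') \<in> carrier (T n)"
      "H (n + q) (D n z) \<in> carrier (T n)" "H (n + q) (D n z') \<in> carrier (T n)" "E z \<in> carrier (T n)" "E z' \<in> carrier (T n)"
      using add(1,2) Dn Hn H(1) D_closed E(1) by simp_all
    have Da: "D (n - q) (H n (z \<oplus>\<^bsub>T n\<^esub> z')) = D (n - q) (H n z) \<oplus>\<^bsub>T n\<^esub> D (n - q) (H n z')"
      using D_add[OF H(1)[OF add(1)] H(1)[OF add(2)]] by (simp add: H(2)[OF add(1,2)])
    have Ha: "H (n + q) (D n (z \<oplus>\<^bsub>T n\<^esub> z')) = H (n + q) (D n z) \<oplus>\<^bsub>T n\<^esub> H (n + q) (D n z')"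
      using H(2)[OF D_closed[OF add(1)] D_closed[OF add(2)]] by (simp add: D_add[OF add(1,2)])
    have "z \<oplus>\<^bsub>T n\<^esub> z' = (E z \<oplus>\<^bsub>T n\<^esub> (D (n - q) (H n z) \<oplus>\<^bsub>T n\<^esub> H (n + q) (D n z))) \<oplus>\<^bsub>T n\<^esub>
        (E z' \<oplus>\<^bsub>T n\<^esub> (D (n - q) (H n z') \<oplus>\<^bsub>T n\<^esub> H (n + q) (D n z')))"
      using add.IH by simp
    also have "\<dots> = E (z \<oplus>\<^bsub>T n\<^esub> z') \<oplus>\<^bsub>T n\<^esub> (D (n - q) (H n (z \<oplus>\<^bsub>T n\<^esub> z')) \<oplus>\<^bsub>T n\<^esub> H (n + q) (D n (z \<oplus>\<^bsub>T n\<^esub> z')))"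
      unfolding Da Ha E(2)[OF add(1,2)] using c by (simp only: T.a_ac T.a_closed)
    finally show ?case .
  qed
  show thesis
  proof (rule that[of E, OF E(1,2)])
    show "E (gen n i v w) = gen n i (e i v) (e' (n - i) w)" if "v \<in> carrier (V i)" "w \<in> carrier (W (n - i))" for i v w
      using E(3)[OF that] by (simp add: sg_even)
    show "\<exists>y\<in>carrier (T (n - q)). z = E z \<oplus>\<^bsub>T n\<^esub> D (n - q) y" if z: "z \<in> carrier (T n)" "D n z = \<zero>\<^bsub>T (n + q)\<^esub>" for z
    proof (rule bexI[OF _ H(1)[OF z(1)]])
      have "H (n + q) \<zero>\<^bsub>T (n + q)\<^esub> = \<zero>\<^bsub>T n\<^esub>" using Hz[of "n + q"] by simp
      then show "z = E z \<oplus>\<^bsub>T n\<^esub> D (n - q) (H n z)"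
        using homotopy[OF z(1)] Dn[OF H(1)[OF z(1)]] unfolding z(2) by simp
    qed
  qed
qed

end

section \<open>The tensor product of two finite resolutions\<close>

locale tensor_resolution = supplemented_tensor K R S \<epsilon> \<delta>
  for K :: "('k, 'x) ring_scheme" and R :: "('k, 'r, 'y) module_scheme" and S :: "('k, 's, 'z) module_scheme"
    and \<epsilon> :: "'r \<Rightarrow> 'k" and \<delta> :: "'s \<Rightarrow> 'k" +
  fixes b c :: "int \<Rightarrow> nat" and d :: "int \<Rightarrow> (nat \<Rightarrow> 'r) \<Rightarrow> nat \<Rightarrow> 'r" and d' :: "int \<Rightarrow> (nat \<Rightarrow> 's) \<Rightarrow> nat \<Rightarrow> 's"
  assumes res_R: "finite_resolution R K \<epsilon> b d" and res_S: "finite_resolution S K \<delta> c d'"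
begin

sublocale tensor_modules K R S \<epsilon> \<delta> b c
  by unfold_locales (use res_R res_S in \<open>simp_all add: finite_resolution_def\<close>)

lemma b0: "b 0 = 1" and c0: "c 0 = 1"
  using res_R res_S by (simp_all add: finite_resolution_def)

lemma d_hom: "d i \<in> mod_hom R (VR i) (VR (i - 1))" and d'_hom: "d' i \<in> mod_hom S (WS i) (WS (i - 1))"
  using res_R res_S by (simp_all only: finite_resolution_def)

lemma d_d: "v \<in> carrier (V i) \<Longrightarrow> d (i - 1) (d i v) = \<zero>\<^bsub>V (i - 1 - 1)\<^esub>"
  using res_R unfolding finite_resolution_def pow_regular_simps by (elim conjE) (erule allE, erule (1) bspec)

lemma d'_d': "w \<in> carrier (W i) \<Longrightarrow> d' (i - 1) (d' i w) = \<zero>\<^bsub>W (i - 1 - 1)\<^esub>"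
  using res_S unfolding finite_resolution_def pow_regular_simps by (elim conjE) (erule allE, erule (1) bspec)

lemma d_exact:
  assumes "0 < i" "v \<in> carrier (V i)" "d i v = \<zero>\<^bsub>V (i - 1)\<^esub>"
  shows "v \<in> d (i + 1) ` carrier (V (i + 1))"
proof -
  have "\<forall>i>0. \<forall>v\<in>carrier (V i). d i v = \<zero>\<^bsub>V (i - 1)\<^esub> \<longrightarrow> v \<in> d (i + 1) ` carrier (V (i + 1))"
    using res_R unfolding finite_resolution_def pow_regular_simps by (elim conjE)
  then show ?thesis using assms by simp
qed

lemma d'_exact:
  assumes "0 < i" "v \<in> carrier (W i)" "d' i v = \<zero>\<^bsub>W (i - 1)\<^esub>"
  shows "v \<in> d' (i + 1) ` carrier (W (i + 1))"
proof -
  have "\<forall>i>0. \<forall>v\<in>carrier (W i). d' i v = \<zero>\<^bsub>W (i - 1)\<^esub> \<longrightarrow> v \<in> d' (i + 1) ` carrier (W (i + 1))"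
    using res_S unfolding finite_resolution_def pow_regular_simps by (elim conjE)
  then show ?thesis using assms by simp
qed

lemma aug_image_R: "v \<in> carrier (V 0) \<Longrightarrow> \<epsilon> (v 0) = \<zero>\<^bsub>K\<^esub> \<longleftrightarrow> v \<in> d 1 ` carrier (V 1)"
  and aug_image_S: "w \<in> carrier (W 0) \<Longrightarrow> \<delta> (w 0) = \<zero>\<^bsub>K\<^esub> \<longleftrightarrow> w \<in> d' 1 ` carrier (W 1)"
  using res_R res_S unfolding finite_resolution_def pow_regular_simps by simp_all

sublocale tensor_differential K R S \<epsilon> \<delta> b c "-1" d d'
  by unfold_locales (use d_hom d'_hom d_d d'_d' in simp_all)

lemma D': "D n \<in> mod_hom A (T n) (T (n - 1))"
  using D[of n] by simp

lemma D'_gen: "\<lbrakk>v \<in> carrier (V i); w \<in> carrier (W (n - i))\<rbrakk> \<Longrightarrow> D n (gen n i v w) =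
    gen (n - 1) (i - 1) (d i v) w \<oplus>\<^bsub>T (n - 1)\<^esub> sg (T (n - 1)) i (gen (n - 1) i v (d' (n - i) w))"
  using D_gen[of v i w n] by simp

lemma D'_D': "z \<in> carrier (T n) \<Longrightarrow> D (n - 1) (D n z) = \<zero>\<^bsub>T (n - 1 - 1)\<^esub>"
  using D_D[of z n] by simp

definition tensor_complex :: "(('r \<times> 's \<Rightarrow>\<^sub>0 int) set, int \<times> nat \<times> nat \<Rightarrow> ('r \<times> 's \<Rightarrow>\<^sub>0 int) set) module_complex"
  where "tensor_complex = \<lparr>obj = (\<lambda>n. T n), bdry = D\<rparr>"

lemma tensor_complex_simps [simp]: "obj tensor_complex n = T n" "bdry tensor_complex n = D n"
  by (simp_all add: tensor_complex_def)

lemma Zs_neg: "n < 0 \<Longrightarrow> Zs n = {}"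
  by (simp add: Zs_def)

lemma T_neg: "n < 0 \<Longrightarrow> carrier (T n) = {\<zero>\<^bsub>T n\<^esub>}"
  by (simp add: Zs_neg pow_module_simps restrict_def)

lemma origin_Zs: "(0, 0, 0) \<in> Zs 0"
  by (simp add: mem_Zs b0 c0)

text \<open>Exactness makes the homotopy contracting away from degree 0, so \<open>e\<close>
  vanishes there; in degree 0 the augmentation kernel consists of boundaries, which \<open>e\<close>
  kills. The forms \<open>i + - 1\<close> and \<open>i - - 1\<close> keep the shape of the general
  lemmas at \<open>q = -1\<close>.\<close>

lemma projections:
  obtains h h' e e' where
    "\<And>i. h i \<in> mod_hom K (V i) (V (i - - 1))" "\<And>i v. v \<in> carrier (V i) \<Longrightarrow> d i (h (i + - 1) (d i v)) = d i v"
    "\<And>i. h' i \<in> mod_hom K (W i) (W (i - - 1))" "\<And>i v. v \<in> carrier (W i) \<Longrightarrow> d' i (h' (i + - 1) (d' i v)) = d' i v"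
    "e = (\<lambda>i. \<lambda>v\<in>carrier (V i). v \<ominus>\<^bsub>V i\<^esub> (d (i - - 1) (h i v) \<oplus>\<^bsub>V i\<^esub> h (i + - 1) (d i v)))"
    "e' = (\<lambda>i. \<lambda>v\<in>carrier (W i). v \<ominus>\<^bsub>W i\<^esub> (d' (i - - 1) (h' i v) \<oplus>\<^bsub>W i\<^esub> h' (i + - 1) (d' i v)))"
    "\<And>i v. \<lbrakk>i \<noteq> 0; v \<in> carrier (V i)\<rbrakk> \<Longrightarrow> e i v = \<zero>\<^bsub>V i\<^esub>"
    "\<And>i w. \<lbrakk>i \<noteq> 0; w \<in> carrier (W i)\<rbrakk> \<Longrightarrow> e' i w = \<zero>\<^bsub>W i\<^esub>"
    "\<And>v. \<lbrakk>v \<in> carrier (V 0); \<epsilon> (v 0) = \<zero>\<^bsub>K\<^esub>\<rbrakk> \<Longrightarrow> e 0 v = \<zero>\<^bsub>V 0\<^esub>"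
    "\<And>w. \<lbrakk>w \<in> carrier (W 0); \<delta> (w 0) = \<zero>\<^bsub>K\<^esub>\<rbrakk> \<Longrightarrow> e' 0 w = \<zero>\<^bsub>W 0\<^esub>"
    "e 0 \<in> mod_hom K (V 0) (V 0)" "e' 0 \<in> mod_hom K (W 0) (W 0)"
proof -
  have dK: "d i \<in> mod_hom K (V i) (V (i + - 1))" and dK': "d' i \<in> mod_hom K (W i) (W (i + - 1))" for i
    using mod_hom_V[OF d_hom] mod_hom_W[OF d'_hom] by simp_all
  have ddm: "d (i + - 1) (d i v) = \<zero>\<^bsub>V (i + - 1 + - 1)\<^esub>" if "v \<in> carrier (V i)" for i v using d_d[OF that] by simp
  have ddm': "d' (i + - 1) (d' i v) = \<zero>\<^bsub>W (i + - 1 + - 1)\<^esub>" if "v \<in> carrier (W i)" for i v using d'_d'[OF that] by simp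
  obtain h where h: "\<And>i. h i \<in> mod_hom K (V i) (V (i - - 1))"
    "\<And>i v. v \<in> carrier (V i) \<Longrightarrow> d i (h (i + - 1) (d i v)) = d i v"
    "\<And>i v. \<lbrakk>{w \<in> carrier (V i). d i w = \<zero>\<^bsub>V (i + - 1)\<^esub>} \<subseteq> d (i - - 1) ` carrier (V (i - - 1)); v \<in> carrier (V i)\<rbrakk>
      \<Longrightarrow> v = d (i - - 1) (h i v) \<oplus>\<^bsub>V i\<^esub> h (i + - 1) (d i v)"
    by (rule contracting_homotopy[where V = "\<lambda>i. V i" and d = d and q = "-1", OF field_K module_V dK ddm], assumption, rule that)
  obtain h' where h': "\<And>i. h' i \<in> mod_hom K (W i) (W (i - - 1))"
    "\<And>i v. v \<in> carrier (W i) \<Longrightarrow> d' i (h' (i + - 1) (d' i v)) = d' i v"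
    "\<And>i v. \<lbrakk>{w \<in> carrier (W i). d' i w = \<zero>\<^bsub>W (i + - 1)\<^esub>} \<subseteq> d' (i - - 1) ` carrier (W (i - - 1)); v \<in> carrier (W i)\<rbrakk>
      \<Longrightarrow> v = d' (i - - 1) (h' i v) \<oplus>\<^bsub>W i\<^esub> h' (i + - 1) (d' i v)"
    by (rule contracting_homotopy[where V = "\<lambda>i. W i" and d = d' and q = "-1", OF field_K module_W dK' ddm'], assumption, rule that)
  define e where "e = (\<lambda>i. \<lambda>v\<in>carrier (V i). v \<ominus>\<^bsub>V i\<^esub> (d (i - - 1) (h i v) \<oplus>\<^bsub>V i\<^esub> h (i + - 1) (d i v)))"
  define e' where "e' = (\<lambda>i. \<lambda>v\<in>carrier (W i). v \<ominus>\<^bsub>W i\<^esub> (d' (i - - 1) (h' i v) \<oplus>\<^bsub>W i\<^esub> h' (i + - 1) (d' i v)))"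
  have ei: "e i = (\<lambda>v\<in>carrier (V i). v \<ominus>\<^bsub>V i\<^esub> (d (i - - 1) (h i v) \<oplus>\<^bsub>V i\<^esub> h (i + - 1) (d i v)))"
    and ei': "e' i = (\<lambda>v\<in>carrier (W i). v \<ominus>\<^bsub>W i\<^esub> (d' (i - - 1) (h' i v) \<oplus>\<^bsub>W i\<^esub> h' (i + - 1) (d' i v)))" for i
    by (simp_all only: e_def e'_def)
  have e: "e i \<in> mod_hom K (V i) (V i)" "v \<in> carrier (V i) \<Longrightarrow> e (i + - 1) (d i v) = \<zero>\<^bsub>V (i + - 1)\<^esub>" for i v
    by (rule homotopy_projection[where V = "\<lambda>i. V i" and K = K and d = d and h = h and q = "-1" and e = e,
      OF module_V dK ddm h(1,2) ei]; assumption)+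
  have e': "e' i \<in> mod_hom K (W i) (W i)" "v \<in> carrier (W i) \<Longrightarrow> e' (i + - 1) (d' i v) = \<zero>\<^bsub>W (i + - 1)\<^esub>" for i v
    by (rule homotopy_projection[where V = "\<lambda>i. W i" and K = K and d = d' and h = h' and q = "-1" and e = e',
      OF module_W dK' ddm' h'(1,2) ei']; assumption)+
  have Vneg: "carrier (V i) = {\<zero>\<^bsub>V i\<^esub>}" and Wneg: "carrier (W i) = {\<zero>\<^bsub>W i\<^esub>}" if "i < 0" for i
    using that b_neg[of i] c_neg[of i] by (simp_all add: pow_module_simps restrict_def)
  \<comment> \<open>In negative degrees exactness is trivial, the modules being zero.\<close>
  have ex: "w \<in> d (i - - 1) ` carrier (V (i - - 1))" if "i \<noteq> 0" "w \<in> carrier (V i)" "d i w = \<zero>\<^bsub>V (i + - 1)\<^esub>" for i w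
  proof (cases "i > 0")
    case True
    then show ?thesis using d_exact[of i w] that by simp
  next
    case False
    then have "w = \<zero>\<^bsub>V i\<^esub>" using Vneg[of i] that by simp
    then have "w = d (i - - 1) \<zero>\<^bsub>V (i - - 1)\<^esub>"
      using mod_hom_zero[OF dK abelian_V abelian_V, of "i - - 1"] by simp
    then show ?thesis using imageI[OF V_zero_closed, of "d (i - - 1)" "i - - 1"] by simp
  qed
  have ex': "w \<in> d' (i - - 1) ` carrier (W (i - - 1))" if "i \<noteq> 0" "w \<in> carrier (W i)" "d' i w = \<zero>\<^bsub>W (i + - 1)\<^esub>" for i w
  proof (cases "i > 0")
    case True
    then show ?thesis using d'_exact[of i w] that by simp
  next
    case False
    then have "w = \<zero>\<^bsub>W i\<^esub>" using Wneg[of i] that by simp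
    then have "w = d' (i - - 1) \<zero>\<^bsub>W (i - - 1)\<^esub>"
      using mod_hom_zero[OF dK' abelian_W abelian_W, of "i - - 1"] by simp
    then show ?thesis using imageI[OF W_zero_closed, of "d' (i - - 1)" "i - - 1"] by simp
  qed
  have e_pos: "e i v = \<zero>\<^bsub>V i\<^esub>" if i: "i \<noteq> 0" and v: "v \<in> carrier (V i)" for i v
  proof -
    have "v = d (i - - 1) (h i v) \<oplus>\<^bsub>V i\<^esub> h (i + - 1) (d i v)" by (rule h(3)[OF _ v], rule subsetI, erule CollectE, erule conjE, rule ex[OF i])
    then have "e i v = v \<ominus>\<^bsub>V i\<^esub> v" unfolding ei restrict_apply'[OF v] by (rule arg_cong[OF sym])
    then show ?thesis using abelian_group_minus_eq_zero_iff[OF abelian_V v v] by simp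
  qed
  have e'_pos: "e' i v = \<zero>\<^bsub>W i\<^esub>" if i: "i \<noteq> 0" and v: "v \<in> carrier (W i)" for i v
  proof -
    have "v = d' (i - - 1) (h' i v) \<oplus>\<^bsub>W i\<^esub> h' (i + - 1) (d' i v)" by (rule h'(3)[OF _ v], rule subsetI, erule CollectE, erule conjE, rule ex'[OF i])
    then have "e' i v = v \<ominus>\<^bsub>W i\<^esub> v" unfolding ei' restrict_apply'[OF v] by (rule arg_cong[OF sym])
    then show ?thesis using abelian_group_minus_eq_zero_iff[OF abelian_W v v] by simp
  qed
  have e0: "e 0 v = \<zero>\<^bsub>V 0\<^esub>" if v: "v \<in> carrier (V 0)" "\<epsilon> (v 0) = \<zero>\<^bsub>K\<^esub>" for v
  proof -
    obtain y where "y \<in> carrier (V 1)" "v = d 1 y" using v aug_image_R by blast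
    then show ?thesis using e(2)[of y 1] by simp
  qed
  have e'0: "e' 0 v = \<zero>\<^bsub>W 0\<^esub>" if v: "v \<in> carrier (W 0)" "\<delta> (v 0) = \<zero>\<^bsub>K\<^esub>" for v
  proof -
    obtain y where "y \<in> carrier (W 1)" "v = d' 1 y" using v aug_image_S by blast
    then show ?thesis using e'(2)[of y 1] by simp
  qed
  show thesis
    by (rule that[OF h(1,2) h'(1,2) e_def e'_def e_pos e'_pos e0 e'0 e(1) e'(1)])
qed

text \<open>A cycle is \<open>e \<otimes> e'\<close> of itself plus a boundary, so it remains to see
  that \<open>e \<otimes> e'\<close> kills it. If \<open>n \<noteq> 0\<close>, one of
  \<open>i\<close> and \<open>n - i\<close> is nonzero and that factor vanishes; if
  \<open>n = 0\<close>, the map factors through the augmentation.\<close>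

lemma tensor_complex_boundary:
  assumes z: "z \<in> carrier (T n)" "D n z = \<zero>\<^bsub>T (n - 1)\<^esub>" and n: "n \<noteq> 0 \<or> aug (z (0, 0, 0)) = \<zero>\<^bsub>K\<^esub>"
  shows "z \<in> D (n + 1) ` carrier (T (n + 1))"
proof -
  obtain h h' e e' where h:
    "\<And>i. h i \<in> mod_hom K (V i) (V (i - - 1))" "\<And>i v. v \<in> carrier (V i) \<Longrightarrow> d i (h (i + - 1) (d i v)) = d i v"
    "\<And>i. h' i \<in> mod_hom K (W i) (W (i - - 1))" "\<And>i v. v \<in> carrier (W i) \<Longrightarrow> d' i (h' (i + - 1) (d' i v)) = d' i v"
    and ed: "e = (\<lambda>i. \<lambda>v\<in>carrier (V i). v \<ominus>\<^bsub>V i\<^esub> (d (i - - 1) (h i v) \<oplus>\<^bsub>V i\<^esub> h (i + - 1) (d i v)))"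
    "e' = (\<lambda>i. \<lambda>v\<in>carrier (W i). v \<ominus>\<^bsub>W i\<^esub> (d' (i - - 1) (h' i v) \<oplus>\<^bsub>W i\<^esub> h' (i + - 1) (d' i v)))"
    and e: "\<And>i v. \<lbrakk>i \<noteq> 0; v \<in> carrier (V i)\<rbrakk> \<Longrightarrow> e i v = \<zero>\<^bsub>V i\<^esub>"
    "\<And>i w. \<lbrakk>i \<noteq> 0; w \<in> carrier (W i)\<rbrakk> \<Longrightarrow> e' i w = \<zero>\<^bsub>W i\<^esub>"
    and e0: "\<And>v. \<lbrakk>v \<in> carrier (V 0); \<epsilon> (v 0) = \<zero>\<^bsub>K\<^esub>\<rbrakk> \<Longrightarrow> e 0 v = \<zero>\<^bsub>V 0\<^esub>"
    "\<And>w. \<lbrakk>w \<in> carrier (W 0); \<delta> (w 0) = \<zero>\<^bsub>K\<^esub>\<rbrakk> \<Longrightarrow> e' 0 w = \<zero>\<^bsub>W 0\<^esub>"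
    and em: "e 0 \<in> mod_hom K (V 0) (V 0)" "e' 0 \<in> mod_hom K (W 0) (W 0)"
    by (rule projections) (rule that)
  have ei: "(\<lambda>v\<in>carrier (V i). v \<ominus>\<^bsub>V i\<^esub> (d (i - - 1) (h i v) \<oplus>\<^bsub>V i\<^esub> h (i + - 1) (d i v))) = e i"
    "(\<lambda>v\<in>carrier (W i). v \<ominus>\<^bsub>W i\<^esub> (d' (i - - 1) (h' i v) \<oplus>\<^bsub>W i\<^esub> h' (i + - 1) (d' i v))) = e' i" for i
    by (simp_all only: ed)
  obtain E where E: "\<And>z. z \<in> carrier (T n) \<Longrightarrow> E z \<in> carrier (T n)"
    "\<And>z z'. \<lbrakk>z \<in> carrier (T n); z' \<in> carrier (T n)\<rbrakk> \<Longrightarrow> E (z \<oplus>\<^bsub>T n\<^esub> z') = E z \<oplus>\<^bsub>T n\<^esub> E z'"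
    "\<And>i v w. \<lbrakk>v \<in> carrier (V i); w \<in> carrier (W (n - i))\<rbrakk> \<Longrightarrow> E (gen n i v w) = gen n i (e i v) (e' (n - i) w)"
    "\<And>z. \<lbrakk>z \<in> carrier (T n); D n z = \<zero>\<^bsub>T (n + - 1)\<^esub>\<rbrakk> \<Longrightarrow> \<exists>y\<in>carrier (T (n - - 1)). z = E z \<oplus>\<^bsub>T n\<^esub> D (n - - 1) y"
  proof (rule kunneth[of h h' n, OF h(1) _ h(3), unfolded ei])
    show "d i (h (i + - 1) (d i v)) = d i v" if "v \<in> carrier (V i)" for i v by (rule h(2)[OF that])
    show "d' i (h' (i + - 1) (d' i v)) = d' i v" if "v \<in> carrier (W i)" for i v by (rule h(4)[OF that])
    fix E
    assume E: "\<And>z. z \<in> carrier (T n) \<Longrightarrow> E z \<in> carrier (T n)"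
      "\<And>z z'. \<lbrakk>z \<in> carrier (T n); z' \<in> carrier (T n)\<rbrakk> \<Longrightarrow> E (z \<oplus>\<^bsub>T n\<^esub> z') = E z \<oplus>\<^bsub>T n\<^esub> E z'"
      "\<And>i v w. \<lbrakk>v \<in> carrier (V i); w \<in> carrier (W (n - i))\<rbrakk> \<Longrightarrow> E (gen n i v w) = gen n i (e i v) (e' (n - i) w)"
      "\<And>z. \<lbrakk>z \<in> carrier (T n); D n z = \<zero>\<^bsub>T (n + - 1)\<^esub>\<rbrakk> \<Longrightarrow> \<exists>y\<in>carrier (T (n - - 1)). z = E z \<oplus>\<^bsub>T n\<^esub> D (n - - 1) y"
    show thesis by (rule that[OF E])
  qed
  obtain y where y: "y \<in> carrier (T (n + 1))" "z = E z \<oplus>\<^bsub>T n\<^esub> D (n + 1) y"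
    using E(4)[OF z(1)] z(2) by auto
  have emc: "e 0 v \<in> carrier (V 0)" "e' 0 w \<in> carrier (W 0)" if "v \<in> carrier (V 0)" "w \<in> carrier (W 0)" for v w
    using mod_hom_closed[OF em(1) that(1)] mod_hom_closed[OF em(2) that(2)] .
  have "E z = \<zero>\<^bsub>T n\<^esub>"
  proof (cases "n = 0")
    case False
    show ?thesis
      using z(1)
    proof (induction z rule: T_induct)
      case (gen i v w)
      show ?case
      proof (cases "i = 0")
        case True
        have "v \<in> carrier (V 0)" "w \<in> carrier (W n)" "n - i \<noteq> 0" using gen True False by simp_all
        then show ?thesis 
          using E(3)[OF gen] e(2)[of n w] mod_hom_closed[OF em(1), of v] gen_zero_right[of "e 0 v" 0 n] True by simp
      next
        case i: False
        have "e' (n - i) w \<in> carrier (W (n - i))"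
          using e(2)[of "n - i" w] emc(2)[of "\<zero>\<^bsub>V 0\<^esub>" w] gen by (cases "n - i = 0") simp_all
        then show ?thesis using E(3)[OF gen] e(1)[OF i gen(1)] by simp
      qed
    next
      case (add z z')
      then show ?case by (simp add: E(2))
    qed
  next
    case n0: True
    define oV where "oV = (\<lambda>x\<in>{..<b 0}. \<one>\<^bsub>R\<^esub>)"
    define oW where "oW = (\<lambda>x\<in>{..<c 0}. \<one>\<^bsub>S\<^esub>)"
    have o: "oV \<in> carrier (V 0)" "oW \<in> carrier (W 0)" by (auto simp: oV_def oW_def pow_module_simps)
    have o0: "oV 0 = \<one>\<^bsub>R\<^esub>" "oW 0 = \<one>\<^bsub>S\<^esub>" by (simp_all add: oV_def oW_def b0 c0)
    \<comment> \<open>\<open>e 0\<close> kills the augmentation kernel, which contains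
      \<open>v\<close> minus \<open>\<epsilon> (v 0)\<close> times the unit vector, so it is
      determined by its value on the unit vector.\<close>
    have eV: "e 0 v = \<epsilon> (v 0) \<odot>\<^bsub>V 0\<^esub> e 0 oV" if v: "v \<in> carrier (V 0)" for v
    proof -
      let ?k = "\<epsilon> (v 0)"
      have v0: "v 0 \<in> carrier R" using V_mem[OF v, of 0] b0 by simp
      then have k: "?k \<in> carrier K" by (rule aug_R(1))
      note c = V_smult_closed[OF k o(1)]
      have "(v \<ominus>\<^bsub>V 0\<^esub> ?k \<odot>\<^bsub>V 0\<^esub> oV) 0 = v 0 \<oplus>\<^bsub>R\<^esub> \<ominus>\<^bsub>R\<^esub> (?k \<odot>\<^bsub>R\<^esub> \<one>\<^bsub>R\<^esub>)"
        unfolding a_minus_def pow_module_a_inv[OF R.abelian_group_axioms c] by (simp add: pow_module_simps b0 o0)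
      also have "\<epsilon> \<dots> = \<zero>\<^bsub>K\<^esub>"
      proof -
        have x: "?k \<odot>\<^bsub>R\<^esub> \<one>\<^bsub>R\<^esub> \<in> carrier R" using k by simp
        have "\<epsilon> (\<ominus>\<^bsub>R\<^esub> (?k \<odot>\<^bsub>R\<^esub> \<one>\<^bsub>R\<^esub>)) = \<ominus>\<^bsub>K\<^esub> \<epsilon> (?k \<odot>\<^bsub>R\<^esub> \<one>\<^bsub>R\<^esub>)"
          by (rule additive_a_inv[OF R.abelian_group_axioms K.abelian_group_axioms aug_R(1,2) x])
        then show ?thesis using v0 k x by (simp add: aug_R K.r_neg)
      qed
      finally have "e 0 (v \<ominus>\<^bsub>V 0\<^esub> ?k \<odot>\<^bsub>V 0\<^esub> oV) = \<zero>\<^bsub>V 0\<^esub>"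
        by (rule e0(1)[rotated]) (rule abelian_group.minus_closed[OF abelian_V v c])
      then have "e 0 v \<ominus>\<^bsub>V 0\<^esub> ?k \<odot>\<^bsub>V 0\<^esub> e 0 oV = \<zero>\<^bsub>V 0\<^esub>"
        using mod_hom_minus[OF em(1) abelian_V abelian_V v c] mod_hom_smult[OF em(1) k o(1)] by simp
      then show ?thesis
        using abelian_group_minus_eq_zero_iff[OF abelian_V emc(1)[OF v o(2)] V_smult_closed[OF k emc(1)[OF o]]] by simp
    qed
    have eW: "e' 0 v = \<delta> (v 0) \<odot>\<^bsub>W 0\<^esub> e' 0 oW" if v: "v \<in> carrier (W 0)" for v
    proof -
      let ?k = "\<delta> (v 0)"
      have v0: "v 0 \<in> carrier S" using W_mem[OF v, of 0] c0 by simp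
      then have k: "?k \<in> carrier K" by (rule aug_S(1))
      note c = W_smult_closed[OF k o(2)]
      have "(v \<ominus>\<^bsub>W 0\<^esub> ?k \<odot>\<^bsub>W 0\<^esub> oW) 0 = v 0 \<oplus>\<^bsub>S\<^esub> \<ominus>\<^bsub>S\<^esub> (?k \<odot>\<^bsub>S\<^esub> \<one>\<^bsub>S\<^esub>)"
        unfolding a_minus_def pow_module_a_inv[OF S.abelian_group_axioms c] by (simp add: pow_module_simps c0 o0)
      also have "\<delta> \<dots> = \<zero>\<^bsub>K\<^esub>"
      proof -
        have x: "?k \<odot>\<^bsub>S\<^esub> \<one>\<^bsub>S\<^esub> \<in> carrier S" using k by simp
        have "\<delta> (\<ominus>\<^bsub>S\<^esub> (?k \<odot>\<^bsub>S\<^esub> \<one>\<^bsub>S\<^esub>)) = \<ominus>\<^bsub>K\<^esub> \<delta> (?k \<odot>\<^bsub>S\<^esub> \<one>\<^bsub>S\<^esub>)"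
          by (rule additive_a_inv[OF S.abelian_group_axioms K.abelian_group_axioms aug_S(1,2) x])
        then show ?thesis using v0 k x by (simp add: aug_S K.r_neg)
      qed
      finally have "e' 0 (v \<ominus>\<^bsub>W 0\<^esub> ?k \<odot>\<^bsub>W 0\<^esub> oW) = \<zero>\<^bsub>W 0\<^esub>"
        by (rule e0(2)[rotated]) (rule abelian_group.minus_closed[OF abelian_W v c])
      then have "e' 0 v \<ominus>\<^bsub>W 0\<^esub> ?k \<odot>\<^bsub>W 0\<^esub> e' 0 oW = \<zero>\<^bsub>W 0\<^esub>"
        using mod_hom_minus[OF em(2) abelian_W abelian_W v c] mod_hom_smult[OF em(2) k o(2)] by simp
      then show ?thesis
        using abelian_group_minus_eq_zero_iff[OF abelian_W emc(2)[OF o(1) v] W_smult_closed[OF k emc(2)[OF o]]] by simp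
    qed
    \<comment> \<open>The structure map of \<open>A\<close> over \<open>K\<close>, written in the
      left factor. In degree 0 the map \<open>E\<close> is \<open>\<kappa>\<close> of the
      augmentation times the fixed element \<open>g\<close>.\<close>
    define \<kappa> where "\<kappa> k = tens (k \<odot>\<^bsub>R\<^esub> \<one>\<^bsub>R\<^esub>) \<one>\<^bsub>S\<^esub>" for k
    define g where "g = gen 0 0 (e 0 oV) (e' 0 oW)"
    have gc: "g \<in> carrier (T 0)" using emc[OF o] by (simp add: g_def)
    have \<kappa>: "\<kappa> k \<in> carrier A" if "k \<in> carrier K" for k using that by (simp add: \<kappa>_def)
    have \<kappa>a: "\<kappa> (k \<oplus>\<^bsub>K\<^esub> l) = \<kappa> k \<oplus>\<^bsub>A\<^esub> \<kappa> l" if "k \<in> carrier K" "l \<in> carrier K" for k l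
      using that by (simp add: \<kappa>_def R.smult_l_distr tens_add_left)
    have "E z = \<kappa> (aug (z (0, 0, 0))) \<odot>\<^bsub>T 0\<^esub> g" if "z \<in> carrier (T 0)" for z
      using that
    proof (induction z rule: T_induct)
      case (gen i v w)
      have gen': "v \<in> carrier (V i)" "w \<in> carrier (W (n - i))" using gen n0 by simp_all
      show ?case
      proof (cases "i = 0")
        case True
        then have v: "v \<in> carrier (V 0)" and w: "w \<in> carrier (W 0)" using gen by simp_all
        have v0: "v 0 \<in> carrier R" "w 0 \<in> carrier S" using V_mem[OF v, of 0] W_mem[OF w, of 0] b0 c0 by simp_all
        then have k: "\<epsilon> (v 0) \<in> carrier K" "\<delta> (w 0) \<in> carrier K" by (simp_all add: aug_R aug_S)
        have "E (gen 0 i v w) = gen 0 0 (\<epsilon> (v 0) \<odot>\<^bsub>V 0\<^esub> e 0 oV) (\<delta> (w 0) \<odot>\<^bsub>W 0\<^esub> e' 0 oW)"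
          using E(3)[OF gen'] eV[OF v] eW[OF w] True n0 by simp
        also have "\<dots> = gen 0 0 ((\<delta> (w 0) \<otimes>\<^bsub>K\<^esub> \<epsilon> (v 0)) \<odot>\<^bsub>V 0\<^esub> e 0 oV) (e' 0 oW)"
          using gen_balanced[of "\<delta> (w 0)" "\<epsilon> (v 0) \<odot>\<^bsub>V 0\<^esub> e 0 oV" 0 "e' 0 oW" 0] k emc[OF o]
          by (simp add: module.smult_assoc1[OF module_V])
        also have "\<dots> = \<kappa> (\<epsilon> (v 0) \<otimes>\<^bsub>K\<^esub> \<delta> (w 0)) \<odot>\<^bsub>T 0\<^esub> g"
        proof -
          let ?k = "\<delta> (w 0) \<otimes>\<^bsub>K\<^esub> \<epsilon> (v 0)"
          have kc: "?k \<in> carrier K" using k by simp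
          have "?k \<odot>\<^bsub>V 0\<^esub> e 0 oV = (?k \<odot>\<^bsub>R\<^esub> \<one>\<^bsub>R\<^esub>) \<odot>\<^bsub>VR 0\<^esub> e 0 oV"
            using V_mem[OF emc(1)[OF o]] kc by (auto simp: pow_module_simps R.smult_assoc2 intro!: restrict_ext)
          moreover have "e' 0 oW = \<one>\<^bsub>S\<^esub> \<odot>\<^bsub>WS (0 - 0)\<^esub> e' 0 oW"
            using module.smult_one[OF module_WS, of "e' 0 oW" 0] emc[OF o] by simp
          ultimately have "gen 0 0 (?k \<odot>\<^bsub>V 0\<^esub> e 0 oV) (e' 0 oW) =
              gen 0 0 ((?k \<odot>\<^bsub>R\<^esub> \<one>\<^bsub>R\<^esub>) \<odot>\<^bsub>VR 0\<^esub> e 0 oV) (\<one>\<^bsub>S\<^esub> \<odot>\<^bsub>WS (0 - 0)\<^esub> e' 0 oW)" by metis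
          also have "\<dots> = tens (?k \<odot>\<^bsub>R\<^esub> \<one>\<^bsub>R\<^esub>) \<one>\<^bsub>S\<^esub> \<odot>\<^bsub>T 0\<^esub> gen 0 0 (e 0 oV) (e' 0 oW)"
            by (rule gen_smult) (use kc emc[OF o] in simp_all)
          finally show ?thesis using k by (simp add: \<kappa>_def g_def K.m_comm)
        qed
        finally show ?thesis using v0 True by (simp add: gen_apply origin_Zs aug_tens)
      next
        case False
        have "\<kappa> \<zero>\<^bsub>K\<^esub> = \<zero>\<^bsub>A\<^esub>" by (simp add: \<kappa>_def tens_zero_left)
        then have r: "\<kappa> (aug (gen 0 i v w (0, 0, 0))) \<odot>\<^bsub>T 0\<^esub> g = \<zero>\<^bsub>T 0\<^esub>"
          using False gc by (simp add: gen_apply origin_Zs aug_zero module.smult_l_null[OF module_T])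
        have "e' (n - i) w = \<zero>\<^bsub>W (n - i)\<^esub>" using e(2)[of "n - i" w] gen' False n0 by simp
        then show ?thesis unfolding r using E(3)[OF gen'] e(1)[OF False gen(1)] n0 by simp
      qed
    next
      case (add z z')
      have zc: "z (0, 0, 0) \<in> carrier A" "z' (0, 0, 0) \<in> carrier A"
        using pow_module_mem[OF add(1) origin_Zs] pow_module_mem[OF add(2) origin_Zs] by simp_all
      show ?case
        using add zc gc E(2)[of z z'] n0
        by (simp add: T_add origin_Zs aug_add \<kappa>a \<kappa> module.smult_l_distr[OF module_T])
    qed
    from this[of z] have "E z = \<kappa> \<zero>\<^bsub>K\<^esub> \<odot>\<^bsub>T 0\<^esub> g" using z(1) n n0 by simp
    also have "\<kappa> \<zero>\<^bsub>K\<^esub> = \<zero>\<^bsub>A\<^esub>" by (simp add: \<kappa>_def tens_zero_left)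
    finally show ?thesis using gc n0 by (simp add: module.smult_l_null[OF module_T])
  qed
  moreover have "D (n + 1) y \<in> carrier (T n)" using mod_hom_closed[OF D' y(1)] by simp
  ultimately have "z = D (n + 1) y" using y(2) by simp
  then show ?thesis using y(1) by (rule image_eqI)
qed

text \<open>In each term of the differential one tensor factor is a boundary of a resolution, on
  which the augmentation is zero.\<close>

lemma aug_boundary:
  assumes "z \<in> carrier (T 1)"
  shows "aug (D 1 z (0, 0, 0)) = \<zero>\<^bsub>K\<^esub>"
  using assms
proof (induction z rule: T_induct)
  case (gen i v w)
  have D1: "D 1 (gen 1 i v w) = gen 0 (i - 1) (d i v) w \<oplus>\<^bsub>T 0\<^esub> sg (T 0) i (gen 0 i v (d' (1 - i) w))"
    using D'_gen[OF gen] by simp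
  have dv: "d i v \<in> carrier (V (i - 1))" using mod_hom_closed[OF d_hom, of v i] gen by simp
  have dw: "d' (1 - i) w \<in> carrier (W (0 - i))" using mod_hom_closed[OF d'_hom, of w "1 - i"] gen by simp
  have g1: "gen 0 (i - 1) (d i v) w \<in> carrier (T 0)" by (rule gen_closed[OF dv]) (use gen in simp)
  have g2: "gen 0 i v (d' (1 - i) w) \<in> carrier (T 0)" by (rule gen_closed[OF gen(1) dw])
  have a1: "aug (gen 0 (i - 1) (d i v) w (0, 0, 0)) = \<zero>\<^bsub>K\<^esub>"
  proof (cases "i = 1")
    case True
    have v: "v \<in> carrier (V 1)" and w: "w \<in> carrier (W 0)" using gen True by simp_all
    have dv0: "d 1 v \<in> carrier (V 0)" using dv True by simp
    have "\<epsilon> (d 1 v 0) = \<zero>\<^bsub>K\<^esub>" using aug_image_R[OF dv0] v by blast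
    moreover have "d 1 v 0 \<in> carrier R" "w 0 \<in> carrier S" using V_mem[OF dv0, of 0] W_mem[OF w, of 0] b0 c0 by simp_all
    ultimately show ?thesis using True by (simp add: gen_apply origin_Zs aug_tens aug_S)
  qed (simp add: gen_apply origin_Zs aug_zero)
  have a2: "aug (gen 0 i v (d' (1 - i) w) (0, 0, 0)) = \<zero>\<^bsub>K\<^esub>"
  proof (cases "i = 0")
    case True
    have v: "v \<in> carrier (V 0)" and w: "w \<in> carrier (W 1)" using gen True by simp_all
    have dw0: "d' 1 w \<in> carrier (W 0)" using dw True by simp
    have "\<delta> (d' 1 w 0) = \<zero>\<^bsub>K\<^esub>" using aug_image_S[OF dw0] w by blast
    moreover have "v 0 \<in> carrier R" "d' 1 w 0 \<in> carrier S" using V_mem[OF v, of 0] W_mem[OF dw0, of 0] b0 c0 by simp_all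
    ultimately show ?thesis using True by (simp add: gen_apply origin_Zs aug_tens aug_R)
  qed (simp add: gen_apply origin_Zs aug_zero)
  have c1: "gen 0 (i - 1) (d i v) w (0, 0, 0) \<in> carrier A" "gen 0 i v (d' (1 - i) w) (0, 0, 0) \<in> carrier A"
    using pow_module_mem[OF g1 origin_Zs] pow_module_mem[OF g2 origin_Zs] by simp_all
  have "sg (T 0) i (gen 0 i v (d' (1 - i) w)) (0, 0, 0) = sg A i (gen 0 i v (d' (1 - i) w) (0, 0, 0))"
    using pow_module_a_inv[OF module_imp_abelian_group[OF module_regular_module[OF cring_A]] g2] origin_Zs
    by (simp add: sg_def)
  moreover have "aug (sg A i a) = sg K i (aug a)" if "a \<in> carrier A" for a
    by (rule additive_sg[OF abelian_A K.abelian_group_axioms aug_closed aug_add that])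
  ultimately show ?case
    unfolding D1 T_add[OF origin_Zs]
    using c1 a1 a2 by (simp add: aug_add sg_closed[OF abelian_A] sg_zero[OF K.abelian_group_axioms])
next
  case (add z z')
  have m: "D 1 x \<in> carrier (T 0)" if "x \<in> carrier (T 1)" for x using mod_hom_closed[OF D' that] by simp
  have "D 1 (z \<oplus>\<^bsub>T 1\<^esub> z') = D 1 z \<oplus>\<^bsub>T 0\<^esub> D 1 z'"
    using mod_hom_add[OF D' add(1,2)] by simp
  moreover have "D 1 z (0, 0, 0) \<in> carrier A" "D 1 z' (0, 0, 0) \<in> carrier A"
    using pow_module_mem[OF m[OF add(1)] origin_Zs] pow_module_mem[OF m[OF add(2)] origin_Zs] by simp_all
  ultimately show ?case using add by (simp add: T_add origin_Zs aug_add)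
qed

lemma free_resolution_tensor_complex:
  "free_resolution A (augmentation_module K aug) tensor_complex"
proof -
  let ?\<pi> = "\<lambda>z\<in>carrier (T 0). aug (z (0, 0, 0))"
  have zc: "z (0, 0, 0) \<in> carrier A" if "z \<in> carrier (T 0)" for z
    using pow_module_mem[OF that origin_Zs] by simp
  have \<pi>: "?\<pi> \<in> mod_hom A (T 0) (augmentation_module K aug)"
    by (rule mod_hom_restrictI[OF module_T])
      (simp_all add: augmentation_module_def zc T_add T_smult origin_Zs aug_add aug_mult)
  have onto: "?\<pi> ` carrier (T 0) = carrier (augmentation_module K aug)"
  proof
    show "?\<pi> ` carrier (T 0) \<subseteq> carrier (augmentation_module K aug)" using mod_hom_closed[OF \<pi>] by blast
    show "carrier (augmentation_module K aug) \<subseteq> ?\<pi> ` carrier (T 0)"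
    proof
      fix k assume "k \<in> carrier (augmentation_module K aug)"
      then have k: "k \<in> carrier K" by (simp add: augmentation_module_def)
      let ?a = "tens (k \<odot>\<^bsub>R\<^esub> \<one>\<^bsub>R\<^esub>) \<one>\<^bsub>S\<^esub>"
      have a: "?a \<in> carrier A" using k by simp
      have eq: "?\<pi> (single A (Zs 0) (0, 0, 0) ?a) = k"
        using a k by (simp add: single_apply origin_Zs aug_tens aug_R aug_S)
      show "k \<in> ?\<pi> ` carrier (T 0)" by (rule image_eqI[where x = "single A (Zs 0) (0, 0, 0) ?a"]) (rule sym[OF eq], rule single_T_closed[OF a])
    qed
  qed
  have img: "D (i + 1) y \<in> carrier (T i) \<and> D i (D (i + 1) y) = \<zero>\<^bsub>T (i - 1)\<^esub>" if "y \<in> carrier (T (i + 1))" for i y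
    using mod_hom_closed[OF D' that] D'_D'[OF that] by simp
  have ex: "{x \<in> carrier (T i). D i x = \<zero>\<^bsub>T (i - 1)\<^esub>} = D (i + 1) ` carrier (T (i + 1))" if "0 < i" for i
  proof
    show "{x \<in> carrier (T i). D i x = \<zero>\<^bsub>T (i - 1)\<^esub>} \<subseteq> D (i + 1) ` carrier (T (i + 1))"
    proof
      fix x assume "x \<in> {x \<in> carrier (T i). D i x = \<zero>\<^bsub>T (i - 1)\<^esub>}"
      from CollectD[OF this] have x: "x \<in> carrier (T i)" "D i x = \<zero>\<^bsub>T (i - 1)\<^esub>" by (rule conjunct1, rule conjunct2)
      show "x \<in> D (i + 1) ` carrier (T (i + 1))"
        by (rule tensor_complex_boundary[OF x]) (use that in simp)
    qed
    show "D (i + 1) ` carrier (T (i + 1)) \<subseteq> {x \<in> carrier (T i). D i x = \<zero>\<^bsub>T (i - 1)\<^esub>}"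
      by (rule image_subsetI, rule CollectI, rule img)
  qed
  have ker: "{x \<in> carrier (T 0). ?\<pi> x = \<zero>\<^bsub>augmentation_module K aug\<^esub>} = D 1 ` carrier (T 1)"
  proof -
    \<comment> \<open>The module in degree \<open>-1\<close> is zero, so every element of degree 0
      is a cycle.\<close>
    have "D 0 z = \<zero>\<^bsub>T (0 - 1)\<^esub>" if "z \<in> carrier (T 0)" for z
      using mod_hom_closed[OF D' that] T_neg[of "0 - 1"] by simp
    then have "z \<in> D 1 ` carrier (T 1)" if "z \<in> carrier (T 0)" "aug (z (0, 0, 0)) = \<zero>\<^bsub>K\<^esub>" for z
      using tensor_complex_boundary[of z 0] that by simp
    moreover have "D 1 y \<in> carrier (T 0)" if "y \<in> carrier (T 1)" for y using img[of y 0] that by simp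
    ultimately show ?thesis using aug_boundary by (auto simp: augmentation_module_def)
  qed
  show ?thesis
    unfolding free_resolution_def tensor_complex_simps
  proof (intro conjI allI impI bexI[of _ ?\<pi>])
    show "free_module A (T i)" for i by (rule free_module_pow_module[OF cring_A A_nontrivial finite_Zs])
  qed (use T_neg D' ex onto ker \<pi> in simp_all)
qed

end

section \<open>Functionals on based modules\<close>

text \<open>The standard pairing, curried and extensional in its second argument, so that
  \<open>dot A J v\<close> is the functional with coefficient vector \<open>v\<close> as an element
  of \<open>mod_hom\<close>.\<close>

definition dot :: "('a, 'x) ring_scheme \<Rightarrow> 'j set \<Rightarrow> ('j \<Rightarrow> 'a) \<Rightarrow> ('j \<Rightarrow> 'a) \<Rightarrow> 'a"
  where "dot A J v = (\<lambda>w\<in>carrier (pow_module (regular_module A) J). \<Oplus>\<^bsub>A\<^esub>j\<in>J. v j \<otimes>\<^bsub>A\<^esub> w j)"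

text \<open>The map given by the transposed matrix; \<open>dot_trans_map\<close> is the adjunction
  that characterizes it.\<close>

definition trans_map :: "('a, 'x) ring_scheme \<Rightarrow> 'j set \<Rightarrow> 'i set \<Rightarrow> (('j \<Rightarrow> 'a) \<Rightarrow> 'i \<Rightarrow> 'a) \<Rightarrow> ('i \<Rightarrow> 'a) \<Rightarrow> 'j \<Rightarrow> 'a"
  where "trans_map A J J' f = (\<lambda>v\<in>carrier (pow_module (regular_module A) J'). \<lambda>j\<in>J. dot A J' v (f (single A J j \<one>\<^bsub>A\<^esub>)))"

lemma single_regular_module: "single (regular_module A) J = single A J"
  by (simp add: single_def fun_eq_iff)

lemma regular_single_closed:
  "cring A \<Longrightarrow> r \<in> carrier A \<Longrightarrow> single A J j r \<in> carrier (pow_module (regular_module A) J)"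
  using single_closed[OF module_imp_abelian_group[OF module_regular_module], of A r J j]
  by (simp add: single_regular_module)

lemma pow_module_one_single:
  assumes "cring A" "r \<in> carrier A"
  shows "single A J j r = r \<odot>\<^bsub>pow_module (regular_module A) J\<^esub> single A J j \<one>\<^bsub>A\<^esub>"
proof -
  interpret A: cring A by fact
  show ?thesis
    using single_smult[OF module_regular_module[OF assms(1)], of r "\<one>\<^bsub>A\<^esub>" J j] assms(2) by (simp add: single_regular_module)
qed

context
  fixes A :: "('a, 'x) ring_scheme" and J :: "'j set"
  assumes A: "cring A" and J: "finite J"
begin

interpretation A: cring A by (rule A)

private abbreviation "M \<equiv> pow_module (regular_module A) J"
private lemma mem: "v \<in> carrier M \<Longrightarrow> j \<in> J \<Longrightarrow> v j \<in> carrier A" using pow_module_mem[of v "regular_module A" J j] by simp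
private lemma mod: "module A M" by (rule module_pow_module[OF module_regular_module[OF A]])
private lemma grp: "abelian_group M" by (rule module_imp_abelian_group[OF mod])

private lemma fun_dot: "v \<in> carrier M \<Longrightarrow> w \<in> carrier M \<Longrightarrow> (\<lambda>j. v j \<otimes>\<^bsub>A\<^esub> w j) \<in> J \<rightarrow> carrier A"
  by (rule Pi_I) (rule A.m_closed; rule mem; assumption)

lemma dot_closed: "v \<in> carrier M \<Longrightarrow> w \<in> carrier M \<Longrightarrow> dot A J v w \<in> carrier A"
  by (simp add: dot_def A.finsum_closed fun_dot)

lemma dot_add_left:
  assumes "v \<in> carrier M" "v' \<in> carrier M" "w \<in> carrier M"
  shows "dot A J (v \<oplus>\<^bsub>M\<^esub> v') w = dot A J v w \<oplus>\<^bsub>A\<^esub> dot A J v' w"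
proof -
  have "(\<Oplus>\<^bsub>A\<^esub>j\<in>J. (v \<oplus>\<^bsub>M\<^esub> v') j \<otimes>\<^bsub>A\<^esub> w j) = (\<Oplus>\<^bsub>A\<^esub>j\<in>J. v j \<otimes>\<^bsub>A\<^esub> w j \<oplus>\<^bsub>A\<^esub> v' j \<otimes>\<^bsub>A\<^esub> w j)"
    using assms by (intro A.finsum_cong') (auto simp: pow_module_simps PiE_const_mem A.l_distr)
  then show ?thesis using assms by (simp add: dot_def A.finsum_addf fun_dot)
qed

lemma dot_hom:
  assumes v: "v \<in> carrier M"
  shows "dot A J v \<in> mod_hom A M (regular_module A)"
proof -
  have "dot A J v (w \<oplus>\<^bsub>M\<^esub> w') = dot A J v w \<oplus>\<^bsub>A\<^esub> dot A J v w'" if w: "w \<in> carrier M" "w' \<in> carrier M" for w w'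
  proof -
    have "(\<Oplus>\<^bsub>A\<^esub>j\<in>J. v j \<otimes>\<^bsub>A\<^esub> (w \<oplus>\<^bsub>M\<^esub> w') j) = (\<Oplus>\<^bsub>A\<^esub>j\<in>J. v j \<otimes>\<^bsub>A\<^esub> w j \<oplus>\<^bsub>A\<^esub> v j \<otimes>\<^bsub>A\<^esub> w' j)"
      using v w by (intro A.finsum_cong') (auto simp: pow_module_simps PiE_const_mem A.r_distr)
    then show ?thesis using v w abelian_groupE(1)[OF grp w] by (simp add: dot_def A.finsum_addf fun_dot)
  qed
  moreover have "dot A J v (a \<odot>\<^bsub>M\<^esub> w) = a \<otimes>\<^bsub>A\<^esub> dot A J v w" if a: "a \<in> carrier A" and w: "w \<in> carrier M" for a w
  proof -
    have "(\<Oplus>\<^bsub>A\<^esub>j\<in>J. v j \<otimes>\<^bsub>A\<^esub> (a \<odot>\<^bsub>M\<^esub> w) j) = (\<Oplus>\<^bsub>A\<^esub>j\<in>J. a \<otimes>\<^bsub>A\<^esub> (v j \<otimes>\<^bsub>A\<^esub> w j))"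
      using mem[OF v] mem[OF w] a by (intro A.finsum_cong') (auto simp: pow_regular_smult A.m_lcomm)
    also have "\<dots> = a \<otimes>\<^bsub>A\<^esub> (\<Oplus>\<^bsub>A\<^esub>j\<in>J. v j \<otimes>\<^bsub>A\<^esub> w j)" by (rule A.finsum_rdistr[OF J a fun_dot[OF v w], symmetric])
    finally show ?thesis using w module.smult_closed[OF mod a, of w] by (simp add: dot_def)
  qed
  ultimately show ?thesis
    by (intro mod_homI) (use v in \<open>simp_all add: dot_closed\<close>, simp add: dot_def)
qed

lemma dot_single: 
  assumes v: "v \<in> carrier M" and j: "j \<in> J" and r: "r \<in> carrier A"
  shows "dot A J v (single A J j r) = v j \<otimes>\<^bsub>A\<^esub> r"
proof -
  have "(\<Oplus>\<^bsub>A\<^esub>i\<in>J. v i \<otimes>\<^bsub>A\<^esub> single A J j r i) = (\<Oplus>\<^bsub>A\<^esub>i\<in>J. if j = i then v j \<otimes>\<^bsub>A\<^esub> r else \<zero>\<^bsub>A\<^esub>)"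
    using mem[OF v] r by (intro A.finsum_cong') (auto simp: single_apply)
  then show ?thesis
    using finsum_delta[OF A.abelian_group_axioms J j, of "v j \<otimes>\<^bsub>A\<^esub> r"] mem[OF v j] r
    by (simp add: dot_def regular_single_closed[OF A])
qed

lemma dot_zero_left: "w \<in> carrier M \<Longrightarrow> dot A J \<zero>\<^bsub>M\<^esub> w = \<zero>\<^bsub>A\<^esub>"
  by (rule additive_zero[OF grp A.abelian_group_axioms, where f = "\<lambda>v. dot A J v w"]) (simp_all add: dot_closed dot_add_left)

lemma dot_zero_right: "v \<in> carrier M \<Longrightarrow> dot A J v \<zero>\<^bsub>M\<^esub> = \<zero>\<^bsub>A\<^esub>"
  using mod_hom_zero[OF dot_hom grp module_imp_abelian_group[OF module_regular_module[OF A]]] by simp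

lemma dot_eq_iff:
  assumes "v \<in> carrier M" "v' \<in> carrier M" "\<And>w. w \<in> carrier M \<Longrightarrow> dot A J v w = dot A J v' w"
  shows "v = v'"
proof (rule pow_module_eqI[OF assms(1,2)])
  fix j assume j: "j \<in> J"
  show "v j = v' j"
    using assms(3)[of "single A J j \<one>\<^bsub>A\<^esub>"] mem[OF assms(1) j] mem[OF assms(2) j]
    by (simp add: dot_single[OF assms(1) j] dot_single[OF assms(2) j] regular_single_closed[OF A])
qed

text \<open>This is where finite rank enters: the values of a functional on the unit vectors form a
  vector of the same module, and by finite expansion they determine the functional.\<close>

lemma functional_eq_dot:
  assumes \<phi>: "\<phi> \<in> mod_hom A M (regular_module A)"
  shows "(\<lambda>j\<in>J. \<phi> (single A J j \<one>\<^bsub>A\<^esub>)) \<in> carrier M" (is "?u \<in> _")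
    and "\<phi> = dot A J (\<lambda>j\<in>J. \<phi> (single A J j \<one>\<^bsub>A\<^esub>))"
proof -
  note G = module_imp_abelian_group[OF mod] module_imp_abelian_group[OF module_regular_module[OF A]]
  have c: "single A J j r \<in> carrier M" if "r \<in> carrier A" for j r using that by (rule regular_single_closed[OF A])
  have \<phi>c: "\<phi> (single A J j \<one>\<^bsub>A\<^esub>) \<in> carrier A" for j
    using mod_hom_closed[OF \<phi> c[OF A.one_closed]] by simp
  then show "?u \<in> carrier M" by (simp add: pow_module_simps)
  define u where "u = ?u"
  with \<open>?u \<in> carrier M\<close> have u: "u \<in> carrier M" by simp
  have uj: "u j = \<phi> (single A J j \<one>\<^bsub>A\<^esub>)" if "j \<in> J" for j using that by (simp add: u_def)
  show "\<phi> = dot A J ?u"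
    unfolding u_def[symmetric]
  proof (rule mod_hom_eqI[OF \<phi> dot_hom[OF u]])
    fix w assume "w \<in> carrier M"
    then have w: "w \<in> carrier M" by simp
    show "\<phi> w = dot A J u w"
      using G(2) J w
    proof (induction w rule: pow_module_induct)
      case zero
      show ?case using mod_hom_zero[OF \<phi> G] mod_hom_zero[OF dot_hom[OF u] G] by simp
    next
      case (single j r')
      then obtain r where r: "r = r'" "j \<in> J" "r \<in> carrier A" by simp
      have "\<phi> (single A J j r) = r \<otimes>\<^bsub>A\<^esub> \<phi> (single A J j \<one>\<^bsub>A\<^esub>)"
        unfolding pow_module_one_single[OF A r(3), of J j] mod_hom_smult[OF \<phi> r(3) c[OF A.one_closed]] by simp
      also have "\<dots> = dot A J u (single A J j r)"
        unfolding dot_single[OF u r(2,3)] uj[OF r(2)] by (rule A.m_comm[OF r(3) \<phi>c])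
      finally show ?case unfolding r(1) single_regular_module .
    next
      case (add w w')
      then show ?case using mod_hom_add[OF \<phi>, of w w'] mod_hom_add[OF dot_hom[OF u], of w w'] by simp
    qed
  qed
qed

end

lemma
  assumes A: "cring A" and J: "finite J" and J': "finite J'"
    and f: "f \<in> mod_hom A (pow_module (regular_module A) J) (pow_module (regular_module A) J')"
  shows dot_trans_map: "\<lbrakk>v \<in> carrier (pow_module (regular_module A) J'); w \<in> carrier (pow_module (regular_module A) J)\<rbrakk> \<Longrightarrow>
      dot A J (trans_map A J J' f v) w = dot A J' v (f w)"
    and trans_map_hom: "trans_map A J J' f \<in> mod_hom A (pow_module (regular_module A) J') (pow_module (regular_module A) J)"
proof -
  interpret A: cring A by (rule A)
  note AM = module_regular_module[OF A]
  note M = module_pow_module[OF AM, of J] and M' = module_pow_module[OF AM, of J']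
  have c: "compose (carrier (pow_module (regular_module A) J)) (dot A J' v) f \<in> mod_hom A (pow_module (regular_module A) J) (regular_module A)"
    if "v \<in> carrier (pow_module (regular_module A) J')" for v
    using mod_hom_compose[OF M f dot_hom[OF A J' that]] by simp
  have one: "single A J j \<one>\<^bsub>A\<^esub> \<in> carrier (pow_module (regular_module A) J)" for j by (rule regular_single_closed[OF A A.one_closed])
  have t: "trans_map A J J' f v = (\<lambda>j\<in>J. compose (carrier (pow_module (regular_module A) J)) (dot A J' v) f (single A J j \<one>\<^bsub>A\<^esub>))"
    if "v \<in> carrier (pow_module (regular_module A) J')" for v
    using that one by (simp add: trans_map_def compose_def)
  have tc: "trans_map A J J' f v \<in> carrier (pow_module (regular_module A) J)" if "v \<in> carrier (pow_module (regular_module A) J')" for v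
    unfolding t[OF that] by (rule functional_eq_dot(1)[OF A J c[OF that]])
  show d: "dot A J (trans_map A J J' f v) w = dot A J' v (f w)"
    if v: "v \<in> carrier (pow_module (regular_module A) J')" and w: "w \<in> carrier (pow_module (regular_module A) J)" for v w
    using functional_eq_dot(2)[OF A J c[OF v]] w unfolding t[OF v] by (metis compose_eq)
  have fc: "f w \<in> carrier (pow_module (regular_module A) J')" if "w \<in> carrier (pow_module (regular_module A) J)" for w
    using mod_hom_closed[OF f, of w] that by simp
  show "trans_map A J J' f \<in> mod_hom A (pow_module (regular_module A) J') (pow_module (regular_module A) J)"
  proof (rule mod_homI)
    fix v v' assume v: "v \<in> carrier (pow_module (regular_module A) J')" "v' \<in> carrier (pow_module (regular_module A) J')"
    note v' = v
    have "v \<oplus>\<^bsub>pow_module (regular_module A) J'\<^esub> v' \<in> carrier (pow_module (regular_module A) J')"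
      by (rule abelian_groupE(1)[OF module_imp_abelian_group[OF M'] v'])
    note s = this
    have "trans_map A J J' f (v \<oplus>\<^bsub>pow_module (regular_module A) J'\<^esub> v') = trans_map A J J' f v \<oplus>\<^bsub>pow_module (regular_module A) J\<^esub> trans_map A J J' f v'"
      by (rule dot_eq_iff[OF A J tc[OF s] abelian_groupE(1)[OF module_imp_abelian_group[OF M] tc[OF v'(1)] tc[OF v'(2)]]])
        (simp add: d s v' fc dot_add_left[OF A] J J' tc)
    then show "trans_map A J J' f (v \<oplus>\<^bsub>pow_module (regular_module A) J'\<^esub> v') =
        trans_map A J J' f v \<oplus>\<^bsub>pow_module (regular_module A) J\<^esub> trans_map A J J' f v'" by simp
  next
    fix a v assume a: "a \<in> carrier A" and v: "v \<in> carrier (pow_module (regular_module A) J')"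
    note v' = v
    have av: "a \<odot>\<^bsub>pow_module (regular_module A) J'\<^esub> v \<in> carrier (pow_module (regular_module A) J')"
      using module.smult_closed[OF M' a v] by simp
    show "trans_map A J J' f (a \<odot>\<^bsub>pow_module (regular_module A) J'\<^esub> v) = a \<odot>\<^bsub>pow_module (regular_module A) J\<^esub> trans_map A J J' f v"
    proof (rule pow_module_eqI[OF tc[OF av]])
      show "a \<odot>\<^bsub>pow_module (regular_module A) J\<^esub> trans_map A J J' f v \<in> carrier (pow_module (regular_module A) J)"
        using module.smult_closed[OF M a] tc[OF v'] by simp
      fix j assume j: "j \<in> J"
      have fs: "f (single A J j \<one>\<^bsub>A\<^esub>) \<in> carrier (pow_module (regular_module A) J')" by (rule fc[OF one])
      have "dot A J' (a \<odot>\<^bsub>pow_module (regular_module A) J'\<^esub> v) w = a \<otimes>\<^bsub>A\<^esub> dot A J' v w" if w: "w \<in> carrier (pow_module (regular_module A) J')" for w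
      proof -
        have "(\<Oplus>\<^bsub>A\<^esub>i\<in>J'. (a \<odot>\<^bsub>pow_module (regular_module A) J'\<^esub> v) i \<otimes>\<^bsub>A\<^esub> w i) = (\<Oplus>\<^bsub>A\<^esub>i\<in>J'. a \<otimes>\<^bsub>A\<^esub> (v i \<otimes>\<^bsub>A\<^esub> w i))"
          using pow_module_mem[OF v', simplified] pow_module_mem[OF w, simplified] a
          by (intro A.finsum_cong') (auto simp: pow_regular_smult A.m_assoc)
        also have "\<dots> = a \<otimes>\<^bsub>A\<^esub> (\<Oplus>\<^bsub>A\<^esub>i\<in>J'. v i \<otimes>\<^bsub>A\<^esub> w i)"
          using pow_module_mem[OF v', simplified] pow_module_mem[OF w, simplified]
          by (intro A.finsum_rdistr[OF J' a, symmetric]) auto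
        finally show ?thesis using w by (simp add: dot_def)
      qed
      from this[OF fs] show "trans_map A J J' f (a \<odot>\<^bsub>pow_module (regular_module A) J'\<^esub> v) j = (a \<odot>\<^bsub>pow_module (regular_module A) J\<^esub> trans_map A J J' f v) j"
        using j av v' by (simp add: trans_map_def pow_regular_smult)
    qed
  qed (use tc in simp_all, simp add: trans_map_def)
qed

lemma trans_map_zero:
  assumes A: "cring A" and J: "finite J" "finite J'"
    and f: "f \<in> mod_hom A (pow_module (regular_module A) J) (pow_module (regular_module A) J')"
    and v: "v \<in> carrier (pow_module (regular_module A) J')" "trans_map A J J' f v = \<zero>\<^bsub>pow_module (regular_module A) J\<^esub>"
    and w: "w \<in> carrier (pow_module (regular_module A) J)"
  shows "dot A J' v (f w) = \<zero>\<^bsub>A\<^esub>"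
  using dot_trans_map[OF A J f v(1) w] dot_zero_left[OF A J(1) w] v(2) by simp

text \<open>Transposition reverses composition, so the transposed boundaries form a complex
  again.\<close>

lemma trans_map_trans_map:
  assumes A: "cring A" and J: "finite J" "finite J'" "finite J''"
    and f: "f \<in> mod_hom A (pow_module (regular_module A) J) (pow_module (regular_module A) J')"
    and g: "g \<in> mod_hom A (pow_module (regular_module A) J') (pow_module (regular_module A) J'')"
    and gf: "\<And>w. w \<in> carrier (pow_module (regular_module A) J) \<Longrightarrow> g (f w) = \<zero>\<^bsub>pow_module (regular_module A) J''\<^esub>"
    and v: "v \<in> carrier (pow_module (regular_module A) J'')"
  shows "trans_map A J J' f (trans_map A J' J'' g v) = \<zero>\<^bsub>pow_module (regular_module A) J\<^esub>"
proof (rule dot_eq_iff[OF A J(1)])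
  have gv: "trans_map A J' J'' g v \<in> carrier (pow_module (regular_module A) J')"
    by (rule mod_hom_closed[OF trans_map_hom[OF A J(2,3) g] v])
  show "trans_map A J J' f (trans_map A J' J'' g v) \<in> carrier (pow_module (regular_module A) J)"
    by (rule mod_hom_closed[OF trans_map_hom[OF A J(1,2) f] gv])
  show "\<zero>\<^bsub>pow_module (regular_module A) J\<^esub> \<in> carrier (pow_module (regular_module A) J)"
    by (rule abelian_groupE(2)[OF module_imp_abelian_group[OF module_pow_module[OF module_regular_module[OF A]]]])
  fix w assume w: "w \<in> carrier (pow_module (regular_module A) J)"
  show "dot A J (trans_map A J J' f (trans_map A J' J'' g v)) w = dot A J \<zero>\<^bsub>pow_module (regular_module A) J\<^esub> w"
    unfolding dot_trans_map[OF A J(1,2) f gv w] dot_trans_map[OF A J(2,3) g v mod_hom_closed[OF f w]] gf[OF w]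
      dot_zero_right[OF A J(3) v] dot_zero_left[OF A J(1) w] ..
qed

section \<open>External products of functionals\<close>

context tensor_resolution
begin

abbreviation "P' \<equiv> finite_complex R b d"
abbreviation "Q' \<equiv> finite_complex S c d'"
abbreviation "RA \<equiv> regular_module A"

lemma finite_complex_simps [simp]:
  "obj P' i = VR i" "bdry P' i = d i" "obj Q' j = WS j" "bdry Q' j = d' j"
  by (simp_all add: finite_complex_def)

lemma chain_P': "chain_complex R P'" and chain_Q': "chain_complex S Q'" and chain_T: "chain_complex A tensor_complex"
  unfolding chain_complex_def
  by (simp_all add: module_VR module_WS module_T d_hom d'_hom d_d d'_d' D' D'_D')

abbreviation "FR i \<equiv> mod_hom R (VR i) (regular_module R)"
abbreviation "FS j \<equiv> mod_hom S (WS j) (regular_module S)"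
abbreviation "FT n \<equiv> mod_hom A (T n) RA"

lemma module_RA: "module A RA"
  by (rule module_regular_module[OF cring_A])

lemma abelian_RA: "abelian_group RA"
  by (rule module_imp_abelian_group[OF module_RA])

lemma FT_eqI:
  assumes f: "f \<in> FT n" and g: "g \<in> FT n"
    and fg: "\<And>i v w. \<lbrakk>v \<in> carrier (V i); w \<in> carrier (W (n - i))\<rbrakk> \<Longrightarrow> f (gen n i v w) = g (gen n i v w)"
  shows "f = g"
proof (rule mod_hom_eqI[OF f g])
  show "f z = g z" if "z \<in> carrier (T n)" for z
    by (rule T_ext[where G = RA and f = f and g = g, OF abelian_RA mod_hom_closed[OF f] mod_hom_add[OF f] mod_hom_add[OF g] fg that])
qed

lemma
  assumes "g \<in> FR i"
  shows FR_closed: "v \<in> carrier (V i) \<Longrightarrow> g v \<in> carrier R"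
    and FR_add: "v \<in> carrier (V i) \<Longrightarrow> v' \<in> carrier (V i) \<Longrightarrow> g (v \<oplus>\<^bsub>V i\<^esub> v') = g v \<oplus>\<^bsub>R\<^esub> g v'"
    and FR_smult: "r \<in> carrier R \<Longrightarrow> v \<in> carrier (V i) \<Longrightarrow> g (r \<odot>\<^bsub>VR i\<^esub> v) = r \<otimes>\<^bsub>R\<^esub> g v"
  using mod_hom_closed[OF assms, of v] mod_hom_add[OF assms, of v v'] mod_hom_smult[OF assms, of r v] by simp_all

lemma
  assumes "h \<in> FS j"
  shows FS_closed: "w \<in> carrier (W j) \<Longrightarrow> h w \<in> carrier S"
    and FS_add: "w \<in> carrier (W j) \<Longrightarrow> w' \<in> carrier (W j) \<Longrightarrow> h (w \<oplus>\<^bsub>W j\<^esub> w') = h w \<oplus>\<^bsub>S\<^esub> h w'"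
    and FS_smult: "s \<in> carrier S \<Longrightarrow> w \<in> carrier (W j) \<Longrightarrow> h (s \<odot>\<^bsub>WS j\<^esub> w) = s \<otimes>\<^bsub>S\<^esub> h w"
  using mod_hom_closed[OF assms, of w] mod_hom_add[OF assms, of w w'] mod_hom_smult[OF assms, of s w] by simp_all

text \<open>The external product \<open>g \<times> h\<close> on the tensor complex, zero on the
  summands whose left degree is not \<open>i\<close>. No sign is built in; the Koszul sign reappears
  in \<open>ext_prod_bdry_right\<close>.\<close>

definition ext_prod :: "int \<Rightarrow> int \<Rightarrow> ((nat \<Rightarrow> 'r) \<Rightarrow> 'r) \<Rightarrow> ((nat \<Rightarrow> 's) \<Rightarrow> 's) \<Rightarrow> (int \<times> nat \<times> nat \<Rightarrow> ('r \<times> 's \<Rightarrow>\<^sub>0 int) set) \<Rightarrow> ('r \<times> 's \<Rightarrow>\<^sub>0 int) set"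
  where "ext_prod n i g h = (SOME f. f \<in> FT n \<and> (\<forall>i'. \<forall>v\<in>carrier (V i'). \<forall>w\<in>carrier (W (n - i')).
    f (gen n i' v w) = (if i' = i then tens (g v) (h w) else \<zero>\<^bsub>A\<^esub>)))"

lemma ext_prod_properties:
  assumes g: "g \<in> FR i" and h: "h \<in> FS j" and n: "n = i + j"
  shows "ext_prod n i g h \<in> FT n \<and> (\<forall>i'. \<forall>v\<in>carrier (V i'). \<forall>w\<in>carrier (W (n - i')).
    ext_prod n i g h (gen n i' v w) = (if i' = i then tens (g v) (h w) else \<zero>\<^bsub>A\<^esub>))"
proof -
  have j: "n - i = j" using n by simp
  have B: "linear_family n RA (\<lambda>i' v w. if i' = i then tens (g v) (h w) else \<zero>\<^bsub>A\<^esub>)"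
    by (rule linear_familyI)
      (auto simp: j FR_closed[OF g] FS_closed[OF h] FR_add[OF g] FS_add[OF h] FR_smult[OF g] FS_smult[OF h]
        tens_add_left tens_add_right tens_mult)
  obtain f where f: "f \<in> FT n" "\<And>i' v w. \<lbrakk>v \<in> carrier (V i'); w \<in> carrier (W (n - i'))\<rbrakk> \<Longrightarrow>
      f (gen n i' v w) = (if i' = i then tens (g v) (h w) else \<zero>\<^bsub>A\<^esub>)"
    by (rule linear_family_hom[OF module_RA B]) (rule that)
  show ?thesis
    unfolding ext_prod_def by (rule someI[of _ f], intro conjI allI ballI, rule f(1), rule f(2))
qed

lemma
  assumes "g \<in> FR i" "h \<in> FS j" "n = i + j"
  shows ext_prod_hom: "ext_prod n i g h \<in> FT n"
    and ext_prod_gen: "\<lbrakk>v \<in> carrier (V i'); w \<in> carrier (W (n - i'))\<rbrakk> \<Longrightarrow>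
      ext_prod n i g h (gen n i' v w) = (if i' = i then tens (g v) (h w) else \<zero>\<^bsub>A\<^esub>)"
  using ext_prod_properties[OF assms] by simp_all

text \<open>The identification of the dual of the tensor complex with the tensor product of the
  duals, on elements: the functional with coefficient vector \<open>v \<otimes> w\<close> is the
  external product of the functionals given by \<open>v\<close> and \<open>w\<close>.\<close>

lemma dot_gen:
  assumes v: "v \<in> carrier (V i)" and w: "w \<in> carrier (W j)" and n: "n = i + j"
  shows "dot A (Zs n) (gen n i v w) = ext_prod n i (dot R {..<b i} v) (dot S {..<c j} w)"
proof -
  have j: "n - i = j" using n by simp
  have v': "v \<in> carrier (VR i)" and w': "w \<in> carrier (WS j)" using v w by simp_all
  note g = dot_hom[OF R.is_cring finite_lessThan v'] and h = dot_hom[OF S.is_cring finite_lessThan w']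
  let ?f = "ext_prod n i (dot R {..<b i} v) (dot S {..<c j} w)"
  have "?f = dot A (Zs n) (\<lambda>p\<in>Zs n. ?f (single A (Zs n) p \<one>\<^bsub>A\<^esub>))"
    by (rule functional_eq_dot(2)[OF cring_A finite_Zs ext_prod_hom[OF g h n]])
  also have "(\<lambda>p\<in>Zs n. ?f (single A (Zs n) p \<one>\<^bsub>A\<^esub>)) = gen n i v w"
    unfolding gen_def
  proof (rule restrict_ext)
    fix p assume p: "p \<in> Zs n"
    obtain i' x y where p': "p = (i', x, y)" by (cases p)
    have xy: "x < b i'" "y < c (n - i')" using p by (simp_all add: p' mem_Zs)
    have o: "single R {..<b i'} x \<one>\<^bsub>R\<^esub> \<in> carrier (V i')" "single S {..<c (n - i')} y \<one>\<^bsub>S\<^esub> \<in> carrier (W (n - i'))"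
      by (simp_all add: R.abelian_group_axioms S.abelian_group_axioms)
    have "single A (Zs n) p \<one>\<^bsub>A\<^esub> = gen n i' (single R {..<b i'} x \<one>\<^bsub>R\<^esub>) (single S {..<c (n - i')} y \<one>\<^bsub>S\<^esub>)"
      using gen_single[of i' x y n "\<one>\<^bsub>R\<^esub>" "\<one>\<^bsub>S\<^esub>"] p by (simp add: p' tens_one)
    then have "?f (single A (Zs n) p \<one>\<^bsub>A\<^esub>) = (if i' = i then tens (dot R {..<b i} v (single R {..<b i'} x \<one>\<^bsub>R\<^esub>))
        (dot S {..<c j} w (single S {..<c (n - i')} y \<one>\<^bsub>S\<^esub>)) else \<zero>\<^bsub>A\<^esub>)"
      using ext_prod_gen[OF g h n o] by simp
    also have "\<dots> = (if i' = i then tens (v x) (w y) else \<zero>\<^bsub>A\<^esub>)"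
      using xy dot_single[OF R.is_cring finite_lessThan v', of x "\<one>\<^bsub>R\<^esub>"] dot_single[OF S.is_cring finite_lessThan w', of y "\<one>\<^bsub>S\<^esub>"]
        V_mem[OF v] W_mem[OF w] by (auto simp: j)
    finally show "?f (single A (Zs n) p \<one>\<^bsub>A\<^esub>) = (case p of (i', x, y) \<Rightarrow> if i' = i then tens (v x) (w y) else \<zero>\<^bsub>A\<^esub>)"
      by (simp add: p')
  qed
  finally show ?thesis by (rule sym)
qed

section \<open>The dual of the tensor complex\<close>

definition "dT i = trans_map R {..<b (i + 1)} {..<b i} (d (i + 1))"
definition "dT' j = trans_map S {..<c (j + 1)} {..<c j} (d' (j + 1))"

lemma d_up: "d (i + 1) \<in> mod_hom R (VR (i + 1)) (VR i)" and d'_up: "d' (i + 1) \<in> mod_hom S (WS (i + 1)) (WS i)"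
  using d_hom[of "i + 1"] d'_hom[of "i + 1"] by simp_all

lemma dT_hom: "dT i \<in> mod_hom R (VR i) (VR (i + 1))"
  unfolding dT_def by (rule trans_map_hom[OF R.is_cring finite_lessThan finite_lessThan d_up])

lemma dT'_hom: "dT' i \<in> mod_hom S (WS i) (WS (i + 1))"
  unfolding dT'_def by (rule trans_map_hom[OF S.is_cring finite_lessThan finite_lessThan d'_up])

lemma dot_dT:
  "\<lbrakk>v \<in> carrier (V i); v' \<in> carrier (V (i + 1))\<rbrakk> \<Longrightarrow>
    dot R {..<b (i + 1)} (dT i v) v' = dot R {..<b i} v (d (i + 1) v')"
  using dot_trans_map[OF R.is_cring finite_lessThan finite_lessThan d_up, of v i v'] by (simp add: dT_def)

lemma dot_dT':
  "\<lbrakk>w \<in> carrier (W i); w' \<in> carrier (W (i + 1))\<rbrakk> \<Longrightarrow>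
    dot S {..<c (i + 1)} (dT' i w) w' = dot S {..<c i} w (d' (i + 1) w')"
  using dot_trans_map[OF S.is_cring finite_lessThan finite_lessThan d'_up, of w i w'] by (simp add: dT'_def)

lemma dT_dT: "v \<in> carrier (V i) \<Longrightarrow> dT (i + 1) (dT i v) = \<zero>\<^bsub>V (i + 1 + 1)\<^esub>"
  using trans_map_trans_map[OF R.is_cring finite_lessThan finite_lessThan finite_lessThan d_up d_up, of i v]
    d_d[of _ "i + 1 + 1", unfolded add_diff_cancel_right'] by (simp add: dT_def)

lemma dT'_dT': "w \<in> carrier (W i) \<Longrightarrow> dT' (i + 1) (dT' i w) = \<zero>\<^bsub>W (i + 1 + 1)\<^esub>"
  using trans_map_trans_map[OF S.is_cring finite_lessThan finite_lessThan finite_lessThan d'_up d'_up, of i w]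
    d'_d'[of _ "i + 1 + 1", unfolded add_diff_cancel_right'] by (simp add: dT'_def)

text \<open>The transposed boundaries raise degrees, hence \<open>q = 1\<close>; this makes the
  Kuenneth homotopy available on the dual side. The sign of \<open>hom_differential\<close> is left
  out, which changes neither cocycles nor coboundaries.\<close>

sublocale co: tensor_differential K R S \<epsilon> \<delta> b c 1 dT dT'
  by unfold_locales (use dT_hom dT'_hom dT_dT dT'_dT' in simp_all)

text \<open>The tensor product of the transposed differentials is the transpose of the tensor
  differential. Both sides are functionals in \<open>z\<close>, so they are compared on pure
  tensors.\<close>

lemma dot_co_D:
  assumes u: "u \<in> carrier (T n)"
  shows "z \<in> carrier (T (n + 1)) \<Longrightarrow> dot A (Zs (n + 1)) (co.D n u) z = dot A (Zs n) u (D (n + 1) z)"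
  using u
proof (induction u arbitrary: z rule: T_induct)
  case (add u u')
  have Dz: "D (n + 1) z \<in> carrier (T n)" using mod_hom_closed[OF D' add(5)] by simp
  show ?case
    unfolding co.D_add[OF add(1,2)]
      dot_add_left[OF cring_A finite_Zs co.D_closed[OF add(1)] co.D_closed[OF add(2)] add(5)]
      dot_add_left[OF cring_A finite_Zs add(1,2) Dz] add.IH(1)[OF add(5)] add.IH(2)[OF add(5)] ..
next
  case (gen i v w)
  have z: "z \<in> carrier (T (n + 1))" by (rule gen(3))
  have Dn: "D (n + 1) \<in> mod_hom A (T (n + 1)) (T n)" using D'[of "n + 1"] by simp
  have g: "gen n i v w \<in> carrier (T n)" using gen(1,2) by simp
  note F1 = dot_hom[OF cring_A finite_Zs co.D_closed[OF g]] and F2 = mod_hom_compose[OF module_T Dn dot_hom[OF cring_A finite_Zs g]]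
  have "dot A (Zs (n + 1)) (co.D n (gen n i v w)) = compose (carrier (T (n + 1))) (dot A (Zs n) (gen n i v w)) (D (n + 1))"
  proof (rule FT_eqI[OF F1 F2])
    fix i' v' w' assume v': "v' \<in> carrier (V i')" and w': "w' \<in> carrier (W (n + 1 - i'))"
    let ?z = "gen (n + 1) i' v' w'"
    note v = gen(1) and w = gen(2)
    note dTv = co.dV_closed[OF v] and dTw = co.dW_closed[OF w]
    have w1: "w \<in> carrier (W (n + 1 - (i + 1)))" using w by simp
    have z: "?z \<in> carrier (T (n + 1))" using v' w' by simp
    have dv': "d i' v' \<in> carrier (V (i' - 1))" using mod_hom_closed[OF d_hom, of v' i'] v' by simp
    have w'1: "w' \<in> carrier (W (n - (i' - 1)))" using w' by (simp add: algebra_simps)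
    have dw': "d' (n + 1 - i') w' \<in> carrier (W (n - i'))" using mod_hom_closed[OF d'_hom, of w' "n + 1 - i'"] w' by simp
    note c1 = gen_closed[OF dTv w1] and c2 = gen_closed[OF v dTw]
    note e1 = gen_closed[OF dv' w'1] and e2 = gen_closed[OF v' dw']
    let ?a = "if i' = i + 1 then tens (dot R {..<b (i + 1)} (dT i v) v') (dot S {..<c (n - i)} w w') else \<zero>\<^bsub>A\<^esub>"
    let ?b = "if i' = i then tens (dot R {..<b i} v v') (dot S {..<c (n - i + 1)} (dT' (n - i) w) w') else \<zero>\<^bsub>A\<^esub>"
    have gv: "dot R {..<b i} v \<in> FR i" "dot R {..<b (i + 1)} (dT i v) \<in> FR (i + 1)"
      "dot S {..<c (n - i)} w \<in> FS (n - i)" "dot S {..<c (n - i + 1)} (dT' (n - i) w) \<in> FS (n - i + 1)"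
      using v dTv w dTw by (auto intro!: dot_hom R.is_cring S.is_cring simp: algebra_simps)
    have dTw': "dT' (n - i) w \<in> carrier (W (n - i + 1))" using dTw by (simp add: algebra_simps)
    have ix: "n + 1 = i + 1 + (n - i)" "n + 1 = i + (n - i + 1)" "n = i + (n - i)" by simp_all
    have L1: "dot A (Zs (n + 1)) (gen (n + 1) (i + 1) (dT i v) w) ?z = ?a"
      unfolding dot_gen[OF dTv w ix(1)] by (rule ext_prod_gen[OF gv(2,3) ix(1) v' w'])
    have L2: "dot A (Zs (n + 1)) (gen (n + 1) i v (dT' (n - i) w)) ?z = ?b"
      unfolding dot_gen[OF v dTw' ix(2)] by (rule ext_prod_gen[OF gv(1,4) ix(2) v' w'])
    have R1: "dot A (Zs n) (gen n i v w) (gen n (i' - 1) (d i' v') w') = ?a"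
      unfolding dot_gen[OF v w ix(3)] ext_prod_gen[OF gv(1,3) ix(3) dv' w'1]
      using dot_dT[OF v, of v'] v' by auto
    have R2: "dot A (Zs n) (gen n i v w) (gen n i' v' (d' (n + 1 - i') w')) = ?b"
    proof (cases "i' = i")
      case True
      have e: "n - i + 1 = n + 1 - i" by simp
      then show ?thesis
        unfolding dot_gen[OF v w ix(3)] ext_prod_gen[OF gv(1,3) ix(3) v' dw']
        using dot_dT'[OF w, of w', unfolded e] w' True unfolding e by simp
    next
      case False
      then show ?thesis unfolding dot_gen[OF v w ix(3)] ext_prod_gen[OF gv(1,3) ix(3) v' dw'] by simp
    qed
    have S: "dot A (Zs (n + 1)) (sg (T (n + 1)) i x) ?z = sg RA i (dot A (Zs (n + 1)) x ?z)" if "x \<in> carrier (T (n + 1))" for x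
      by (rule additive_sg[OF abelian_T abelian_RA, where f = "\<lambda>x. dot A (Zs (n + 1)) x ?z"])
        (simp_all add: that z dot_closed[OF cring_A finite_Zs] dot_add_left[OF cring_A finite_Zs])
    have "dot A (Zs (n + 1)) (co.D n (gen n i v w)) ?z = ?a \<oplus>\<^bsub>A\<^esub> sg RA i ?b"
      unfolding co.D_gen[OF v w] dot_add_left[OF cring_A finite_Zs c1 sg_closed[OF abelian_T c2] z] S[OF c2] L1 L2 ..
    \<comment> \<open>The two sides carry signs for different degrees, \<open>i\<close> and
      \<open>i'\<close>, but the term is zero unless these agree.\<close>
    also have "sg RA i ?b = sg RA i' ?b"
      using sg_zero[OF abelian_RA] by (cases "i' = i") simp_all
    also have "?a \<oplus>\<^bsub>A\<^esub> sg RA i' ?b = dot A (Zs n) (gen n i v w) (D (n + 1) ?z)"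
    proof -
      have Dg: "D (n + 1) ?z = gen n (i' - 1) (d i' v') w' \<oplus>\<^bsub>T n\<^esub> sg (T n) i' (gen n i' v' (d' (n + 1 - i') w'))"
        using D'_gen[OF v' w'] by simp
      show ?thesis
        unfolding Dg mod_hom_add[OF dot_hom[OF cring_A finite_Zs g] e1 sg_closed[OF abelian_T e2]]
          mod_hom_sg[OF dot_hom[OF cring_A finite_Zs g] abelian_T abelian_RA e2] R1 R2 by simp
    qed
    finally show "dot A (Zs (n + 1)) (co.D n (gen n i v w)) ?z = compose (carrier (T (n + 1))) (dot A (Zs n) (gen n i v w)) (D (n + 1)) ?z"
      unfolding compose_eq[OF z] .
  qed
  then show ?case using z by (simp add: compose_eq)
qed

lemma ext_prod_eqI:
  assumes g: "g \<in> FR i" and h: "h \<in> FS j" and n: "n = i + j" and f: "f \<in> FT n"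
    and gen: "\<And>i' v w. \<lbrakk>v \<in> carrier (V i'); w \<in> carrier (W (n - i'))\<rbrakk> \<Longrightarrow>
      f (gen n i' v w) = (if i' = i then tens (g v) (h w) else \<zero>\<^bsub>A\<^esub>)"
  shows "ext_prod n i g h = f"
  by (rule FT_eqI[OF ext_prod_hom[OF g h n] f]) (simp add: ext_prod_gen[OF g h n] gen)

lemma cocycle_R:
  assumes "g \<in> cocycle_functionals R P' i"
  shows "g \<in> FR i" "v \<in> carrier (V (i + 1)) \<Longrightarrow> g (d (i + 1) v) = \<zero>\<^bsub>R\<^esub>"
  using assms unfolding cocycle_functionals_def by simp_all

lemma cocycle_S:
  assumes "h \<in> cocycle_functionals S Q' j"
  shows "h \<in> FS j" "w \<in> carrier (W (j + 1)) \<Longrightarrow> h (d' (j + 1) w) = \<zero>\<^bsub>S\<^esub>"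
  using assms unfolding cocycle_functionals_def by simp_all

lemma ext_prod_add_left:
  assumes g: "g \<in> FR i" "g' \<in> FR i" and h: "h \<in> FS j" and n: "n = i + j"
  shows "ext_prod n i (\<lambda>v\<in>carrier (V i). g v \<oplus>\<^bsub>R\<^esub> g' v) h = (\<lambda>z\<in>carrier (T n). ext_prod n i g h z \<oplus>\<^bsub>A\<^esub> ext_prod n i g' h z)"
proof -
  note RM = module_regular_module[OF R.is_cring]
  have s: "(\<lambda>v\<in>carrier (V i). g v \<oplus>\<^bsub>R\<^esub> g' v) \<in> FR i"
    using mod_hom_plus[OF module_VR RM g] by simp
  have f: "(\<lambda>z\<in>carrier (T n). ext_prod n i g h z \<oplus>\<^bsub>A\<^esub> ext_prod n i g' h z) \<in> FT n"
    using mod_hom_plus[OF module_T module_RA ext_prod_hom[OF g(1) h n] ext_prod_hom[OF g(2) h n]] by simp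
  show ?thesis
    by (rule ext_prod_eqI[OF s h n f])
      (auto simp: n ext_prod_gen[OF g(1) h] ext_prod_gen[OF g(2) h] FR_closed[OF g(1)] FR_closed[OF g(2)] FS_closed[OF h] tens_add_left)
qed

lemma ext_prod_add_right:
  assumes g: "g \<in> FR i" and h: "h \<in> FS j" "h' \<in> FS j" and n: "n = i + j"
  shows "ext_prod n i g (\<lambda>w\<in>carrier (W j). h w \<oplus>\<^bsub>S\<^esub> h' w) = (\<lambda>z\<in>carrier (T n). ext_prod n i g h z \<oplus>\<^bsub>A\<^esub> ext_prod n i g h' z)"
proof -
  note SM = module_regular_module[OF S.is_cring]
  have s: "(\<lambda>v\<in>carrier (W j). h v \<oplus>\<^bsub>S\<^esub> h' v) \<in> FS j"
    using mod_hom_plus[OF module_WS SM h] by simp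
  have f: "(\<lambda>z\<in>carrier (T n). ext_prod n i g h z \<oplus>\<^bsub>A\<^esub> ext_prod n i g h' z) \<in> FT n"
    using mod_hom_plus[OF module_T module_RA ext_prod_hom[OF g h(1) n] ext_prod_hom[OF g h(2) n]] by simp
  show ?thesis
    by (rule ext_prod_eqI[OF g s n f])
      (auto simp: n ext_prod_gen[OF g h(1)] ext_prod_gen[OF g h(2)] FR_closed[OF g] FS_closed[OF h(1)] FS_closed[OF h(2)] tens_add_right)
qed

text \<open>Evaluating \<open>u \<times> h\<close> on \<open>D (v \<otimes> w)\<close> gives a term
  with \<open>u (d v)\<close> and a term with \<open>h (d' w)\<close>, and the second is zero as
  \<open>h\<close> is a cocycle.\<close>

lemma ext_prod_bdry_left:
  assumes u: "u \<in> FR (i - 1)" and h: "h \<in> cocycle_functionals S Q' j" and n: "n = i + j"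
  shows "ext_prod n i (\<lambda>v\<in>carrier (V i). u (d i v)) h = (\<lambda>z\<in>carrier (T n). ext_prod (n - 1) (i - 1) u h (D n z))"
    and "ext_prod (n - 1) (i - 1) u h \<in> FT (n - 1)"
proof -
  note h1 = cocycle_S(1)[OF h]
  have n1: "n - 1 = i - 1 + j" using n by simp
  have ud: "(\<lambda>v\<in>carrier (V i). u (d i v)) \<in> FR i"
    using mod_hom_compose[OF module_VR d_hom u] by (simp add: compose_def)
  show f1: "ext_prod (n - 1) (i - 1) u h \<in> FT (n - 1)" by (rule ext_prod_hom[OF u h1 n1])
  have f: "(\<lambda>z\<in>carrier (T n). ext_prod (n - 1) (i - 1) u h (D n z)) \<in> FT n"
    using mod_hom_compose[OF module_T D' f1] by (simp add: compose_def)
  show "ext_prod n i (\<lambda>v\<in>carrier (V i). u (d i v)) h = (\<lambda>z\<in>carrier (T n). ext_prod (n - 1) (i - 1) u h (D n z))"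
  proof (rule ext_prod_eqI[OF ud h1 n f])
    fix i' v w assume v: "v \<in> carrier (V i')" and w: "w \<in> carrier (W (n - i'))"
    have dv: "d i' v \<in> carrier (V (i' - 1))" using mod_hom_closed[OF d_hom, of v i'] v by simp
    have dw: "d' (n - i') w \<in> carrier (W (n - 1 - i'))"
      using mod_hom_closed[OF d'_hom, of w "n - i'"] w by (simp add: algebra_simps)
    have w1: "w \<in> carrier (W (n - 1 - (i' - 1)))" using w by simp
    note c1 = gen_closed[OF dv w1] and c2 = gen_closed[OF v dw]
    \<comment> \<open>The second term survives only in left degree \<open>i - 1\<close>; there
      \<open>w\<close> has degree \<open>j + 1\<close>, and \<open>h\<close> kills its
      boundary.\<close>
    have z: "ext_prod (n - 1) (i - 1) u h (gen (n - 1) i' v (d' (n - i') w)) = \<zero>\<^bsub>A\<^esub>"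
    proof (cases "i' = i - 1")
      case True
      have "n - i' = j + 1" using True n by simp
      then have "h (d' (n - i') w) = \<zero>\<^bsub>S\<^esub>" using cocycle_S(2)[OF h, of w] w by simp
      moreover have "u v \<in> carrier R" using FR_closed[OF u] v True by simp
      ultimately show ?thesis unfolding ext_prod_gen[OF u h1 n1 v dw] by (simp add: tens_zero_right flip: True)
    next
      case False
      then show ?thesis unfolding ext_prod_gen[OF u h1 n1 v dw] by simp
    qed
    have "ext_prod (n - 1) (i - 1) u h (D n (gen n i' v w)) = (if i' - 1 = i - 1 then tens (u (d i' v)) (h w) else \<zero>\<^bsub>A\<^esub>) \<oplus>\<^bsub>A\<^esub> \<zero>\<^bsub>A\<^esub>"
      unfolding D'_gen[OF v w] mod_hom_add[OF f1 c1 sg_closed[OF abelian_T c2]] mod_hom_sg[OF f1 abelian_T abelian_RA c2] z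
        ext_prod_gen[OF u h1 n1 dv w1] by (simp add: sg_zero[OF abelian_RA, simplified])
    moreover have "tens (u (d i v)) (h w) \<in> carrier A" if "i' = i"
      using FR_closed[OF u, of "d i v"] FS_closed[OF h1, of w] dv w that n by simp
    ultimately show "(\<lambda>z\<in>carrier (T n). ext_prod (n - 1) (i - 1) u h (D n z)) (gen n i' v w) =
        (if i' = i then tens ((\<lambda>v\<in>carrier (V i). u (d i v)) v) (h w) else \<zero>\<^bsub>A\<^esub>)"
      using v w by auto
  qed
qed

text \<open>As on the left, with the roles exchanged. The differential acts on the right factor with
  the sign \<open>(-1)^i\<close>, which is compensated in the functional.\<close>

lemma ext_prod_bdry_right:
  assumes g: "g \<in> cocycle_functionals R P' i" and u: "u \<in> FS (j - 1)" and n: "n = i + j"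
  shows "ext_prod n i g (\<lambda>w\<in>carrier (W j). u (d' j w)) =
      (\<lambda>z\<in>carrier (T n). (\<lambda>y\<in>carrier (T (n - 1)). sg RA i (ext_prod (n - 1) i g u y)) (D n z))"
    and "(\<lambda>y\<in>carrier (T (n - 1)). sg RA i (ext_prod (n - 1) i g u y)) \<in> FT (n - 1)" (is "?f \<in> _")
proof -
  note g1 = cocycle_R(1)[OF g]
  have n1: "n - 1 = i + (j - 1)" using n by simp
  have ud: "(\<lambda>w\<in>carrier (W j). u (d' j w)) \<in> FS j"
    using mod_hom_compose[OF module_WS d'_hom u] by (simp add: compose_def)
  note e = ext_prod_hom[OF g1 u n1]
  show f1: "?f \<in> FT (n - 1)"
  proof (cases "even i")
    case True
    have "?f = ext_prod (n - 1) i g u" 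
      using True mod_hom_extensional[OF e] by (simp add: sg_def extensional_restrict)
    then show ?thesis using e by simp
  next
    case False
    then show ?thesis using mod_hom_uminus[OF module_T module_RA e] by (simp add: sg_def)
  qed
  have f: "(\<lambda>z\<in>carrier (T n). ?f (D n z)) \<in> FT n"
    using mod_hom_compose[OF module_T D' f1] unfolding compose_def .
  show "ext_prod n i g (\<lambda>w\<in>carrier (W j). u (d' j w)) = (\<lambda>z\<in>carrier (T n). ?f (D n z))"
  proof (rule ext_prod_eqI[OF g1 ud n f])
    fix i' v w assume v: "v \<in> carrier (V i')" and w: "w \<in> carrier (W (n - i'))"
    have dv: "d i' v \<in> carrier (V (i' - 1))" using mod_hom_closed[OF d_hom, of v i'] v by simp
    have dw: "d' (n - i') w \<in> carrier (W (n - 1 - i'))"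
      using mod_hom_closed[OF d'_hom, of w "n - i'"] w by (simp add: algebra_simps)
    have w1: "w \<in> carrier (W (n - 1 - (i' - 1)))" using w by simp
    note c1 = gen_closed[OF dv w1] and c2 = gen_closed[OF v dw]
    have z: "ext_prod (n - 1) i g u (gen (n - 1) (i' - 1) (d i' v) w) = \<zero>\<^bsub>A\<^esub>"
    proof (cases "i' = i + 1")
      case True
      have "g (d i' v) = \<zero>\<^bsub>R\<^esub>" using cocycle_R(2)[OF g, of v] v True by simp
      moreover have "n - 1 - (i' - 1) = j - 1" using True n by simp
      then have "u w \<in> carrier S" using FS_closed[OF u, of w] w1 by simp
      ultimately show ?thesis unfolding ext_prod_gen[OF g1 u n1 dv w1] by (simp add: tens_zero_left)
    next
      case False
      then show ?thesis unfolding ext_prod_gen[OF g1 u n1 dv w1] by simp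
    qed
    have t: "tens (g v) (u (d' j w)) \<in> carrier A" if "i' = i"
      using FR_closed[OF g1, of v] FS_closed[OF u, of "d' (n - i') w"] dw v that n by simp
    have "?f (D n (gen n i' v w)) = sg RA i \<zero>\<^bsub>A\<^esub> \<oplus>\<^bsub>A\<^esub> sg RA i' (sg RA i (if i' = i then tens (g v) (u (d' (n - i') w)) else \<zero>\<^bsub>A\<^esub>))"
      unfolding D'_gen[OF v w] mod_hom_add[OF f1 c1 sg_closed[OF abelian_T c2]] mod_hom_sg[OF f1 abelian_T abelian_RA c2]
        restrict_apply'[OF c1] restrict_apply'[OF c2] z
        ext_prod_gen[OF g1 u n1 v dw] by simp
    also have "\<dots> = (if i' = i then tens (g v) (u (d' j w)) else \<zero>\<^bsub>A\<^esub>)"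
      using t n sg_sg[OF abelian_RA, of "tens (g v) (u (d' j w))" i i] sg_zero[OF abelian_RA]
      by (auto simp: sg_even)
    finally show "(\<lambda>z\<in>carrier (T n). ?f (D n z)) (gen n i' v w) =
        (if i' = i then tens (g v) ((\<lambda>w\<in>carrier (W j). u (d' j w)) w) else \<zero>\<^bsub>A\<^esub>)"
      using v w n by auto
  qed
qed

section \<open>External products of endomorphism cocycles and their action\<close>

lemma cocycle_endo_R:
  assumes "\<alpha> \<in> hom_cocycles R P' P' m"
  shows "\<alpha> i \<in> mod_hom R (VR i) (VR (i - m))"
    and "v \<in> carrier (V i) \<Longrightarrow> d (i - m) (\<alpha> i v) = sg (V (i - m - 1)) m (\<alpha> (i - 1) (d i v))"
  using assms unfolding cocycle_endo_iff[OF chain_P'] by (simp_all add: sg_def)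

lemma cocycle_endo_S:
  assumes "\<beta> \<in> hom_cocycles S Q' Q' m"
  shows "\<beta> j \<in> mod_hom S (WS j) (WS (j - m))"
    and "w \<in> carrier (W j) \<Longrightarrow> d' (j - m) (\<beta> j w) = sg (W (j - m - 1)) m (\<beta> (j - 1) (d' j w))"
  using assms unfolding cocycle_endo_iff[OF chain_Q'] by (simp_all add: sg_def)

lemma gen_sg_left: "v \<in> carrier (V i) \<Longrightarrow> w \<in> carrier (W (n - i)) \<Longrightarrow> gen n i (sg (V i) k v) w = sg (T n) k (gen n i v w)"
  and gen_sg_right: "v \<in> carrier (V i) \<Longrightarrow> w \<in> carrier (W (n - i)) \<Longrightarrow> gen n i v (sg (W (n - i)) k w) = sg (T n) k (gen n i v w)"
  by (simp_all add: sg_def gen_minus_left gen_minus_right)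

text \<open>This is \<open>\<alpha> \<otimes> \<beta>\<close> with the Koszul sign
  \<open>(-1)^(m' i)\<close>, without which it would not commute with the differentials up to the
  required sign. The free parameter \<open>k\<close> changes \<open>\<gamma>\<close> by a global
  sign only and is used to normalize it.\<close>

lemma tensor_cocycle:
  assumes \<alpha>: "\<alpha> \<in> hom_cocycles R P' P' m" and \<beta>: "\<beta> \<in> hom_cocycles S Q' Q' m'" and e: "e = m + m'"
  obtains \<gamma> where "\<gamma> \<in> hom_cocycles A tensor_complex tensor_complex e"
    "\<And>N i v w. \<lbrakk>v \<in> carrier (V i); w \<in> carrier (W (N - i))\<rbrakk> \<Longrightarrow>
      \<gamma> N (gen N i v w) = sg (T (N - e)) (m' * (i - k)) (gen (N - e) (i - m) (\<alpha> i v) (\<beta> (N - i) w))"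
proof -
  note \<alpha>h = cocycle_endo_R(1)[OF \<alpha>] and \<beta>h = cocycle_endo_S(1)[OF \<beta>]
  have h: "\<And>i. \<alpha> i \<in> mod_hom R (VR i) (VR (i + - m))" "\<And>j. \<beta> j \<in> mod_hom S (WS j) (WS (j + - m'))"
    using \<alpha>h \<beta>h by simp_all
  have "\<exists>f. f \<in> mod_hom A (T N) (T (N - e)) \<and> (\<forall>i. \<forall>v\<in>carrier (V i). \<forall>w\<in>carrier (W (N - i)).
      f (gen N i v w) = sg (T (N - e)) (m' * (i - k)) (gen (N - e) (i - m) (\<alpha> i v) (\<beta> (N - i) w)))" for N
  proof -
    have "linear_family N (T (N - e)) (\<lambda>i v w. sg (T (N - e)) (m' * (i - k)) (gen (N - e) (i + - m) (\<alpha> i v) (\<beta> (N - i) w)))"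
      by (rule linear_family_gen[OF h]) (simp add: e)
    note B = this
    obtain f where f: "f \<in> mod_hom A (T N) (T (N - e))" "\<And>i v w. \<lbrakk>v \<in> carrier (V i); w \<in> carrier (W (N - i))\<rbrakk> \<Longrightarrow>
      f (gen N i v w) = sg (T (N - e)) (m' * (i - k)) (gen (N - e) (i + - m) (\<alpha> i v) (\<beta> (N - i) w))"
      by (rule linear_family_hom[OF module_T B]) (rule that)
    show ?thesis
      by (intro exI[of _ f] conjI allI ballI, rule f(1)) (use f(2) in simp)
  qed
  then have "\<exists>\<gamma>. \<forall>N. \<gamma> N \<in> mod_hom A (T N) (T (N - e)) \<and> (\<forall>i. \<forall>v\<in>carrier (V i). \<forall>w\<in>carrier (W (N - i)).
      \<gamma> N (gen N i v w) = sg (T (N - e)) (m' * (i - k)) (gen (N - e) (i - m) (\<alpha> i v) (\<beta> (N - i) w)))"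
    by (intro choice allI)
  then obtain \<gamma> where \<gamma>: "\<forall>N. \<gamma> N \<in> mod_hom A (T N) (T (N - e)) \<and> (\<forall>i. \<forall>v\<in>carrier (V i). \<forall>w\<in>carrier (W (N - i)).
      \<gamma> N (gen N i v w) = sg (T (N - e)) (m' * (i - k)) (gen (N - e) (i - m) (\<alpha> i v) (\<beta> (N - i) w)))"
    by (rule exE)
  have \<gamma>h: "\<gamma> N \<in> mod_hom A (T N) (T (N - e))" for N using \<gamma> by simp
  have \<gamma>g: "\<gamma> N (gen N i v w) = sg (T (N - e)) (m' * (i - k)) (gen (N - e) (i - m) (\<alpha> i v) (\<beta> (N - i) w))"
    if "v \<in> carrier (V i)" "w \<in> carrier (W (N - i))" for N i v w using \<gamma> that by simp
  have Dc: "D N z \<in> carrier (T (N - 1))" if "z \<in> carrier (T N)" for N z using mod_hom_closed[OF D' that] .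
  have \<gamma>1: "\<gamma> (N - 1) \<in> mod_hom A (T (N - 1)) (T (N - e - 1))" for N
    using \<gamma>h[of "N - 1"] by (simp add: algebra_simps)
  have comm: "D (N - e) (\<gamma> N z) = sg (T (N - e - 1)) e (\<gamma> (N - 1) (D N z))" if "z \<in> carrier (T N)" for N z
    using that
  proof (induction z rule: T_induct)
    case (gen i v w)
    note v = gen(1) and w = gen(2)
    let ?M = "N - e" and ?L = "N - e - 1"
    have \<alpha>v: "\<alpha> i v \<in> carrier (V (i - m))" using mod_hom_closed[OF \<alpha>h, of v i] v by simp
    have \<beta>w: "\<beta> (N - i) w \<in> carrier (W (?M - (i - m)))" using mod_hom_closed[OF \<beta>h, of w "N - i"] w by (simp add: e algebra_simps)
    have dv: "d i v \<in> carrier (V (i - 1))" using mod_hom_closed[OF d_hom, of v i] v by simp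
    have dw: "d' (N - i) w \<in> carrier (W (N - 1 - i))"
      using mod_hom_closed[OF d'_hom, of w "N - i"] w by (simp add: algebra_simps)
    have w1: "w \<in> carrier (W (N - 1 - (i - 1)))" using w by simp
    have \<alpha>dv: "\<alpha> (i - 1) (d i v) \<in> carrier (V (i - m - 1))"
      using mod_hom_closed[OF \<alpha>h, of "d i v" "i - 1"] dv by (simp add: algebra_simps)
    have \<beta>dw: "\<beta> (N - 1 - i) (d' (N - i) w) \<in> carrier (W (?L - (i - m)))"
      using mod_hom_closed[OF \<beta>h, of "d' (N - i) w" "N - 1 - i"] dw by (simp add: e algebra_simps)
    have \<beta>w1: "\<beta> (N - i) w \<in> carrier (W (?L - (i - m - 1)))" 
    proof -
      have "?L - (i - m - 1) = ?M - (i - m)" by simp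
      then show ?thesis using \<beta>w by (simp only:)
    qed
    define x where "x = gen ?L (i - m - 1) (\<alpha> (i - 1) (d i v)) (\<beta> (N - i) w)"
    define y where "y = gen ?L (i - m) (\<alpha> i v) (\<beta> (N - 1 - i) (d' (N - i) w))"
    have x: "x \<in> carrier (T ?L)" unfolding x_def by (rule gen_closed[OF \<alpha>dv \<beta>w1])
    have y: "y \<in> carrier (T ?L)" unfolding y_def by (rule gen_closed[OF \<alpha>v \<beta>dw])
    note sc = sg_closed[OF abelian_T x] sg_closed[OF abelian_T y] and ss = sg_sg[OF abelian_T x] sg_sg[OF abelian_T y]
    have Dg: "D ?M (gen ?M (i - m) (\<alpha> i v) (\<beta> (N - i) w)) = sg (T ?L) m x \<oplus>\<^bsub>T ?L\<^esub> sg (T ?L) (i - m + m') y"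
    proof -
      have j: "?M - (i - m) = N - i - m'" "N - i - 1 = N - 1 - i" "N - i - m' - 1 = ?L - (i - m)" by (simp_all add: e)
      have 1: "gen ?L (i - m - 1) (d (i - m) (\<alpha> i v)) (\<beta> (N - i) w) = sg (T ?L) m x"
        unfolding x_def cocycle_endo_R(2)[OF \<alpha> v] by (rule gen_sg_left[OF \<alpha>dv \<beta>w1])
      have 2: "gen ?L (i - m) (\<alpha> i v) (d' (?M - (i - m)) (\<beta> (N - i) w)) = sg (T ?L) m' y"
        unfolding y_def j(1) cocycle_endo_S(2)[OF \<beta> w] j(2,3) by (rule gen_sg_right[OF \<alpha>v \<beta>dw])
      show ?thesis unfolding D'_gen[OF \<alpha>v \<beta>w] 1 2 ss ..
    qed
    have L: "D ?M (\<gamma> N (gen N i v w)) = sg (T ?L) (m' * (i - k) + m) x \<oplus>\<^bsub>T ?L\<^esub> sg (T ?L) (m' * (i - k) + (i - m + m')) y"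
      unfolding \<gamma>g[OF v w] mod_hom_sg[OF D' abelian_T abelian_T gen_closed[OF \<alpha>v \<beta>w]] Dg
        sg_add[OF abelian_T sc] ss ..
    have g1: "gen (N - 1) (i - 1) (d i v) w \<in> carrier (T (N - 1))" by (rule gen_closed[OF dv w1])
    have g2: "gen (N - 1) i v (d' (N - i) w) \<in> carrier (T (N - 1))" by (rule gen_closed[OF v dw])
    have ix: "N - 1 - e = ?L" "i - 1 - m = i - m - 1" "N - 1 - (i - 1) = N - i" by simp_all
    have \<gamma>x: "\<gamma> (N - 1) (gen (N - 1) (i - 1) (d i v) w) = sg (T ?L) (m' * (i - 1 - k)) x"
      using \<gamma>g[OF dv w1] unfolding ix x_def .
    have \<gamma>y: "\<gamma> (N - 1) (gen (N - 1) i v (d' (N - i) w)) = sg (T ?L) (m' * (i - k)) y"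
      using \<gamma>g[OF v dw] unfolding ix y_def .
    have "sg (T ?L) e (\<gamma> (N - 1) (D N (gen N i v w))) =
        sg (T ?L) (e + m' * (i - 1 - k)) x \<oplus>\<^bsub>T ?L\<^esub> sg (T ?L) (e + (i + m' * (i - k))) y"
      unfolding D'_gen[OF v w] mod_hom_add[OF \<gamma>1 g1 sg_closed[OF abelian_T g2]] mod_hom_sg[OF \<gamma>1 abelian_T abelian_T g2]
        \<gamma>x \<gamma>y ss sg_add[OF abelian_T sc] ..
    \<comment> \<open>With \<open>e = m + m'\<close> the exponents at \<open>x\<close> are equal,
      and those at \<open>y\<close> differ by \<open>2 * m\<close>.\<close>
    also have "sg (T ?L) (e + m' * (i - 1 - k)) x = sg (T ?L) (m' * (i - k) + m) x"
      by (rule sg_cong) (simp add: e algebra_simps)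
    also have "sg (T ?L) (e + (i + m' * (i - k))) y = sg (T ?L) (m' * (i - k) + (i - m + m')) y"
      by (rule sg_cong) (simp add: e algebra_simps)
    finally show ?case unfolding L by (rule sym)
  next
    case (add z z')
    note D0 = mod_hom_closed[OF \<gamma>h add(1)] mod_hom_closed[OF \<gamma>h add(2)]
    note D1 = mod_hom_closed[OF \<gamma>1 Dc[OF add(1)]] mod_hom_closed[OF \<gamma>1 Dc[OF add(2)]]
    have "D (N - e) (\<gamma> N (z \<oplus>\<^bsub>T N\<^esub> z')) = D (N - e) (\<gamma> N z) \<oplus>\<^bsub>T (N - e - 1)\<^esub> D (N - e) (\<gamma> N z')"
      unfolding mod_hom_add[OF \<gamma>h add(1,2)] by (rule mod_hom_add[OF D' D0])
    also have "\<dots> = sg (T (N - e - 1)) e (\<gamma> (N - 1) (D N z) \<oplus>\<^bsub>T (N - e - 1)\<^esub> \<gamma> (N - 1) (D N z'))"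
      unfolding add.IH by (rule sg_add[OF abelian_T D1, symmetric])
    also have "\<gamma> (N - 1) (D N z) \<oplus>\<^bsub>T (N - e - 1)\<^esub> \<gamma> (N - 1) (D N z') = \<gamma> (N - 1) (D N (z \<oplus>\<^bsub>T N\<^esub> z'))"
      unfolding mod_hom_add[OF D' add(1,2)] by (rule mod_hom_add[OF \<gamma>1 Dc[OF add(1)] Dc[OF add(2)], symmetric])
    finally show ?case .
  qed
  have "\<gamma> \<in> hom_cocycles A tensor_complex tensor_complex e"
    unfolding cocycle_endo_iff[OF chain_T] tensor_complex_simps
    using comm \<gamma>h by (simp add: sg_def)
  then show thesis by (rule that) (rule \<gamma>g; assumption)
qed

text \<open>This is \<open>(g \<alpha>) \<times> (h \<beta>) = (g \<times> h) (\<alpha> \<times>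
  \<beta>)\<close> with the sign moved into the cocycle \<open>\<gamma>\<close>.\<close>

lemma ext_prod_act:
  assumes g: "g \<in> FR p" and h: "h \<in> FS r" and \<alpha>: "\<alpha> \<in> hom_cocycles R P' P' (i - p)" and \<beta>: "\<beta> \<in> hom_cocycles S Q' Q' (j - r)"
    and n: "n = i + j"
  obtains \<gamma> where "\<gamma> \<in> hom_cocycles A tensor_complex tensor_complex (n - (p + r))"
    "ext_prod n i (\<lambda>v\<in>carrier (V i). g (\<alpha> i v)) (\<lambda>w\<in>carrier (W j). h (\<beta> j w)) =
      (\<lambda>z\<in>carrier (T n). ext_prod (p + r) p g h (\<gamma> n z))"
proof -
  have e: "n - (p + r) = (i - p) + (j - r)" using n by simp
  \<comment> \<open>The base degree is \<open>k = i\<close>: the functional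
    \<open>g \<times> h\<close> sees \<open>\<gamma>\<close> only on left degree
    \<open>i' = i\<close>, where the exponent \<open>(j - r) * (i' - i)\<close> is zero.\<close>
  obtain \<gamma> where \<gamma>: "\<gamma> \<in> hom_cocycles A tensor_complex tensor_complex (n - (p + r))"
    "\<And>N i' v w. \<lbrakk>v \<in> carrier (V i'); w \<in> carrier (W (N - i'))\<rbrakk> \<Longrightarrow>
      \<gamma> N (gen N i' v w) = sg (T (N - (n - (p + r)))) ((j - r) * (i' - i)) (gen (N - (n - (p + r))) (i' - (i - p)) (\<alpha> i' v) (\<beta> (N - i') w))"
    by (rule tensor_cocycle[OF \<alpha> \<beta> e, of i]) (rule that)
  have N: "n - (n - (p + r)) = p + r" by simp
  have \<gamma>h: "\<gamma> n \<in> mod_hom A (T n) (T (p + r))"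
    using \<gamma>(1) unfolding cocycle_endo_iff[OF chain_T] tensor_complex_simps by (metis N)
  note E = ext_prod_hom[OF g h refl]
  have \<alpha>h: "\<alpha> i' \<in> mod_hom R (VR i') (VR (i' - (i - p)))" for i' by (rule cocycle_endo_R(1)[OF \<alpha>])
  have \<beta>h: "\<beta> i' \<in> mod_hom S (WS i') (WS (i' - (j - r)))" for i' by (rule cocycle_endo_S(1)[OF \<beta>])
  have g\<alpha>: "(\<lambda>v\<in>carrier (V i). g (\<alpha> i v)) \<in> FR i"
    using mod_hom_compose[OF module_VR \<alpha>h[of i], of g] g by (simp add: compose_def)
  have h\<beta>: "(\<lambda>w\<in>carrier (W j). h (\<beta> j w)) \<in> FS j"
    using mod_hom_compose[OF module_WS \<beta>h[of j], of h] h by (simp add: compose_def)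
  have f: "(\<lambda>z\<in>carrier (T n). ext_prod (p + r) p g h (\<gamma> n z)) \<in> FT n"
    using mod_hom_compose[OF module_T \<gamma>h E] unfolding compose_def .
  have "ext_prod n i (\<lambda>v\<in>carrier (V i). g (\<alpha> i v)) (\<lambda>w\<in>carrier (W j). h (\<beta> j w)) =
      (\<lambda>z\<in>carrier (T n). ext_prod (p + r) p g h (\<gamma> n z))"
  proof (rule ext_prod_eqI[OF g\<alpha> h\<beta> n f])
    fix i' v w assume v: "v \<in> carrier (V i')" and w: "w \<in> carrier (W (n - i'))"
    have \<alpha>v: "\<alpha> i' v \<in> carrier (V (i' - (i - p)))" using mod_hom_closed[OF \<alpha>h, of v i'] v by simp
    have \<beta>w: "\<beta> (n - i') w \<in> carrier (W (p + r - (i' - (i - p))))"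
      using mod_hom_closed[OF \<beta>h, of w "n - i'"] w n by (simp add: algebra_simps)
    have "ext_prod (p + r) p g h (\<gamma> n (gen n i' v w)) =
        sg RA ((j - r) * (i' - i)) (if i' - (i - p) = p then tens (g (\<alpha> i' v)) (h (\<beta> (n - i') w)) else \<zero>\<^bsub>A\<^esub>)"
      unfolding \<gamma>(2)[OF v w] N mod_hom_sg[OF E abelian_T abelian_RA gen_closed[OF \<alpha>v \<beta>w]]
        ext_prod_gen[OF g h refl \<alpha>v \<beta>w] ..
    also have "\<dots> = (if i' = i then tens (g (\<alpha> i v)) (h (\<beta> j w)) else \<zero>\<^bsub>A\<^esub>)"
      using n sg_zero[OF abelian_RA] by (auto simp: sg_even)
    finally show "(\<lambda>z\<in>carrier (T n). ext_prod (p + r) p g h (\<gamma> n z)) (gen n i' v w) =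
        (if i' = i then tens ((\<lambda>v\<in>carrier (V i). g (\<alpha> i v)) v) ((\<lambda>w\<in>carrier (W j). h (\<beta> j w)) w) else \<zero>\<^bsub>A\<^esub>)"
      using v w n by auto
  qed
  with \<gamma>(1) show thesis by (rule that)
qed

text \<open>Induction on the left factor with the right one fixed, and in the case of an action,
  induction on the right factor. Boundaries are handled by the Leibniz rules, which ask that the
  other factor be a cocycle; only action against action calls for the product of cocycles.\<close>

lemma generated_ext_prod:
  assumes G: "\<And>p g. (p, g) \<in> G \<Longrightarrow> g \<in> cocycle_functionals R P' p"
    and H: "\<And>r h. (r, h) \<in> H \<Longrightarrow> h \<in> cocycle_functionals S Q' r"
  defines "GH \<equiv> (\<lambda>((p, g), (r, h)). (p + r, ext_prod (p + r) p g h)) ` (G \<times> H)"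
  assumes g: "generated_functional R P' G i g" and h: "generated_functional S Q' H j h"
  shows "generated_functional A tensor_complex GH (i + j) (ext_prod (i + j) i g h)"
proof -
  interpret P': ring_hom_complex R P' by unfold_locales (rule chain_P')
  interpret Q': ring_hom_complex S Q' by unfold_locales (rule chain_Q')
  have gc: "g \<in> cocycle_functionals R P' i" if "generated_functional R P' G i g" for i g
    by (rule P'.generated_imp_cocycle[OF G that])
  have hc: "h \<in> cocycle_functionals S Q' j" if "generated_functional S Q' H j h" for j h
    by (rule Q'.generated_imp_cocycle[OF H that])
  note hz = hc[OF h]
  show ?thesis
    using g
  proof (induction rule: generated_functional.induct)
    case (add i g g')
    show ?case
      unfolding finite_complex_simps pow_regular_simps
        ext_prod_add_left[OF cocycle_R(1)[OF gc[OF add(1)]] cocycle_R(1)[OF gc[OF add(2)]] cocycle_S(1)[OF hz] refl]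
      by (rule generated_functional.add[OF add.IH, unfolded tensor_complex_simps])
  next
    case (bdry u i)
    then have u: "u \<in> FR (i - 1)" by simp
    show ?case
      unfolding finite_complex_simps pow_regular_simps ext_prod_bdry_left(1)[OF u hz refl]
      by (rule generated_functional.bdry[of _ A tensor_complex, unfolded tensor_complex_simps, OF ext_prod_bdry_left(2)[OF u hz refl]])
  next
    case (act p g \<alpha> i)
    note g = generated_functional.act[OF act]
    note gz = gc[OF g, unfolded finite_complex_simps pow_regular_simps]
    from h show ?case
      unfolding finite_complex_simps pow_regular_simps
    proof (induction rule: generated_functional.induct)
      case (add j h h')
      show ?case
        unfolding finite_complex_simps pow_regular_simps
          ext_prod_add_right[OF cocycle_R(1)[OF gz] cocycle_S(1)[OF hc[OF add(1)]] cocycle_S(1)[OF hc[OF add(2)]] refl]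
        by (rule generated_functional.add[OF add.IH, unfolded tensor_complex_simps])
    next
      case (bdry u j)
      then have u: "u \<in> FS (j - 1)" by simp
      show ?case
        unfolding finite_complex_simps pow_regular_simps ext_prod_bdry_right(1)[OF gz u refl]
        by (rule generated_functional.bdry[of _ A tensor_complex, unfolded tensor_complex_simps, OF ext_prod_bdry_right(2)[OF gz u refl]])
    next
      case (act r h \<beta> j)
      note g' = \<open>(p, g) \<in> G\<close> and \<alpha> = \<open>\<alpha> \<in> hom_cocycles R P' P' (i - p)\<close>
      obtain \<gamma> where \<gamma>: "\<gamma> \<in> hom_cocycles A tensor_complex tensor_complex (i + j - (p + r))"
        "ext_prod (i + j) i (\<lambda>v\<in>carrier (V i). g (\<alpha> i v)) (\<lambda>w\<in>carrier (W j). h (\<beta> j w)) =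
          (\<lambda>z\<in>carrier (T (i + j)). ext_prod (p + r) p g h (\<gamma> (i + j) z))"
        by (rule ext_prod_act[OF cocycle_R(1)[OF G[OF g']] cocycle_S(1)[OF H[OF act(1)]] \<alpha> act(2) refl]) (rule that)
      have "(p + r, ext_prod (p + r) p g h) \<in> GH"
        unfolding GH_def by (rule image_eqI[of _ _ "((p, g), (r, h))"]) (use g' act(1) in simp_all)
      from generated_functional.act[OF this \<gamma>(1)] show ?case
        unfolding finite_complex_simps pow_regular_simps \<gamma>(2) tensor_complex_simps .
    qed
  qed
qed

text \<open>By the Leibniz rule \<open>(g \<times> h) \<circ> \<partial>\<close> is
  \<open>(g \<circ> \<partial>) \<times> h\<close>, the external product of zero with
  \<open>h\<close>.\<close>

lemma ext_prod_cocycle: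
  assumes g: "g \<in> cocycle_functionals R P' p" and h: "h \<in> cocycle_functionals S Q' r" and n: "n = p + r"
  shows "ext_prod n p g h \<in> cocycle_functionals A tensor_complex n"
proof -
  note g1 = cocycle_R(1)[OF g] and h1 = cocycle_S(1)[OF h]
  have n1: "n + 1 = p + 1 + r" using n by simp
  have g': "g \<in> FR (p + 1 - 1)" using g1 by simp
  let ?z = "\<lambda>v\<in>carrier (V (p + 1)). \<zero>\<^bsub>R\<^esub>"
  have gd: "(\<lambda>v\<in>carrier (V (p + 1)). g (d (p + 1) v)) = ?z"
    by (rule restrict_ext) (rule cocycle_R(2)[OF g])
  have z: "?z \<in> FR (p + 1)" using mod_hom_null[OF module_VR module_regular_module[OF R.is_cring]] by simp
  have null: "(\<lambda>x\<in>carrier (T (n + 1)). \<zero>\<^bsub>A\<^esub>) \<in> FT (n + 1)" using mod_hom_null[OF module_T module_RA] by simp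
  have "ext_prod (n + 1) (p + 1) ?z h = (\<lambda>x\<in>carrier (T (n + 1)). \<zero>\<^bsub>A\<^esub>)"
    by (rule ext_prod_eqI[OF z h1 n1 null]) (use FS_closed[OF h1] n in \<open>auto simp: tens_zero_left\<close>)
  then have eq: "(\<lambda>x\<in>carrier (T (n + 1)). ext_prod n p g h (D (n + 1) x)) = (\<lambda>x\<in>carrier (T (n + 1)). \<zero>\<^bsub>A\<^esub>)"
    using ext_prod_bdry_left(1)[OF g' h n1] unfolding gd by simp
  have "ext_prod n p g h (D (n + 1) y) = \<zero>\<^bsub>A\<^esub>" if y: "y \<in> carrier (T (n + 1))" for y
    using fun_cong[OF eq, of y] unfolding restrict_apply'[OF y] .
  then show ?thesis
    using ext_prod_hom[OF g1 h1 n] by (simp add: cocycle_functionals_def)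
qed

lemma dot_cocycle_R:
  assumes "v \<in> carrier (V i)" "dT i v = \<zero>\<^bsub>V (i + 1)\<^esub>"
  shows "dot R {..<b i} v \<in> cocycle_functionals R P' i"
  using trans_map_zero[OF R.is_cring finite_lessThan finite_lessThan d_up, of v i] dot_hom[OF R.is_cring finite_lessThan, of v] assms
  by (simp add: cocycle_functionals_def dT_def)

lemma dot_cocycle_S:
  assumes "w \<in> carrier (W j)" "dT' j w = \<zero>\<^bsub>W (j + 1)\<^esub>"
  shows "dot S {..<c j} w \<in> cocycle_functionals S Q' j"
  using trans_map_zero[OF S.is_cring finite_lessThan finite_lessThan d'_up, of w j] dot_hom[OF S.is_cring finite_lessThan, of w] assms
  by (simp add: cocycle_functionals_def dT'_def)

text \<open>A cocycle of the dual complex of \<open>T\<close> is, up to a boundary, a sum of external products of cocycles, by the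
  Kuenneth homotopy of the dual complexes.\<close>

lemma functional_decomposition:
  assumes \<phi>: "\<phi> \<in> cocycle_functionals A tensor_complex n"
    and prod: "\<And>i g h. \<lbrakk>g \<in> cocycle_functionals R P' i; h \<in> cocycle_functionals S Q' (n - i)\<rbrakk> \<Longrightarrow>
      generated_functional A tensor_complex G n (ext_prod n i g h)"
  shows "generated_functional A tensor_complex G n \<phi>"
proof -
  have \<phi>z: "\<phi> (D (n + 1) y) = \<zero>\<^bsub>A\<^esub>" if "y \<in> carrier (T (n + 1))" for y
    using \<phi> that by (simp add: cocycle_functionals_def)
  have \<phi>h: "\<phi> \<in> FT n" using \<phi> by (simp add: cocycle_functionals_def)
  obtain u where u: "u \<in> carrier (T n)" "\<phi> = dot A (Zs n) u"
    by (rule that[OF functional_eq_dot[OF cring_A finite_Zs \<phi>h]])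
  note du = co.D_closed[OF u(1)]
  \<comment> \<open>Adjointness of the two differentials turns the vanishing of
    \<open>\<phi>\<close> on boundaries into a cocycle condition on its coefficient vector.\<close>
  have cu: "co.D n u = \<zero>\<^bsub>T (n + 1)\<^esub>"
  proof (rule dot_eq_iff[OF cring_A finite_Zs du T_zero_closed])
    fix z assume z: "z \<in> carrier (T (n + 1))"
    have "dot A (Zs (n + 1)) (co.D n u) z = \<zero>\<^bsub>A\<^esub>"
      unfolding dot_co_D[OF u(1) z] using \<phi>z[OF z] u(2) by simp
    moreover have "dot A (Zs (n + 1)) \<zero>\<^bsub>T (n + 1)\<^esub> z = \<zero>\<^bsub>A\<^esub>" by (rule dot_zero_left[OF cring_A finite_Zs z])
    ultimately show "dot A (Zs (n + 1)) (co.D n u) z = dot A (Zs (n + 1)) \<zero>\<^bsub>T (n + 1)\<^esub> z" by simp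
  qed
  note dK = mod_hom_V[OF co.d] and dK' = mod_hom_W[OF co.d']
  \<comment> \<open>Only \<open>d h d = d\<close> is drawn from the homotopies here: the dual
    complexes may have cohomology in any degree.\<close>
  obtain h where h: "\<And>i. h i \<in> mod_hom K (V i) (V (i - 1))"
    "\<And>i v. v \<in> carrier (V i) \<Longrightarrow> dT i (h (i + 1) (dT i v)) = dT i v"
    by (rule contracting_homotopy[where V = "\<lambda>i. V i" and d = dT and q = 1, OF field_K module_V dK co.dd], assumption, rule that)
  obtain h' where h': "\<And>i. h' i \<in> mod_hom K (W i) (W (i - 1))"
    "\<And>i v. v \<in> carrier (W i) \<Longrightarrow> dT' i (h' (i + 1) (dT' i v)) = dT' i v"
    by (rule contracting_homotopy[where V = "\<lambda>i. W i" and d = dT' and q = 1, OF field_K module_W dK' co.dd'], assumption, rule that)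
  define e where "e = (\<lambda>i. \<lambda>v\<in>carrier (V i). v \<ominus>\<^bsub>V i\<^esub> (dT (i - 1) (h i v) \<oplus>\<^bsub>V i\<^esub> h (i + 1) (dT i v)))"
  define e' where "e' = (\<lambda>i. \<lambda>v\<in>carrier (W i). v \<ominus>\<^bsub>W i\<^esub> (dT' (i - 1) (h' i v) \<oplus>\<^bsub>W i\<^esub> h' (i + 1) (dT' i v)))"
  have ei: "e i = (\<lambda>v\<in>carrier (V i). v \<ominus>\<^bsub>V i\<^esub> (dT (i - 1) (h i v) \<oplus>\<^bsub>V i\<^esub> h (i + 1) (dT i v)))"
    and ei': "e' i = (\<lambda>v\<in>carrier (W i). v \<ominus>\<^bsub>W i\<^esub> (dT' (i - 1) (h' i v) \<oplus>\<^bsub>W i\<^esub> h' (i + 1) (dT' i v)))" for i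
    by (simp_all only: e_def e'_def)
  have e: "e i \<in> mod_hom K (V i) (V i)" "v \<in> carrier (V i) \<Longrightarrow> dT i (e i v) = \<zero>\<^bsub>V (i + 1)\<^esub>" for i v
    by (rule homotopy_projection[where V = "\<lambda>i. V i" and K = K and d = dT and h = h and q = 1 and e = e,
      OF module_V dK co.dd h ei]; assumption)+
  have e': "e' i \<in> mod_hom K (W i) (W i)" "v \<in> carrier (W i) \<Longrightarrow> dT' i (e' i v) = \<zero>\<^bsub>W (i + 1)\<^esub>" for i v
    by (rule homotopy_projection[where V = "\<lambda>i. W i" and K = K and d = dT' and h = h' and q = 1 and e = e',
      OF module_W dK' co.dd' h' ei']; assumption)+
  obtain E where E: "\<And>z. z \<in> carrier (T n) \<Longrightarrow> E z \<in> carrier (T n)"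
    "\<And>z z'. \<lbrakk>z \<in> carrier (T n); z' \<in> carrier (T n)\<rbrakk> \<Longrightarrow> E (z \<oplus>\<^bsub>T n\<^esub> z') = E z \<oplus>\<^bsub>T n\<^esub> E z'"
    "\<And>i v w. \<lbrakk>v \<in> carrier (V i); w \<in> carrier (W (n - i))\<rbrakk> \<Longrightarrow> E (gen n i v w) = gen n i (e i v) (e' (n - i) w)"
    "\<And>z. \<lbrakk>z \<in> carrier (T n); co.D n z = \<zero>\<^bsub>T (n + 1)\<^esub>\<rbrakk> \<Longrightarrow> \<exists>y\<in>carrier (T (n - 1)). z = E z \<oplus>\<^bsub>T n\<^esub> co.D (n - 1) y"
  proof (rule co.kunneth[of h h' n, OF h(1) _ h'(1), folded ei ei'])
    show "dT i (h (i + 1) (dT i v)) = dT i v" if "v \<in> carrier (V i)" for i v by (rule h(2)[OF that])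
    show "dT' i (h' (i + 1) (dT' i v)) = dT' i v" if "v \<in> carrier (W i)" for i v by (rule h'(2)[OF that])
    fix E
    assume E: "\<And>z. z \<in> carrier (T n) \<Longrightarrow> E z \<in> carrier (T n)"
      "\<And>z z'. \<lbrakk>z \<in> carrier (T n); z' \<in> carrier (T n)\<rbrakk> \<Longrightarrow> E (z \<oplus>\<^bsub>T n\<^esub> z') = E z \<oplus>\<^bsub>T n\<^esub> E z'"
      "\<And>i v w. \<lbrakk>v \<in> carrier (V i); w \<in> carrier (W (n - i))\<rbrakk> \<Longrightarrow> E (gen n i v w) = gen n i (e i v) (e' (n - i) w)"
      "\<And>z. \<lbrakk>z \<in> carrier (T n); co.D n z = \<zero>\<^bsub>T (n + 1)\<^esub>\<rbrakk> \<Longrightarrow> \<exists>y\<in>carrier (T (n - 1)). z = E z \<oplus>\<^bsub>T n\<^esub> co.D (n - 1) y"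
    show thesis by (rule that[OF E])
  qed
  \<comment> \<open>The values of \<open>e\<close> and \<open>e'\<close> are cocycles of the dual
    complexes, so the functional of a pure tensor under \<open>E\<close> is an external product of
    cocycles.\<close>
  have gE: "generated_functional A tensor_complex G n (dot A (Zs n) (E z))" if "z \<in> carrier (T n)" for z
    using that
  proof (induction z rule: T_induct)
    case (gen i v w)
    have ev: "e i v \<in> carrier (V i)" and ew: "e' (n - i) w \<in> carrier (W (n - i))"
      using mod_hom_closed[OF e(1) gen(1)] mod_hom_closed[OF e'(1) gen(2)] .
    have n: "n = i + (n - i)" by simp
    show ?case
      unfolding E(3)[OF gen] dot_gen[OF ev ew n]
      by (rule prod[OF dot_cocycle_R[OF ev e(2)[OF gen(1)]] dot_cocycle_S[OF ew e'(2)[OF gen(2)]]])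
  next
    case (add z z')
    have "dot A (Zs n) (E (z \<oplus>\<^bsub>T n\<^esub> z')) = (\<lambda>x\<in>carrier (T n). dot A (Zs n) (E z) x \<oplus>\<^bsub>A\<^esub> dot A (Zs n) (E z') x)"
      unfolding E(2)[OF add(1,2)]
      by (rule extensionalityI[of _ "carrier (T n)"])
        (simp_all add: E(1) add(1,2) dot_add_left[OF cring_A finite_Zs] mod_hom_extensional[OF dot_hom[OF cring_A finite_Zs]])
    then show ?case using generated_functional.add[OF add.IH] by (simp only: tensor_complex_simps)
  qed
  \<comment> \<open>The Kuenneth formula for the cocycle \<open>u\<close>: the remainder is a
    coboundary, that is, a functional composed with the differential of the tensor complex.\<close>
  obtain y where y: "y \<in> carrier (T (n - 1))" "u = E u \<oplus>\<^bsub>T n\<^esub> co.D (n - 1) y"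
    using E(4)[OF u(1) cu] by (rule bexE) (rule that)
  have cy: "co.D (n - 1) y \<in> carrier (T n)" using co.D_closed[OF y(1)] by simp
  have gy: "generated_functional A tensor_complex G n (\<lambda>x\<in>carrier (T n). dot A (Zs (n - 1)) y (D n x))"
    by (rule generated_functional.bdry[of _ A tensor_complex, unfolded tensor_complex_simps, OF dot_hom[OF cring_A finite_Zs y(1)]])
  have "\<phi> = (\<lambda>x\<in>carrier (T n). dot A (Zs n) (E u) x \<oplus>\<^bsub>A\<^esub> (\<lambda>x\<in>carrier (T n). dot A (Zs (n - 1)) y (D n x)) x)"
  proof (rule extensionalityI[of _ "carrier (T n)"])
    show "\<phi> \<in> extensional (carrier (T n))" by (rule mod_hom_extensional[OF \<phi>h])
    fix x assume x: "x \<in> carrier (T n)"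
    have "\<phi> x = dot A (Zs n) (E u \<oplus>\<^bsub>T n\<^esub> co.D (n - 1) y) x" using u(2) y(2) by simp
    also have "\<dots> = dot A (Zs n) (E u) x \<oplus>\<^bsub>A\<^esub> dot A (Zs n) (co.D (n - 1) y) x"
      by (rule dot_add_left[OF cring_A finite_Zs E(1)[OF u(1)] cy x])
    also have "dot A (Zs n) (co.D (n - 1) y) x = dot A (Zs (n - 1)) y (D n x)"
      using dot_co_D[OF y(1), of x] x by simp
    finally show "\<phi> x = (\<lambda>x\<in>carrier (T n). dot A (Zs n) (E u) x \<oplus>\<^bsub>A\<^esub> (\<lambda>x\<in>carrier (T n). dot A (Zs (n - 1)) y (D n x)) x) x"
      using x by simp
  qed simp
  then show ?thesis using generated_functional.add[OF gE[OF u(1)] gy] by (simp only: tensor_complex_simps)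
qed

lemma functionals_fin_gen_tensor_complex:
  assumes "functionals_fin_gen R P'" "functionals_fin_gen S Q'"
  shows "functionals_fin_gen A tensor_complex"
proof -
  obtain G where G: "finite G" "\<And>p g. (p, g) \<in> G \<Longrightarrow> g \<in> cocycle_functionals R P' p"
    "\<And>i g. g \<in> cocycle_functionals R P' i \<Longrightarrow> generated_functional R P' G i g"
    using assms(1) unfolding functionals_fin_gen_def by blast
  obtain H where H: "finite H" "\<And>r h. (r, h) \<in> H \<Longrightarrow> h \<in> cocycle_functionals S Q' r"
    "\<And>j h. h \<in> cocycle_functionals S Q' j \<Longrightarrow> generated_functional S Q' H j h"
    using assms(2) unfolding functionals_fin_gen_def by blast
  let ?GH = "(\<lambda>((p, g), (r, h)). (p + r, ext_prod (p + r) p g h)) ` (G \<times> H)"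
  show ?thesis
    unfolding functionals_fin_gen_def
  proof (intro exI[of _ ?GH] conjI allI ballI)
    show "finite ?GH" using G(1) H(1) by simp
    show "case x of (n, f) \<Rightarrow> f \<in> cocycle_functionals A tensor_complex n" if "x \<in> ?GH" for x
      using that ext_prod_cocycle[OF G(2) H(2) refl] by auto
    show "generated_functional A tensor_complex ?GH n \<phi>" if "\<phi> \<in> cocycle_functionals A tensor_complex n" for n \<phi>
      using that
    proof (rule functional_decomposition)
      show "generated_functional A tensor_complex ?GH n (ext_prod n i g h)"
        if "g \<in> cocycle_functionals R P' i" "h \<in> cocycle_functionals S Q' (n - i)" for i g h
        using generated_ext_prod[OF G(2) H(2) G(3)[OF that(1)] H(3)[OF that(2)]] by simp
    qed
  qed
qed

end

section \<open>Passage to arbitrary resolutions\<close>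

lemma abelian_group_augmentation_module:
  assumes "cring K"
  shows "abelian_group (augmentation_module K \<epsilon>)"
proof -
  interpret K: cring K by fact
  show ?thesis
  proof (rule abelian_groupI)
    show "\<exists>y\<in>carrier (augmentation_module K \<epsilon>). y \<oplus>\<^bsub>augmentation_module K \<epsilon>\<^esub> x = \<zero>\<^bsub>augmentation_module K \<epsilon>\<^esub>"
      if "x \<in> carrier (augmentation_module K \<epsilon>)" for x
      using that by (intro bexI[of _ "\<ominus>\<^bsub>K\<^esub> x"]) (simp_all add: augmentation_module_def K.l_neg)
  qed (simp_all add: augmentation_module_def K.a_ac)
qed

lemma supplemented_algebra_augmentation:
  assumes K: "field K" and A: "supplemented_algebra K A \<epsilon>"
  shows "cring A" "cring K" "\<epsilon> \<in> ring_hom A K" "carrier K \<subseteq> \<epsilon> ` carrier A" "\<one>\<^bsub>A\<^esub> \<noteq> \<zero>\<^bsub>A\<^esub>"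
proof -
  interpret K: field K by fact
  interpret A: supplemented_algebra K A \<epsilon> by fact
  note h = A.augmentation_ring_hom
  show A': "cring A" and "cring K" "\<epsilon> \<in> ring_hom A K" by (rule A.is_cring K.is_cring h)+
  show "carrier K \<subseteq> \<epsilon> ` carrier A"
  proof
    fix k assume k: "k \<in> carrier K"
    then have "\<epsilon> (k \<odot>\<^bsub>A\<^esub> \<one>\<^bsub>A\<^esub>) = k" using A.augmentation_linear[OF k A.one_closed] ring_hom_one[OF h] by simp
    then show "k \<in> \<epsilon> ` carrier A" using k by (intro image_eqI[of _ _ "k \<odot>\<^bsub>A\<^esub> \<one>\<^bsub>A\<^esub>"]) simp_all
  qed
  show "\<one>\<^bsub>A\<^esub> \<noteq> \<zero>\<^bsub>A\<^esub>"
    using ring_hom_one[OF h] ring_hom_zero[OF h cring.axioms(1)[OF A'] K.ring_axioms] K.one_not_zero by metis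
qed

theorem mainTheorem10:
  fixes K :: "('k, 'x) ring_scheme"
    and R :: "('k, 'r, 'y) module_scheme" and \<epsilon> :: "'r \<Rightarrow> 'k"
    and S :: "('k, 's, 'z) module_scheme" and \<delta> :: "'s \<Rightarrow> 'k"
    and P :: "('r, 'p) module_complex"
    and Q :: "('s, 'q) module_complex"
    and W :: "(('r \<times> 's \<Rightarrow>\<^sub>0 int) set, 'w) module_complex"
  assumes "field K"
    and "local_supplemented_algebra K R \<epsilon>"
    and "local_supplemented_algebra K S \<delta>"
    and "free_resolution R (augmentation_module K \<epsilon>) P"
    and "free_resolution S (augmentation_module K \<delta>) Q"
    and "free_resolution (tensor_ring K R S)
           (augmentation_module K (tensor_augmentation K \<epsilon> \<delta>)) W"
    and "Ext_ring_fin_gen R P"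
    and "Ext_ring_fin_gen S Q"
  shows "Ext_ring_fin_gen (tensor_ring K R S) W"
proof -
  have R: "supplemented_algebra K R \<epsilon>" "noetherian_ring R" and S: "supplemented_algebra K S \<delta>" "noetherian_ring S"
    using assms(2,3) by (simp_all add: local_supplemented_algebra_def)
  note r = supplemented_algebra_augmentation[OF assms(1) R(1)] and s = supplemented_algebra_augmentation[OF assms(1) S(1)]
  note N = abelian_group_augmentation_module[OF r(2)]
  obtain b d where bd: "finite_resolution R K \<epsilon> b d"
    by (rule finite_resolution_exists[OF r(1) R(2) r(2,3)])
  obtain c d' where cd: "finite_resolution S K \<delta> c d'"
    by (rule finite_resolution_exists[OF s(1) S(2) s(2,3)])
  have "supplemented_tensor K R S \<epsilon> \<delta>"
    using assms(1) R(1) S(1)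
    by (simp add: supplemented_tensor_def supplemented_tensor_axioms_def tensor_algebras_def supplemented_algebra_def)
  then interpret tensor_resolution K R S \<epsilon> \<delta> b c d d'
    by (intro tensor_resolution.intro tensor_resolution_axioms.intro bd cd)
  note fR = finite_resolution_free_resolution[OF r(1,5,3,4) bd] and fS = finite_resolution_free_resolution[OF s(1,5,3,4) cd]
  have P: "functionals_fin_gen R P" and Q: "functionals_fin_gen S Q"
    using Ext_ring_fin_gen_iff[OF free_resolution_chain_complex[OF assms(4)]]
      Ext_ring_fin_gen_iff[OF free_resolution_chain_complex[OF assms(5)]] assms(7,8) by simp_all
  \<comment> \<open>Finite generation travels from the given resolutions to the finite ones, through
    the tensor product, and finally to the given resolution \<open>W\<close>.\<close>
  have T: "functionals_fin_gen A tensor_complex"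
    by (rule functionals_fin_gen_tensor_complex[OF functionals_fin_gen_transfer[OF assms(4) fR N P]
      functionals_fin_gen_transfer[OF assms(5) fS N Q]])
  from functionals_fin_gen_transfer[OF free_resolution_tensor_complex assms(6) N T]
  show ?thesis using Ext_ring_fin_gen_iff[OF free_resolution_chain_complex[OF assms(6)]] by simp
qed

end
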